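(* Let $k$ be a field of characteristic not $2$ and $r\ge1$. The functor $\mathcal{C}_r$ is represented by a geometrically reduced affine scheme which is equidimensional of dimension $r+3$. It has three irreducible components: two isomorphic to $\mathcal{A}_{r+2}$ (defined by the equations $\alpha=1$ and $\alpha=-1$ respectively) and one isomorphic to $\mathcal{B}_r$ (defined by the equation $m_{r+1}=0$).
   Context: A matrix $m\in M_2(T)$ over a $k$-algebra $T$ is strongly nilpotent if its trace and determinant are $0$. $\mathcal{C}_r$ assigns to a $k$-algebra $T$ the set of tuples $(\phi,\alpha;m_1,\ldots,m_{r+1})$ with $\phi\in M_2(T)$ of determinant $1$, $\alpha\in T$ a root of the characteristic polynomial of $\phi$, and $m_i$ strongly nilpotent with $m_im_j=0$ and $m_i\phi=\alpha m_i$ for $1\le i,j\le r+1$, and $m_{r+1}\phi=\phi m_{r+1}$. For $n\ge1$, $\mathcal{A}_n$ assigns to $T$ the tuples $(m_1,\ldots,m_n)$ of strongly nilpotent matrices with $m_im_j=0$ for all $i,j$. $\mathcal{B}_r$ assigns to $T$ the tuples $(\phi,\alpha;m_1,\ldots,m_r)$ with $\phi$ of determinant $1$, $\alpha$ a root of its characteristic polynomial, $m_i$ strongly nilpotent with $m_im_j=0$ and $m_i\phi=\alpha m_i$. *)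

theory Defs
  imports
    "HOL-Algebra.Indexed_Polynomials"
    "HOL-Algebra.QuotRing"
    "HOL-Algebra.Module"
    "HOL-Analysis.Function_Topology"
    "HOL-Library.Extended_Nat"
begin

section \<open>Commutative algebras over a ring\<close>

text \<open>A (commutative, unital) \<open>k\<close>-algebra is a record \<open>T\<close> with \<^term>\<open>algebra k T\<close>; the zero ring
  is allowed.  Homomorphisms are made extensional, so that two of them are equal as soon as they
  agree on the carrier.\<close>

definition alg_hom ::
    "('k, 'c) ring_scheme \<Rightarrow> ('k, 'a) module \<Rightarrow> ('k, 'b) module \<Rightarrow> ('a \<Rightarrow> 'b) set"
  where "alg_hom k A B =
    {f \<in> ring_hom A B \<inter> extensional (carrier A).
       \<forall>c\<in>carrier k. \<forall>x\<in>carrier A. f (c \<odot>\<^bsub>A\<^esub> x) = c \<odot>\<^bsub>B\<^esub> f x}"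

definition alg_isomorphic ::
    "('k, 'c) ring_scheme \<Rightarrow> ('k, 'a) module \<Rightarrow> ('k, 'b) module \<Rightarrow> bool"
  where "alg_isomorphic k A B \<longleftrightarrow> (\<exists>f\<in>alg_hom k A B. bij_betw f (carrier A) (carrier B))"

text \<open>\<^const>\<open>FactRing\<close> together with the induced scalar multiplication
  \<open>c \<cdot> (x + J) = c x + J\<close>.\<close>

definition quot_alg :: "('k, 'a) module \<Rightarrow> 'a set \<Rightarrow> ('k, 'a set) module"
  where "quot_alg A J =
    \<lparr>carrier = carrier (A Quot J), monoid.mult = monoid.mult (A Quot J), one = one (A Quot J),
     zero = zero (A Quot J), add = add (A Quot J),
     smult = (\<lambda>c S. \<Union>x\<in>S. J +>\<^bsub>A\<^esub> (c \<odot>\<^bsub>A\<^esub> x))\<rparr>"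

text \<open>The polynomial algebra \<open>k[X\<^sub>v : v \<in> I]\<close>; a polynomial maps a monomial, i.e. a multiset
  of variables, to its coefficient.\<close>

definition mpoly :: "('k, 'c) ring_scheme \<Rightarrow> 'v set \<Rightarrow> ('k, 'v multiset \<Rightarrow> 'k) module"
  where "mpoly k I =
    \<lparr>carrier = ring.indexed_pset k I (carrier k),
     monoid.mult = (\<lambda>P Q m. \<Oplus>\<^bsub>k\<^esub>s\<in>{s. s \<subseteq># m}. P s \<otimes>\<^bsub>k\<^esub> Q (m - s)),
     one = ring.indexed_const k \<one>\<^bsub>k\<^esub>,
     zero = ring.indexed_const k \<zero>\<^bsub>k\<^esub>,
     add = ring.indexed_padd k,
     smult = (\<lambda>c P m. c \<otimes>\<^bsub>k\<^esub> P m)\<rparr>"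

text \<open>The tensor product \<open>A \<otimes>\<^sub>k B\<close> of algebras: generated by the pure tensors \<open>x \<otimes> a\<close>
  (the variables \<open>(x, a)\<close>), subject to \<open>k\<close>-bilinearity and to
  \<open>(x \<otimes> a)(y \<otimes> b) = xy \<otimes> ab\<close>, \<open>1 \<otimes> 1 = 1\<close>.\<close>

definition tensor_rels ::
    "('k, 'c) ring_scheme \<Rightarrow> ('k, 'a) module \<Rightarrow> ('k, 'b) module
      \<Rightarrow> (('a \<times> 'b) multiset \<Rightarrow> 'k) set"
  where "tensor_rels k A B =
    (let P = mpoly k (carrier A \<times> carrier B); t = (\<lambda>x a. ring.indexed_var k (x, a)) in
      {t (x \<oplus>\<^bsub>A\<^esub> y) a \<ominus>\<^bsub>P\<^esub> (t x a \<oplus>\<^bsub>P\<^esub> t y a) | x y a.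
         x \<in> carrier A \<and> y \<in> carrier A \<and> a \<in> carrier B} \<union>
      {t x (a \<oplus>\<^bsub>B\<^esub> b) \<ominus>\<^bsub>P\<^esub> (t x a \<oplus>\<^bsub>P\<^esub> t x b) | x a b.
         x \<in> carrier A \<and> a \<in> carrier B \<and> b \<in> carrier B} \<union>
      {t (c \<odot>\<^bsub>A\<^esub> x) a \<ominus>\<^bsub>P\<^esub> c \<odot>\<^bsub>P\<^esub> t x a | c x a.
         c \<in> carrier k \<and> x \<in> carrier A \<and> a \<in> carrier B} \<union>
      {t x (c \<odot>\<^bsub>B\<^esub> a) \<ominus>\<^bsub>P\<^esub> c \<odot>\<^bsub>P\<^esub> t x a | c x a.
         c \<in> carrier k \<and> x \<in> carrier A \<and> a \<in> carrier B} \<union>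
      {t (x \<otimes>\<^bsub>A\<^esub> y) (a \<otimes>\<^bsub>B\<^esub> b) \<ominus>\<^bsub>P\<^esub> t x a \<otimes>\<^bsub>P\<^esub> t y b | x y a b.
         x \<in> carrier A \<and> y \<in> carrier A \<and> a \<in> carrier B \<and> b \<in> carrier B} \<union>
      {t \<one>\<^bsub>A\<^esub> \<one>\<^bsub>B\<^esub> \<ominus>\<^bsub>P\<^esub> \<one>\<^bsub>P\<^esub>})"

definition tensor ::
    "('k, 'c) ring_scheme \<Rightarrow> ('k, 'a) module \<Rightarrow> ('k, 'b) module
      \<Rightarrow> ('k, (('a \<times> 'b) multiset \<Rightarrow> 'k) set) module"
  where "tensor k A B =
    (let P = mpoly k (carrier A \<times> carrier B) in quot_alg P (Idl\<^bsub>P\<^esub> (tensor_rels k A B)))"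

definition reduced_ring :: "('a, 'c) ring_scheme \<Rightarrow> bool"
  where "reduced_ring R \<longleftrightarrow>
    (\<forall>x\<in>carrier R. (\<exists>n::nat. x [^]\<^bsub>R\<^esub> n = \<zero>\<^bsub>R\<^esub>) \<longrightarrow> x = \<zero>\<^bsub>R\<^esub>)"

text \<open>A definition cannot quantify over types, so the type \<open>'l\<close> carrying the field extensions
  \<open>K\<close> of \<open>k\<close> is a parameter; a theorem with a type variable in this place covers all extensions.\<close>

definition geometrically_reduced ::
    "'l itself \<Rightarrow> ('k, 'c) ring_scheme \<Rightarrow> ('k, 'a) module \<Rightarrow> bool"
  where "geometrically_reduced L k A \<longleftrightarrow>
    (\<forall>K :: ('k, 'l) module. algebra k K \<and> field K \<longrightarrow> reduced_ring (tensor k K A))"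

text \<open>\<open>F\<close> is the object part, on algebras with elements of type \<open>'t\<close>, and \<open>Fmap\<close> the action on
  homomorphisms of a set-valued functor; \<open>u\<close> is the universal element in \<open>F A\<close> of the Yoneda
  correspondence \<open>Hom(A, T) \<cong> F T\<close>.  As above, \<open>'t\<close> is to be a type variable of the theorem.\<close>

definition represents ::
    "('k, 'c) ring_scheme \<Rightarrow> ('k, 'a) module \<Rightarrow> 'x \<Rightarrow> (('k, 't) module \<Rightarrow> 'y set)
      \<Rightarrow> (('a \<Rightarrow> 't) \<Rightarrow> 'x \<Rightarrow> 'y) \<Rightarrow> bool"
  where "represents k A u F Fmap \<longleftrightarrow>
    algebra k A \<and>
    (\<forall>T. algebra k T \<longrightarrow> bij_betw (\<lambda>f. Fmap f u) (alg_hom k A T) (F T))"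


section \<open>Spectra and irreducible components\<close>

definition Spec :: "('a, 'c) ring_scheme \<Rightarrow> 'a set set"
  where "Spec R = {p. primeideal p R}"

definition zariski :: "('a, 'c) ring_scheme \<Rightarrow> 'a set topology"
  where "zariski R = topology_generated_by {{p \<in> Spec R. f \<notin> p} | f. f \<in> carrier R}"

definition zero_locus :: "('a, 'c) ring_scheme \<Rightarrow> 'a set \<Rightarrow> 'a set set"
  where "zero_locus R E = {p \<in> Spec R. E \<subseteq> p}"

definition vanishing_ideal :: "('a, 'c) ring_scheme \<Rightarrow> 'a set set \<Rightarrow> 'a set"
  where "vanishing_ideal R Z = {x \<in> carrier R. \<forall>p\<in>Z. x \<in> p}"

definition irreducible_in :: "'p topology \<Rightarrow> 'p set \<Rightarrow> bool"
  where "irreducible_in Y S \<longleftrightarrow> S \<subseteq> topspace Y \<and> S \<noteq> {} \<and>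
    (\<forall>C D. closedin Y C \<and> closedin Y D \<and> S \<subseteq> C \<union> D \<longrightarrow> S \<subseteq> C \<or> S \<subseteq> D)"

definition irreducible_components :: "'p topology \<Rightarrow> 'p set set"
  where "irreducible_components Y =
    {S. irreducible_in Y S \<and> (\<forall>S'. irreducible_in Y S' \<and> S \<subseteq> S' \<longrightarrow> S' = S)}"

text \<open>Supremum of the lengths \<open>n\<close> of chains \<open>Z\<^sub>0 \<subset> \<dots> \<subset> Z\<^sub>n\<close> of irreducible closed subsets (with
  value \<open>0\<close> for the empty space, which is never an irreducible component).\<close>

definition krull_dim :: "'p topology \<Rightarrow> enat"
  where "krull_dim Y = (SUP n\<in>{n. \<exists>Z :: nat \<Rightarrow> 'p set.
      (\<forall>i\<le>n. closedin Y (Z i) \<and> irreducible_in Y (Z i)) \<and> (\<forall>i<n. Z i \<subset> Z (Suc i))}. enat n)"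

definition equidimensional :: "'p topology \<Rightarrow> nat \<Rightarrow> bool"
  where "equidimensional Y d \<longleftrightarrow>
    (\<forall>S\<in>irreducible_components Y. krull_dim (subtopology Y S) = enat d)"


section \<open>Two by two matrices over a ring\<close>

datatype 'a mat2 = Mat2 (m11: 'a) (m12: 'a) (m21: 'a) (m22: 'a)

definition mat2_carrier :: "('t, 'c) ring_scheme \<Rightarrow> 't mat2 set"
  where "mat2_carrier T = {m. set_mat2 m \<subseteq> carrier T}"

definition mat2_zero :: "('t, 'c) ring_scheme \<Rightarrow> 't mat2"
  where "mat2_zero T = Mat2 \<zero>\<^bsub>T\<^esub> \<zero>\<^bsub>T\<^esub> \<zero>\<^bsub>T\<^esub> \<zero>\<^bsub>T\<^esub>"

definition mat2_one :: "('t, 'c) ring_scheme \<Rightarrow> 't mat2"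
  where "mat2_one T = Mat2 \<one>\<^bsub>T\<^esub> \<zero>\<^bsub>T\<^esub> \<zero>\<^bsub>T\<^esub> \<one>\<^bsub>T\<^esub>"

definition mat2_minus :: "('t, 'c) ring_scheme \<Rightarrow> 't mat2 \<Rightarrow> 't mat2 \<Rightarrow> 't mat2"
  where "mat2_minus T m n =
    Mat2 (m11 m \<ominus>\<^bsub>T\<^esub> m11 n) (m12 m \<ominus>\<^bsub>T\<^esub> m12 n) (m21 m \<ominus>\<^bsub>T\<^esub> m21 n) (m22 m \<ominus>\<^bsub>T\<^esub> m22 n)"

definition mat2_smult :: "('t, 'c) ring_scheme \<Rightarrow> 't \<Rightarrow> 't mat2 \<Rightarrow> 't mat2"
  where "mat2_smult T a m = map_mat2 (\<lambda>x. a \<otimes>\<^bsub>T\<^esub> x) m"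

definition mat2_mult :: "('t, 'c) ring_scheme \<Rightarrow> 't mat2 \<Rightarrow> 't mat2 \<Rightarrow> 't mat2"
  where "mat2_mult T m n =
    Mat2 (m11 m \<otimes>\<^bsub>T\<^esub> m11 n \<oplus>\<^bsub>T\<^esub> m12 m \<otimes>\<^bsub>T\<^esub> m21 n) (m11 m \<otimes>\<^bsub>T\<^esub> m12 n \<oplus>\<^bsub>T\<^esub> m12 m \<otimes>\<^bsub>T\<^esub> m22 n)
         (m21 m \<otimes>\<^bsub>T\<^esub> m11 n \<oplus>\<^bsub>T\<^esub> m22 m \<otimes>\<^bsub>T\<^esub> m21 n) (m21 m \<otimes>\<^bsub>T\<^esub> m12 n \<oplus>\<^bsub>T\<^esub> m22 m \<otimes>\<^bsub>T\<^esub> m22 n)"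

definition mat2_trace :: "('t, 'c) ring_scheme \<Rightarrow> 't mat2 \<Rightarrow> 't"
  where "mat2_trace T m = m11 m \<oplus>\<^bsub>T\<^esub> m22 m"

definition mat2_det :: "('t, 'c) ring_scheme \<Rightarrow> 't mat2 \<Rightarrow> 't"
  where "mat2_det T m = m11 m \<otimes>\<^bsub>T\<^esub> m22 m \<ominus>\<^bsub>T\<^esub> m12 m \<otimes>\<^bsub>T\<^esub> m21 m"

text \<open>The value \<open>det (a \<cdot> 1 - m)\<close> at \<open>a\<close> of the characteristic polynomial of \<open>m\<close>.\<close>

definition mat2_charpoly_at :: "('t, 'c) ring_scheme \<Rightarrow> 't mat2 \<Rightarrow> 't \<Rightarrow> 't"
  where "mat2_charpoly_at T m a = mat2_det T (mat2_minus T (mat2_smult T a (mat2_one T)) m)"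

definition strongly_nilpotent :: "('t, 'c) ring_scheme \<Rightarrow> 't mat2 \<Rightarrow> bool"
  where "strongly_nilpotent T m \<longleftrightarrow>
    m \<in> mat2_carrier T \<and> mat2_trace T m = \<zero>\<^bsub>T\<^esub> \<and> mat2_det T m = \<zero>\<^bsub>T\<^esub>"


section \<open>The functors\<close>

text \<open>A tuple \<open>(m\<^sub>1, \<dots>, m\<^sub>n)\<close> is a list of length \<open>n\<close>, so \<open>m\<^sub>i\<close> is \<open>ms ! (i - 1)\<close>.\<close>

definition functor_A :: "nat \<Rightarrow> ('k, 't) module \<Rightarrow> 't mat2 list set"
  where "functor_A n T =
    {ms. length ms = n \<and>
       (\<forall>m\<in>set ms. strongly_nilpotent T m) \<and>
       (\<forall>m\<in>set ms. \<forall>m'\<in>set ms. mat2_mult T m m' = mat2_zero T)}"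

definition functor_B :: "nat \<Rightarrow> ('k, 't) module \<Rightarrow> ('t mat2 \<times> 't \<times> 't mat2 list) set"
  where "functor_B r T =
    {(\<phi>, \<alpha>, ms). length ms = r \<and>
       \<phi> \<in> mat2_carrier T \<and> mat2_det T \<phi> = \<one>\<^bsub>T\<^esub> \<and>
       \<alpha> \<in> carrier T \<and> mat2_charpoly_at T \<phi> \<alpha> = \<zero>\<^bsub>T\<^esub> \<and>
       (\<forall>m\<in>set ms. strongly_nilpotent T m) \<and>
       (\<forall>m\<in>set ms. \<forall>m'\<in>set ms. mat2_mult T m m' = mat2_zero T) \<and>
       (\<forall>m\<in>set ms. mat2_mult T m \<phi> = mat2_smult T \<alpha> m)}"

definition functor_C :: "nat \<Rightarrow> ('k, 't) module \<Rightarrow> ('t mat2 \<times> 't \<times> 't mat2 list) set"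
  where "functor_C r T =
    {(\<phi>, \<alpha>, ms). length ms = r + 1 \<and>
       \<phi> \<in> mat2_carrier T \<and> mat2_det T \<phi> = \<one>\<^bsub>T\<^esub> \<and>
       \<alpha> \<in> carrier T \<and> mat2_charpoly_at T \<phi> \<alpha> = \<zero>\<^bsub>T\<^esub> \<and>
       (\<forall>m\<in>set ms. strongly_nilpotent T m) \<and>
       (\<forall>m\<in>set ms. \<forall>m'\<in>set ms. mat2_mult T m m' = mat2_zero T) \<and>
       (\<forall>m\<in>set ms. mat2_mult T m \<phi> = mat2_smult T \<alpha> m) \<and>
       mat2_mult T (ms ! r) \<phi> = mat2_mult T \<phi> (ms ! r)}"

definition map_A :: "('a \<Rightarrow> 'b) \<Rightarrow> 'a mat2 list \<Rightarrow> 'b mat2 list"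
  where "map_A f = map (map_mat2 f)"

definition map_BC ::
    "('a \<Rightarrow> 'b) \<Rightarrow> 'a mat2 \<times> 'a \<times> 'a mat2 list \<Rightarrow> 'b mat2 \<times> 'b \<times> 'b mat2 list"
  where "map_BC f = (\<lambda>(\<phi>, \<alpha>, ms). (map_mat2 f \<phi>, f \<alpha>, map (map_mat2 f) ms))"


section \<open>Coordinate rings\<close>

text \<open>Each coordinate ring is the polynomial ring on the entries of a generic tuple modulo the
  ideal generated by the defining equations; the class of the generic tuple is the universal
  element.\<close>

datatype entry = E11 | E12 | E21 | E22

datatype coord = PhiV entry | AlphaV | MV nat entry

definition vars_A :: "nat \<Rightarrow> coord set"
  where "vars_A n = {MV i e | i e. i < n}"

definition vars_BC :: "nat \<Rightarrow> coord set"
  where "vars_BC n = range PhiV \<union> {AlphaV} \<union> vars_A n"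

definition gen_mat :: "('k, 'c) ring_scheme \<Rightarrow> (entry \<Rightarrow> coord) \<Rightarrow> (coord multiset \<Rightarrow> 'k) mat2"
  where "gen_mat k v = map_mat2 (\<lambda>e. ring.indexed_var k (v e)) (Mat2 E11 E12 E21 E22)"

definition gen_A :: "('k, 'c) ring_scheme \<Rightarrow> nat \<Rightarrow> (coord multiset \<Rightarrow> 'k) mat2 list"
  where "gen_A k n = map (\<lambda>i. gen_mat k (MV i)) [0..<n]"

definition gen_BC :: "('k, 'c) ring_scheme \<Rightarrow> nat \<Rightarrow>
    (coord multiset \<Rightarrow> 'k) mat2 \<times> (coord multiset \<Rightarrow> 'k) \<times> (coord multiset \<Rightarrow> 'k) mat2 list"
  where "gen_BC k n = (gen_mat k PhiV, ring.indexed_var k AlphaV, gen_A k n)"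

definition rels_A :: "('p, 'c) ring_scheme \<Rightarrow> 'p mat2 list \<Rightarrow> 'p set"
  where "rels_A P ms =
    (\<Union>m\<in>set ms. {mat2_trace P m, mat2_det P m}) \<union>
    (\<Union>m\<in>set ms. \<Union>m'\<in>set ms. set_mat2 (mat2_mult P m m'))"

definition rels_B :: "('p, 'c) ring_scheme \<Rightarrow> 'p mat2 \<times> 'p \<times> 'p mat2 list \<Rightarrow> 'p set"
  where "rels_B P = (\<lambda>(\<phi>, \<alpha>, ms).
    {mat2_det P \<phi> \<ominus>\<^bsub>P\<^esub> \<one>\<^bsub>P\<^esub>, mat2_charpoly_at P \<phi> \<alpha>} \<union> rels_A P ms \<union>
    (\<Union>m\<in>set ms. set_mat2 (mat2_minus P (mat2_mult P m \<phi>) (mat2_smult P \<alpha> m))))"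

definition rels_C :: "nat \<Rightarrow> ('p, 'c) ring_scheme \<Rightarrow> 'p mat2 \<times> 'p \<times> 'p mat2 list \<Rightarrow> 'p set"
  where "rels_C r P = (\<lambda>(\<phi>, \<alpha>, ms).
    rels_B P (\<phi>, \<alpha>, ms) \<union>
    set_mat2 (mat2_minus P (mat2_mult P (ms ! r) \<phi>) (mat2_mult P \<phi> (ms ! r))))"

definition ideal_A :: "('k, 'c) ring_scheme \<Rightarrow> nat \<Rightarrow> (coord multiset \<Rightarrow> 'k) set"
  where "ideal_A k n = (let P = mpoly k (vars_A n) in Idl\<^bsub>P\<^esub> (rels_A P (gen_A k n)))"

definition ideal_B :: "('k, 'c) ring_scheme \<Rightarrow> nat \<Rightarrow> (coord multiset \<Rightarrow> 'k) set"
  where "ideal_B k r = (let P = mpoly k (vars_BC r) in Idl\<^bsub>P\<^esub> (rels_B P (gen_BC k r)))"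

definition ideal_C :: "('k, 'c) ring_scheme \<Rightarrow> nat \<Rightarrow> (coord multiset \<Rightarrow> 'k) set"
  where "ideal_C k r =
    (let P = mpoly k (vars_BC (r + 1)) in Idl\<^bsub>P\<^esub> (rels_C r P (gen_BC k (r + 1))))"

definition coord_A :: "('k, 'c) ring_scheme \<Rightarrow> nat \<Rightarrow> ('k, (coord multiset \<Rightarrow> 'k) set) module"
  where "coord_A k n = quot_alg (mpoly k (vars_A n)) (ideal_A k n)"

definition coord_B :: "('k, 'c) ring_scheme \<Rightarrow> nat \<Rightarrow> ('k, (coord multiset \<Rightarrow> 'k) set) module"
  where "coord_B k r = quot_alg (mpoly k (vars_BC r)) (ideal_B k r)"

definition coord_C :: "('k, 'c) ring_scheme \<Rightarrow> nat \<Rightarrow> ('k, (coord multiset \<Rightarrow> 'k) set) module"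
  where "coord_C k r = quot_alg (mpoly k (vars_BC (r + 1))) (ideal_C k r)"

definition univ_A :: "('k, 'c) ring_scheme \<Rightarrow> nat \<Rightarrow> (coord multiset \<Rightarrow> 'k) set mat2 list"
  where "univ_A k n = map_A (\<lambda>p. ideal_A k n +>\<^bsub>mpoly k (vars_A n)\<^esub> p) (gen_A k n)"

definition univ_B :: "('k, 'c) ring_scheme \<Rightarrow> nat \<Rightarrow> (coord multiset \<Rightarrow> 'k) set mat2 \<times>
    (coord multiset \<Rightarrow> 'k) set \<times> (coord multiset \<Rightarrow> 'k) set mat2 list"
  where "univ_B k r = map_BC (\<lambda>p. ideal_B k r +>\<^bsub>mpoly k (vars_BC r)\<^esub> p) (gen_BC k r)"

definition univ_C :: "('k, 'c) ring_scheme \<Rightarrow> nat \<Rightarrow> (coord multiset \<Rightarrow> 'k) set mat2 \<times>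
    (coord multiset \<Rightarrow> 'k) set \<times> (coord multiset \<Rightarrow> 'k) set mat2 list"
  where "univ_C k r =
    map_BC (\<lambda>p. ideal_C k r +>\<^bsub>mpoly k (vars_BC (r + 1))\<^esub> p) (gen_BC k (r + 1))"

end

theory Submission
  imports Defs "HOL-Library.Poly_Mapping" "HOL-Library.Multiset_Order"
begin

text \<open>
  Taking adjugates in \<open>m\<^sub>r\<^sub>+\<^sub>1 \<phi> = \<alpha> m\<^sub>r\<^sub>+\<^sub>1 = \<phi> m\<^sub>r\<^sub>+\<^sub>1\<close> gives \<open>(\<alpha>\<^sup>2 - 1) m\<^sub>r\<^sub>+\<^sub>1 = 0\<close> on \<open>\<C>\<^sub>r\<close>.
  Where \<open>\<alpha> = \<epsilon>\<close> with \<open>\<epsilon> = \<plusminus>1\<close>, the matrix \<open>\<phi> - \<epsilon>\<close> is strongly nilpotent and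
  \<open>(m\<^sub>1, \<dots>, m\<^sub>r\<^sub>+\<^sub>1, \<phi> - \<epsilon>)\<close> is an arbitrary point of \<open>\<A>\<^sub>r\<^sub>+\<^sub>2\<close>; where \<open>m\<^sub>r\<^sub>+\<^sub>1 = 0\<close>, the rest is an
  arbitrary point of \<open>\<B>\<^sub>r\<close>.  If these loci are integral and \<open>2\<close> is invertible, their ideals meet in
  \<open>0\<close>: an element of \<open>(\<alpha> - 1) \<inter> (\<alpha> + 1)\<close> is a multiple \<open>w (\<alpha>\<^sup>2 - 1)\<close>, and if it also vanishes where
  \<open>m\<^sub>r\<^sub>+\<^sub>1 = 0\<close>, then so does \<open>w\<close>, whence \<open>w (\<alpha>\<^sup>2 - 1) = 0\<close>.

  Strongly nilpotent matrices with vanishing products are points \<open>t (x, -y)\<^sup>T (y, x)\<close> of a rational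
  normal scroll with a common direction \<open>(x : y)\<close>, so a monomial in their entries depends only on
  which matrices occur and on the total degree in \<open>y\<close>.  In the chart \<open>x = 1\<close> such monomials
  become distinct monomials of a polynomial ring; hence the coordinate ring of \<open>\<A>\<^sub>n\<close> embeds into
  it.  In the same way that of \<open>\<B>\<^sub>r\<close>, where the columns of \<open>\<phi> - \<alpha>\<close> lie on the scroll too, embeds into
  a ring of Laurent polynomials.  Both are therefore domains, and counting monomials bounds the
  length of their chains of primes; chains of the full length come from setting the chart
  coordinates to zero one after the other.  Geometric reducedness follows because \<open>K \<otimes> k[\<C>\<^sub>r]\<close>
  embeds into the coordinate ring of \<open>\<C>\<^sub>r\<close> over \<open>K\<close>.
\<close>

section \<open>Monoid algebras\<close>

text \<open>The ideals are given by equations, so that they are prime or that a ring is reduced must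
  be read off from explicit normal forms: products of generators are rewritten by the equations
  until their images in a chart are visibly independent. For \<A> these images are distinct
  monomials. For \<B> they are not: determinant 1 forces one chart entry to be p = y v + 1/\<alpha>
  - \<alpha>, a trinomial, and \<alpha> satisfies a quadratic equation, so the normal forms are
  words times 1 or \<alpha>. Their images are only triangular. The terms of p^n of extreme degree in
  \<alpha> are pure powers of \<alpha>; the lowest one serves as lead for words without \<alpha>,
  the highest one for words with \<alpha>, and these leads do not collide. Polynomial and Laurent
  rings are both monoid algebras, so integrality, evaluation and the dimension bound are proved
  once. The bound needs a homomorphism into such an algebra, not surjectivity. A full chain in the
  component m_{r+1} = 0 first steps into the component \<alpha> = 1 and continues in its chart.
  Reducedness holds over every field in which 2 is not 0, hence over every extension of k.\<close>

definition mterm :: "('a, 'c) ring_scheme \<Rightarrow> 'm \<Rightarrow> 'a \<Rightarrow> 'm \<Rightarrow> 'a"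
  where "mterm R m c = (\<lambda>n. if n = m then c else \<zero>\<^bsub>R\<^esub>)"

text \<open>The sum runs over the two supports instead of the decompositions m = a + b, because a
  Laurent exponent has infinitely many of those.\<close>

definition mconv :: "('a, 'c) ring_scheme \<Rightarrow> ('m::plus \<Rightarrow> 'a) \<Rightarrow> ('m \<Rightarrow> 'a) \<Rightarrow> 'm \<Rightarrow> 'a"
  where "mconv R f g = (\<lambda>m. \<Oplus>\<^bsub>R\<^esub>a\<in>{a. f a \<noteq> \<zero>\<^bsub>R\<^esub>}. \<Oplus>\<^bsub>R\<^esub>b\<in>{b. g b \<noteq> \<zero>\<^bsub>R\<^esub>}.
     if a + b = m then f a \<otimes>\<^bsub>R\<^esub> g b else \<zero>\<^bsub>R\<^esub>)"

text \<open>\<open>N\<close> is a submonoid of the type of exponents, so one type serves for every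
  number of variables.\<close>

definition monoid_alg ::
    "('a, 'c) ring_scheme \<Rightarrow> 'm::comm_monoid_add set \<Rightarrow> ('a, 'm \<Rightarrow> 'a) module"
  where "monoid_alg R N =
    \<lparr>carrier = {f. (\<forall>m. f m \<in> carrier R) \<and> finite {m. f m \<noteq> \<zero>\<^bsub>R\<^esub>} \<and> {m. f m \<noteq> \<zero>\<^bsub>R\<^esub>} \<subseteq> N},
     monoid.mult = mconv R, one = mterm R 0 \<one>\<^bsub>R\<^esub>, zero = (\<lambda>m. \<zero>\<^bsub>R\<^esub>),
     ring.add = (\<lambda>f g m. f m \<oplus>\<^bsub>R\<^esub> g m), smult = (\<lambda>c f m. c \<otimes>\<^bsub>R\<^esub> f m)\<rparr>"

context cring
begin

lemma monoid_algD:
  assumes "f \<in> carrier (monoid_alg R N)"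
  shows "f m \<in> carrier R" "finite {m. f m \<noteq> \<zero>}" "f m \<noteq> \<zero> \<Longrightarrow> m \<in> N"
  using assms by (auto simp: monoid_alg_def)

lemma monoid_alg_sel [simp]:
  "monoid.mult (monoid_alg R N) = mconv R"
  "one (monoid_alg R N) = mterm R 0 \<one>"
  "zero (monoid_alg R N) = (\<lambda>m. \<zero>)"
  "ring.add (monoid_alg R N) = (\<lambda>f g m. f m \<oplus> g m)"
  "module.smult (monoid_alg R N) = (\<lambda>c f m. c \<otimes> f m)"
  by (simp_all add: monoid_alg_def)

lemma monoid_alg_mono:
  "N \<subseteq> N' \<Longrightarrow> carrier (monoid_alg R N) \<subseteq> carrier (monoid_alg R N')"
  by (auto simp: monoid_alg_def)

lemma mterm_closed: "m \<in> N \<Longrightarrow> c \<in> carrier R \<Longrightarrow> mterm R m c \<in> carrier (monoid_alg R N)"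
  by (auto simp: monoid_alg_def mterm_def intro: finite_subset[of _ "{m}"])

lemma madd_closed:
  assumes "f \<in> carrier (monoid_alg R N)" "g \<in> carrier (monoid_alg R N)"
  shows "(\<lambda>m. f m \<oplus> g m) \<in> carrier (monoid_alg R N)"
proof -
  have "{m. f m \<oplus> g m \<noteq> \<zero>} \<subseteq> {m. f m \<noteq> \<zero>} \<union> {m. g m \<noteq> \<zero>}"
    by auto
  with assms show ?thesis
    unfolding monoid_alg_def by (auto intro: finite_subset)
qed

lemma msmult_closed:
  assumes "f \<in> carrier (monoid_alg R N)" "c \<in> carrier R"
  shows "(\<lambda>m. c \<otimes> f m) \<in> carrier (monoid_alg R N)"
proof -
  have "{m. c \<otimes> f m \<noteq> \<zero>} \<subseteq> {m. f m \<noteq> \<zero>}"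
    using assms by auto
  with assms show ?thesis
    unfolding monoid_alg_def by (auto intro: finite_subset)
qed

text \<open>Induction on the support: deleting one exponent leaves an element with smaller support.
  Laws that are additive in an argument are thereby reduced to single terms, where they are laws of
  the exponents and coefficients.\<close>

lemma monoid_alg_induct [consumes 1, case_names zero add_term]:
  assumes f: "f \<in> carrier (monoid_alg R N)"
    and zero: "P (\<lambda>m. \<zero>)"
    and add: "\<And>f m c. f \<in> carrier (monoid_alg R N) \<Longrightarrow> P f \<Longrightarrow> m \<in> N \<Longrightarrow> c \<in> carrier R \<Longrightarrow>
       P (\<lambda>n. mterm R m c n \<oplus> f n)"
  shows "P f"
proof -
  have "P f" if "finite S" "{m. f m \<noteq> \<zero>} = S" "f \<in> carrier (monoid_alg R N)" for S f
    using that
  proof (induction S arbitrary: f rule: finite_induct)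
    case empty
    then have "f = (\<lambda>m. \<zero>)" by auto
    then show ?case using zero by simp
  next
    case (insert m S)
    define g where "g = f(m := \<zero>)"
    have "{m. g m \<noteq> \<zero>} = S"
      using insert by (auto simp: g_def)
    moreover have gc: "g \<in> carrier (monoid_alg R N)"
      using insert.prems calculation insert.hyps unfolding monoid_alg_def by (auto simp: g_def)
    ultimately have "P g" using insert.IH by blast
    have m: "m \<in> N" "f m \<in> carrier R"
      using insert.prems monoid_algD[OF insert.prems(2)] by auto
    have "f = (\<lambda>n. mterm R m (f m) n \<oplus> g n)"
      using monoid_algD(1)[OF insert.prems(2)] by (auto simp: g_def mterm_def fun_eq_iff)
    then show ?case
      using add[OF gc \<open>P g\<close> m] by simp
  qed
  then show ?thesis using f monoid_algD(2)[OF f] by blast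
qed

text \<open>Outside the supports every summand is zero. Enlarging the index sets lets two elements
  be summed over a common set, as distributivity requires.\<close>

lemma mconv_eq:
  assumes f: "f \<in> carrier (monoid_alg R N)" and g: "g \<in> carrier (monoid_alg R N')"
    and A: "finite A" "{a. f a \<noteq> \<zero>} \<subseteq> A" and B: "finite B" "{b. g b \<noteq> \<zero>} \<subseteq> B"
  shows "mconv R f g m = (\<Oplus>a\<in>A. \<Oplus>b\<in>B. if a + b = m then f a \<otimes> g b else \<zero>)"
proof -
  note cf = monoid_algD(1)[OF f] and cg = monoid_algD(1)[OF g]
  have "(\<Oplus>b\<in>{b. g b \<noteq> \<zero>}. if a + b = m then f a \<otimes> g b else \<zero>) =
        (\<Oplus>b\<in>B. if a + b = m then f a \<otimes> g b else \<zero>)" for a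
    by (rule add.finprod_mono_neutral_cong_left) (use B cf cg in auto)
  then have "mconv R f g m =
      (\<Oplus>a\<in>{a. f a \<noteq> \<zero>}. \<Oplus>b\<in>B. if a + b = m then f a \<otimes> g b else \<zero>)"
    by (simp add: mconv_def)
  also have "\<dots> = (\<Oplus>a\<in>A. \<Oplus>b\<in>B. if a + b = m then f a \<otimes> g b else \<zero>)"
    by (rule add.finprod_mono_neutral_cong_left)
      (use A cf cg in \<open>auto intro!: finsum_closed add.finprod_one_eqI\<close>)
  finally show ?thesis .
qed

lemma mconv_nonzero:
  assumes f: "f \<in> carrier (monoid_alg R N)" and g: "g \<in> carrier (monoid_alg R N')"
    and nz: "mconv R f g m \<noteq> \<zero>"
  obtains a b where "f a \<noteq> \<zero>" "g b \<noteq> \<zero>" "a + b = m"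
proof (rule ccontr)
  assume "\<not> thesis"
  then have "\<And>a b. f a \<noteq> \<zero> \<Longrightarrow> g b \<noteq> \<zero> \<Longrightarrow> a + b \<noteq> m" using that by blast
  then have "mconv R f g m = \<zero>"
    unfolding mconv_def by (auto intro!: add.finprod_one_eqI)
  with nz show False by simp
qed

lemma mconv_closed:
  fixes N :: "'m::comm_monoid_add set"
  assumes f: "f \<in> carrier (monoid_alg R N)" and g: "g \<in> carrier (monoid_alg R N)"
    and N: "\<And>a b. a \<in> N \<Longrightarrow> b \<in> N \<Longrightarrow> a + b \<in> N"
  shows "mconv R f g \<in> carrier (monoid_alg R N)"
proof -
  let ?S = "(\<lambda>(a, b). a + b) ` ({a. f a \<noteq> \<zero>} \<times> {b. g b \<noteq> \<zero>})"
  have "{m. mconv R f g m \<noteq> \<zero>} \<subseteq> ?S"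
    by (auto elim!: mconv_nonzero[OF f g])
  moreover have "finite ?S" "?S \<subseteq> N"
    using monoid_algD[OF f] monoid_algD[OF g] N by auto
  moreover have "mconv R f g m \<in> carrier R" for m
    using monoid_algD(1)[OF f] monoid_algD(1)[OF g]
    by (auto simp: mconv_def intro!: finsum_closed)
  ultimately show ?thesis
    unfolding monoid_alg_def by (auto intro: finite_subset)
qed

lemma mconv_mterm_mterm:
  fixes a b :: "'m::comm_monoid_add"
  assumes "c \<in> carrier R" "d \<in> carrier R"
  shows "mconv R (mterm R a c) (mterm R b d) = mterm R (a + b) (c \<otimes> d)"
proof
  fix m
  have "mconv R (mterm R a c) (mterm R b d) m =
    (\<Oplus>a'\<in>{a}. \<Oplus>b'\<in>{b}. if a' + b' = m then mterm R a c a' \<otimes> mterm R b d b' else \<zero>)"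
    by (rule mconv_eq[OF mterm_closed[OF UNIV_I assms(1)] mterm_closed[OF UNIV_I assms(2)]])
      (auto simp: mterm_def)
  also have "\<dots> = mterm R (a + b) (c \<otimes> d) m"
    using assms by (auto simp: mterm_def finsum_insert[of "{}", simplified])
  finally show "mconv R (mterm R a c) (mterm R b d) m = mterm R (a + b) (c \<otimes> d) m" .
qed

lemma mconv_add_left:
  assumes f: "f \<in> carrier (monoid_alg R N)" and f': "f' \<in> carrier (monoid_alg R N)"
    and g: "g \<in> carrier (monoid_alg R N')"
  shows "mconv R (\<lambda>m. f m \<oplus> f' m) g = (\<lambda>m. mconv R f g m \<oplus> mconv R f' g m)"
proof
  fix m
  let ?A = "{a. f a \<noteq> \<zero>} \<union> {a. f' a \<noteq> \<zero>}" and ?B = "{b. g b \<noteq> \<zero>}"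
  have fin: "finite ?A" "finite ?B" using monoid_algD(2)[OF f] monoid_algD(2)[OF f'] monoid_algD(2)[OF g] by auto
  note c = monoid_algD(1)[OF f] monoid_algD(1)[OF f'] monoid_algD(1)[OF g]
  have "mconv R (\<lambda>m. f m \<oplus> f' m) g m =
    (\<Oplus>a\<in>?A. \<Oplus>b\<in>?B. if a + b = m then (f a \<oplus> f' a) \<otimes> g b else \<zero>)"
    by (rule mconv_eq[OF madd_closed[OF f f'] g]) (use fin in auto)
  also have "\<dots> = (\<Oplus>a\<in>?A. \<Oplus>b\<in>?B. (if a + b = m then f a \<otimes> g b else \<zero>) \<oplus>
      (if a + b = m then f' a \<otimes> g b else \<zero>))"
    using c by (intro finsum_cong' refl) (auto simp: l_distr)
  also have "\<dots> = (\<Oplus>a\<in>?A. (\<Oplus>b\<in>?B. (if a + b = m then f a \<otimes> g b else \<zero>)) \<oplus>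
      (\<Oplus>b\<in>?B. if a + b = m then f' a \<otimes> g b else \<zero>))"
    using c by (intro finsum_cong' refl finsum_addf) (auto intro!: finsum_closed)
  also have "\<dots> = (\<Oplus>a\<in>?A. \<Oplus>b\<in>?B. (if a + b = m then f a \<otimes> g b else \<zero>)) \<oplus>
      (\<Oplus>a\<in>?A. \<Oplus>b\<in>?B. if a + b = m then f' a \<otimes> g b else \<zero>)"
    using c by (intro finsum_addf) (auto intro!: finsum_closed)
  also have "\<dots> = mconv R f g m \<oplus> mconv R f' g m"
    using mconv_eq[OF f g fin(1) _ fin(2)] mconv_eq[OF f' g fin(1) _ fin(2)] by auto
  finally show "mconv R (\<lambda>m. f m \<oplus> f' m) g m = mconv R f g m \<oplus> mconv R f' g m" .
qed

lemma mconv_add_right: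
  assumes f: "f \<in> carrier (monoid_alg R N)" and f': "f' \<in> carrier (monoid_alg R N)"
    and g: "g \<in> carrier (monoid_alg R N')"
  shows "mconv R g (\<lambda>m. f m \<oplus> f' m) = (\<lambda>m. mconv R g f m \<oplus> mconv R g f' m)"
proof
  fix m
  let ?A = "{a. f a \<noteq> \<zero>} \<union> {a. f' a \<noteq> \<zero>}" and ?B = "{b. g b \<noteq> \<zero>}"
  have fin: "finite ?A" "finite ?B" using monoid_algD(2)[OF f] monoid_algD(2)[OF f'] monoid_algD(2)[OF g] by auto
  note c = monoid_algD(1)[OF f] monoid_algD(1)[OF f'] monoid_algD(1)[OF g]
  have "mconv R g (\<lambda>m. f m \<oplus> f' m) m =
    (\<Oplus>b\<in>?B. \<Oplus>a\<in>?A. if b + a = m then g b \<otimes> (f a \<oplus> f' a) else \<zero>)"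
    by (rule mconv_eq[OF g madd_closed[OF f f']]) (use fin in auto)
  also have "\<dots> = (\<Oplus>b\<in>?B. \<Oplus>a\<in>?A. (if b + a = m then g b \<otimes> f a else \<zero>) \<oplus>
      (if b + a = m then g b \<otimes> f' a else \<zero>))"
    using c by (intro finsum_cong' refl) (auto simp: r_distr)
  also have "\<dots> = (\<Oplus>b\<in>?B. (\<Oplus>a\<in>?A. (if b + a = m then g b \<otimes> f a else \<zero>)) \<oplus>
      (\<Oplus>a\<in>?A. if b + a = m then g b \<otimes> f' a else \<zero>))"
    using c by (intro finsum_cong' refl finsum_addf) (auto intro!: finsum_closed)
  also have "\<dots> = (\<Oplus>b\<in>?B. \<Oplus>a\<in>?A. (if b + a = m then g b \<otimes> f a else \<zero>)) \<oplus>
      (\<Oplus>b\<in>?B. \<Oplus>a\<in>?A. if b + a = m then g b \<otimes> f' a else \<zero>)"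
    using c by (intro finsum_addf) (auto intro!: finsum_closed)
  also have "\<dots> = mconv R g f m \<oplus> mconv R g f' m"
    using mconv_eq[OF g f fin(2) _ fin(1)] mconv_eq[OF g f' fin(2) _ fin(1)] by auto
  finally show "mconv R g (\<lambda>m. f m \<oplus> f' m) m = mconv R g f m \<oplus> mconv R g f' m" .
qed

lemma mconv_zero_left [simp]: "mconv R (\<lambda>m. \<zero>) g = (\<lambda>m. \<zero>)"
  by (simp add: mconv_def)

lemma mconv_zero_right [simp]: "mconv R g (\<lambda>m. \<zero>) = (\<lambda>m. \<zero>)"
  by (simp add: mconv_def)

lemma mconv_comm:
  fixes N :: "'m::comm_monoid_add set"
  assumes f: "f \<in> carrier (monoid_alg R N)" and g: "g \<in> carrier (monoid_alg R N)"
  shows "mconv R f g = mconv R g f"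
  using f
proof (induction rule: monoid_alg_induct)
  case (add_term f a c)
  have "mconv R (mterm R a c) g = mconv R g (mterm R a c)"
    using g
  proof (induction rule: monoid_alg_induct)
    case (add_term g b d)
    then show ?case
      using \<open>a \<in> N\<close> \<open>c \<in> carrier R\<close>
      by (simp add: mconv_add_left[of _ N _ _ N] mconv_add_right[of _ N _ _ N] mterm_closed
          mconv_mterm_mterm m_comm add.commute)
  qed simp
  with add_term g show ?case
    by (simp add: mconv_add_left[of _ N _ _ N] mconv_add_right[of _ N _ _ N] mterm_closed)
qed simp

lemma mconv_assoc:
  fixes N :: "'m::comm_monoid_add set"
  assumes f: "f \<in> carrier (monoid_alg R N)" and g: "g \<in> carrier (monoid_alg R N)"
    and h: "h \<in> carrier (monoid_alg R N)" and N: "\<And>a b. a \<in> N \<Longrightarrow> b \<in> N \<Longrightarrow> a + b \<in> N"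
  shows "mconv R (mconv R f g) h = mconv R f (mconv R g h)"
  using f
proof (induction rule: monoid_alg_induct)
  case (add_term f a c)
  have "mconv R (mconv R (mterm R a c) g) h = mconv R (mterm R a c) (mconv R g h)"
    using g
  proof (induction rule: monoid_alg_induct)
    case (add_term g b d)
    have "mconv R (mconv R (mterm R a c) (mterm R b d)) h =
        mconv R (mterm R a c) (mconv R (mterm R b d) h)"
      using h
    proof (induction rule: monoid_alg_induct)
      case (add_term h e x)
      then show ?case
        using \<open>a \<in> N\<close> \<open>c \<in> carrier R\<close> \<open>b \<in> N\<close> \<open>d \<in> carrier R\<close>
        by (simp add: mconv_add_left[of _ N _ _ N] mconv_add_right[of _ N _ _ N] mterm_closed
            mconv_closed mconv_mterm_mterm m_assoc add.assoc N)
    qed simp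
    with add_term h show ?case
      using \<open>a \<in> N\<close> \<open>c \<in> carrier R\<close>
      by (simp add: mconv_add_left[of _ N _ _ N] mconv_add_right[of _ N _ _ N] mterm_closed
          mconv_closed N)
  qed simp
  with add_term g h show ?case
    by (simp add: mconv_add_left[of _ N _ _ N] mconv_add_right[of _ N _ _ N] mterm_closed
        mconv_closed N)
qed simp

lemma mconv_one:
  fixes N :: "'m::comm_monoid_add set"
  assumes f: "f \<in> carrier (monoid_alg R N)"
  shows "mconv R (mterm R 0 \<one>) f = f"
proof -
  have N: "carrier (monoid_alg R N) \<subseteq> carrier (monoid_alg R UNIV)"
    by (intro monoid_alg_mono) auto
  from f show ?thesis
  proof (induction rule: monoid_alg_induct)
    case (add_term f a c)
    then show ?case
      using N by (subst mconv_add_right[of _ N _ _ UNIV])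
        (auto simp: mterm_closed mconv_mterm_mterm)
  qed simp
qed

lemma mconv_smult:
  fixes N :: "'m::comm_monoid_add set"
  assumes f: "f \<in> carrier (monoid_alg R N)" and g: "g \<in> carrier (monoid_alg R N)"
    and c: "c \<in> carrier R"
  shows "mconv R (\<lambda>m. c \<otimes> f m) g = (\<lambda>m. c \<otimes> mconv R f g m)"
proof
  fix m
  let ?A = "{a. f a \<noteq> \<zero>}" and ?B = "{b. g b \<noteq> \<zero>}"
  have fin: "finite ?A" "finite ?B" using monoid_algD(2)[OF f] monoid_algD(2)[OF g] by auto
  note cc = monoid_algD(1)[OF f] monoid_algD(1)[OF g] c
  have "mconv R (\<lambda>m. c \<otimes> f m) g m =
     (\<Oplus>a\<in>?A. \<Oplus>b\<in>?B. if a + b = m then (c \<otimes> f a) \<otimes> g b else \<zero>)"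
    by (rule mconv_eq[OF msmult_closed[OF f c] g]) (use fin c in auto)
  also have "\<dots> = (\<Oplus>a\<in>?A. \<Oplus>b\<in>?B. c \<otimes> (if a + b = m then f a \<otimes> g b else \<zero>))"
    using cc by (intro finsum_cong' refl) (auto simp: m_assoc)
  also have "\<dots> = (\<Oplus>a\<in>?A. c \<otimes> (\<Oplus>b\<in>?B. if a + b = m then f a \<otimes> g b else \<zero>))"
    using cc fin by (intro finsum_cong' refl finsum_rdistr[symmetric]) (auto intro!: finsum_closed)
  also have "\<dots> = c \<otimes> (\<Oplus>a\<in>?A. \<Oplus>b\<in>?B. if a + b = m then f a \<otimes> g b else \<zero>)"
    using cc fin by (intro finsum_rdistr[symmetric]) (auto intro!: finsum_closed)
  finally show "mconv R (\<lambda>m. c \<otimes> f m) g m = c \<otimes> mconv R f g m"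
    by (simp add: mconv_def)
qed

lemma monoid_alg_algebra:
  fixes N :: "'m::comm_monoid_add set"
  assumes N: "0 \<in> N" "\<And>a b. a \<in> N \<Longrightarrow> b \<in> N \<Longrightarrow> a + b \<in> N"
  shows "algebra R (monoid_alg R N)"
proof -
  let ?M = "monoid_alg R N"
  have z: "(\<lambda>m. \<zero>) \<in> carrier ?M" by (simp add: monoid_alg_def)
  have ab: "abelian_group ?M"
  proof (rule abelian_groupI)
    fix f assume f: "f \<in> carrier ?M"
    show "\<exists>g\<in>carrier ?M. g \<oplus>\<^bsub>?M\<^esub> f = \<zero>\<^bsub>?M\<^esub>"
    proof
      show "(\<lambda>m. \<ominus> \<one> \<otimes> f m) \<in> carrier ?M" using f by (simp add: msmult_closed)
      show "(\<lambda>m. \<ominus> \<one> \<otimes> f m) \<oplus>\<^bsub>?M\<^esub> f = \<zero>\<^bsub>?M\<^esub>"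
        using monoid_algD(1)[OF f] by (simp add: l_minus l_neg)
    qed
  qed (auto simp: madd_closed z a_ac monoid_algD(1) fun_eq_iff)
  have cm: "comm_monoid ?M"
    by (rule comm_monoidI)
      (auto simp: mconv_closed[OF _ _ N(2)] mterm_closed N(1) mconv_one mconv_comm
         mconv_assoc[OF _ _ _ N(2)])
  have cr: "cring ?M"
    by (rule cringI[OF ab cm]) (simp add: mconv_add_left)
  show ?thesis
    by (rule algebraI[OF is_cring cr])
      (auto simp: msmult_closed l_distr r_distr m_assoc monoid_algD(1) mconv_smult)
qed

end

text \<open>The product of the terms with largest exponents cannot cancel: in an ordered
  cancellative monoid the sum of the two maxima arises from no other pair of exponents in the
  supports.\<close>

lemma (in domain) monoid_alg_domain:
  fixes N :: "'m::{linordered_cancel_ab_semigroup_add, cancel_comm_monoid_add} set"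
  assumes N: "0 \<in> N" "\<And>a b. a \<in> N \<Longrightarrow> b \<in> N \<Longrightarrow> a + b \<in> N"
  shows "domain (monoid_alg R N)"
proof -
  let ?M = "monoid_alg R N"
  interpret M: algebra R ?M by (rule monoid_alg_algebra[OF N])
  show ?thesis
  proof (rule domainI)
    show "cring ?M" ..
    have "mterm R (0::'m) \<one> 0 = \<one>" by (simp add: mterm_def)
    then have "mterm R (0::'m) \<one> \<noteq> (\<lambda>m. \<zero>)"
      using one_not_zero by metis
    then show "\<one>\<^bsub>?M\<^esub> \<noteq> \<zero>\<^bsub>?M\<^esub>" by simp
    fix f g assume fg: "f \<otimes>\<^bsub>?M\<^esub> g = \<zero>\<^bsub>?M\<^esub>" and f: "f \<in> carrier ?M" and g: "g \<in> carrier ?M"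
    show "f = \<zero>\<^bsub>?M\<^esub> \<or> g = \<zero>\<^bsub>?M\<^esub>"
    proof (rule ccontr)
      assume "\<not> ?thesis"
      then have ne: "{m. f m \<noteq> \<zero>} \<noteq> {}" "{m. g m \<noteq> \<zero>} \<noteq> {}" by auto
      define m where "m = Max {m. f m \<noteq> \<zero>}"
      define n where "n = Max {m. g m \<noteq> \<zero>}"
      note fin = monoid_algD(2)[OF f] monoid_algD(2)[OF g]
      note c = monoid_algD(1)[OF f] monoid_algD(1)[OF g]
      have m: "f m \<noteq> \<zero>" "\<And>a. f a \<noteq> \<zero> \<Longrightarrow> a \<le> m"
        using Max_in[OF fin(1) ne(1)] fin(1) by (auto simp: m_def)
      have n: "g n \<noteq> \<zero>" "\<And>a. g a \<noteq> \<zero> \<Longrightarrow> a \<le> n"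
        using Max_in[OF fin(2) ne(2)] fin(2) by (auto simp: n_def)
      have eq: "a = m \<and> b = n" if "f a \<noteq> \<zero>" "g b \<noteq> \<zero>" "a + b = m + n" for a b
      proof -
        have "a \<le> m" "b \<le> n" using that m n by auto
        then have "a = m" using that(3)
          by (metis add_less_le_mono less_irrefl order_le_less)
        then show ?thesis using that(3) by simp
      qed
      have "mconv R f g (m + n) =
         (\<Oplus>a\<in>{a. f a \<noteq> \<zero>}. if a = m then f a \<otimes> g n else \<zero>)"
        unfolding mconv_def
      proof (rule finsum_cong'[OF refl])
        fix a assume a: "a \<in> {a. f a \<noteq> \<zero>}"
        have "(\<Oplus>b\<in>{b. g b \<noteq> \<zero>}. if a + b = m + n then f a \<otimes> g b else \<zero>) =
          (\<Oplus>b\<in>{b. g b \<noteq> \<zero>}. if n = b then (if a = m then f a \<otimes> g b else \<zero>) else \<zero>)"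
          using a eq c by (intro finsum_cong' refl) auto
        also have "\<dots> = (if a = m then f a \<otimes> g n else \<zero>)"
          using fin(2) n(1) c by (subst finsum_singleton) auto
        finally show "(\<Oplus>b\<in>{b. g b \<noteq> \<zero>}. if a + b = m + n then f a \<otimes> g b else \<zero>) =
           (if a = m then f a \<otimes> g n else \<zero>)" .
      qed (use c in auto)
      also have "\<dots> = (\<Oplus>a\<in>{a. f a \<noteq> \<zero>}. if m = a then f a \<otimes> g n else \<zero>)"
        by (intro finsum_cong' refl) (use c in auto)
      also have "\<dots> = f m \<otimes> g n"
        using fin(1) m(1) c by (subst finsum_singleton) auto
      finally have "f m \<otimes> g n = \<zero>" using fg by simp
      then show False using m(1) n(1) c integral by blast
    qed
  qed
qed

section \<open>Algebra homomorphisms and quotients\<close>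

text \<open>The operations are compared on the carrier only, since records describing the same ring
  may disagree off it.\<close>

lemma cring_cong:
  assumes A: "cring A" and c: "carrier B = carrier A" and z: "zero B = zero A"
    and o: "one B = one A"
    and a: "\<And>x y. x \<in> carrier A \<Longrightarrow> y \<in> carrier A \<Longrightarrow> x \<oplus>\<^bsub>B\<^esub> y = x \<oplus>\<^bsub>A\<^esub> y"
    and m: "\<And>x y. x \<in> carrier A \<Longrightarrow> y \<in> carrier A \<Longrightarrow> x \<otimes>\<^bsub>B\<^esub> y = x \<otimes>\<^bsub>A\<^esub> y"
  shows "cring B"
proof -
  interpret A: cring A by fact
  have "abelian_group B"
  proof (rule abelian_groupI)
    fix x assume x: "x \<in> carrier B"
    then have "\<ominus>\<^bsub>A\<^esub> x \<in> carrier B" "(\<ominus>\<^bsub>A\<^esub> x) \<oplus>\<^bsub>B\<^esub> x = \<zero>\<^bsub>B\<^esub>"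
      by (simp_all add: c z a A.l_neg)
    then show "\<exists>y\<in>carrier B. y \<oplus>\<^bsub>B\<^esub> x = \<zero>\<^bsub>B\<^esub>" by blast
  qed (simp_all add: c z a A.a_ac)
  moreover have "comm_monoid B"
    by (rule comm_monoidI) (simp_all add: c o m A.m_ac)
  ultimately show ?thesis
    by (rule cringI) (simp add: c a m A.l_distr)
qed

lemma algebra_subD:
  assumes "algebra k A"
  shows "cring k" "cring A" "ring A" "module k A"
  using assms by (auto simp: algebra.R_cring algebra.M_cring algebra.module cring.axioms(1))

lemma alg_homD:
  assumes "f \<in> alg_hom k A B"
  shows "f \<in> ring_hom A B" "x \<in> carrier A \<Longrightarrow> f x \<in> carrier B"
    "c \<in> carrier k \<Longrightarrow> x \<in> carrier A \<Longrightarrow> f (c \<odot>\<^bsub>A\<^esub> x) = c \<odot>\<^bsub>B\<^esub> f x"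
    "f \<in> extensional (carrier A)"
  using assms by (auto simp: alg_hom_def ring_hom_closed)

lemma alg_hom_ring_hom_cring:
  assumes "algebra k A" "algebra k B" "f \<in> alg_hom k A B"
  shows "ring_hom_cring A B f"
  using assms by (auto simp: ring_hom_cring_def ring_hom_cring_axioms_def algebra_subD alg_homD)

lemma alg_hom_restrict:
  assumes "algebra k A" "f \<in> ring_hom A B"
    "\<And>c x. c \<in> carrier k \<Longrightarrow> x \<in> carrier A \<Longrightarrow> f (c \<odot>\<^bsub>A\<^esub> x) = c \<odot>\<^bsub>B\<^esub> f x"
  shows "restrict f (carrier A) \<in> alg_hom k A B"
proof -
  interpret A: algebra k A by fact
  show ?thesis
    using assms unfolding alg_hom_def
    by (auto intro!: ring_hom_memI simp: ring_hom_closed ring_hom_mult ring_hom_add ring_hom_one)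
qed

lemma alg_hom_compose:
  assumes A: "algebra k A" and f: "f \<in> alg_hom k A B" and g: "g \<in> alg_hom k B C"
  shows "compose (carrier A) g f \<in> alg_hom k A C"
proof -
  have "restrict (g \<circ> f) (carrier A) \<in> alg_hom k A C"
    using f g by (intro alg_hom_restrict A ring_hom_trans[OF alg_homD(1) alg_homD(1)])
      (auto simp: alg_homD)
  then show ?thesis by (simp add: compose_def restrict_def comp_def)
qed

lemma alg_hom_eqI:
  "f \<in> alg_hom k A B \<Longrightarrow> g \<in> alg_hom k A B \<Longrightarrow> (\<And>x. x \<in> carrier A \<Longrightarrow> f x = g x) \<Longrightarrow> f = g"
  by (meson alg_homD(4) extensionalityI)

lemma carrier_quot_alg: "carrier (quot_alg A J) = (\<lambda>x. J +>\<^bsub>A\<^esub> x) ` carrier A"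
  by (auto simp: quot_alg_def FactRing_def A_RCOSETS_def' )

lemma quot_alg_sel:
  "one (quot_alg A J) = one (A Quot J)" "zero (quot_alg A J) = zero (A Quot J)"
  "monoid.mult (quot_alg A J) = monoid.mult (A Quot J)" "ring.add (quot_alg A J) = ring.add (A Quot J)"
  "carrier (quot_alg A J) = carrier (A Quot J)"
  by (simp_all add: quot_alg_def)

context
  fixes k :: "('k, 'c) ring_scheme" and A :: "('k, 'a) module" and J :: "'a set"
  assumes A: "algebra k A" and J: "ideal J A"
begin

interpretation A: algebra k A by (rule A)
interpretation J: ideal J A by (rule J)

text \<open>\<open>J\<close> is stable under scalars, as c j = (c 1) j, so all representatives of a
  coset yield the same coset. The union in the definition of \<open>quot_alg\<close> is then a union
  of equal sets over a nonempty index set.\<close>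

lemma quot_alg_smult:
  assumes "c \<in> carrier k" "x \<in> carrier A"
  shows "c \<odot>\<^bsub>quot_alg A J\<^esub> (J +>\<^bsub>A\<^esub> x) = J +>\<^bsub>A\<^esub> (c \<odot>\<^bsub>A\<^esub> x)"
proof -
  have "J +>\<^bsub>A\<^esub> (c \<odot>\<^bsub>A\<^esub> y) = J +>\<^bsub>A\<^esub> (c \<odot>\<^bsub>A\<^esub> x)" if y: "y \<in> J +>\<^bsub>A\<^esub> x" for y
  proof -
    obtain j where j: "j \<in> J" "y = j \<oplus>\<^bsub>A\<^esub> x" using y by (auto simp: a_r_coset_def')
    have jc: "j \<in> carrier A" using j(1) by (rule J.Icarr)
    have "c \<odot>\<^bsub>A\<^esub> j = (c \<odot>\<^bsub>A\<^esub> \<one>\<^bsub>A\<^esub>) \<otimes>\<^bsub>A\<^esub> j"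
      using assms jc by (simp add: A.smult_assoc2)
    then have "c \<odot>\<^bsub>A\<^esub> j \<in> J" using assms j by (simp add: J.I_l_closed)
    then have "c \<odot>\<^bsub>A\<^esub> y \<in> J +>\<^bsub>A\<^esub> (c \<odot>\<^bsub>A\<^esub> x)"
      using assms j jc by (auto simp: a_r_coset_def' A.smult_r_distr)
    then show ?thesis using J.a_repr_independence'[OF _ A.smult_closed] assms by blast
  qed
  then have "(\<Union>y\<in>J +>\<^bsub>A\<^esub> x. J +>\<^bsub>A\<^esub> (c \<odot>\<^bsub>A\<^esub> y)) = (\<Union>y\<in>J +>\<^bsub>A\<^esub> x. J +>\<^bsub>A\<^esub> (c \<odot>\<^bsub>A\<^esub> x))"
    by (rule SUP_cong[OF refl])
  moreover have "J +>\<^bsub>A\<^esub> x \<noteq> {}" using assms J.a_rcos_self by blast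
  ultimately show ?thesis by (simp add: quot_alg_def)
qed

lemma quot_cring: "cring (quot_alg A J)"
proof -
  show ?thesis
    by (rule cring_cong[OF J.quotient_is_cring[OF A.M_cring]]) (simp_all add: quot_alg_sel)
qed

lemma quot_alg_proj_ring_hom: "(\<lambda>x. J +>\<^bsub>A\<^esub> x) \<in> ring_hom A (quot_alg A J)"
  using J.rcos_ring_hom unfolding ring_hom_def by (simp add: quot_alg_sel)

lemma quot_alg_algebra: "algebra k (quot_alg A J)"
proof -
  interpret h: ring_hom_cring A "quot_alg A J" "\<lambda>x. J +>\<^bsub>A\<^esub> x"
    by (intro ring_hom_cring.intro ring_hom_cring_axioms.intro A.M_cring quot_cring
        quot_alg_proj_ring_hom)
  show ?thesis
    by (rule algebraI[OF A.R_cring quot_cring])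
      (auto simp: carrier_quot_alg quot_alg_smult A.smult_l_distr A.smult_r_distr A.smult_assoc1
         A.smult_assoc2 simp flip: h.hom_add h.hom_mult)
qed

lemma quot_alg_proj: "(\<lambda>x\<in>carrier A. J +>\<^bsub>A\<^esub> x) \<in> alg_hom k A (quot_alg A J)"
  by (intro alg_hom_restrict A quot_alg_proj_ring_hom) (simp add: quot_alg_smult)

lemma quot_alg_zero_iff:
  "x \<in> carrier A \<Longrightarrow> J +>\<^bsub>A\<^esub> x = \<zero>\<^bsub>quot_alg A J\<^esub> \<longleftrightarrow> x \<in> J"
  using J.a_rcos_const J.rcos_const_imp_mem by (auto simp: quot_alg_sel FactRing_def)

lemma quot_alg_lift:
  assumes T: "algebra k T" and f: "f \<in> alg_hom k A T" and fJ: "\<And>x. x \<in> J \<Longrightarrow> f x = \<zero>\<^bsub>T\<^esub>"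
  obtains g where "g \<in> alg_hom k (quot_alg A J) T" "\<And>x. x \<in> carrier A \<Longrightarrow> g (J +>\<^bsub>A\<^esub> x) = f x"
proof -
  interpret T: algebra k T by fact
  interpret f: ring_hom_cring A T f by (rule alg_hom_ring_hom_cring[OF A T f])
  interpret h: ring_hom_cring A "quot_alg A J" "\<lambda>x. J +>\<^bsub>A\<^esub> x"
    by (intro ring_hom_cring.intro ring_hom_cring_axioms.intro A.M_cring quot_cring
        quot_alg_proj_ring_hom)
  \<comment> \<open>The value at a coset is taken at an arbitrary representative; two of them differ
    by an element of \<open>J\<close>, which \<open>f\<close> kills.\<close>
  define g where "g S = f (SOME x. x \<in> S)" for S
  have g: "g (J +>\<^bsub>A\<^esub> x) = f x" if x: "x \<in> carrier A" for x
  proof -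
    have "x \<in> J +>\<^bsub>A\<^esub> x" using x by (simp add: J.a_rcos_self)
    then have "(SOME y. y \<in> J +>\<^bsub>A\<^esub> x) \<in> J +>\<^bsub>A\<^esub> x" by (metis someI_ex)
    then obtain j where j: "j \<in> J" "(SOME y. y \<in> J +>\<^bsub>A\<^esub> x) = j \<oplus>\<^bsub>A\<^esub> x"
      by (auto simp: a_r_coset_def')
    then show ?thesis using x fJ J.Icarr by (simp add: g_def)
  qed
  have "restrict g (carrier (quot_alg A J)) \<in> alg_hom k (quot_alg A J) T"
    using f
    by (intro alg_hom_restrict quot_alg_algebra ring_hom_memI)
      (auto simp: carrier_quot_alg g alg_homD quot_alg_smult simp flip: h.hom_add h.hom_mult h.hom_one)
  then show thesis by (rule that) (use g in \<open>auto simp: carrier_quot_alg\<close>)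
qed

end

section \<open>Polynomial algebras\<close>

text \<open>Meant for \<open>mpoly\<close>, whose product is compared with the convolution
  \<open>mconv\<close> on the carrier only.\<close>

lemma algebra_cong:
  assumes A: "algebra k A" and c: "carrier B = carrier A" and z: "zero B = zero A"
    and o: "one B = one A"
    and a: "\<And>x y. x \<in> carrier A \<Longrightarrow> y \<in> carrier A \<Longrightarrow> x \<oplus>\<^bsub>B\<^esub> y = x \<oplus>\<^bsub>A\<^esub> y"
    and m: "\<And>x y. x \<in> carrier A \<Longrightarrow> y \<in> carrier A \<Longrightarrow> x \<otimes>\<^bsub>B\<^esub> y = x \<otimes>\<^bsub>A\<^esub> y"
    and s: "\<And>b x. b \<in> carrier k \<Longrightarrow> x \<in> carrier A \<Longrightarrow> b \<odot>\<^bsub>B\<^esub> x = b \<odot>\<^bsub>A\<^esub> x"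
  shows "algebra k B"
proof -
  interpret A: algebra k A by fact
  have "cring B"
    using A.M_cring c z o a m by (rule cring_cong)
  then show ?thesis
    by (intro algebraI A.R_cring)
      (auto simp: c a m s A.smult_l_distr A.smult_r_distr A.smult_assoc1 A.smult_assoc2)
qed

definition mprod :: "('a, 'c) monoid_scheme \<Rightarrow> ('v \<Rightarrow> 'a) \<Rightarrow> 'v multiset \<Rightarrow> 'a"
  where "mprod G f M = (\<Otimes>\<^bsub>G\<^esub>v\<in>set_mset M. f v [^]\<^bsub>G\<^esub> count M v)"

context comm_monoid
begin

lemma mprod_empty [simp]: "mprod G f {#} = \<one>"
  by (simp add: mprod_def)

lemma mprod_closed [simp]:
  "(\<And>v. v \<in># M \<Longrightarrow> f v \<in> carrier G) \<Longrightarrow> mprod G f M \<in> carrier G"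
  by (auto simp: mprod_def)

lemma mprod_add_mset:
  assumes "\<And>w. w \<in># add_mset v M \<Longrightarrow> f w \<in> carrier G"
  shows "mprod G f (add_mset v M) = f v \<otimes> mprod G f M"
proof -
  \<comment> \<open>The factor at \<open>v\<close> is split off, since its exponent is the only one
    that changes.\<close>
  let ?S = "set_mset M - {v}" and ?g = "\<lambda>w. f w [^] count M w"
  have *: "(\<Otimes>w\<in>?S. f w [^] count (add_mset v M) w) = finprod G ?g ?S"
    using assms by (intro finprod_cong') auto
  have "mprod G f M = f v [^] count M v \<otimes> finprod G ?g ?S"
  proof (cases "v \<in># M")
    case True
    then have "finprod G ?g (insert v ?S) = f v [^] count M v \<otimes> finprod G ?g ?S"
      using assms by (intro finprod_insert) auto
    then show ?thesis using True by (simp add: mprod_def insert_absorb)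
  next
    case False
    then have "?S = set_mset M" "count M v = 0" by (auto simp: not_in_iff)
    then show ?thesis using assms by (simp add: mprod_def Pi_def)
  qed
  moreover have "mprod G f (add_mset v M) =
      f v [^] count (add_mset v M) v \<otimes> (\<Otimes>w\<in>?S. f w [^] count (add_mset v M) w)"
  proof -
    have "set_mset (add_mset v M) = insert v ?S" by auto
    then show ?thesis using assms unfolding mprod_def
      by (metis (no_types, lifting) DiffD2 Pi_I finite_Diff finite_set_mset finprod_insert insertCI
          insertI1 nat_pow_closed)
  qed
  moreover have "count (add_mset v M) v = Suc (count M v)" by simp
  moreover have "finprod G ?g ?S \<in> carrier G" using assms by (intro finprod_closed) auto
  ultimately show ?thesis
    using assms by (simp only: * nat_pow_Suc) (simp add: m_ac)
qed

lemma mprod_union: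
  assumes "\<And>w. w \<in># M + N \<Longrightarrow> f w \<in> carrier G"
  shows "mprod G f (M + N) = mprod G f M \<otimes> mprod G f N"
  using assms
proof (induction M)
  case (add x M)
  have "mprod G f (add_mset x (M + N)) = f x \<otimes> mprod G f (M + N)"
    "mprod G f (add_mset x M) = f x \<otimes> mprod G f M"
    using add.prems by (intro mprod_add_mset; auto)+
  then show ?case using add by (simp add: m_assoc)
qed simp

end

definition monoid_alg_lift :: "('k, 'c) ring_scheme \<Rightarrow> ('k, 't) module \<Rightarrow> ('m \<Rightarrow> 't) \<Rightarrow> ('m \<Rightarrow> 'k) \<Rightarrow> 't"
  where "monoid_alg_lift k T \<mu> f = (\<Oplus>\<^bsub>T\<^esub>m\<in>{m. f m \<noteq> \<zero>\<^bsub>k\<^esub>}. f m \<odot>\<^bsub>T\<^esub> \<mu> m)"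

text \<open>Universal property of a monoid algebra: a multiplicative map on the exponents extends
  linearly. Multiplicativity is checked on pairs of terms and carried over to all elements by
  additivity in each argument.\<close>

lemma (in cring) monoid_alg_lift_hom:
  fixes N :: "'m::comm_monoid_add set"
  assumes T: "algebra R T" and N: "0 \<in> N" "\<And>a b. a \<in> N \<Longrightarrow> b \<in> N \<Longrightarrow> a + b \<in> N"
    and \<mu>: "\<And>a. a \<in> N \<Longrightarrow> \<mu> a \<in> carrier T" "\<mu> 0 = \<one>\<^bsub>T\<^esub>"
      "\<And>a b. a \<in> N \<Longrightarrow> b \<in> N \<Longrightarrow> \<mu> (a + b) = \<mu> a \<otimes>\<^bsub>T\<^esub> \<mu> b"
  shows "monoid_alg_lift R T \<mu> \<in> ring_hom (monoid_alg R N) T"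
    and "c \<in> carrier R \<Longrightarrow> f \<in> carrier (monoid_alg R N) \<Longrightarrow>
      monoid_alg_lift R T \<mu> (\<lambda>m. c \<otimes> f m) = c \<odot>\<^bsub>T\<^esub> monoid_alg_lift R T \<mu> f"
    and "c \<in> carrier R \<Longrightarrow> a \<in> N \<Longrightarrow> monoid_alg_lift R T \<mu> (mterm R a c) = c \<odot>\<^bsub>T\<^esub> \<mu> a"
proof -
  interpret T: algebra R T by fact
  let ?e = "monoid_alg_lift R T \<mu>" and ?M = "monoid_alg R N"
  have enl: "?e f = (\<Oplus>\<^bsub>T\<^esub>m\<in>A. f m \<odot>\<^bsub>T\<^esub> \<mu> m)"
    if "f \<in> carrier ?M" "finite A" "{m. f m \<noteq> \<zero>} \<subseteq> A" "A \<subseteq> N" for f A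
    unfolding monoid_alg_lift_def
    by (rule T.M.add.finprod_mono_neutral_cong_left)
      (use that \<mu> monoid_algD[OF that(1)] in \<open>auto\<close>)
  have cl: "?e f \<in> carrier T" if "f \<in> carrier ?M" for f
    unfolding monoid_alg_lift_def
    using \<mu>(1) monoid_algD[OF that] by (auto intro!: T.M.finsum_closed)
  have add: "?e (\<lambda>m. f m \<oplus> g m) = ?e f \<oplus>\<^bsub>T\<^esub> ?e g"
    if f: "f \<in> carrier ?M" and g: "g \<in> carrier ?M" for f g
  proof -
    let ?A = "{m. f m \<noteq> \<zero>} \<union> {m. g m \<noteq> \<zero>}"
    note D = monoid_algD[OF f] monoid_algD[OF g]
    have A: "finite ?A" "?A \<subseteq> N" using D by auto
    have AN: "m \<in> N" if "m \<in> ?A" for m using that A(2) by blast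
    have "?e (\<lambda>m. f m \<oplus> g m) = (\<Oplus>\<^bsub>T\<^esub>m\<in>?A. (f m \<oplus> g m) \<odot>\<^bsub>T\<^esub> \<mu> m)"
      by (rule enl[OF madd_closed[OF f g]]) (use A in auto)
    also have "\<dots> = (\<Oplus>\<^bsub>T\<^esub>m\<in>?A. f m \<odot>\<^bsub>T\<^esub> \<mu> m \<oplus>\<^bsub>T\<^esub> g m \<odot>\<^bsub>T\<^esub> \<mu> m)"
      using D(1,4) \<mu>(1) AN by (intro T.M.finsum_cong' refl) (auto simp: T.smult_l_distr)
    also have "\<dots> = (\<Oplus>\<^bsub>T\<^esub>m\<in>?A. f m \<odot>\<^bsub>T\<^esub> \<mu> m) \<oplus>\<^bsub>T\<^esub> (\<Oplus>\<^bsub>T\<^esub>m\<in>?A. g m \<odot>\<^bsub>T\<^esub> \<mu> m)"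
      using D(1,4) \<mu>(1) AN by (intro T.M.finsum_addf) auto
    also have "\<dots> = ?e f \<oplus>\<^bsub>T\<^esub> ?e g"
      using enl[OF f A(1) _ A(2)] enl[OF g A(1) _ A(2)] by auto
    finally show ?thesis .
  qed
  have zero: "?e (\<lambda>m. \<zero>) = \<zero>\<^bsub>T\<^esub>"
    by (simp add: monoid_alg_lift_def)
  show sing: "?e (mterm R a c) = c \<odot>\<^bsub>T\<^esub> \<mu> a" if "c \<in> carrier R" "a \<in> N" for a c
  proof -
    have "?e (mterm R a c) = (\<Oplus>\<^bsub>T\<^esub>m\<in>{a}. mterm R a c m \<odot>\<^bsub>T\<^esub> \<mu> m)"
      by (rule enl) (use that mterm_closed[of a N c] in \<open>auto simp: mterm_def split: if_splits\<close>)
    also have "\<dots> = c \<odot>\<^bsub>T\<^esub> \<mu> a"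
      using that \<mu>(1) by (simp add: mterm_def T.M.finsum_insert[of "{}", simplified])
    finally show ?thesis .
  qed
  have mult: "?e (mconv R f g) = ?e f \<otimes>\<^bsub>T\<^esub> ?e g"
    if f: "f \<in> carrier ?M" and g: "g \<in> carrier ?M" for f g
    using f
  proof (induction rule: monoid_alg_induct)
    case zero
    then show ?case using cl[OF g] by (simp add: \<open>?e (\<lambda>m. \<zero>) = \<zero>\<^bsub>T\<^esub>\<close>)
  next
    case (add_term f a c)
    have "?e (mconv R (mterm R a c) g) = ?e (mterm R a c) \<otimes>\<^bsub>T\<^esub> ?e g"
      using g
    proof (induction rule: monoid_alg_induct)
      case zero
      then show ?case using cl add_term by (simp add: \<open>?e (\<lambda>m. \<zero>) = \<zero>\<^bsub>T\<^esub>\<close> mterm_closed)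
    next
      case (add_term g b d)
      then show ?case
        using \<open>a \<in> N\<close> \<open>c \<in> carrier R\<close> \<mu>
        by (simp add: mconv_add_right[of _ N _ _ N] mterm_closed mconv_mterm_mterm add cl sing
            mconv_closed N T.r_distr T.smult_assoc1 T.smult_assoc2 T.m_assoc T.smult_closed
            T.m_comm[of "\<mu> a"])
    qed
    then show ?case
      using add_term g
      by (simp add: mconv_add_left[of _ N _ _ N] mterm_closed add cl mconv_closed N T.l_distr)
  qed
  show "?e \<in> ring_hom ?M T"
    using \<mu> N by (intro ring_hom_memI) (simp_all add: cl add mult sing)
  show "?e (\<lambda>m. c \<otimes> f m) = c \<odot>\<^bsub>T\<^esub> ?e f" if "c \<in> carrier R" "f \<in> carrier ?M" for c f
    using that(2)
  proof (induction rule: monoid_alg_induct)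
    case zero
    then show ?case using that(1) by (simp add: \<open>?e (\<lambda>m. \<zero>) = \<zero>\<^bsub>T\<^esub>\<close>)
  next
    case (add_term f a d)
    have 1: "(\<lambda>m. c \<otimes> mterm R a d m) = mterm R a (c \<otimes> d)"
      using that(1) by (auto simp: mterm_def)
    have "(\<lambda>m. c \<otimes> (mterm R a d m \<oplus> f m)) = (\<lambda>m. mterm R a (c \<otimes> d) m \<oplus> c \<otimes> f m)"
      using add_term that(1) monoid_algD(1)[OF add_term(1)]
      by (auto simp: mterm_def r_distr)
    then show ?case
      using add_term that(1) \<mu>(1)
      by (simp add: add mterm_closed msmult_closed sing cl T.smult_assoc1 T.smult_r_distr)
  qed
qed

context cring
begin

lemma indexed_var_mterm: "indexed_var v = mterm R {#v#} \<one>"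
  by (auto simp: indexed_var_def indexed_pmult_def indexed_const_def mterm_def fun_eq_iff
      dest: multi_member_split)

lemma indexed_const_mterm: "indexed_const c = mterm R {#} c"
  by (simp add: indexed_const_def mterm_def)

text \<open>Each constructor of polynomials keeps the support finite and inside the monomials over
  \<open>I\<close>; conversely a single term is a constant multiplied by its variables one after the
  other. Polynomial rings thus become monoid algebras over multisets.\<close>

lemma mpoly_carrier:
  "carrier (mpoly R I) = carrier (monoid_alg R {M. set_mset M \<subseteq> I})"
proof -
  let ?N = "{M. set_mset M \<subseteq> I}"
  have "f \<in> carrier (monoid_alg R ?N)" if "f \<in> indexed_pset I (carrier R)" for f
    using that
  proof (induction rule: indexed_pset.induct)
    case (indexed_const c)
    then show ?case by (simp add: indexed_const_mterm mterm_closed)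
  next
    case (indexed_padd P Q)
    then show ?case by (simp add: indexed_padd_def madd_closed)
  next
    case (indexed_pmult P i)
    note D = monoid_algD[OF indexed_pmult.IH]
    have "{m. (P \<Otimes> i) m \<noteq> \<zero>} \<subseteq> add_mset i ` {m. P m \<noteq> \<zero>}"
      by (auto simp: indexed_pmult_def image_iff split: if_splits) (metis insert_DiffM)
    moreover have "finite (add_mset i ` {m. P m \<noteq> \<zero>})" "add_mset i ` {m. P m \<noteq> \<zero>} \<subseteq> ?N"
      using D(2) indexed_pmult.hyps(2) by (auto dest!: D(3))
    moreover have "(P \<Otimes> i) m \<in> carrier R" for m
      using D by (simp add: indexed_pmult_def)
    ultimately show ?case
      unfolding monoid_alg_def by (auto intro: finite_subset)
  qed
  moreover have "f \<in> indexed_pset I (carrier R)" if "f \<in> carrier (monoid_alg R ?N)" for f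
    using that
  proof (induction rule: monoid_alg_induct)
    case zero
    then show ?case
      using indexed_pset.indexed_const[of \<zero> "carrier R" I] by (simp add: indexed_zero_def)
  next
    case (add_term f M c)
    have "mterm R M c \<in> indexed_pset I (carrier R)" if "set_mset M \<subseteq> I"
      using that
    proof (induction M)
      case empty
      then show ?case
        using add_term by (auto simp flip: indexed_const_mterm intro: indexed_pset.intros)
    next
      case (add v M)
      have "mterm R (add_mset v M) c = indexed_pmult (mterm R M c) v"
        by (auto simp: mterm_def indexed_pmult_def fun_eq_iff dest: multi_member_split)
      then show ?case using add by (auto intro: indexed_pset.intros)
    qed
    then show ?case
      using add_term indexed_pset.indexed_padd[of _ I "carrier R" f]
      by (auto simp: indexed_padd_def)
  qed
  ultimately show ?thesis
    unfolding mpoly_def by auto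
qed

lemma finite_submultisets: "finite {s. s \<subseteq># m}"
proof (rule finite_subset)
  show "{s. s \<subseteq># m} \<subseteq> mset ` {xs. set xs \<subseteq> set_mset m \<and> length xs \<le> size m}"
  proof
    fix s assume s: "s \<in> {s. s \<subseteq># m}"
    obtain xs where xs: "s = mset xs" using ex_mset by metis
    with s have "set xs \<subseteq> set_mset m \<and> length xs \<le> size m"
      using set_mset_mono[of s m] size_mset_mono[of s m] by simp
    with xs show "s \<in> mset ` {xs. set xs \<subseteq> set_mset m \<and> length xs \<le> size m}" by blast
  qed
qed (simp add: finite_lists_length_le)

text \<open>In the double sum of \<open>mconv\<close> the exponent b = m - a is determined by a
  submultiset a of m. The index sets are enlarged by all submultisets of m so that this b is
  present.\<close>

lemma mpoly_mult:
  fixes I :: "'v set"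
  assumes f: "f \<in> carrier (mpoly R I)" and g: "g \<in> carrier (mpoly R I)"
  shows "f \<otimes>\<^bsub>mpoly R I\<^esub> g = mconv R f g"
proof
  fix m :: "'v multiset"
  note f' = f[unfolded mpoly_carrier] and g' = g[unfolded mpoly_carrier]
  note c = monoid_algD(1)[OF f'] monoid_algD(1)[OF g']
  let ?A = "{a. f a \<noteq> \<zero>} \<union> {s. s \<subseteq># m}" and ?B = "{a. g a \<noteq> \<zero>} \<union> {s. s \<subseteq># m}"
  have fin: "finite ?A" "finite ?B"
    using monoid_algD(2)[OF f'] monoid_algD(2)[OF g'] finite_submultisets[of m] by auto
  have "mconv R f g m = (\<Oplus>a\<in>?A. \<Oplus>b\<in>?B. if a + b = m then f a \<otimes> g b else \<zero>)"
    by (rule mconv_eq[OF f' g']) (use fin in auto)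
  also have "\<dots> = (\<Oplus>a\<in>?A. if a \<subseteq># m then f a \<otimes> g (m - a) else \<zero>)"
  proof (intro finsum_cong' refl)
    fix a assume "a \<in> ?A"
    show "(\<Oplus>b\<in>?B. if a + b = m then f a \<otimes> g b else \<zero>) = (if a \<subseteq># m then f a \<otimes> g (m - a) else \<zero>)"
    proof (cases "a \<subseteq># m")
      case True
      have "(\<Oplus>b\<in>?B. if a + b = m then f a \<otimes> g b else \<zero>) =
         (\<Oplus>b\<in>?B. if m - a = b then f a \<otimes> g b else \<zero>)"
        using True c by (intro finsum_cong' refl) auto
      also have "\<dots> = f a \<otimes> g (m - a)"
        using fin c by (subst finsum_singleton) auto
      finally show ?thesis using True by simp
    next
      case False
      then show ?thesis
        by (auto intro!: add.finprod_one_eqI)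
    qed
  qed (use c in auto)
  also have "\<dots> = (\<Oplus>a\<in>{s. s \<subseteq># m}. f a \<otimes> g (m - a))"
    by (rule add.finprod_mono_neutral_cong_right) (use fin c in auto)
  finally show "(f \<otimes>\<^bsub>mpoly R I\<^esub> g) m = mconv R f g m"
    by (simp add: mpoly_def)
qed

lemma mpoly_sel:
  "one (mpoly R I) = mterm R {#} \<one>" "zero (mpoly R I) = (\<lambda>m. \<zero>)"
  "ring.add (mpoly R I) = (\<lambda>f g m. f m \<oplus> g m)" "module.smult (mpoly R I) = (\<lambda>c f m. c \<otimes> f m)"
  by (simp_all add: mpoly_def indexed_const_mterm indexed_padd_def fun_eq_iff) (simp add: mterm_def)

lemma mpoly_algebra: "algebra R (mpoly R I)"
proof (rule algebra_cong)
  show "algebra R (monoid_alg R {M. set_mset M \<subseteq> I})"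
    by (rule monoid_alg_algebra) auto
qed (auto simp: mpoly_carrier mpoly_sel mpoly_mult[where I = I, unfolded mpoly_carrier])

lemma mpoly_var_closed: "v \<in> I \<Longrightarrow> indexed_var v \<in> carrier (mpoly R I)"
  by (simp add: indexed_var_mterm mpoly_carrier mterm_closed)

text \<open>Identifies a constructor of polynomials with a ring product; this turns the inductive
  definition of polynomials into \<open>mpoly_induct\<close>.\<close>

lemma mpoly_mult_var:
  assumes f: "f \<in> carrier (mpoly R I)" and v: "v \<in> I"
  shows "indexed_pmult f v = indexed_var v \<otimes>\<^bsub>mpoly R I\<^esub> f"
proof -
  have "indexed_pmult f v = mconv R (indexed_var v) f"
    using f[unfolded mpoly_carrier]
  proof (induction rule: monoid_alg_induct)
    case zero
    then show ?case using indexed_pmult_zero[of v] by (simp add: indexed_zero_def)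
  next
    case (add_term f M c)
    have "indexed_pmult (\<lambda>n. mterm R M c n \<oplus> f n) v =
       (\<lambda>m. indexed_pmult (mterm R M c) v m \<oplus> indexed_pmult f v m)"
      by (auto simp: indexed_pmult_def)
    moreover have "indexed_pmult (mterm R M c) v = mterm R (add_mset v M) c"
      by (auto simp: mterm_def indexed_pmult_def fun_eq_iff dest: multi_member_split)
    ultimately show ?case
      using add_term v unfolding indexed_var_mterm
      by (simp add: mconv_add_right[of _ "{M. set_mset M \<subseteq> I}" _ _ "{M. set_mset M \<subseteq> I}"]
          mterm_closed mconv_mterm_mterm)
  qed
  then show ?thesis using f v by (simp add: mpoly_mult mpoly_var_closed)
qed

lemma mpoly_induct [consumes 1, case_names one smult add var]:
  assumes f: "f \<in> carrier (mpoly R I)"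
    and "P \<one>\<^bsub>mpoly R I\<^esub>"
    and "\<And>c f. c \<in> carrier R \<Longrightarrow> f \<in> carrier (mpoly R I) \<Longrightarrow> P f \<Longrightarrow> P (c \<odot>\<^bsub>mpoly R I\<^esub> f)"
    and "\<And>f g. f \<in> carrier (mpoly R I) \<Longrightarrow> P f \<Longrightarrow> g \<in> carrier (mpoly R I) \<Longrightarrow> P g \<Longrightarrow>
      P (f \<oplus>\<^bsub>mpoly R I\<^esub> g)"
    and "\<And>f v. f \<in> carrier (mpoly R I) \<Longrightarrow> P f \<Longrightarrow> v \<in> I \<Longrightarrow>
      P (indexed_var v \<otimes>\<^bsub>mpoly R I\<^esub> f)"
  shows "P f"
proof -
  have car: "carrier (mpoly R I) = indexed_pset I (carrier R)" by (simp add: mpoly_def)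
  from f have "f \<in> indexed_pset I (carrier R)" by (simp add: car)
  then show ?thesis
  proof (induction rule: indexed_pset.induct)
    case (indexed_const c)
    interpret M: algebra R "mpoly R I" by (rule mpoly_algebra)
    have "indexed_const c = c \<odot>\<^bsub>mpoly R I\<^esub> \<one>\<^bsub>mpoly R I\<^esub>"
      using indexed_const by (simp add: mpoly_sel indexed_const_mterm) (auto simp: mterm_def)
    then show ?case using assms(2,3) indexed_const by simp
  next
    case (indexed_padd f g)
    then show ?case using assms(4)[of f g] by (simp add: car mpoly_sel indexed_padd_def)
  next
    case (indexed_pmult f v)
    then show ?case using assms(5)[of f v] mpoly_mult_var[of f I v] by (simp add: car)
  qed
qed

lemma mpoly_hom_eqI:
  assumes T: "algebra R T" and f: "f \<in> alg_hom R (mpoly R I) T" and g: "g \<in> alg_hom R (mpoly R I) T"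
    and eq: "\<And>v. v \<in> I \<Longrightarrow> f (indexed_var v) = g (indexed_var v)"
  shows "f = g"
proof (rule alg_hom_eqI[OF f g])
  interpret f: ring_hom_cring "mpoly R I" T f by (rule alg_hom_ring_hom_cring[OF mpoly_algebra T f])
  interpret g: ring_hom_cring "mpoly R I" T g by (rule alg_hom_ring_hom_cring[OF mpoly_algebra T g])
  fix x assume "x \<in> carrier (mpoly R I)"
  then show "f x = g x"
    by (induction rule: mpoly_induct) (simp_all add: eq alg_homD[OF f] alg_homD[OF g] mpoly_var_closed)
qed

text \<open>A monomial is evaluated as the product of the values of its variables, which is
  multiplicative in the monomial, and \<open>monoid_alg_lift\<close> extends this map.\<close>

lemma mpoly_hom_ex:
  assumes T: "algebra R T" and a: "\<And>v. v \<in> I \<Longrightarrow> a v \<in> carrier T"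
  obtains f where "f \<in> alg_hom R (mpoly R I) T" "\<And>v. v \<in> I \<Longrightarrow> f (indexed_var v) = a v"
proof -
  interpret T: algebra R T by fact
  let ?N = "{M. set_mset M \<subseteq> I}" and ?e = "monoid_alg_lift R T (mprod T a)"
  have e: "?e \<in> ring_hom (monoid_alg R ?N) T"
    "\<And>c f. c \<in> carrier R \<Longrightarrow> f \<in> carrier (monoid_alg R ?N) \<Longrightarrow> ?e (\<lambda>m. c \<otimes> f m) = c \<odot>\<^bsub>T\<^esub> ?e f"
    "\<And>c M. c \<in> carrier R \<Longrightarrow> M \<in> ?N \<Longrightarrow> ?e (mterm R M c) = c \<odot>\<^bsub>T\<^esub> mprod T a M"
  proof -
    have 1: "mprod T a M \<in> carrier T" if "M \<in> ?N" for M
      using a that by (auto intro!: T.mprod_closed)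
    have 2: "mprod T a (M + M') = mprod T a M \<otimes>\<^bsub>T\<^esub> mprod T a M'" if "M \<in> ?N" "M' \<in> ?N" for M M'
      using a that by (intro T.mprod_union) auto
    note h = monoid_alg_lift_hom[OF T, of ?N "mprod T a", OF _ _ 1 _ 2]
    show "?e \<in> ring_hom (monoid_alg R ?N) T" by (rule h(1)) auto
    show "?e (\<lambda>m. c \<otimes> f m) = c \<odot>\<^bsub>T\<^esub> ?e f"
      if "c \<in> carrier R" "f \<in> carrier (monoid_alg R ?N)" for c f
      using that by (intro h(2)) auto
    show "?e (mterm R M c) = c \<odot>\<^bsub>T\<^esub> mprod T a M" if "c \<in> carrier R" "M \<in> ?N" for c M
      using that by (intro h(3)) auto
  qed
  have "?e \<in> ring_hom (mpoly R I) T"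
    using e(1) by (auto simp: ring_hom_def mpoly_carrier mpoly_mult mpoly_sel
        mpoly_mult[where I = I, unfolded mpoly_carrier])
  then have "restrict ?e (carrier (mpoly R I)) \<in> alg_hom R (mpoly R I) T"
    by (intro alg_hom_restrict mpoly_algebra) (auto simp: mpoly_sel mpoly_carrier e(2))
  moreover have "?e (indexed_var v) = a v" if "v \<in> I" for v
    using that a e(3)[of \<one> "{#v#}"] T.mprod_add_mset[of v "{#}" a] by (simp add: indexed_var_mterm)
  ultimately show thesis
    by (intro that) (auto simp: mpoly_var_closed)
qed

end

text \<open>The variables are linearly ordered in order that the multiset order on monomials be
  total, as the argument with leading terms requires.\<close>

lemma (in domain) mpoly_domain:
  fixes I :: "'v::linorder set"
  shows "domain (mpoly R I)"
proof -
  interpret M: algebra R "mpoly R I" by (rule mpoly_algebra)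
  interpret D: domain "monoid_alg R {M. set_mset M \<subseteq> I}"
    by (rule monoid_alg_domain) auto
  show ?thesis
    using D.one_not_zero D.integral
    by (intro domainI M.M_cring) (auto simp: mpoly_sel mpoly_carrier mpoly_mult[where I = I, unfolded mpoly_carrier])
qed

section \<open>Presentations and represented functors\<close>

context cring
begin

context
  fixes I :: "'v set" and rels :: "('v multiset \<Rightarrow> 'a) set"
  assumes rels: "rels \<subseteq> carrier (mpoly R I)"
begin

interpretation P: algebra R "mpoly R I" by (rule mpoly_algebra)

lemma pres_ideal: "ideal (Idl\<^bsub>mpoly R I\<^esub> rels) (mpoly R I)"
  by (rule P.genideal_ideal[OF rels])

lemmas pres_algebra = quot_alg_algebra[OF mpoly_algebra pres_ideal]
lemmas pres_proj = quot_alg_proj[OF mpoly_algebra pres_ideal]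

lemma pres_var_closed:
  "v \<in> I \<Longrightarrow> Idl\<^bsub>mpoly R I\<^esub> rels +>\<^bsub>mpoly R I\<^esub> indexed_var v \<in>
     carrier (quot_alg (mpoly R I) (Idl\<^bsub>mpoly R I\<^esub> rels))"
  by (auto simp: carrier_quot_alg mpoly_var_closed)

lemma pres_rels_zero:
  "x \<in> rels \<Longrightarrow> Idl\<^bsub>mpoly R I\<^esub> rels +>\<^bsub>mpoly R I\<^esub> x =
     \<zero>\<^bsub>quot_alg (mpoly R I) (Idl\<^bsub>mpoly R I\<^esub> rels)\<^esub>"
  using rels P.genideal_self[OF rels]
  by (subst quot_alg_zero_iff[OF mpoly_algebra pres_ideal]) auto

lemma pres_hom_eqI:
  assumes T: "algebra R T"
    and f: "f \<in> alg_hom R (quot_alg (mpoly R I) (Idl\<^bsub>mpoly R I\<^esub> rels)) T"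
    and g: "g \<in> alg_hom R (quot_alg (mpoly R I) (Idl\<^bsub>mpoly R I\<^esub> rels)) T"
    and eq: "\<And>v. v \<in> I \<Longrightarrow> f (Idl\<^bsub>mpoly R I\<^esub> rels +>\<^bsub>mpoly R I\<^esub> indexed_var v) =
       g (Idl\<^bsub>mpoly R I\<^esub> rels +>\<^bsub>mpoly R I\<^esub> indexed_var v)"
  shows "f = g"
proof (rule alg_hom_eqI[OF f g])
  let ?p = "\<lambda>x\<in>carrier (mpoly R I). Idl\<^bsub>mpoly R I\<^esub> rels +>\<^bsub>mpoly R I\<^esub> x"
  have *: "compose (carrier (mpoly R I)) f ?p = compose (carrier (mpoly R I)) g ?p"
    by (rule mpoly_hom_eqI[OF T alg_hom_compose[OF mpoly_algebra pres_proj f]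
          alg_hom_compose[OF mpoly_algebra pres_proj g]])
      (simp add: compose_def mpoly_var_closed eq)
  fix x assume "x \<in> carrier (quot_alg (mpoly R I) (Idl\<^bsub>mpoly R I\<^esub> rels))"
  then obtain y where y: "y \<in> carrier (mpoly R I)" "x = Idl\<^bsub>mpoly R I\<^esub> rels +>\<^bsub>mpoly R I\<^esub> y"
    by (auto simp: carrier_quot_alg)
  then show "f x = g x" using fun_cong[OF *, of y] by (simp add: compose_def)
qed

lemma pres_hom_ex:
  assumes T: "algebra R T" and f: "f \<in> alg_hom R (mpoly R I) T" and z: "f ` rels \<subseteq> {\<zero>\<^bsub>T\<^esub>}"
  obtains g where "g \<in> alg_hom R (quot_alg (mpoly R I) (Idl\<^bsub>mpoly R I\<^esub> rels)) T"
    "\<And>x. x \<in> carrier (mpoly R I) \<Longrightarrow> g (Idl\<^bsub>mpoly R I\<^esub> rels +>\<^bsub>mpoly R I\<^esub> x) = f x"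
proof -
  interpret f: ring_hom_cring "mpoly R I" T f
    by (rule alg_hom_ring_hom_cring[OF mpoly_algebra T f])
  have "ideal (a_kernel (mpoly R I) T f) (mpoly R I)"
    by (rule ring_hom_ring.kernel_is_ideal[OF ring_hom_ringI2])
      (rule algebra_subD(3)[OF mpoly_algebra] algebra_subD(3)[OF T] f.homh)+
  moreover have "rels \<subseteq> a_kernel (mpoly R I) T f"
  proof
    fix x assume "x \<in> rels"
    then have "x \<in> carrier (mpoly R I)" "f x = \<zero>\<^bsub>T\<^esub>" using z rels by blast+
    then show "x \<in> a_kernel (mpoly R I) T f" unfolding a_kernel_def' by blast
  qed
  ultimately have "Idl\<^bsub>mpoly R I\<^esub> rels \<subseteq> a_kernel (mpoly R I) T f"
    by (rule P.genideal_minimal)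
  then have "f x = \<zero>\<^bsub>T\<^esub>" if "x \<in> Idl\<^bsub>mpoly R I\<^esub> rels" for x
    using that unfolding a_kernel_def' by blast
  then show thesis
    using quot_alg_lift[OF mpoly_algebra pres_ideal T f] that by metis
qed

text \<open>Induction on polynomials, passed to the quotient. It reduces the claim that a subspace
  is everything to stability under multiplication by the generators.\<close>

lemma pres_induct [consumes 1, case_names one smult add var]:
  fixes Q
  defines "Q \<equiv> quot_alg (mpoly R I) (Idl\<^bsub>mpoly R I\<^esub> rels)"
  assumes x: "x \<in> carrier Q"
    and one: "Pr \<one>\<^bsub>Q\<^esub>"
    and smult: "\<And>c y. c \<in> carrier R \<Longrightarrow> y \<in> carrier Q \<Longrightarrow> Pr y \<Longrightarrow> Pr (c \<odot>\<^bsub>Q\<^esub> y)"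
    and add: "\<And>y z. y \<in> carrier Q \<Longrightarrow> Pr y \<Longrightarrow> z \<in> carrier Q \<Longrightarrow> Pr z \<Longrightarrow> Pr (y \<oplus>\<^bsub>Q\<^esub> z)"
    and var: "\<And>y v. y \<in> carrier Q \<Longrightarrow> Pr y \<Longrightarrow> v \<in> I \<Longrightarrow>
      Pr ((Idl\<^bsub>mpoly R I\<^esub> rels +>\<^bsub>mpoly R I\<^esub> indexed_var v) \<otimes>\<^bsub>Q\<^esub> y)"
  shows "Pr x"
proof -
  let ?p = "\<lambda>x\<in>carrier (mpoly R I). Idl\<^bsub>mpoly R I\<^esub> rels +>\<^bsub>mpoly R I\<^esub> x"
  interpret p: ring_hom_cring "mpoly R I" Q ?p
    unfolding Q_def by (rule alg_hom_ring_hom_cring[OF mpoly_algebra pres_algebra pres_proj])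
  obtain y where y: "y \<in> carrier (mpoly R I)" "x = ?p y"
    using x by (auto simp: carrier_quot_alg Q_def)
  have "Pr (?p y)"
    using y(1)
  proof (induction rule: mpoly_induct)
    case one
    then show ?case using assms(3) p.hom_one by simp
  next
    case (smult c f)
    then show ?case
      using assms(4)[of c "?p f"] alg_homD(3)[OF pres_proj, of c f] p.hom_closed[of f]
      by (simp add: Q_def)
  next
    case (add f g)
    then show ?case using assms(5)[of "?p f" "?p g"] p.hom_closed p.hom_add[of f g] by simp
  next
    case (var f v)
    then show ?case
      using assms(6)[of "?p f" v] p.hom_closed p.hom_mult[of "indexed_var v" f]
      by (simp add: mpoly_var_closed)
  qed
  with y show ?thesis by simp
qed

text \<open>\<open>mk\<close> assembles a point from its coordinates. By \<open>F2\<close> a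
  homomorphism on the polynomial ring gives a point of \<open>F\<close> exactly when it kills the
  relations, that is, when it factors through the quotient; its values on the variables are the
  coordinates of the point.\<close>

lemma represents_presI:
  fixes mk :: "('v \<Rightarrow> 't) \<Rightarrow> 'y" and Fmap :: "(('v multiset \<Rightarrow> 'a) set \<Rightarrow> 't) \<Rightarrow> 'x \<Rightarrow> 'y"
  assumes Fmap: "\<And>f. Fmap f u = mk (\<lambda>v. f (Idl\<^bsub>mpoly R I\<^esub> rels +>\<^bsub>mpoly R I\<^esub> indexed_var v))"
    and inj: "\<And>a b v. mk a = mk b \<Longrightarrow> v \<in> I \<Longrightarrow> a v = b v"
    and cong: "\<And>a b. (\<And>v. v \<in> I \<Longrightarrow> a v = b v) \<Longrightarrow> mk a = mk b"
    and F1: "\<And>T y. algebra R T \<Longrightarrow> y \<in> F T \<Longrightarrow> \<exists>a. y = mk a \<and> (\<forall>v\<in>I. a v \<in> carrier T)"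
    and F2: "\<And>T f. algebra R T \<Longrightarrow> f \<in> alg_hom R (mpoly R I) T \<Longrightarrow>
       mk (\<lambda>v. f (indexed_var v)) \<in> F T \<longleftrightarrow> f ` rels \<subseteq> {\<zero>\<^bsub>T\<^esub>}"
  shows "represents R (quot_alg (mpoly R I) (Idl\<^bsub>mpoly R I\<^esub> rels)) u F Fmap"
  unfolding represents_def
proof (intro conjI allI impI)
  let ?J = "Idl\<^bsub>mpoly R I\<^esub> rels"
  let ?Q = "quot_alg (mpoly R I) ?J"
  show "algebra R ?Q" by (rule pres_algebra)
  fix T :: "('a, 't) module" assume T: "algebra R T"
  interpret T: algebra R T by (rule T)
  show "bij_betw (\<lambda>f. Fmap f u) (alg_hom R ?Q T) (F T)"
  proof (intro bij_betwI' iffI)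
    fix f g assume fg: "f \<in> alg_hom R ?Q T" "g \<in> alg_hom R ?Q T" "Fmap f u = Fmap g u"
    show "f = g"
      by (rule pres_hom_eqI[OF T fg(1,2)], rule inj) (use fg(3) in \<open>simp_all add: Fmap\<close>)
  next
    fix f assume f: "f \<in> alg_hom R ?Q T"
    let ?p = "\<lambda>x\<in>carrier (mpoly R I). ?J +>\<^bsub>mpoly R I\<^esub> x"
    let ?f = "compose (carrier (mpoly R I)) f ?p"
    interpret f: ring_hom_cring ?Q T f by (rule alg_hom_ring_hom_cring[OF pres_algebra T f])
    have "?f \<in> alg_hom R (mpoly R I) T"
      by (rule alg_hom_compose[OF mpoly_algebra pres_proj f])
    moreover have "?f x = \<zero>\<^bsub>T\<^esub>" if "x \<in> rels" for x
    proof -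
      have "x \<in> carrier (mpoly R I)" using that rels by auto
      then show ?thesis by (simp add: compose_def pres_rels_zero[OF that])
    qed
    ultimately have "mk (\<lambda>v. ?f (indexed_var v)) \<in> F T"
      by (subst F2[OF T]) auto
    moreover have "mk (\<lambda>v. ?f (indexed_var v)) = Fmap f u"
      unfolding Fmap by (rule cong) (simp add: compose_def mpoly_var_closed)
    ultimately show "Fmap f u \<in> F T" by simp
  next
    fix y assume y: "y \<in> F T"
    then obtain a where a: "y = mk a" "\<forall>v\<in>I. a v \<in> carrier T" using F1[OF T] by blast
    obtain f where f: "f \<in> alg_hom R (mpoly R I) T" "\<And>v. v \<in> I \<Longrightarrow> f (indexed_var v) = a v"
      using mpoly_hom_ex[OF T, of I a] a(2) by blast
    have ya: "y = mk (\<lambda>v. f (indexed_var v))" unfolding a(1) by (rule cong) (simp add: f(2))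
    then have "f ` rels \<subseteq> {\<zero>\<^bsub>T\<^esub>}" using y F2[OF T f(1)] by simp
    then obtain g where g: "g \<in> alg_hom R ?Q T"
      "\<And>x. x \<in> carrier (mpoly R I) \<Longrightarrow> g (?J +>\<^bsub>mpoly R I\<^esub> x) = f x"
      using pres_hom_ex[OF T f(1)] by blast
    have "y = Fmap g u"
      unfolding ya Fmap by (rule cong) (simp add: g(2) mpoly_var_closed)
    with g(1) show "\<exists>x\<in>alg_hom R ?Q T. y = Fmap x u" by blast
  qed simp
qed

end

end

section \<open>Naturality of the defining equations\<close>

lemma mat2_carrier_iff:
  "m \<in> mat2_carrier T \<longleftrightarrow> m11 m \<in> carrier T \<and> m12 m \<in> carrier T \<and> m21 m \<in> carrier T \<and> m22 m \<in> carrier T"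
  by (cases m) (simp add: mat2_carrier_def)

lemma set_mat2_eq: "set_mat2 m = {m11 m, m12 m, m21 m, m22 m}"
  by (cases m) auto

lemma map_mat2_sel [simp]:
  "m11 (map_mat2 f m) = f (m11 m)" "m12 (map_mat2 f m) = f (m12 m)"
  "m21 (map_mat2 f m) = f (m21 m)" "m22 (map_mat2 f m) = f (m22 m)"
  by (cases m; simp)+

lemma mat2_eq_iff:
  "m = n \<longleftrightarrow> m11 m = m11 n \<and> m12 m = m12 n \<and> m21 m = m21 n \<and> m22 m = m22 n"
  by (cases m; cases n) simp

lemmas mat2_defs = mat2_zero_def mat2_one_def mat2_minus_def mat2_smult_def mat2_mult_def
  mat2_trace_def mat2_det_def mat2_charpoly_at_def

lemma (in ring) minus_eq_zero_iff:
  "x \<in> carrier R \<Longrightarrow> y \<in> carrier R \<Longrightarrow> x \<ominus> y = \<zero> \<longleftrightarrow> x = y"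
  using r_right_minus_eq by simp

text \<open>Membership becomes the vanishing of the relations evaluated in \<open>T\<close>, a form
  in which naturality in \<open>T\<close> can be used. The same is done for the other two
  functors.\<close>

lemma functor_A_iff:
  "ms \<in> functor_A n T \<longleftrightarrow> length ms = n \<and> set ms \<subseteq> mat2_carrier T \<and> rels_A T ms \<subseteq> {\<zero>\<^bsub>T\<^esub>}"
  by (auto simp: functor_A_def rels_A_def strongly_nilpotent_def set_mat2_eq mat2_eq_iff
      mat2_zero_def UN_subset_iff)

lemma functor_B_iff:
  assumes "cring T"
  shows "(\<phi>, \<alpha>, ms) \<in> functor_B r T \<longleftrightarrow> length ms = r \<and> \<phi> \<in> mat2_carrier T \<and> \<alpha> \<in> carrier T \<and>
    set ms \<subseteq> mat2_carrier T \<and> rels_B T (\<phi>, \<alpha>, ms) \<subseteq> {\<zero>\<^bsub>T\<^esub>}"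
proof -
  interpret T: cring T by fact
  have det: "mat2_det T \<phi> \<ominus>\<^bsub>T\<^esub> \<one>\<^bsub>T\<^esub> = \<zero>\<^bsub>T\<^esub> \<longleftrightarrow> mat2_det T \<phi> = \<one>\<^bsub>T\<^esub>"
    if "\<phi> \<in> mat2_carrier T"
    using that by (intro T.minus_eq_zero_iff) (auto simp: mat2_defs mat2_carrier_iff)
  have mm: "set_mat2 (mat2_minus T (mat2_mult T m \<phi>) (mat2_smult T \<alpha> m)) \<subseteq> {\<zero>\<^bsub>T\<^esub>} \<longleftrightarrow>
      mat2_mult T m \<phi> = mat2_smult T \<alpha> m"
    if "\<phi> \<in> mat2_carrier T" "\<alpha> \<in> carrier T" "m \<in> mat2_carrier T" for m
    using that by (simp add: set_mat2_eq mat2_eq_iff mat2_carrier_iff mat2_minus_def mat2_mult_def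
        mat2_smult_def T.minus_eq_zero_iff)
  have B: "(\<phi>, \<alpha>, ms) \<in> functor_B r T \<longleftrightarrow> ms \<in> functor_A r T \<and> \<phi> \<in> mat2_carrier T \<and>
      mat2_det T \<phi> = \<one>\<^bsub>T\<^esub> \<and> \<alpha> \<in> carrier T \<and> mat2_charpoly_at T \<phi> \<alpha> = \<zero>\<^bsub>T\<^esub> \<and>
      (\<forall>m\<in>set ms. mat2_mult T m \<phi> = mat2_smult T \<alpha> m)"
    unfolding functor_B_def functor_A_def by blast
  show ?thesis
  proof (cases "\<phi> \<in> mat2_carrier T \<and> \<alpha> \<in> carrier T \<and> set ms \<subseteq> mat2_carrier T")
    case True
    then have "(\<forall>m\<in>set ms. mat2_mult T m \<phi> = mat2_smult T \<alpha> m) \<longleftrightarrow>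
        (\<Union>m\<in>set ms. set_mat2 (mat2_minus T (mat2_mult T m \<phi>) (mat2_smult T \<alpha> m))) \<subseteq> {\<zero>\<^bsub>T\<^esub>}"
      unfolding UN_subset_iff using mm by (meson subsetD)
    with True det show ?thesis
      unfolding B functor_A_iff rels_B_def prod.case Un_subset_iff insert_subset by blast
  next
    case False
    then show ?thesis unfolding B functor_A_iff by blast
  qed
qed

lemma functor_C_iff:
  assumes "cring T"
  shows "(\<phi>, \<alpha>, ms) \<in> functor_C r T \<longleftrightarrow> length ms = r + 1 \<and> \<phi> \<in> mat2_carrier T \<and>
    \<alpha> \<in> carrier T \<and> set ms \<subseteq> mat2_carrier T \<and> rels_C r T (\<phi>, \<alpha>, ms) \<subseteq> {\<zero>\<^bsub>T\<^esub>}"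
proof -
  interpret T: cring T by fact
  have mm: "set_mat2 (mat2_minus T (mat2_mult T m \<phi>) (mat2_mult T \<phi> m)) \<subseteq> {\<zero>\<^bsub>T\<^esub>} \<longleftrightarrow>
      mat2_mult T m \<phi> = mat2_mult T \<phi> m"
    if "\<phi> \<in> mat2_carrier T" "m \<in> mat2_carrier T" for m
    using that by (simp add: set_mat2_eq mat2_eq_iff mat2_carrier_iff mat2_minus_def mat2_mult_def
        T.minus_eq_zero_iff)
  have "(\<phi>, \<alpha>, ms) \<in> functor_C r T \<longleftrightarrow>
     (\<phi>, \<alpha>, ms) \<in> functor_B (r + 1) T \<and> mat2_mult T (ms ! r) \<phi> = mat2_mult T \<phi> (ms ! r)"
    by (auto simp: functor_C_def functor_B_def)
  also have "\<dots> \<longleftrightarrow> (\<phi>, \<alpha>, ms) \<in> functor_B (r + 1) T \<and>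
     set_mat2 (mat2_minus T (mat2_mult T (ms ! r) \<phi>) (mat2_mult T \<phi> (ms ! r))) \<subseteq> {\<zero>\<^bsub>T\<^esub>}"
    using mm[of "ms ! r"] by (auto simp: functor_B_def strongly_nilpotent_def)
  finally show ?thesis
    by (auto simp: functor_B_iff[OF assms] rels_C_def)
qed

context ring_hom_cring
begin

lemma hom_minus: "x \<in> carrier R \<Longrightarrow> y \<in> carrier R \<Longrightarrow> h (x \<ominus> y) = h x \<ominus>\<^bsub>S\<^esub> h y"
  by (simp add: a_minus_def)

lemma map_mat2_carrier: "m \<in> mat2_carrier R \<Longrightarrow> map_mat2 h m \<in> mat2_carrier S"
  by (simp add: mat2_carrier_iff)

lemma map_mat2_ops:
  assumes "m \<in> mat2_carrier R"
  shows "mat2_trace S (map_mat2 h m) = h (mat2_trace R m)"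
    "mat2_det S (map_mat2 h m) = h (mat2_det R m)"
    "n \<in> mat2_carrier R \<Longrightarrow> mat2_mult S (map_mat2 h m) (map_mat2 h n) = map_mat2 h (mat2_mult R m n)"
    "n \<in> mat2_carrier R \<Longrightarrow> mat2_minus S (map_mat2 h m) (map_mat2 h n) = map_mat2 h (mat2_minus R m n)"
    "a \<in> carrier R \<Longrightarrow> mat2_smult S (h a) (map_mat2 h m) = map_mat2 h (mat2_smult R a m)"
    "a \<in> carrier R \<Longrightarrow> mat2_charpoly_at S (map_mat2 h m) (h a) = h (mat2_charpoly_at R m a)"
  using assms by (simp_all add: mat2_carrier_iff mat2_eq_iff mat2_defs hom_minus)

lemma mat2_ops_closed:
  assumes "m \<in> mat2_carrier R"
  shows "mat2_trace R m \<in> carrier R" "mat2_det R m \<in> carrier R"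
    "n \<in> mat2_carrier R \<Longrightarrow> mat2_mult R m n \<in> mat2_carrier R"
    "n \<in> mat2_carrier R \<Longrightarrow> mat2_minus R m n \<in> mat2_carrier R"
    "a \<in> carrier R \<Longrightarrow> mat2_smult R a m \<in> mat2_carrier R"
    "a \<in> carrier R \<Longrightarrow> mat2_charpoly_at R m a \<in> carrier R"
  using assms by (simp_all add: mat2_carrier_iff mat2_defs)

lemma rels_A_map:
  assumes "set ms \<subseteq> mat2_carrier R"
  shows "rels_A S (map_A h ms) = h ` rels_A R ms"
proof -
  have "\<And>m. m \<in> set ms \<Longrightarrow> m \<in> mat2_carrier R" using assms by auto
  then show ?thesis
    by (simp add: rels_A_def map_A_def image_Un image_UN map_mat2_ops mat2.set_map)
qed

lemma rels_B_map:
  assumes "\<phi> \<in> mat2_carrier R" "\<alpha> \<in> carrier R" "set ms \<subseteq> mat2_carrier R"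
  shows "rels_B S (map_BC h (\<phi>, \<alpha>, ms)) = h ` rels_B R (\<phi>, \<alpha>, ms)"
proof -
  have "\<And>m. m \<in> set ms \<Longrightarrow> m \<in> mat2_carrier R" using assms by auto
  then show ?thesis
    using assms rels_A_map[OF assms(3)]
    by (simp add: rels_B_def map_BC_def map_A_def image_Un image_UN map_mat2_ops mat2_ops_closed
        mat2.set_map hom_minus insert_commute)
qed

lemma rels_C_map:
  assumes "\<phi> \<in> mat2_carrier R" "\<alpha> \<in> carrier R" "set ms \<subseteq> mat2_carrier R" "length ms = r + 1"
  shows "rels_C r S (map_BC h (\<phi>, \<alpha>, ms)) = h ` rels_C r R (\<phi>, \<alpha>, ms)"
proof -
  have "ms ! r \<in> mat2_carrier R" using assms by auto
  then show ?thesis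
    using assms rels_B_map[OF assms(1-3)]
    by (simp add: rels_C_def map_BC_def image_Un map_mat2_ops mat2_ops_closed mat2.set_map)
qed

end

context
  fixes S :: "('s, 'd) ring_scheme" and T :: "('k, 't) module" and h :: "'s \<Rightarrow> 't"
  assumes h: "ring_hom_cring S T h"
begin

interpretation h: ring_hom_cring S T h by (rule h)

text \<open>Evaluating the relations commutes with ring homomorphisms. For the generic tuple this
  equivalence is the hypothesis \<open>F2\<close> of \<open>represents_presI\<close>.\<close>

lemma functor_A_map_iff:
  assumes "set ms \<subseteq> mat2_carrier S" "length ms = n"
  shows "map_A h ms \<in> functor_A n T \<longleftrightarrow> h ` rels_A S ms \<subseteq> {\<zero>\<^bsub>T\<^esub>}"
  using assms h.map_mat2_carrier unfolding functor_A_iff h.rels_A_map[OF assms(1)]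
  by (auto simp: map_A_def)

lemma functor_B_map_iff:
  assumes "\<phi> \<in> mat2_carrier S" "\<alpha> \<in> carrier S" "set ms \<subseteq> mat2_carrier S" "length ms = n"
  shows "map_BC h (\<phi>, \<alpha>, ms) \<in> functor_B n T \<longleftrightarrow> h ` rels_B S (\<phi>, \<alpha>, ms) \<subseteq> {\<zero>\<^bsub>T\<^esub>}"
  using assms h.map_mat2_carrier h.rels_B_map[OF assms(1-3)]
  by (auto simp: map_BC_def functor_B_iff[OF h.S.is_cring])

lemma functor_C_map_iff:
  assumes "\<phi> \<in> mat2_carrier S" "\<alpha> \<in> carrier S" "set ms \<subseteq> mat2_carrier S" "length ms = r + 1"
  shows "map_BC h (\<phi>, \<alpha>, ms) \<in> functor_C r T \<longleftrightarrow> h ` rels_C r S (\<phi>, \<alpha>, ms) \<subseteq> {\<zero>\<^bsub>T\<^esub>}"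
  using assms h.map_mat2_carrier h.rels_C_map[OF assms]
  by (auto simp: map_BC_def functor_C_iff[OF h.S.is_cring])

end

section \<open>Tuples of matrices as functions of the coordinates\<close>

definition mat2_of :: "(entry \<Rightarrow> 'a) \<Rightarrow> 'a mat2"
  where "mat2_of a = Mat2 (a E11) (a E12) (a E21) (a E22)"

text \<open>Points are indexed by the variables of the polynomial ring, the shape that
  \<open>mk\<close> has in \<open>represents_presI\<close>.\<close>

definition tuple_A :: "nat \<Rightarrow> (coord \<Rightarrow> 'a) \<Rightarrow> 'a mat2 list"
  where "tuple_A n a = map (\<lambda>i. mat2_of (\<lambda>e. a (MV i e))) [0..<n]"

definition tuple_BC :: "nat \<Rightarrow> (coord \<Rightarrow> 'a) \<Rightarrow> 'a mat2 \<times> 'a \<times> 'a mat2 list"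
  where "tuple_BC n a = (mat2_of (\<lambda>e. a (PhiV e)), a AlphaV, tuple_A n a)"

lemma mat2_of_eq_iff: "mat2_of a = mat2_of b \<longleftrightarrow> (\<forall>e. a e = b e)"
  unfolding mat2_of_def by (metis entry.exhaust mat2.inject)

lemma mat2_of_ex: "\<exists>a. m = mat2_of a"
proof -
  have "m = mat2_of (\<lambda>e. case e of E11 \<Rightarrow> m11 m | E12 \<Rightarrow> m12 m | E21 \<Rightarrow> m21 m | E22 \<Rightarrow> m22 m)"
    by (simp add: mat2_of_def)
  then show ?thesis by blast
qed

lemma mat2_of_carrier: "mat2_of a \<in> mat2_carrier T \<longleftrightarrow> (\<forall>e. a e \<in> carrier T)"
  by (auto simp: mat2_of_def mat2_carrier_iff) (metis entry.exhaust)

lemma map_mat2_of: "map_mat2 f (mat2_of a) = mat2_of (\<lambda>e. f (a e))"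
  by (simp add: mat2_of_def)

lemma map_tuple_A: "map_A f (tuple_A n a) = tuple_A n (\<lambda>v. f (a v))"
  by (simp add: map_A_def tuple_A_def map_mat2_of)

lemma map_tuple_BC: "map_BC f (tuple_BC n a) = tuple_BC n (\<lambda>v. f (a v))"
  by (simp add: map_BC_def tuple_BC_def map_mat2_of map_tuple_A[unfolded map_A_def])

lemma gen_A_eq: "gen_A k n = tuple_A n (ring.indexed_var k)"
  by (simp add: gen_A_def tuple_A_def gen_mat_def mat2_of_def)

lemma gen_BC_eq: "gen_BC k n = tuple_BC n (ring.indexed_var k)"
  by (simp add: gen_BC_def tuple_BC_def gen_mat_def mat2_of_def gen_A_eq)

lemma tuple_A_inj: "tuple_A n a = tuple_A n b \<Longrightarrow> v \<in> vars_A n \<Longrightarrow> a v = b v"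
  by (auto simp: tuple_A_def vars_A_def mat2_of_eq_iff)

lemma tuple_A_cong: "(\<And>v. v \<in> vars_A n \<Longrightarrow> a v = b v) \<Longrightarrow> tuple_A n a = tuple_A n b"
  by (auto simp: tuple_A_def vars_A_def mat2_of_eq_iff)

lemma tuple_BC_inj: "tuple_BC n a = tuple_BC n b \<Longrightarrow> v \<in> vars_BC n \<Longrightarrow> a v = b v"
  using tuple_A_inj[of n a b v] by (auto simp: tuple_BC_def vars_BC_def mat2_of_eq_iff)

lemma tuple_BC_cong: "(\<And>v. v \<in> vars_BC n \<Longrightarrow> a v = b v) \<Longrightarrow> tuple_BC n a = tuple_BC n b"
  using tuple_A_cong[of n a b] by (auto simp: tuple_BC_def vars_BC_def mat2_of_eq_iff)

lemma length_tuple_A [simp]: "length (tuple_A n a) = n"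
  by (simp add: tuple_A_def)

lemma tuple_A_carrier:
  "set (tuple_A n a) \<subseteq> mat2_carrier T \<longleftrightarrow> (\<forall>v\<in>vars_A n. a v \<in> carrier T)"
  by (auto simp: tuple_A_def vars_A_def mat2_of_carrier image_subset_iff)

lemma tuple_A_ex:
  assumes "length ms = n"
  shows "\<exists>a. ms = tuple_A n a"
proof -
  define b where "b i = (SOME a. ms ! i = mat2_of a)" for i
  have b: "ms ! i = mat2_of (b i)" for i
    unfolding b_def by (rule someI_ex[OF mat2_of_ex])
  have "ms = tuple_A n (\<lambda>v. case v of MV i e \<Rightarrow> b i e)"
    using assms b by (intro nth_equalityI) (auto simp: tuple_A_def)
  then show ?thesis by blast
qed

lemma tuple_BC_ex:
  assumes "length ms = n"
  shows "\<exists>a. (\<phi>, \<alpha>, ms) = tuple_BC n a"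
proof -
  obtain b where b: "ms = tuple_A n b" using tuple_A_ex[OF assms] by blast
  obtain c where c: "\<phi> = mat2_of c" using mat2_of_ex by blast
  have "(\<phi>, \<alpha>, ms) =
     tuple_BC n (\<lambda>v. case v of MV i e \<Rightarrow> b (MV i e) | PhiV e \<Rightarrow> c e | AlphaV \<Rightarrow> \<alpha>)"
    unfolding b c by (simp add: tuple_BC_def tuple_A_def)
  then show ?thesis by blast
qed

lemma tuple_BC_carrier:
  "(case tuple_BC n a of (\<phi>, \<alpha>, ms) \<Rightarrow>
     \<phi> \<in> mat2_carrier T \<and> \<alpha> \<in> carrier T \<and> set ms \<subseteq> mat2_carrier T \<and> length ms = n) \<longleftrightarrow>
   (\<forall>v\<in>vars_BC n. a v \<in> carrier T)"
  by (auto simp: tuple_BC_def mat2_of_carrier tuple_A_carrier vars_BC_def)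

section \<open>The coordinate rings represent the functors\<close>

context cring
begin

lemma gen_A_carrier: "set (tuple_A n indexed_var) \<subseteq> mat2_carrier (mpoly R (vars_A n))"
  by (simp add: tuple_A_carrier mpoly_var_closed)

lemma gen_BC_carrier:
  "mat2_of (\<lambda>e. indexed_var (PhiV e)) \<in> mat2_carrier (mpoly R (vars_BC n))"
  "indexed_var AlphaV \<in> carrier (mpoly R (vars_BC n))"
  "set (tuple_A n indexed_var) \<subseteq> mat2_carrier (mpoly R (vars_BC n))"
  by (simp_all add: mat2_of_carrier tuple_A_carrier mpoly_var_closed vars_BC_def)

lemma rels_closed:
  "rels_A (mpoly R (vars_A n)) (gen_A R n) \<subseteq> carrier (mpoly R (vars_A n))"
  "rels_B (mpoly R (vars_BC n)) (gen_BC R n) \<subseteq> carrier (mpoly R (vars_BC n))"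
  "rels_C r (mpoly R (vars_BC (r + 1))) (gen_BC R (r + 1)) \<subseteq> carrier (mpoly R (vars_BC (r + 1)))"
proof -
  have A: "rels_A P ms \<subseteq> carrier P" if "cring P" "set ms \<subseteq> mat2_carrier P"
    for P :: "('a, coord multiset \<Rightarrow> 'a) module" and ms
  proof -
    \<comment> \<open>Closure under the matrix operations was proved in the locale of homomorphisms;
      the identity makes it available for \<open>P\<close> alone.\<close>
    interpret P: ring_hom_cring P P id
      using that(1) by (simp add: ring_hom_cring_def ring_hom_cring_axioms_def)
    have "\<And>m. m \<in> set ms \<Longrightarrow> m \<in> mat2_carrier P" using that by auto
    then have "mat2_trace P m \<in> carrier P" "mat2_det P m \<in> carrier P"
      "m' \<in> set ms \<Longrightarrow> set_mat2 (mat2_mult P m m') \<subseteq> carrier P" if "m \<in> set ms" for m m'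
      using that P.mat2_ops_closed[of m] by (simp_all, simp add: mat2_carrier_def)
    then show ?thesis
      unfolding rels_A_def by blast
  qed
  have B: "rels_B P (\<phi>, \<alpha>, ms) \<subseteq> carrier P"
    if "cring P" "\<phi> \<in> mat2_carrier P" "\<alpha> \<in> carrier P" "set ms \<subseteq> mat2_carrier P"
    for P :: "('a, coord multiset \<Rightarrow> 'a) module" and \<phi> \<alpha> ms
  proof -
    interpret P: ring_hom_cring P P id
      using that(1) by (simp add: ring_hom_cring_def ring_hom_cring_axioms_def)
    have m: "m \<in> mat2_carrier P" if "m \<in> set ms" for m using that \<open>set ms \<subseteq> _\<close> by auto
    have "set_mat2 (mat2_minus P (mat2_mult P m \<phi>) (mat2_smult P \<alpha> m)) \<subseteq> carrier P"
      if "m \<in> set ms" for m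
    proof -
      have "mat2_minus P (mat2_mult P m \<phi>) (mat2_smult P \<alpha> m) \<in> mat2_carrier P"
        using m[OF that] \<open>\<phi> \<in> _\<close> \<open>\<alpha> \<in> _\<close> by (intro P.mat2_ops_closed)
      then show ?thesis by (simp add: mat2_carrier_def)
    qed
    then show ?thesis
      using A[OF that(1,4)] that P.mat2_ops_closed[OF that(2)]
      by (auto simp: rels_B_def)
  qed
  have cr: "cring (mpoly R I)" for I :: "coord set"
    using mpoly_algebra by (rule algebra_subD)
  show "rels_A (mpoly R (vars_A n)) (gen_A R n) \<subseteq> carrier (mpoly R (vars_A n))"
    unfolding gen_A_eq by (intro A cr gen_A_carrier)
  show B': "rels_B (mpoly R (vars_BC n)) (gen_BC R n) \<subseteq> carrier (mpoly R (vars_BC n))" for n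
    unfolding gen_BC_eq tuple_BC_def by (intro B cr gen_BC_carrier)
  let ?P = "mpoly R (vars_BC (r + 1))"
  interpret P: ring_hom_cring ?P ?P id
    using cr by (simp add: ring_hom_cring_def ring_hom_cring_axioms_def)
  let ?m = "tuple_A (r + 1) indexed_var ! r" and ?\<phi> = "mat2_of (\<lambda>e. indexed_var (PhiV e))"
  have "?m \<in> set (tuple_A (r + 1) indexed_var)" by (rule nth_mem) simp
  then have "?m \<in> mat2_carrier ?P" using gen_BC_carrier(3)[of "r + 1"] by blast
  then have "mat2_minus ?P (mat2_mult ?P ?m ?\<phi>) (mat2_mult ?P ?\<phi> ?m) \<in> mat2_carrier ?P"
    by (intro P.mat2_ops_closed gen_BC_carrier)
  then show "rels_C r ?P (gen_BC R (r + 1)) \<subseteq> carrier ?P"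
    using B'[of "r + 1"] unfolding gen_BC_eq tuple_BC_def rels_C_def
    by (simp add: mat2_carrier_def)
qed

lemma represents_coord_A: "represents R (coord_A R n) (univ_A R n) (functor_A n) map_A"
  unfolding coord_A_def ideal_A_def Let_def
proof (rule represents_presI[OF rels_closed(1)])
  let ?P = "mpoly R (vars_A n)"
  show "map_A f (univ_A R n) = tuple_A n (\<lambda>v. f (Idl\<^bsub>?P\<^esub> (rels_A ?P (gen_A R n)) +>\<^bsub>?P\<^esub> indexed_var v))"
    for f :: "_ \<Rightarrow> 't"
    by (simp add: univ_A_def map_tuple_A ideal_A_def Let_def gen_A_eq)
  show "tuple_A n a = tuple_A n b \<Longrightarrow> v \<in> vars_A n \<Longrightarrow> a v = b v" for a b :: "_ \<Rightarrow> 't" and v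
    by (rule tuple_A_inj)
  show "(\<And>v. v \<in> vars_A n \<Longrightarrow> a v = b v) \<Longrightarrow> tuple_A n a = tuple_A n b" for a b :: "_ \<Rightarrow> 't"
    by (rule tuple_A_cong)
  show "\<exists>a. y = tuple_A n a \<and> (\<forall>v\<in>vars_A n. a v \<in> carrier T)"
    if "algebra R T" "y \<in> functor_A n T" for T :: "('a, 't) module" and y
    using tuple_A_ex[of y n] that by (auto simp: functor_A_iff tuple_A_carrier)
  fix T :: "('a, 't) module" and f assume T: "algebra R T" and f: "f \<in> alg_hom R ?P T"
  interpret f: ring_hom_cring ?P T f by (rule alg_hom_ring_hom_cring[OF mpoly_algebra T f])
  show "tuple_A n (\<lambda>v. f (indexed_var v)) \<in> functor_A n T \<longleftrightarrow>
     f ` rels_A ?P (gen_A R n) \<subseteq> {\<zero>\<^bsub>T\<^esub>}"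
    using functor_A_map_iff[OF f.ring_hom_cring_axioms gen_A_carrier, of n]
    by (simp add: map_tuple_A gen_A_eq)
qed

lemma represents_coord_B: "represents R (coord_B R r) (univ_B R r) (functor_B r) map_BC"
  unfolding coord_B_def ideal_B_def Let_def
proof (rule represents_presI[OF rels_closed(2)])
  let ?P = "mpoly R (vars_BC r)"
  show "map_BC f (univ_B R r) = tuple_BC r (\<lambda>v. f (Idl\<^bsub>?P\<^esub> (rels_B ?P (gen_BC R r)) +>\<^bsub>?P\<^esub> indexed_var v))"
    for f :: "_ \<Rightarrow> 't"
    by (simp add: univ_B_def map_tuple_BC ideal_B_def Let_def gen_BC_eq)
  show "tuple_BC r a = tuple_BC r b \<Longrightarrow> v \<in> vars_BC r \<Longrightarrow> a v = b v" for a b :: "_ \<Rightarrow> 't" and v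
    by (rule tuple_BC_inj)
  show "(\<And>v. v \<in> vars_BC r \<Longrightarrow> a v = b v) \<Longrightarrow> tuple_BC r a = tuple_BC r b" for a b :: "_ \<Rightarrow> 't"
    by (rule tuple_BC_cong)
  show "\<exists>a. y = tuple_BC r a \<and> (\<forall>v\<in>vars_BC r. a v \<in> carrier T)"
    if "algebra R T" "y \<in> functor_B r T" for T :: "('a, 't) module" and y
  proof -
    obtain \<phi> \<alpha> ms where y: "y = (\<phi>, \<alpha>, ms)" by (cases y)
    note D = that(2)[unfolded y functor_B_iff[OF algebra_subD(2)[OF that(1)]]]
    obtain a where a: "y = tuple_BC r a" using tuple_BC_ex[of ms r \<phi> \<alpha>] D y by blast
    with D y have "\<forall>v\<in>vars_BC r. a v \<in> carrier T"
      using tuple_BC_carrier[where n = r and a = a and T = T] by auto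
    with a show ?thesis by blast
  qed
  fix T :: "('a, 't) module" and f assume T: "algebra R T" and f: "f \<in> alg_hom R ?P T"
  interpret f: ring_hom_cring ?P T f by (rule alg_hom_ring_hom_cring[OF mpoly_algebra T f])
  show "tuple_BC r (\<lambda>v. f (indexed_var v)) \<in> functor_B r T \<longleftrightarrow>
     f ` rels_B ?P (gen_BC R r) \<subseteq> {\<zero>\<^bsub>T\<^esub>}"
    using functor_B_map_iff[OF f.ring_hom_cring_axioms gen_BC_carrier, of r]
    by (simp add: gen_BC_eq flip: tuple_BC_def map_tuple_BC)
qed

lemma represents_coord_C: "represents R (coord_C R r) (univ_C R r) (functor_C r) map_BC"
  unfolding coord_C_def ideal_C_def Let_def
proof (rule represents_presI[OF rels_closed(3)])
  let ?n = "r + 1"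
  let ?P = "mpoly R (vars_BC ?n)"
  show "map_BC f (univ_C R r) = tuple_BC ?n (\<lambda>v. f (Idl\<^bsub>?P\<^esub> (rels_C r ?P (gen_BC R ?n)) +>\<^bsub>?P\<^esub> indexed_var v))"
    for f :: "_ \<Rightarrow> 't"
    unfolding univ_C_def by (simp only: map_tuple_BC ideal_C_def Let_def gen_BC_eq)
  show "tuple_BC ?n a = tuple_BC ?n b \<Longrightarrow> v \<in> vars_BC ?n \<Longrightarrow> a v = b v" for a b :: "_ \<Rightarrow> 't" and v
    by (rule tuple_BC_inj)
  show "(\<And>v. v \<in> vars_BC ?n \<Longrightarrow> a v = b v) \<Longrightarrow> tuple_BC ?n a = tuple_BC ?n b" for a b :: "_ \<Rightarrow> 't"
    by (rule tuple_BC_cong)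
  show "\<exists>a. y = tuple_BC ?n a \<and> (\<forall>v\<in>vars_BC ?n. a v \<in> carrier T)"
    if "algebra R T" "y \<in> functor_C r T" for T :: "('a, 't) module" and y
  proof -
    obtain \<phi> \<alpha> ms where y: "y = (\<phi>, \<alpha>, ms)" by (cases y)
    note D = that(2)[unfolded y functor_C_iff[OF algebra_subD(2)[OF that(1)]]]
    obtain a where a: "y = tuple_BC ?n a" using tuple_BC_ex[of ms ?n \<phi> \<alpha>] D y by blast
    with D y have "\<forall>v\<in>vars_BC ?n. a v \<in> carrier T"
      using tuple_BC_carrier[where n = ?n and a = a and T = T] by auto
    with a show ?thesis by blast
  qed
  fix T :: "('a, 't) module" and f assume T: "algebra R T" and f: "f \<in> alg_hom R ?P T"
  interpret f: ring_hom_cring ?P T f by (rule alg_hom_ring_hom_cring[OF mpoly_algebra T f])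
  show "tuple_BC ?n (\<lambda>v. f (indexed_var v)) \<in> functor_C r T \<longleftrightarrow>
     f ` rels_C r ?P (gen_BC R ?n) \<subseteq> {\<zero>\<^bsub>T\<^esub>}"
    using functor_C_map_iff[OF f.ring_hom_cring_axioms gen_BC_carrier length_tuple_A]
    unfolding gen_BC_eq tuple_BC_def[symmetric] map_tuple_BC by simp
qed

end

section \<open>Spectra\<close>

context cring
begin

lemma SpecD: "p \<in> Spec R \<Longrightarrow> primeideal p R"
  by (simp add: Spec_def)

lemma prime_one_notin: "primeideal p R \<Longrightarrow> \<one> \<notin> p"
  using ideal.one_imp_carrier primeideal.I_notcarr primeideal.axioms(1) by blast

lemma prime_subset: "primeideal p R \<Longrightarrow> p \<subseteq> carrier R"
  using additive_subgroup.a_subset ideal.axioms(1) primeideal.axioms(1) by blast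

lemma prime_mult_iff:
  assumes p: "primeideal p R" and x: "x \<in> carrier R" and y: "y \<in> carrier R"
  shows "x \<otimes> y \<in> p \<longleftrightarrow> x \<in> p \<or> y \<in> p"
  using assms by (meson ideal.I_l_closed ideal.I_r_closed primeideal.I_prime primeideal.axioms(1))

lemma topspace_zariski: "topspace (zariski R) = Spec R"
proof -
  have "\<Union> {{p \<in> Spec R. f \<notin> p} |f. f \<in> carrier R} = Spec R"
    using prime_one_notin SpecD by blast
  then show ?thesis by (simp add: zariski_def)
qed

text \<open>The generating sets are closed under intersection up to products: f g avoids a prime
  exactly when f and g both do.\<close>

lemma zariski_basis:
  assumes "openin (zariski R) U" "p \<in> U"
  shows "\<exists>f\<in>carrier R. f \<notin> p \<and> {q \<in> Spec R. f \<notin> q} \<subseteq> U"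
proof -
  have "generate_topology_on {{p \<in> Spec R. f \<notin> p} |f. f \<in> carrier R} U"
    using assms(1) openin_topology_generated_by unfolding zariski_def by blast
  then show ?thesis
    using assms(2)
  proof induction
    case (Int a b)
    then obtain f g where fg: "f \<in> carrier R" "f \<notin> p" "{q \<in> Spec R. f \<notin> q} \<subseteq> a"
      "g \<in> carrier R" "g \<notin> p" "{q \<in> Spec R. g \<notin> q} \<subseteq> b" by blast
    have pS: "p \<in> Spec R"
    proof -
      have "generate_topology_on {{p \<in> Spec R. f \<notin> p} |f. f \<in> carrier R} a" by fact
      then have "openin (zariski R) a"
        unfolding zariski_def by (simp add: openin_topology_generated_by_iff)
      then show ?thesis using Int.prems openin_subset topspace_zariski by blast
    qed
    have "f \<otimes> g \<notin> p" using fg pS SpecD prime_mult_iff by blast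
    moreover have "{q \<in> Spec R. f \<otimes> g \<notin> q} \<subseteq> a \<inter> b"
      using fg SpecD prime_mult_iff by blast
    ultimately show ?case using fg by blast
  next
    case (UN K)
    then obtain V where V: "V \<in> K" "p \<in> V" by blast
    then obtain f where "f \<in> carrier R" "f \<notin> p" "{q \<in> Spec R. f \<notin> q} \<subseteq> V"
      using UN.IH by blast
    with V show ?case by blast
  qed auto
qed

text \<open>A point outside \<open>C\<close> has a basic neighbourhood disjoint from
  \<open>C\<close>; the function defining that neighbourhood vanishes on \<open>C\<close> but not at
  the point.\<close>

lemma closedin_zariski:
  assumes C: "closedin (zariski R) C"
  shows "C = zero_locus R (vanishing_ideal R C)"
proof
  show "C \<subseteq> zero_locus R (vanishing_ideal R C)"
    using closedin_subset[OF C] by (auto simp: topspace_zariski zero_locus_def vanishing_ideal_def)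
  show "zero_locus R (vanishing_ideal R C) \<subseteq> C"
  proof (rule subsetI, rule ccontr)
    fix p assume p: "p \<in> zero_locus R (vanishing_ideal R C)" "p \<notin> C"
    have "openin (zariski R) (Spec R - C)"
      using openin_diff[OF openin_topspace C] by (simp add: topspace_zariski)
    moreover have "p \<in> Spec R - C" using p by (simp add: zero_locus_def)
    ultimately obtain f where f: "f \<in> carrier R" "f \<notin> p" "{q \<in> Spec R. f \<notin> q} \<subseteq> Spec R - C"
      using zariski_basis by blast
    then have "f \<in> vanishing_ideal R C"
      using closedin_subset[OF C] by (auto simp: vanishing_ideal_def topspace_zariski)
    with p f show False by (auto simp: zero_locus_def)
  qed
qed

lemma zero_locus_closed:
  assumes "E \<subseteq> carrier R"
  shows "closedin (zariski R) (zero_locus R E)"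
proof -
  have "Spec R - zero_locus R E = (\<Union>f\<in>E. {p \<in> Spec R. f \<notin> p})"
    by (auto simp: zero_locus_def)
  moreover have "openin (zariski R) {p \<in> Spec R. f \<notin> p}" if "f \<in> E" for f
    unfolding zariski_def using that assms by (auto intro!: topology_generated_by_Basis)
  ultimately have "openin (zariski R) (topspace (zariski R) - zero_locus R E)"
    by (auto simp: topspace_zariski)
  then show ?thesis
    by (auto simp: closedin_def topspace_zariski zero_locus_def)
qed

lemma vanishing_ideal_zero_locus:
  assumes "primeideal P R"
  shows "vanishing_ideal R (zero_locus R P) = P"
  using assms prime_subset by (auto simp: vanishing_ideal_def zero_locus_def Spec_def)

text \<open>\<open>P\<close> is the generic point: a closed set that contains it contains the whole
  locus.\<close>

lemma zero_locus_irreducible: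
  assumes P: "primeideal P R"
  shows "irreducible_in (zariski R) (zero_locus R P)"
  unfolding irreducible_in_def
proof (intro conjI allI impI)
  show "zero_locus R P \<subseteq> topspace (zariski R)"
    by (auto simp: topspace_zariski zero_locus_def)
  have PP: "P \<in> zero_locus R P" using P by (simp add: zero_locus_def Spec_def)
  then show "zero_locus R P \<noteq> {}" by blast
  fix C D assume *: "closedin (zariski R) C \<and> closedin (zariski R) D \<and> zero_locus R P \<subseteq> C \<union> D"
  have "zero_locus R P \<subseteq> C" if "P \<in> C" "closedin (zariski R) C" for C
  proof -
    have "vanishing_ideal R C \<subseteq> P" using that(1) by (auto simp: vanishing_ideal_def)
    then have "zero_locus R P \<subseteq> zero_locus R (vanishing_ideal R C)" by (auto simp: zero_locus_def)
    then show ?thesis using closedin_zariski[OF that(2)] by simp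
  qed
  then show "zero_locus R P \<subseteq> C \<or> zero_locus R P \<subseteq> D" using * PP by blast
qed

text \<open>If a b vanishes on \<open>S\<close>, then \<open>S\<close> is covered by the closed loci
  of a and of b and therefore lies in one of them.\<close>

lemma irreducible_vanishing_prime:
  assumes S: "irreducible_in (zariski R) S"
  shows "primeideal (vanishing_ideal R S) R"
proof -
  have S': "S \<subseteq> Spec R" "S \<noteq> {}"
    using S by (auto simp: irreducible_in_def topspace_zariski)
  have eq: "vanishing_ideal R S = \<Inter>S"
  proof
    show "vanishing_ideal R S \<subseteq> \<Inter>S" by (auto simp: vanishing_ideal_def)
    obtain p where "p \<in> S" using S'(2) by blast
    then have "\<Inter>S \<subseteq> carrier R" using S'(1) prime_subset[OF SpecD] by blast
    then show "\<Inter>S \<subseteq> vanishing_ideal R S" by (auto simp: vanishing_ideal_def)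
  qed
  have id: "ideal (\<Inter>S) R"
    using S' primeideal.axioms(1)[OF SpecD] by (intro i_Intersect) blast+
  show ?thesis
    unfolding eq
  proof (rule primeidealI[OF id is_cring])
    obtain p where "p \<in> S" using S' by blast
    then show "carrier R \<noteq> \<Inter>S"
      using S'(1) prime_one_notin SpecD by blast
    fix a b assume ab: "a \<in> carrier R" "b \<in> carrier R" "a \<otimes> b \<in> \<Inter>S"
    have "S \<subseteq> zero_locus R {a} \<union> zero_locus R {b}"
    proof
      fix p assume p: "p \<in> S"
      then have "a \<otimes> b \<in> p" using ab by blast
      then show "p \<in> zero_locus R {a} \<union> zero_locus R {b}"
        using p S'(1) ab prime_mult_iff[of p a b] by (auto simp: zero_locus_def Spec_def)
    qed
    moreover have "closedin (zariski R) (zero_locus R {a})" "closedin (zariski R) (zero_locus R {b})"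
      using ab by (auto intro: zero_locus_closed)
    ultimately have "S \<subseteq> zero_locus R {a} \<or> S \<subseteq> zero_locus R {b}"
      using S unfolding irreducible_in_def by blast
    then show "a \<in> \<Inter>S \<or> b \<in> \<Inter>S" by (auto simp: zero_locus_def)
  qed
qed

text \<open>The hypotheses say that \<open>Ps\<close> is the set of minimal primes. Every
  irreducible set lies in the locus of one of them, and the generic point of a locus turns
  containment of loci into containment of primes.\<close>

lemma irreducible_components_zariski:
  assumes prime: "\<And>P. P \<in> Ps \<Longrightarrow> primeideal P R"
    and incomparable: "\<And>P Q. P \<in> Ps \<Longrightarrow> Q \<in> Ps \<Longrightarrow> P \<subseteq> Q \<Longrightarrow> P = Q"
    and cover: "\<And>Q. primeideal Q R \<Longrightarrow> \<exists>P\<in>Ps. P \<subseteq> Q"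
  shows "irreducible_components (zariski R) = zero_locus R ` Ps"
proof -
  have sub: "\<exists>P\<in>Ps. S \<subseteq> zero_locus R P" if S: "irreducible_in (zariski R) S" for S
  proof -
    obtain P where P: "P \<in> Ps" "P \<subseteq> vanishing_ideal R S"
      using cover[OF irreducible_vanishing_prime[OF S]] by blast
    have "S \<subseteq> Spec R" using S by (auto simp: irreducible_in_def topspace_zariski)
    then have "S \<subseteq> zero_locus R P" using P(2) by (auto simp: zero_locus_def vanishing_ideal_def)
    with P(1) show ?thesis by blast
  qed
  have self: "P \<in> zero_locus R P" if "P \<in> Ps" for P
    using prime[OF that] by (simp add: zero_locus_def Spec_def)
  show ?thesis
  proof (rule equalityI; rule subsetI)
    fix S assume "S \<in> irreducible_components (zariski R)"
    then have S: "irreducible_in (zariski R) S"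
      "\<And>S'. irreducible_in (zariski R) S' \<Longrightarrow> S \<subseteq> S' \<Longrightarrow> S' = S"
      by (auto simp: irreducible_components_def)
    obtain P where P: "P \<in> Ps" "S \<subseteq> zero_locus R P" using sub[OF S(1)] by blast
    then show "S \<in> zero_locus R ` Ps"
      using S(2)[OF zero_locus_irreducible[OF prime[OF P(1)]]] by blast
  next
    fix S assume "S \<in> zero_locus R ` Ps"
    then obtain P where P: "P \<in> Ps" "S = zero_locus R P" by blast
    have "S' = S" if S': "irreducible_in (zariski R) S'" "S \<subseteq> S'" for S'
    proof -
      obtain Q where Q: "Q \<in> Ps" "S' \<subseteq> zero_locus R Q" using sub[OF S'(1)] by blast
      have "P \<in> zero_locus R Q" using self[OF P(1)] P(2) S'(2) Q(2) by blast
      then have "Q \<subseteq> P" by (simp add: zero_locus_def)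
      then have "Q = P" using incomparable Q(1) P(1) by blast
      then show ?thesis using Q S'(2) P by blast
    qed
    then show "S \<in> irreducible_components (zariski R)"
      using zero_locus_irreducible[OF prime[OF P(1)]] P(2)
      by (simp add: irreducible_components_def)
  qed
qed

lemma irreducible_in_subtopology_closed:
  assumes S: "closedin Y S" and Z: "Z \<subseteq> S"
  shows "irreducible_in (subtopology Y S) Z \<longleftrightarrow> irreducible_in Y Z"
proof
  assume *: "irreducible_in (subtopology Y S) Z"
  show "irreducible_in Y Z"
    unfolding irreducible_in_def
  proof (intro conjI allI impI)
    show "Z \<subseteq> topspace Y" "Z \<noteq> {}" using * by (auto simp: irreducible_in_def)
    fix C D assume CD: "closedin Y C \<and> closedin Y D \<and> Z \<subseteq> C \<union> D"
    then have "closedin (subtopology Y S) (C \<inter> S)" "closedin (subtopology Y S) (D \<inter> S)"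
      by (auto simp: closedin_subtopology)
    moreover have "Z \<subseteq> (C \<inter> S) \<union> (D \<inter> S)" using CD Z by blast
    ultimately have "Z \<subseteq> C \<inter> S \<or> Z \<subseteq> D \<inter> S" using * unfolding irreducible_in_def by blast
    then show "Z \<subseteq> C \<or> Z \<subseteq> D" by blast
  qed
next
  assume "irreducible_in Y Z"
  then show "irreducible_in (subtopology Y S) Z"
    using S Z closedin_closed_subtopology[OF S] unfolding irreducible_in_def
    by (metis Int_subset_iff topspace_subtopology)
qed

text \<open>Irreducible closed subsets of the locus correspond to primes above \<open>P\<close> with
  inclusions reversed; hence the indices n - i and d - i when a chain is translated.\<close>

lemma krull_dim_zero_locus:
  assumes P: "primeideal P R"
    and upper: "\<And>n Q. (\<And>i. i \<le> n \<Longrightarrow> primeideal (Q i) R) \<Longrightarrow> (\<And>i. i < n \<Longrightarrow> Q i \<subset> Q (Suc i)) \<Longrightarrow>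
      P \<subseteq> Q 0 \<Longrightarrow> n \<le> d"
    and lower: "\<And>i. i \<le> d \<Longrightarrow> primeideal (C i) R" "\<And>i. i < d \<Longrightarrow> C i \<subset> C (Suc i)" "P \<subseteq> C 0"
  shows "krull_dim (subtopology (zariski R) (zero_locus R P)) = enat d"
proof -
  let ?Y = "zariski R" and ?S = "zero_locus R P"
  let ?X = "subtopology ?Y ?S"
  let ?N = "{n. \<exists>Z :: nat \<Rightarrow> 'a set set. (\<forall>i\<le>n. closedin ?X (Z i) \<and> irreducible_in ?X (Z i)) \<and>
     (\<forall>i<n. Z i \<subset> Z (Suc i))}"
  have S: "closedin ?Y ?S" by (rule zero_locus_closed[OF prime_subset[OF P]])
  have "n \<le> d" if n: "n \<in> ?N" for n
  proof -
    obtain Z :: "nat \<Rightarrow> 'a set set" where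
      Z0: "(\<forall>i\<le>n. closedin ?X (Z i) \<and> irreducible_in ?X (Z i)) \<and> (\<forall>i<n. Z i \<subset> Z (Suc i))"
      using n by blast
    have Z: "closedin ?X (Z i)" "irreducible_in ?X (Z i)" if "i \<le> n" for i
      using Z0 that by simp_all
    have Zlt: "Z i \<subset> Z (Suc i)" if "i < n" for i using Z0 that by simp
    have Z': "Z i \<subseteq> ?S" "closedin ?Y (Z i)" "irreducible_in ?Y (Z i)" if "i \<le> n" for i
      using Z[OF that] closedin_closed_subtopology[OF S, of "Z i"]
        irreducible_in_subtopology_closed[OF S, of "Z i"]
      by simp_all
    define Q where "Q i = vanishing_ideal R (Z (n - i))" for i
    show ?thesis
    proof (rule upper[of n Q])
      show "primeideal (Q i) R" if "i \<le> n" for i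
        unfolding Q_def by (intro irreducible_vanishing_prime Z') simp
      show "Q i \<subset> Q (Suc i)" if "i < n" for i
      proof -
        have lt: "Z (n - Suc i) \<subset> Z (n - i)"
          using Zlt[of "n - Suc i"] that by (simp add: Suc_diff_Suc)
        then have "Q i \<subseteq> Q (Suc i)" by (auto simp: Q_def vanishing_ideal_def)
        moreover have "Q i \<noteq> Q (Suc i)"
          using lt closedin_zariski[OF Z'(2)[of "n - i"]] closedin_zariski[OF Z'(2)[of "n - Suc i"]]
          by (auto simp: Q_def)
        ultimately show ?thesis by blast
      qed
      show "P \<subseteq> Q 0"
        using Z'(1)[of n] prime_subset[OF P] by (auto simp: Q_def vanishing_ideal_def zero_locus_def)
    qed
  qed
  moreover have "d \<in> ?N"
  proof -
    define Z where "Z i = zero_locus R (C (d - i))" for i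
    have PC: "P \<subseteq> C i" if "i \<le> d" for i
      using that
    proof (induction i)
      case (Suc i)
      then show ?case using lower(2)[of i] by auto
    qed (use lower(3) in simp)
    have cl: "closedin ?X (Z i) \<and> irreducible_in ?X (Z i)" if "i \<le> d" for i
    proof -
      have p: "primeideal (C (d - i)) R" by (rule lower) simp
      have "Z i \<subseteq> ?S" using PC[of "d - i"] by (auto simp: Z_def zero_locus_def)
      then show ?thesis
        using closedin_closed_subtopology[OF S] irreducible_in_subtopology_closed[OF S]
          zero_locus_irreducible[OF p] zero_locus_closed[OF prime_subset[OF p]]
        by (simp add: Z_def)
    qed
    have st: "Z i \<subset> Z (Suc i)" if "i < d" for i
    proof -
      have lt: "C (d - Suc i) \<subset> C (d - i)"
        using lower(2)[of "d - Suc i"] that by (simp add: Suc_diff_Suc)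
      have "C (d - Suc i) \<in> zero_locus R (C (d - Suc i))"
        using lower(1)[of "d - Suc i"] by (simp add: zero_locus_def Spec_def)
      moreover have "C (d - Suc i) \<notin> zero_locus R (C (d - i))"
        using lt by (auto simp: zero_locus_def)
      ultimately show ?thesis using lt by (auto simp: Z_def zero_locus_def)
    qed
    show ?thesis
      unfolding mem_Collect_eq by (rule exI[of _ Z]) (use cl st in simp)
  qed
  ultimately have "(SUP n\<in>?N. enat n) = enat d"
    by (intro antisym SUP_least SUP_upper) auto
  then show ?thesis by (simp add: krull_dim_def)
qed

end

section \<open>Chains of prime ideals and algebraic dependence\<close>

lemma (in ideal) finsum_closed:
  assumes "\<And>i. i \<in> A \<Longrightarrow> f i \<in> I"
  shows "finsum R f A \<in> I"
  using assms
proof (induction A rule: infinite_finite_induct)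
  case (insert x F)
  then have "f \<in> F \<rightarrow> carrier R" "f x \<in> carrier R" by (auto intro: Icarr)
  with insert show ?case by (simp add: finsum_insert)
qed auto

lemma (in ideal) add_cancel_right:
  assumes "x \<oplus> y \<in> I" "y \<in> I" "x \<in> carrier R"
  shows "x \<in> I"
proof -
  have y: "y \<in> carrier R" using assms(2) by (rule Icarr)
  have "(x \<oplus> y) \<oplus> \<ominus> y \<in> I" by (rule additive_subgroup.a_closed[OF is_additive_subgroup assms(1)
          additive_subgroup.a_inv_closed[OF is_additive_subgroup assms(2)]])
  then show ?thesis using assms(3) y by (simp add: a_assoc r_neg)
qed

lemma (in cring) monoid_alg_finsum_apply:
  fixes N :: "'m::comm_monoid_add set"
  assumes N: "0 \<in> N" "\<And>a b. a \<in> N \<Longrightarrow> b \<in> N \<Longrightarrow> a + b \<in> N"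
    and "finite S" "\<And>s. s \<in> S \<Longrightarrow> f s \<in> carrier (monoid_alg R N)"
  shows "finsum (monoid_alg R N) f S a = (\<Oplus>s\<in>S. f s a)"
proof -
  interpret M: algebra R "monoid_alg R N" by (rule monoid_alg_algebra[OF N])
  show ?thesis
    using assms(3-)
  proof (induction S rule: finite_induct)
    case (insert s S)
    have "finsum (monoid_alg R N) f (insert s S) =
        f s \<oplus>\<^bsub>monoid_alg R N\<^esub> finsum (monoid_alg R N) f S"
      using insert by (intro M.M.finsum_insert) auto
    moreover have "(\<Oplus>s\<in>insert s S. f s a) = f s a \<oplus> (\<Oplus>s\<in>S. f s a)"
      using insert monoid_algD(1) by (intro finsum_insert) auto
    ultimately show ?case using insert by simp
  qed simp
qed

lemma (in cring) elimination_identity: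
  assumes "c \<in> carrier R" "v \<in> carrier R" "q \<in> carrier R" "w \<in> carrier R"
  shows "c \<otimes> v = c \<otimes> (v \<ominus> q \<otimes> w) \<oplus> (c \<otimes> q) \<otimes> w"
  using assms by algebra

lemma (in cring) cancel_identity:
  assumes "c \<in> carrier R" "v \<in> carrier R" "w \<in> carrier R"
  shows "\<ominus> c \<otimes> v \<oplus> (w \<oplus> c \<otimes> v) = w"
  using assms by (simp add: l_minus a_lcomm[of _ w] l_neg)

text \<open>Gaussian elimination, one coordinate \<open>s\<close> at a time: a vector with nonzero
  entry at \<open>s\<close> is the pivot, multiples of it are subtracted to clear \<open>s\<close>
  in the others, and the coefficient of the pivot is chosen at the end to undo these
  subtractions.\<close>

lemma (in field) linear_dependence:
  assumes "finite S" "finite J" "card S < card J"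
    and "\<And>j s. j \<in> J \<Longrightarrow> s \<in> S \<Longrightarrow> v j s \<in> carrier R"
  shows "\<exists>c. (\<forall>j\<in>J. c j \<in> carrier R) \<and> (\<exists>j\<in>J. c j \<noteq> \<zero>) \<and> (\<forall>s\<in>S. (\<Oplus>j\<in>J. c j \<otimes> v j s) = \<zero>)"
  using assms
proof (induction S arbitrary: J v rule: finite_induct)
  case empty
  then obtain j where "j \<in> J" by fastforce
  then show ?case by (intro exI[of _ "\<lambda>_. \<one>"]) auto
next
  case (insert s S)
  show ?case
  proof (cases "\<forall>j\<in>J. v j s = \<zero>")
    case True
    obtain c where c: "\<forall>j\<in>J. c j \<in> carrier R" "\<exists>j\<in>J. c j \<noteq> \<zero>"
      "\<forall>s\<in>S. (\<Oplus>j\<in>J. c j \<otimes> v j s) = \<zero>"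
      using insert.IH[of J v] insert.prems insert.hyps by auto
    have "(\<Oplus>j\<in>J. c j \<otimes> v j s) = \<zero>"
      using True c(1) by (intro add.finprod_one_eqI) auto
    with c show ?thesis by blast
  next
    case False
    then obtain i where i: "i \<in> J" "v i s \<noteq> \<zero>" by blast
    have vi: "v i s \<in> carrier R" "v i s \<in> Units R" using insert.prems i by (auto simp: field_Units)
    define q where "q j = v j s \<otimes> inv (v i s)" for j
    have q: "q j \<in> carrier R" "q j \<otimes> v i s = v j s" if "j \<in> J" for j
      using that vi insert.prems(3) by (simp_all add: q_def m_assoc)
    let ?J = "J - {i}"
    define w where "w j t = v j t \<ominus> q j \<otimes> v i t" for j t
    have J: "finite ?J" "card S < card ?J" "insert i ?J = J"
      using insert.prems insert.hyps i by auto
    have "w j t \<in> carrier R" if "j \<in> ?J" "t \<in> S" for j t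
      using that insert.prems(3) i q by (simp add: w_def)
    then obtain c where c: "\<forall>j\<in>?J. c j \<in> carrier R" "\<exists>j\<in>?J. c j \<noteq> \<zero>"
      "\<forall>t\<in>S. (\<Oplus>j\<in>?J. c j \<otimes> w j t) = \<zero>"
      using insert.IH[OF J(1,2), of w] by auto
    define e where "e = (\<Oplus>j\<in>?J. c j \<otimes> q j)"
    have cq: "(\<lambda>j. c j \<otimes> q j) \<in> ?J \<rightarrow> carrier R" using c(1) q by auto
    then have e: "e \<in> carrier R" unfolding e_def by (rule finsum_closed)
    define d where "d = c(i := \<ominus> e)"
    have key: "(\<Oplus>j\<in>J. d j \<otimes> v j t) = (\<Oplus>j\<in>?J. c j \<otimes> w j t)" if t: "t \<in> insert s S" for t
    proof -
      have vt: "v j t \<in> carrier R" if "j \<in> J" for j using insert.prems(3) that t by blast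
      have "(\<Oplus>j\<in>J. d j \<otimes> v j t) = (\<Oplus>j\<in>insert i ?J. d j \<otimes> v j t)" using J by simp
      also have "\<dots> = d i \<otimes> v i t \<oplus> (\<Oplus>j\<in>?J. d j \<otimes> v j t)"
        using J c(1) vt e i by (intro finsum_insert) (auto simp: d_def)
      also have "(\<Oplus>j\<in>?J. d j \<otimes> v j t) = (\<Oplus>j\<in>?J. c j \<otimes> w j t \<oplus> (c j \<otimes> q j) \<otimes> v i t)"
      proof (rule finsum_cong'[OF refl])
        fix j assume j: "j \<in> ?J"
        then have jc: "c j \<in> carrier R" "v j t \<in> carrier R" "q j \<in> carrier R" "v i t \<in> carrier R"
          using c(1) vt q i by auto
        then have "c j \<otimes> v j t = c j \<otimes> (v j t \<ominus> q j \<otimes> v i t) \<oplus> (c j \<otimes> q j) \<otimes> v i t"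
          by (rule elimination_identity)
        then show "d j \<otimes> v j t = c j \<otimes> w j t \<oplus> (c j \<otimes> q j) \<otimes> v i t"
          using j by (simp add: d_def w_def)
      qed (use c(1) vt q i in \<open>auto simp: w_def\<close>)
      also have "\<dots> = (\<Oplus>j\<in>?J. c j \<otimes> w j t) \<oplus> (\<Oplus>j\<in>?J. (c j \<otimes> q j) \<otimes> v i t)"
        using c(1) vt q i by (intro finsum_addf) (auto simp: w_def)
      also have "(\<Oplus>j\<in>?J. (c j \<otimes> q j) \<otimes> v i t) = e \<otimes> v i t"
        unfolding e_def using J(1) cq vt i by (intro finsum_ldistr[symmetric]) auto
      also have "d i \<otimes> v i t \<oplus> ((\<Oplus>j\<in>?J. c j \<otimes> w j t) \<oplus> e \<otimes> v i t) = (\<Oplus>j\<in>?J. c j \<otimes> w j t)"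
      proof -
        have "(\<Oplus>j\<in>?J. c j \<otimes> w j t) \<in> carrier R"
          using c(1) vt q i by (intro finsum_closed) (auto simp: w_def)
        moreover have "\<ominus> e \<otimes> y \<oplus> (z \<oplus> e \<otimes> y) = z" if "y \<in> carrier R" "z \<in> carrier R" for y z
          using cancel_identity[OF e that] .
        ultimately show ?thesis using vt[OF i(1)] by (simp add: d_def)
      qed
      finally show ?thesis .
    qed
    have "(\<Oplus>j\<in>?J. c j \<otimes> w j s) = \<zero>"
    proof (rule add.finprod_one_eqI)
      fix j assume j: "j \<in> ?J"
      then have "w j s = \<zero>" using q[of j] insert.prems(3)[of j s] by (simp add: w_def)
      then show "c j \<otimes> w j s = \<zero>" using c(1) j by simp
    qed
    then have "\<forall>t\<in>insert s S. (\<Oplus>j\<in>J. d j \<otimes> v j t) = \<zero>"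
      using key c(3) by auto
    moreover have "\<forall>j\<in>J. d j \<in> carrier R" using c(1) e by (auto simp: d_def)
    moreover have "\<exists>j\<in>J. d j \<noteq> \<zero>" using c(2) by (auto simp: d_def)
    ultimately show ?thesis by blast
  qed
qed

text \<open>The elements are shifted with each exponent, so the tail is a monomial in x 1, x 2 and
  so on, matching a chain of primes whose first member has been dropped.\<close>

fun list_monomial :: "('a, 'c) monoid_scheme \<Rightarrow> (nat \<Rightarrow> 'a) \<Rightarrow> nat list \<Rightarrow> 'a"
  where
    "list_monomial G x [] = \<one>\<^bsub>G\<^esub>"
  | "list_monomial G x (e # es) = x 0 [^]\<^bsub>G\<^esub> e \<otimes>\<^bsub>G\<^esub> list_monomial G (x \<circ> Suc) es"

lemma (in monoid) list_monomial_closed: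
  "(\<And>i. i < length es \<Longrightarrow> x i \<in> carrier G) \<Longrightarrow> list_monomial G x es \<in> carrier G"
proof (induction es arbitrary: x)
  case (Cons e es)
  then show ?case using Cons.IH[of "x \<circ> Suc"] Cons.prems[of 0] by auto
qed simp

lemma (in cring) prime_pow:
  assumes "primeideal p R" "x \<in> carrier R" "x \<notin> p"
  shows "x [^] (n::nat) \<notin> p"
  using assms by (induction n) (auto simp: prime_one_notin prime_mult_iff)

text \<open>Monomials in elements that separate the steps of a chain of primes are linearly independent
  modulo the first prime: divide a relation by the smallest occurring power of the first element
  and pass to the next prime of the chain.\<close>

lemma prime_chain_independent:
  fixes k :: "('k, 'c) ring_scheme" and A :: "('k, 'a) module"
  assumes k: "field k" and A: "algebra k A"
    and "\<And>i. i \<le> n \<Longrightarrow> primeideal (Q i) A"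
    and "\<And>i. i < n \<Longrightarrow> Q i \<subseteq> Q (Suc i) \<and> x i \<in> Q (Suc i) - Q i"
    and "finite F" "F \<noteq> {}" "\<And>es. es \<in> F \<Longrightarrow> length es = n \<and> c es \<in> carrier k - {\<zero>\<^bsub>k\<^esub>}"
  shows "(\<Oplus>\<^bsub>A\<^esub>es\<in>F. c es \<odot>\<^bsub>A\<^esub> list_monomial A x es) \<notin> Q 0"
  using assms(3-)
proof (induction n arbitrary: Q x F c)
  case 0
  interpret k: field k by (rule k)
  interpret A: algebra k A by (rule A)
  \<comment> \<open>Without elements the only exponent list is the empty one, and the sum is a
    nonzero scalar, hence a unit.\<close>
  have "F = {[]}" using 0 by fastforce
  then have eq: "(\<Oplus>\<^bsub>A\<^esub>es\<in>F. c es \<odot>\<^bsub>A\<^esub> list_monomial A x es) = c [] \<odot>\<^bsub>A\<^esub> \<one>\<^bsub>A\<^esub>"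
    using 0 by (simp add: A.M.finsum_insert[of "{}", simplified])
  interpret Q: primeideal "Q 0" A using 0 by simp
  have c: "c [] \<in> Units k" using 0(5) \<open>F = {[]}\<close> by (simp add: k.field_Units)
  show ?case
  proof
    assume "(\<Oplus>\<^bsub>A\<^esub>es\<in>F. c es \<odot>\<^bsub>A\<^esub> list_monomial A x es) \<in> Q 0"
    then have "(inv\<^bsub>k\<^esub> c [] \<odot>\<^bsub>A\<^esub> \<one>\<^bsub>A\<^esub>) \<otimes>\<^bsub>A\<^esub> (c [] \<odot>\<^bsub>A\<^esub> \<one>\<^bsub>A\<^esub>) \<in> Q 0"
      unfolding eq using c by (intro Q.I_l_closed) auto
    moreover have "(inv\<^bsub>k\<^esub> c [] \<odot>\<^bsub>A\<^esub> \<one>\<^bsub>A\<^esub>) \<otimes>\<^bsub>A\<^esub> (c [] \<odot>\<^bsub>A\<^esub> \<one>\<^bsub>A\<^esub>) = \<one>\<^bsub>A\<^esub>"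
      using c k.Units_l_inv[OF c] by (simp add: A.smult_assoc2 k.Units_closed flip: A.smult_assoc1)
    ultimately show False using A.prime_one_notin Q.primeideal by simp
  qed
next
  case (Suc n)
  interpret A: algebra k A by (rule A)
  interpret Q0: primeideal "Q 0" A using Suc.prems(1)[of 0] by simp
  interpret Q1: primeideal "Q 1" A using Suc.prems(1)[of 1] by simp
  have x: "x i \<in> carrier A" if "i < Suc n" for i
    using Suc.prems(2)[OF that] A.prime_subset[OF Suc.prems(1)[of "Suc i"]] that by auto
  define m where "m = Min (hd ` F)"
  define t where "t es = list_monomial A (x \<circ> Suc) (tl es)" for es
  have F: "es = hd es # tl es" "length (tl es) = n" "c es \<in> carrier k" "c es \<noteq> \<zero>\<^bsub>k\<^esub>" "m \<le> hd es"
    if "es \<in> F" for es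
    using Suc.prems(5)[OF that] that Suc.prems(3) by (auto simp: m_def neq_Nil_conv length_Suc_conv)
  have tc: "t es \<in> carrier A" if "es \<in> F" for es
    unfolding t_def using F(2)[OF that] x by (intro A.list_monomial_closed) auto
  have x0: "x 0 \<in> carrier A" "x 0 \<in> Q 1" "x 0 \<notin> Q 0" using x Suc.prems(2)[of 0] by auto
  let ?u = "\<lambda>es. c es \<odot>\<^bsub>A\<^esub> (x 0 [^]\<^bsub>A\<^esub> (hd es - m) \<otimes>\<^bsub>A\<^esub> t es)"
  have uc: "?u es \<in> carrier A" if "es \<in> F" for es using F[OF that] tc[OF that] x0 by simp
  have "c es \<odot>\<^bsub>A\<^esub> list_monomial A x es = x 0 [^]\<^bsub>A\<^esub> m \<otimes>\<^bsub>A\<^esub> ?u es" if es: "es \<in> F" for es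
  proof -
    have "list_monomial A x es = x 0 [^]\<^bsub>A\<^esub> hd es \<otimes>\<^bsub>A\<^esub> t es"
      using F(1)[OF es] by (metis list_monomial.simps(2) t_def)
    also have "x 0 [^]\<^bsub>A\<^esub> hd es = x 0 [^]\<^bsub>A\<^esub> m \<otimes>\<^bsub>A\<^esub> x 0 [^]\<^bsub>A\<^esub> (hd es - m)"
      using x0 F(5)[OF es] by (simp add: A.nat_pow_mult)
    finally show ?thesis
      using F[OF es] tc[OF es] x0
      by (simp add: A.m_assoc A.m_comm[of "x 0 [^]\<^bsub>A\<^esub> m"] A.smult_assoc2)
  qed
  then have "(\<Oplus>\<^bsub>A\<^esub>es\<in>F. c es \<odot>\<^bsub>A\<^esub> list_monomial A x es) = (\<Oplus>\<^bsub>A\<^esub>es\<in>F. x 0 [^]\<^bsub>A\<^esub> m \<otimes>\<^bsub>A\<^esub> ?u es)"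
    using uc x0 by (intro A.M.finsum_cong' refl) auto
  also have "\<dots> = x 0 [^]\<^bsub>A\<^esub> m \<otimes>\<^bsub>A\<^esub> (\<Oplus>\<^bsub>A\<^esub>es\<in>F. ?u es)"
    using uc x0 Suc.prems(3) by (intro A.finsum_rdistr[symmetric]) auto
  finally have sum: "(\<Oplus>\<^bsub>A\<^esub>es\<in>F. c es \<odot>\<^bsub>A\<^esub> list_monomial A x es) =
     x 0 [^]\<^bsub>A\<^esub> m \<otimes>\<^bsub>A\<^esub> (\<Oplus>\<^bsub>A\<^esub>es\<in>F. ?u es)" .
  let ?F0 = "{es \<in> F. hd es = m}" and ?F1 = "{es \<in> F. hd es \<noteq> m}"
  have F01: "F = ?F0 \<union> ?F1" "finite ?F0" "finite ?F1" "?F0 \<inter> ?F1 = {}" using Suc.prems(3) by auto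
  have "finsum A ?u F = finsum A ?u (?F0 \<union> ?F1)" using F01(1) by simp
  also have "\<dots> = finsum A ?u ?F0 \<oplus>\<^bsub>A\<^esub> finsum A ?u ?F1"
    using uc F01 by (intro A.M.finsum_Un_disjoint) auto
  finally have split: "finsum A ?u F = finsum A ?u ?F0 \<oplus>\<^bsub>A\<^esub> finsum A ?u ?F1" .
  \<comment> \<open>These terms keep a positive power of \<open>x 0\<close>, which lies in
    \<open>Q 1\<close>.\<close>
  have "?u es \<in> Q 1" if "es \<in> ?F1" for es
  proof -
    have es: "es \<in> F" "m < hd es" using that F(5)[of es] by auto
    then obtain d where d: "hd es - m = Suc d" by (metis Suc_diff_Suc)
    have "?u es = (c es \<odot>\<^bsub>A\<^esub> (x 0 [^]\<^bsub>A\<^esub> d \<otimes>\<^bsub>A\<^esub> t es)) \<otimes>\<^bsub>A\<^esub> x 0"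
      using F[OF es(1)] tc[OF es(1)] x0 by (simp add: d A.smult_assoc2) (simp add: A.m_ac)
    also have "\<dots> \<in> Q 1"
      using F[OF es(1)] tc[OF es(1)] x0 by (intro Q1.I_l_closed) auto
    finally show ?thesis .
  qed
  then have f1: "finsum A ?u ?F1 \<in> Q 1" by (rule Q1.finsum_closed)
  let ?G = "tl ` ?F0"
  have inj: "inj_on tl ?F0" using F(1) by (metis (mono_tags, lifting) inj_onI mem_Collect_eq)
  have "finsum A ?u ?F0 = (\<Oplus>\<^bsub>A\<^esub>es\<in>?F0. c (m # tl es) \<odot>\<^bsub>A\<^esub> list_monomial A (x \<circ> Suc) (tl es))"
  proof (rule A.M.finsum_cong'[OF refl])
    fix es assume es: "es \<in> ?F0"
    then have "m # tl es = es" using F(1) by auto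
    then show "?u es = c (m # tl es) \<odot>\<^bsub>A\<^esub> list_monomial A (x \<circ> Suc) (tl es)"
      using es tc[of es] by (simp add: t_def)
  next
    show "(\<lambda>es. c (m # tl es) \<odot>\<^bsub>A\<^esub> list_monomial A (x \<circ> Suc) (tl es)) \<in> ?F0 \<rightarrow> carrier A"
    proof
      fix es assume es: "es \<in> ?F0"
      then have "m # tl es = es" using F(1) by auto
      then show "c (m # tl es) \<odot>\<^bsub>A\<^esub> list_monomial A (x \<circ> Suc) (tl es) \<in> carrier A"
        using es tc[of es] F(3)[of es] by (simp add: t_def)
    qed
  qed
  also have "\<dots> = (\<Oplus>\<^bsub>A\<^esub>es\<in>?G. c (m # es) \<odot>\<^bsub>A\<^esub> list_monomial A (x \<circ> Suc) es)"
  proof (rule A.M.finsum_reindex[symmetric, OF _ inj])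
    show "(\<lambda>es. c (m # es) \<odot>\<^bsub>A\<^esub> list_monomial A (x \<circ> Suc) es) \<in> ?G \<rightarrow> carrier A"
    proof
      fix es assume "es \<in> ?G"
      then obtain fs where fs: "fs \<in> F" "m # es = fs" using F(1) by force
      then show "c (m # es) \<odot>\<^bsub>A\<^esub> list_monomial A (x \<circ> Suc) es \<in> carrier A"
        using tc[of fs] F(3)[of fs] by (auto simp: t_def)
    qed
  qed
  finally have f0: "finsum A ?u ?F0 = (\<Oplus>\<^bsub>A\<^esub>es\<in>?G. c (m # es) \<odot>\<^bsub>A\<^esub> list_monomial A (x \<circ> Suc) es)" .
  \<comment> \<open>The minimum is attained, so what survives modulo \<open>Q 1\<close> is a
    nonempty sum of the same kind, with one exponent fewer.\<close>
  have "m \<in> hd ` F" unfolding m_def using Suc.prems(3,4) by (intro Min_in) auto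
  then have "?G \<noteq> {}" by auto
  have nin: "(\<Oplus>\<^bsub>A\<^esub>es\<in>?G. c (m # es) \<odot>\<^bsub>A\<^esub> list_monomial A (x \<circ> Suc) es) \<notin> (Q \<circ> Suc) 0"
  proof (rule Suc.IH)
    fix es assume "es \<in> ?G"
    then obtain fs where fs: "fs \<in> F" "m # es = fs" using F(1) by force
    then show "length es = n \<and> c (m # es) \<in> carrier k - {\<zero>\<^bsub>k\<^esub>}"
      using F[of fs] by auto
  qed (use Suc.prems \<open>?G \<noteq> {}\<close> in auto)
  show ?case
  proof
    assume "(\<Oplus>\<^bsub>A\<^esub>es\<in>F. c es \<odot>\<^bsub>A\<^esub> list_monomial A x es) \<in> Q 0"
    moreover have "finsum A ?u F \<in> carrier A" using uc by (intro A.M.finsum_closed) auto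
    ultimately have "finsum A ?u F \<in> Q 0"
      using x0 A.prime_pow[OF Q0.primeideal x0(1,3)] Q0.I_prime unfolding sum by blast
    then have "finsum A ?u F \<in> Q 1" using Suc.prems(2)[of 0] by auto
    then have "finsum A ?u ?F0 \<oplus>\<^bsub>A\<^esub> finsum A ?u ?F1 \<in> Q 1" using split by simp
    moreover have c0: "finsum A ?u ?F0 \<in> carrier A" using uc by (intro A.M.finsum_closed) auto
    ultimately have "finsum A ?u ?F0 \<in> Q 1"
      using Q1.add_cancel_right[OF _ f1] by blast
    then show False using nin f0 by simp
  qed
qed

text \<open>\<kappa> stands for integer coordinates of an exponent. They add up in products, so the
  bound for a single element is multiplied by the total degree of the monomial.\<close>

lemma (in cring) monoid_alg_hom_monomial_bound:
  fixes \<kappa> :: "'m::comm_monoid_add \<Rightarrow> nat \<Rightarrow> int"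
  assumes N: "0 \<in> N" "\<And>a b. a \<in> N \<Longrightarrow> b \<in> N \<Longrightarrow> a + b \<in> N"
    and \<kappa>: "\<And>a b i. \<kappa> (a + b) i = \<kappa> a i + \<kappa> b i"
    and y: "\<And>i. i < length es \<Longrightarrow> y i \<in> carrier (monoid_alg R N)"
      "\<And>i a j. i < length es \<Longrightarrow> y i a \<noteq> \<zero> \<Longrightarrow> \<bar>\<kappa> a j\<bar> \<le> int C"
    and m: "list_monomial (monoid_alg R N) y es m \<noteq> \<zero>"
  shows "\<bar>\<kappa> m j\<bar> \<le> int (C * sum_list es)"
proof -
  interpret M: algebra R "monoid_alg R N" by (rule monoid_alg_algebra[OF N])
  have \<kappa>0: "\<kappa> 0 j = 0" for j using \<kappa>[of 0 0 j] by simp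
  have one: "\<bar>\<kappa> m j\<bar> \<le> 0" if "mterm R 0 \<one> m \<noteq> \<zero>" for m j
    using that \<kappa>0 by (auto simp: mterm_def split: if_splits)
  have pow: "\<bar>\<kappa> m j\<bar> \<le> int (C * e)"
    if "f \<in> carrier (monoid_alg R N)" "\<And>a j. f a \<noteq> \<zero> \<Longrightarrow> \<bar>\<kappa> a j\<bar> \<le> int C"
      "(f [^]\<^bsub>monoid_alg R N\<^esub> e) m \<noteq> \<zero>" for f m j and e :: nat
    using that(3) that(1,2)
  proof (induction e arbitrary: m)
    case 0
    then show ?case using one by simp
  next
    case (Suc e)
    then have "mconv R (f [^]\<^bsub>monoid_alg R N\<^esub> e) f m \<noteq> \<zero>" by simp
    then obtain a b where ab: "(f [^]\<^bsub>monoid_alg R N\<^esub> e) a \<noteq> \<zero>" "f b \<noteq> \<zero>" "a + b = m"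
      using mconv_nonzero[OF M.nat_pow_closed[OF Suc.prems(2)] Suc.prems(2)] by blast
    then show ?case using Suc.IH[OF ab(1) Suc.prems(2,3)] Suc.prems(3)[OF ab(2), of j] \<kappa>[of a b j] by simp
  qed
  show ?thesis
    using y m
  proof (induction es arbitrary: y m)
    case Nil
    then show ?case using one by simp
  next
    case (Cons e es)
    have y0: "y 0 \<in> carrier (monoid_alg R N)" using Cons.prems(1)[of 0] by simp
    have ys: "list_monomial (monoid_alg R N) (y \<circ> Suc) es \<in> carrier (monoid_alg R N)"
      using Cons.prems(1) by (intro M.list_monomial_closed) auto
    have "mconv R (y 0 [^]\<^bsub>monoid_alg R N\<^esub> e) (list_monomial (monoid_alg R N) (y \<circ> Suc) es) m \<noteq> \<zero>"
      using Cons.prems(3) by simp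
    then obtain a b where ab: "(y 0 [^]\<^bsub>monoid_alg R N\<^esub> e) a \<noteq> \<zero>"
      "list_monomial (monoid_alg R N) (y \<circ> Suc) es b \<noteq> \<zero>" "a + b = m"
      using mconv_nonzero[OF M.nat_pow_closed[OF y0] ys] by blast
    have "\<bar>\<kappa> a j\<bar> \<le> int (C * e)"
      using pow[OF y0 _ ab(1)] Cons.prems(2)[of 0] by auto
    moreover have "\<bar>\<kappa> b j\<bar> \<le> int (C * sum_list es)"
    proof (rule Cons.IH[OF _ _ ab(2)])
      show "(y \<circ> Suc) i \<in> carrier (monoid_alg R N)" if "i < length es" for i
        using Cons.prems(1)[of "Suc i"] that by simp
      show "\<bar>\<kappa> a j\<bar> \<le> int C" if "i < length es" "(y \<circ> Suc) i a \<noteq> \<zero>" for i a j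
        using Cons.prems(2)[of "Suc i" a j] that by simp
    qed
    ultimately show ?case using ab(3) \<kappa>[of a b j] by (simp add: distrib_left)
  qed
qed

text \<open>A Krull dimension bound by counting: with all exponents below \<open>M\<close> there are \<open>M\<^bsup>d+1\<^esup>\<close>
  monomials in \<open>d + 1\<close> elements, but they live in a space of dimension \<open>O(M\<^bsup>d\<^esup>)\<close>.\<close>

lemma prime_chain_length_le:
  fixes k :: "('k, 'c) ring_scheme" and A :: "('k, 'a) module"
    and N :: "'m::comm_monoid_add set" and \<kappa> :: "'m \<Rightarrow> nat \<Rightarrow> int"
  assumes k: "field k" and A: "algebra k A"
    and N: "0 \<in> N" "\<And>a b. a \<in> N \<Longrightarrow> b \<in> N \<Longrightarrow> a + b \<in> N"
    and \<kappa>: "\<And>a b i. \<kappa> (a + b) i = \<kappa> a i + \<kappa> b i" "inj_on \<kappa> N"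
    and D: "finite D" "card D = d" "\<And>a i. a \<in> N \<Longrightarrow> i \<notin> D \<Longrightarrow> \<kappa> a i = 0"
    and h: "h \<in> alg_hom k A (monoid_alg k N)"
    and Q: "\<And>i. i \<le> n \<Longrightarrow> primeideal (Q i) A" "\<And>i. i < n \<Longrightarrow> Q i \<subset> Q (Suc i)"
    and ker: "\<And>a. a \<in> carrier A \<Longrightarrow> h a = \<zero>\<^bsub>monoid_alg k N\<^esub> \<Longrightarrow> a \<in> Q 0"
  shows "n \<le> d"
proof (rule ccontr)
  assume "\<not> n \<le> d"
  then have dn: "d < n" by simp
  interpret k: field k by (rule k)
  interpret A: algebra k A by (rule A)
  let ?M = "monoid_alg k N"
  interpret M: algebra k ?M by (rule k.monoid_alg_algebra[OF N])
  interpret h: ring_hom_cring A ?M h by (rule alg_hom_ring_hom_cring[OF A M.algebra_axioms h])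
  define x where "x i = (SOME y. y \<in> Q (Suc i) - Q i)" for i
  have x: "x i \<in> Q (Suc i) - Q i" if "i < n" for i
    unfolding x_def by (rule someI_ex) (use Q(2)[OF that] in blast)
  have xc: "x i \<in> carrier A" if "i < n" for i
    using x[OF that] A.prime_subset[OF Q(1)[of "Suc i"]] that by auto
  \<comment> \<open>All absolute coordinates of the finitely many exponents that occur in the images
    of the x i; \<open>C\<close> is a common bound for them.\<close>
  define V where "V = (\<Union>i<n. (\<lambda>(a, j). nat \<bar>\<kappa> a j\<bar>) ` ({a. h (x i) a \<noteq> \<zero>\<^bsub>k\<^esub>} \<times> D))"
  have V: "finite V"
    unfolding V_def using k.monoid_algD(2)[OF h.hom_closed[OF xc]] D(1) by auto
  define C where "C = Max (insert 0 V)"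
  have C: "\<bar>\<kappa> a j\<bar> \<le> int C" if "i < n" "h (x i) a \<noteq> \<zero>\<^bsub>k\<^esub>" for i a j
  proof (cases "j \<in> D")
    case True
    then have "nat \<bar>\<kappa> a j\<bar> \<in> insert 0 V" using that by (auto simp: V_def image_iff)
    then have "nat \<bar>\<kappa> a j\<bar> \<le> C" unfolding C_def using V by (intro Max_ge) auto
    then show ?thesis by simp
  next
    case False
    then show ?thesis using D(3)[of a j] k.monoid_algD(3)[OF h.hom_closed[OF xc[OF that(1)]] that(2)] by simp
  qed
  define q where "q = 2 * n * C + 1"
  define m where "m = Suc (q ^ d)"
  define B where "B = C * (n * m)"
  define J where "J = {es. set es \<subseteq> {..<m} \<and> length es = n}"
  define W where "W = {a \<in> N. \<forall>j. \<bar>\<kappa> a j\<bar> \<le> int B}"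
  have J: "finite J" "card J = m ^ n"
    unfolding J_def by (simp_all add: finite_lists_length_eq card_lists_length_eq)
  have W: "finite W" "card W \<le> (2 * B + 1) ^ d"
  proof -
    let ?r = "\<lambda>a. restrict (\<kappa> a) D" and ?E = "D \<rightarrow>\<^sub>E {- int B..int B}"
    have sub: "?r ` W \<subseteq> ?E" by (auto simp: W_def abs_le_iff minus_le_iff)
    have inj: "inj_on ?r W"
    proof (rule inj_onI)
      fix a b assume ab: "a \<in> W" "b \<in> W" "?r a = ?r b"
      have "\<kappa> a j = \<kappa> b j" for j
        using fun_cong[OF ab(3), of j] D(3)[of a j] D(3)[of b j] ab(1,2)
        by (cases "j \<in> D") (auto simp: W_def)
      then have "\<kappa> a = \<kappa> b" by (rule ext)
      then show "a = b" using \<kappa>(2) ab(1,2) by (auto simp: W_def dest: inj_onD)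
    qed
    have E: "finite ?E" "card ?E = (2 * B + 1) ^ d"
      using D by (auto simp: finite_PiE card_PiE nat_add_distrib nat_mult_distrib)
    show "finite W" using inj sub E(1) by (meson finite_imageD finite_subset)
    show "card W \<le> (2 * B + 1) ^ d"
      using card_mono[OF E(1) sub] card_image[OF inj] E(2) by simp
  qed
  have "2 * B + 1 \<le> q * m" by (simp add: B_def q_def algebra_simps m_def)
  then have "(2 * B + 1) ^ d \<le> (q * m) ^ d" by (rule power_mono) simp
  also have "\<dots> < m * m ^ d"
  proof -
    have "q ^ d < m" "0 < m ^ d" by (simp_all add: m_def)
    then show ?thesis unfolding power_mult_distrib by (rule mult_strict_right_mono)
  qed
  also have "\<dots> \<le> m ^ n"
  proof -
    have "m ^ Suc d \<le> m ^ n" using dn by (intro power_increasing) (auto simp: m_def)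
    then show ?thesis by simp
  qed
  finally have lt: "card W < card J" using W(2) J(2) by simp
  let ?v = "\<lambda>es. list_monomial ?M (h \<circ> x) es"
  have vc: "?v es \<in> carrier ?M" if "es \<in> J" for es
    using that xc by (intro M.list_monomial_closed) (auto simp: J_def)
  obtain c where c: "\<forall>es\<in>J. c es \<in> carrier k" "\<exists>es\<in>J. c es \<noteq> \<zero>\<^bsub>k\<^esub>"
    "\<forall>a\<in>W. (\<Oplus>\<^bsub>k\<^esub>es\<in>J. c es \<otimes>\<^bsub>k\<^esub> ?v es a) = \<zero>\<^bsub>k\<^esub>"
    using k.linear_dependence[OF W(1) J(1) lt, of ?v] k.monoid_algD(1)[OF vc] by blast
  have bound: "a \<in> W" if "es \<in> J" "?v es a \<noteq> \<zero>\<^bsub>k\<^esub>" for es a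
  proof -
    have "\<bar>\<kappa> a j\<bar> \<le> int (C * sum_list es)" for j
      by (rule k.monoid_alg_hom_monomial_bound[OF N \<kappa>(1) _ _ that(2)])
        (use that(1) xc C in \<open>auto simp: J_def\<close>)
    moreover have "sum_list es \<le> n * m"
      using that(1) sum_list_mono[of es "\<lambda>x. x" "\<lambda>_. m"]
      by (auto simp: J_def sum_list_triv subset_iff less_imp_le)
    then have "int (C * sum_list es) \<le> int B" unfolding B_def by (simp only: of_nat_le_iff mult_le_mono2)
    ultimately show ?thesis
      using k.monoid_algD(3)[OF vc[OF that(1)] that(2)] unfolding W_def
      by (auto intro: order_trans)
  qed
  have hv: "h (list_monomial A x es) = ?v es" if "length es \<le> n" for es
  proof -
    have "h (list_monomial A z es) = list_monomial ?M (h \<circ> z) es"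
      if "\<And>i. i < length es \<Longrightarrow> z i \<in> carrier A" for z
      using that
    proof (induction es arbitrary: z)
      case (Cons e es)
      have zc: "(z \<circ> Suc) i \<in> carrier A" if "i < length es" for i
        using Cons.prems[of "Suc i"] that by simp
      have lc: "list_monomial A (z \<circ> Suc) es \<in> carrier A"
        using zc by (intro A.list_monomial_closed)
      have z0: "z 0 \<in> carrier A" using Cons.prems[of 0] by simp
      have hp: "h (z 0 [^]\<^bsub>A\<^esub> e) = h (z 0) [^]\<^bsub>?M\<^esub> e"
        using z0 by (induction e) simp_all
      have IH: "h (list_monomial A (z \<circ> Suc) es) = list_monomial ?M (h \<circ> (z \<circ> Suc)) es"
        by (rule Cons.IH) (rule zc)
      show ?case
        unfolding list_monomial.simps comp_assoc h.hom_mult[OF A.nat_pow_closed[OF z0] lc] hp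
          IH by (simp only: comp_apply)
    qed (simp del: k.monoid_alg_sel)
    then show ?thesis using xc that by auto
  qed
  define F where "F = {es \<in> J. c es \<noteq> \<zero>\<^bsub>k\<^esub>}"
  have "finite F" using J(1) by (simp add: F_def)
  then have F: "finite F" "F \<noteq> {}" "\<And>es. es \<in> F \<Longrightarrow> length es = n \<and> c es \<in> carrier k - {\<zero>\<^bsub>k\<^esub>}"
    using c(1,2) by (auto simp: F_def J_def)
  have mc: "list_monomial A x es \<in> carrier A" if "es \<in> F" for es
    using F(3)[OF that] xc by (intro A.list_monomial_closed) auto
  \<comment> \<open>A linear relation between the images of the monomials is an element of the
    kernel, hence of \<open>Q 0\<close>; but the monomials are independent modulo
    \<open>Q 0\<close>.\<close>
  let ?s = "\<Oplus>\<^bsub>A\<^esub>es\<in>F. c es \<odot>\<^bsub>A\<^esub> list_monomial A x es"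
  have "?s \<notin> Q 0"
    by (rule prime_chain_independent[OF k A Q(1) _ F]) (use Q(2) x in auto)
  moreover have "?s \<in> carrier A" using mc F(3) by (intro A.M.finsum_closed) auto
  moreover have "h ?s = \<zero>\<^bsub>?M\<^esub>"
  proof -
    have sc: "c es \<odot>\<^bsub>?M\<^esub> ?v es \<in> carrier ?M" if "es \<in> F" for es
      using that vc[of es] c(1) by (intro M.smult_closed) (auto simp: F_def)
    have "h ?s = (\<Oplus>\<^bsub>?M\<^esub>es\<in>F. c es \<odot>\<^bsub>?M\<^esub> ?v es)"
    proof -
      have "h ?s = (\<Oplus>\<^bsub>?M\<^esub>es\<in>F. h (c es \<odot>\<^bsub>A\<^esub> list_monomial A x es))"
        using mc F(3) by (subst h.hom_finsum) (auto simp: comp_def)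
      also have "\<dots> = (\<Oplus>\<^bsub>?M\<^esub>es\<in>F. c es \<odot>\<^bsub>?M\<^esub> ?v es)"
      proof (rule M.M.finsum_cong'[OF refl])
        fix es assume "es \<in> F"
        then show "h (c es \<odot>\<^bsub>A\<^esub> list_monomial A x es) = c es \<odot>\<^bsub>?M\<^esub> ?v es"
          using F(3)[of es] mc[of es] hv[of es] alg_homD(3)[OF h, of "c es"] by simp
      qed (use sc in blast)
      finally show ?thesis .
    qed
    also have "\<dots> = (\<lambda>a. \<zero>\<^bsub>k\<^esub>)"
    proof
      fix a
      have "(\<Oplus>\<^bsub>?M\<^esub>es\<in>F. c es \<odot>\<^bsub>?M\<^esub> ?v es) a = (\<Oplus>\<^bsub>k\<^esub>es\<in>F. c es \<otimes>\<^bsub>k\<^esub> ?v es a)"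
        by (subst k.monoid_alg_finsum_apply[OF N F(1) sc]) simp_all
      also have "\<dots> = (\<Oplus>\<^bsub>k\<^esub>es\<in>J. c es \<otimes>\<^bsub>k\<^esub> ?v es a)"
        by (rule k.add.finprod_mono_neutral_cong_left)
          (use J(1) c(1) k.monoid_algD(1)[OF vc] in \<open>auto simp: F_def\<close>)
      also have "\<dots> = \<zero>\<^bsub>k\<^esub>"
      proof (cases "a \<in> W")
        case False
        then have "?v es a = \<zero>\<^bsub>k\<^esub>" if "es \<in> J" for es using bound that by blast
        then show ?thesis using c(1) by (intro k.add.finprod_one_eqI) auto
      qed (use c(3) in blast)
      finally show "(\<Oplus>\<^bsub>?M\<^esub>es\<in>F. c es \<odot>\<^bsub>?M\<^esub> ?v es) a = \<zero>\<^bsub>k\<^esub>" .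
    qed
    finally show ?thesis by simp
  qed
  ultimately show False using ker by blast
qed

section \<open>Words on a rational normal scroll\<close>

text \<open>A letter (i, e) stands for a generator t_i y^e on the scroll, so the degree of a word is
  its total exponent of y.\<close>

definition word_degree :: "('i \<times> nat) multiset \<Rightarrow> nat"
  where "word_degree W = sum_mset (image_mset snd W)"

definition words :: "'i set \<Rightarrow> ('i \<Rightarrow> nat) \<Rightarrow> ('i \<times> nat) multiset set"
  where "words I cap = {W. \<forall>(i, e)\<in>#W. i \<in> I \<and> e \<le> cap i}"

lemma word_degree_simps [simp]:
  "word_degree {#} = 0" "word_degree (add_mset (i, e) W) = e + word_degree W"
  by (simp_all add: word_degree_def)

lemma words_simps [simp]:
  "{#} \<in> words I cap"
  "add_mset (i, e) W \<in> words I cap \<longleftrightarrow> i \<in> I \<and> e \<le> cap i \<and> W \<in> words I cap"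
  by (auto simp: words_def)

context comm_monoid
begin

context
  fixes I :: "'i set" and cap :: "'i \<Rightarrow> nat" and x :: "'i \<Rightarrow> nat \<Rightarrow> 'a"
  assumes x_closed: "\<And>i e. i \<in> I \<Longrightarrow> e \<le> cap i \<Longrightarrow> x i e \<in> carrier G"
    and x_move: "\<And>i j e f. i \<in> I \<Longrightarrow> j \<in> I \<Longrightarrow> e < cap i \<Longrightarrow> f < cap j \<Longrightarrow>
      x i e \<otimes> x j (Suc f) = x i (Suc e) \<otimes> x j f"
begin

lemma word_closed: "W \<in> words I cap \<Longrightarrow> mprod G (case_prod x) W \<in> carrier G"
  using x_closed by (intro mprod_closed) (auto simp: words_def)

lemma word_add:
  assumes "add_mset (i, e) W \<in> words I cap"
  shows "mprod G (case_prod x) (add_mset (i, e) W) = x i e \<otimes> mprod G (case_prod x) W"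
proof -
  have "(case_prod x) w \<in> carrier G" if "w \<in># add_mset (i, e) W" for w
    using assms that x_closed by (auto simp: words_def)
  then show ?thesis using mprod_add_mset[of "(i, e)" W "case_prod x"] by simp
qed

text \<open>\<open>x_move\<close> passes one unit of degree from another letter to the letter with
  index i. Repeated, this raises its exponent from e to e' as long as the rest of the word has that
  much degree to give.\<close>

lemma word_shift:
  assumes "add_mset (i, e) U \<in> words I cap" "e \<le> e'" "e' \<le> cap i" "e' - e \<le> word_degree U"
  shows "\<exists>U'. add_mset (i, e') U' \<in> words I cap \<and> image_mset fst U' = image_mset fst U \<and>
    word_degree U = word_degree U' + (e' - e) \<and>
    mprod G (case_prod x) (add_mset (i, e) U) = mprod G (case_prod x) (add_mset (i, e') U')"
  using assms
proof (induction "e' - e" arbitrary: e U)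
  case 0
  then show ?case by (intro exI[of _ U]) auto
next
  case (Suc d)
  then have "word_degree U \<noteq> 0" by auto
  then obtain j g where jg: "(j, g) \<in># U" "g \<noteq> 0"
    by (auto simp: word_degree_def)
  then obtain V f where V: "U = add_mset (j, Suc f) V"
    by (metis multi_member_split not0_implies_Suc)
  let ?U = "add_mset (j, f) V"
  have w: "i \<in> I" "j \<in> I" "e < cap i" "f < cap j" "V \<in> words I cap"
    using Suc.prems Suc.hyps(2) V by auto
  have "mprod G (case_prod x) (add_mset (i, e) U) =
      (x i e \<otimes> x j (Suc f)) \<otimes> mprod G (case_prod x) V"
    using w V x_closed by (simp add: word_add word_closed m_assoc)
  also have "\<dots> = (x i (Suc e) \<otimes> x j f) \<otimes> mprod G (case_prod x) V"
    using x_move w by simp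
  also have "\<dots> = mprod G (case_prod x) (add_mset (i, Suc e) ?U)"
    using w x_closed by (simp add: word_add word_closed m_assoc)
  finally have eq: "mprod G (case_prod x) (add_mset (i, e) U) =
    mprod G (case_prod x) (add_mset (i, Suc e) ?U)" .
  have "\<exists>U'. add_mset (i, e') U' \<in> words I cap \<and> image_mset fst U' = image_mset fst ?U \<and>
    word_degree ?U = word_degree U' + (e' - Suc e) \<and>
    mprod G (case_prod x) (add_mset (i, Suc e) ?U) = mprod G (case_prod x) (add_mset (i, e') U')"
    by (rule Suc.hyps(1)) (use Suc.prems Suc.hyps(2) V w in auto)
  then obtain U' where U': "add_mset (i, e') U' \<in> words I cap" "image_mset fst U' = image_mset fst ?U"
    "word_degree ?U = word_degree U' + (e' - Suc e)"
    "mprod G (case_prod x) (add_mset (i, Suc e) ?U) = mprod G (case_prod x) (add_mset (i, e') U')"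
    by blast
  have "word_degree U = word_degree U' + (e' - e)" using U'(3) V Suc.hyps(2) by simp
  then show ?case using U' eq V by (intro exI[of _ U']) simp
qed

text \<open>Induction on the length: a letter with the same index is picked from both words,
  \<open>word_shift\<close> makes the two exponents equal, and the remaining words again have equal
  indices and equal degree.\<close>

lemma word_eq:
  assumes "W \<in> words I cap" "W' \<in> words I cap" "image_mset fst W = image_mset fst W'"
    "word_degree W = word_degree W'"
  shows "mprod G (case_prod x) W = mprod G (case_prod x) W'"
  using assms
proof (induction "size W" arbitrary: W W')
  case 0
  then show ?case by simp
next
  case (Suc n)
  then obtain i e U where W: "W = add_mset (i, e) U"
    by (metis old.prod.exhaust size_eq_Suc_imp_eq_union)
  then have "i \<in># image_mset fst W'" using Suc.prems(3) by (metis fst_conv image_mset_add_mset union_single_eq_member)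
  then obtain e' where "(i, e') \<in># W'" by auto
  then obtain U' where W': "W' = add_mset (i, e') U'" by (metis multi_member_split)
  \<comment> \<open>The case in which the letter of the first word has the smaller exponent; the
    other case is symmetric.\<close>
  have *: "mprod G (case_prod x) (add_mset (i, a) V) = mprod G (case_prod x) (add_mset (i, b) V')"
    if ab: "a \<le> b" "add_mset (i, a) V \<in> words I cap" "add_mset (i, b) V' \<in> words I cap"
      "image_mset fst V = image_mset fst V'" "a + word_degree V = b + word_degree V'" "size V = n"
    for a b V V'
  proof -
    have "b - a \<le> word_degree V" using ab(1,5) by arith
    then obtain V'' where V'': "add_mset (i, b) V'' \<in> words I cap" "image_mset fst V'' = image_mset fst V"
      "word_degree V = word_degree V'' + (b - a)"
      "mprod G (case_prod x) (add_mset (i, a) V) = mprod G (case_prod x) (add_mset (i, b) V'')"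
      using word_shift[OF ab(2,1)] ab(3) by auto
    have "size V'' = n" using V''(2) ab(6) by (metis size_image_mset)
    then have "mprod G (case_prod x) V'' = mprod G (case_prod x) V'"
      using V'' ab by (intro Suc.hyps(1)) auto
    then show ?thesis using V'' ab word_add by simp
  qed
  have sz: "size U = n" "size U' = n"
    using Suc.hyps(2) W W' Suc.prems(3) by (simp_all, metis W W' add_mset_add_single size_add_mset size_image_mset Suc.hyps(2) old.nat.inject)
  show ?case
  proof (cases "e \<le> e'")
    case True
    show ?thesis unfolding W W'
      by (rule *[OF True]) (use Suc.prems W W' sz in auto)
  next
    case False
    then show ?thesis unfolding W W'
      by (intro *[symmetric]) (use Suc.prems W W' sz in auto)
  qed
qed

end

end

section \<open>Spanning sets and triangular families\<close>

inductive_set lspan :: "('k, 'c) ring_scheme \<Rightarrow> ('k, 'a, 'd) module_scheme \<Rightarrow> 'a set \<Rightarrow> 'a set"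
  for k A S where
    zero: "\<zero>\<^bsub>A\<^esub> \<in> lspan k A S"
  | add: "x \<in> lspan k A S \<Longrightarrow> c \<in> carrier k \<Longrightarrow> s \<in> S \<Longrightarrow> c \<odot>\<^bsub>A\<^esub> s \<oplus>\<^bsub>A\<^esub> x \<in> lspan k A S"

context algebra
begin

context
  fixes S
  assumes S: "S \<subseteq> carrier M"
begin

lemma lspan_closed: "x \<in> lspan R M S \<Longrightarrow> x \<in> carrier M"
proof (induction rule: lspan.induct)
  case (add x c s)
  then have "s \<in> carrier M" using S by blast
  with add show ?case by simp
qed simp

lemma lspan_add: "x \<in> lspan R M S \<Longrightarrow> y \<in> lspan R M S \<Longrightarrow> x \<oplus>\<^bsub>M\<^esub> y \<in> lspan R M S"
proof (induction rule: lspan.induct)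
  case zero
  then show ?case using lspan_closed by simp
next
  case (add x c s)
  then have "c \<odot>\<^bsub>M\<^esub> s \<oplus>\<^bsub>M\<^esub> (x \<oplus>\<^bsub>M\<^esub> y) \<in> lspan R M S" by (intro lspan.add)
  moreover have "s \<in> carrier M" using add S by auto
  ultimately show ?case using add lspan_closed by (simp add: M.a_assoc)
qed

lemma lspan_base: "s \<in> S \<Longrightarrow> s \<in> lspan R M S"
  using lspan.add[OF lspan.zero, of "\<one>\<^bsub>R\<^esub>" R s S M] S by auto

lemma lspan_smult: "c \<in> carrier R \<Longrightarrow> x \<in> lspan R M S \<Longrightarrow> c \<odot>\<^bsub>M\<^esub> x \<in> lspan R M S"
proof (rotate_tac, induction rule: lspan.induct)
  case zero
  then show ?case by (simp add: lspan.zero)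
next
  case (add x d s)
  then have "(c \<otimes>\<^bsub>R\<^esub> d) \<odot>\<^bsub>M\<^esub> s \<oplus>\<^bsub>M\<^esub> c \<odot>\<^bsub>M\<^esub> x \<in> lspan R M S" by (intro lspan.add) auto
  moreover have "s \<in> carrier M" using add S by auto
  ultimately show ?case
    using add lspan_closed[OF add.hyps(1)] by (simp add: smult_r_distr smult_assoc1)
qed

lemma lspan_minus:
  assumes "x \<in> lspan R M S"
  shows "\<ominus>\<^bsub>M\<^esub> x \<in> lspan R M S"
proof -
  have "(\<ominus>\<^bsub>R\<^esub> \<one>\<^bsub>R\<^esub>) \<odot>\<^bsub>M\<^esub> x \<in> lspan R M S" using assms by (intro lspan_smult) auto
  moreover have "(\<ominus>\<^bsub>R\<^esub> \<one>\<^bsub>R\<^esub>) \<odot>\<^bsub>M\<^esub> x = \<ominus>\<^bsub>M\<^esub> x"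
    using lspan_closed[OF assms] by (simp add: smult_l_minus)
  ultimately show ?thesis by simp
qed

lemma lspan_mult:
  assumes g: "g \<in> carrier M" and gS: "\<And>s. s \<in> S \<Longrightarrow> g \<otimes>\<^bsub>M\<^esub> s \<in> lspan R M S"
    and x: "x \<in> lspan R M S"
  shows "g \<otimes>\<^bsub>M\<^esub> x \<in> lspan R M S"
  using x
proof (induction rule: lspan.induct)
  case zero
  then show ?case using g by (simp add: lspan.zero)
next
  case (add x c s)
  have s: "s \<in> carrier M" using add S by auto
  have "c \<odot>\<^bsub>M\<^esub> (g \<otimes>\<^bsub>M\<^esub> s) \<oplus>\<^bsub>M\<^esub> g \<otimes>\<^bsub>M\<^esub> x \<in> lspan R M S"
    using add gS by (intro lspan_add lspan_smult)
  moreover have "g \<otimes>\<^bsub>M\<^esub> (c \<odot>\<^bsub>M\<^esub> s) = c \<odot>\<^bsub>M\<^esub> (g \<otimes>\<^bsub>M\<^esub> s)"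
    using g s add by (simp add: m_comm[of g] smult_assoc2)
  ultimately show ?case
    using g s add lspan_closed[OF add.hyps(1)] by (simp add: r_distr)
qed

end

text \<open>The sum has pairwise distinct labels, as the choice of a label of maximal rank requires;
  when a label occurs again, its coefficients are merged.\<close>

lemma lspan_finsum:
  assumes w: "\<And>l. l \<in> L \<Longrightarrow> w l \<in> carrier M" and x: "x \<in> lspan R M (w ` L)"
  shows "\<exists>c J. finite J \<and> J \<subseteq> L \<and> (\<forall>l\<in>J. c l \<in> carrier R) \<and> x = (\<Oplus>\<^bsub>M\<^esub>l\<in>J. c l \<odot>\<^bsub>M\<^esub> w l)"
  using x
proof (induction rule: lspan.induct)
  case zero
  show ?case by (intro exI[of _ "\<lambda>_. \<zero>\<^bsub>R\<^esub>"] exI[of _ "{}"]) simp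
next
  case (add x a s)
  obtain l where l: "l \<in> L" "s = w l" using add by auto
  obtain c J where J: "finite J" "J \<subseteq> L" "\<forall>l\<in>J. c l \<in> carrier R"
    "x = (\<Oplus>\<^bsub>M\<^esub>l\<in>J. c l \<odot>\<^bsub>M\<^esub> w l)" using add.IH by blast
  define b where "b = (if l \<in> J then c l else \<zero>\<^bsub>R\<^esub>)"
  have b: "b \<in> carrier R" using J by (simp add: b_def)
  let ?J = "J - {l}"
  have Jw: "(\<lambda>l. c l \<odot>\<^bsub>M\<^esub> w l) \<in> ?J \<rightarrow> carrier M" using J w by auto
  have sc: "(\<Oplus>\<^bsub>M\<^esub>l\<in>?J. c l \<odot>\<^bsub>M\<^esub> w l) \<in> carrier M" using Jw by (rule M.finsum_closed)
  have wl: "w l \<in> carrier M" using w l by simp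
  have xb: "x = b \<odot>\<^bsub>M\<^esub> w l \<oplus>\<^bsub>M\<^esub> (\<Oplus>\<^bsub>M\<^esub>l\<in>?J. c l \<odot>\<^bsub>M\<^esub> w l)"
  proof (cases "l \<in> J")
    case True
    then have "(\<Oplus>\<^bsub>M\<^esub>l\<in>insert l ?J. c l \<odot>\<^bsub>M\<^esub> w l) = c l \<odot>\<^bsub>M\<^esub> w l \<oplus>\<^bsub>M\<^esub> (\<Oplus>\<^bsub>M\<^esub>l\<in>?J. c l \<odot>\<^bsub>M\<^esub> w l)"
      using J Jw wl by (intro M.finsum_insert) auto
    then show ?thesis using True J(4) by (simp add: b_def insert_absorb)
  next
    case False
    then have "?J = J" by blast
    then show ?thesis using False J(4) sc wl by (simp add: b_def)
  qed
  define d where "d = c(l := a \<oplus>\<^bsub>R\<^esub> b)"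
  have "(\<Oplus>\<^bsub>M\<^esub>l\<in>insert l ?J. d l \<odot>\<^bsub>M\<^esub> w l) = d l \<odot>\<^bsub>M\<^esub> w l \<oplus>\<^bsub>M\<^esub> (\<Oplus>\<^bsub>M\<^esub>l\<in>?J. d l \<odot>\<^bsub>M\<^esub> w l)"
    using J w wl b add.hyps by (intro M.finsum_insert) (auto simp: d_def)
  also have "(\<Oplus>\<^bsub>M\<^esub>l\<in>?J. d l \<odot>\<^bsub>M\<^esub> w l) = (\<Oplus>\<^bsub>M\<^esub>l\<in>?J. c l \<odot>\<^bsub>M\<^esub> w l)"
    using Jw by (intro M.finsum_cong' refl) (auto simp: d_def)
  finally have "(\<Oplus>\<^bsub>M\<^esub>l\<in>insert l ?J. d l \<odot>\<^bsub>M\<^esub> w l) = a \<odot>\<^bsub>M\<^esub> s \<oplus>\<^bsub>M\<^esub> x"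
    using b wl sc add.hyps l by (simp add: d_def xb smult_l_distr M.a_assoc)
  moreover have "finite (insert l ?J)" "insert l ?J \<subseteq> L" "\<forall>j\<in>insert l ?J. d j \<in> carrier R"
    using J l b add.hyps by (auto simp: d_def)
  ultimately show ?case by metis
qed

end

text \<open>Among the labels with nonzero coefficient one of maximal rank is chosen. Its lead occurs
  in the image of no other label in the combination, so the coefficient of the image at this lead is
  a product of two nonzero scalars.\<close>

lemma triangular_injective:
  fixes k :: "('k, 'c) ring_scheme" and A :: "('k, 'a) module"
    and N :: "'m::comm_monoid_add set" and rank :: "'l \<Rightarrow> nat"
  assumes k: "field k" and A: "algebra k A"
    and N: "0 \<in> N" "\<And>a b. a \<in> N \<Longrightarrow> b \<in> N \<Longrightarrow> a + b \<in> N"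
    and h: "h \<in> alg_hom k A (monoid_alg k N)"
    and w: "\<And>l. l \<in> L \<Longrightarrow> w l \<in> carrier A" and span: "carrier A \<subseteq> lspan k A (w ` L)"
    and lead: "\<And>l. l \<in> L \<Longrightarrow> h (w l) (lead l) \<noteq> \<zero>\<^bsub>k\<^esub>"
    and tri: "\<And>i l. i \<in> L \<Longrightarrow> l \<in> L \<Longrightarrow> rank i \<le> rank l \<Longrightarrow> h (w i) (lead l) \<noteq> \<zero>\<^bsub>k\<^esub> \<Longrightarrow> i = l"
    and x: "x \<in> carrier A" "h x = \<zero>\<^bsub>monoid_alg k N\<^esub>"
  shows "x = \<zero>\<^bsub>A\<^esub>"
proof -
  interpret k: field k by (rule k)
  interpret A: algebra k A by (rule A)
  let ?M = "monoid_alg k N"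
  interpret M: algebra k ?M by (rule k.monoid_alg_algebra[OF N])
  interpret h: ring_hom_cring A ?M h by (rule alg_hom_ring_hom_cring[OF A M.algebra_axioms h])
  obtain c J where J: "finite J" "J \<subseteq> L" "\<forall>l\<in>J. c l \<in> carrier k"
    "x = (\<Oplus>\<^bsub>A\<^esub>l\<in>J. c l \<odot>\<^bsub>A\<^esub> w l)"
  proof -
    have "x \<in> lspan k A (w ` L)" using span x(1) by blast
    from A.lspan_finsum[OF w this] show thesis using that by blast
  qed
  have wJ: "w l \<in> carrier A" "h (w l) m \<in> carrier k" if "l \<in> J" for l m
    using that J(2) w k.monoid_algD(1)[OF h.hom_closed] by blast+
  have hx: "h x m = (\<Oplus>\<^bsub>k\<^esub>l\<in>J. c l \<otimes>\<^bsub>k\<^esub> h (w l) m)" for m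
  proof -
    have hl: "h (c l \<odot>\<^bsub>A\<^esub> w l) = c l \<odot>\<^bsub>?M\<^esub> h (w l)" if "l \<in> J" for l
      using that J(3) wJ alg_homD(3)[OF h] by blast
    have "h x = (\<Oplus>\<^bsub>?M\<^esub>l\<in>J. h (c l \<odot>\<^bsub>A\<^esub> w l))"
      unfolding J(4) using J(3) wJ by (subst h.hom_finsum) (auto simp: comp_def)
    then have "h x m = (\<Oplus>\<^bsub>k\<^esub>l\<in>J. h (c l \<odot>\<^bsub>A\<^esub> w l) m)"
      using k.monoid_alg_finsum_apply[OF N J(1), of "\<lambda>l. h (c l \<odot>\<^bsub>A\<^esub> w l)" m] J(3) wJ by simp
    also have "\<dots> = (\<Oplus>\<^bsub>k\<^esub>l\<in>J. c l \<otimes>\<^bsub>k\<^esub> h (w l) m)"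
      using hl J(3) wJ by (intro k.finsum_cong' refl) auto
    finally show ?thesis .
  qed
  define F where "F = {l \<in> J. c l \<noteq> \<zero>\<^bsub>k\<^esub>}"
  have "F = {}"
  proof (rule ccontr)
    assume "F \<noteq> {}"
    have "finite F" using J(1) by (simp add: F_def)
    then have "Max (rank ` F) \<in> rank ` F" using \<open>F \<noteq> {}\<close> by (intro Max_in) auto
    then obtain l where l: "l \<in> F" "rank l = Max (rank ` F)" by auto
    have max: "rank i \<le> rank l" if "i \<in> F" for i
      using that \<open>finite F\<close> unfolding l(2) by (intro Max_ge) auto
    have lJ: "l \<in> J" "l \<in> L" using l J(2) by (auto simp: F_def)
    have "h x (lead l) = (\<Oplus>\<^bsub>k\<^esub>i\<in>J. if l = i then c i \<otimes>\<^bsub>k\<^esub> h (w i) (lead l) else \<zero>\<^bsub>k\<^esub>)"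
      unfolding hx
    proof (rule k.finsum_cong'[OF refl])
      fix i assume i: "i \<in> J"
      show "c i \<otimes>\<^bsub>k\<^esub> h (w i) (lead l) = (if l = i then c i \<otimes>\<^bsub>k\<^esub> h (w i) (lead l) else \<zero>\<^bsub>k\<^esub>)"
      proof (cases "i = l \<or> c i = \<zero>\<^bsub>k\<^esub>")
        case True
        then show ?thesis using wJ[OF i] by auto
      next
        case False
        then have "i \<in> F" using i by (simp add: F_def)
        then have "h (w i) (lead l) = \<zero>\<^bsub>k\<^esub>" using tri[of i l] max[of i] False i J(2) lJ by blast
        then show ?thesis using J(3) i False by auto
      qed
    qed (use J(3) wJ in auto)
    also have "\<dots> = c l \<otimes>\<^bsub>k\<^esub> h (w l) (lead l)"
      using k.add.finprod_singleton[OF lJ(1) J(1), of "\<lambda>i. c i \<otimes>\<^bsub>k\<^esub> h (w i) (lead l)"] J(3) wJ by auto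
    finally have "c l \<otimes>\<^bsub>k\<^esub> h (w l) (lead l) = \<zero>\<^bsub>k\<^esub>" using x(2) by simp
    moreover have "c l \<in> carrier k" "c l \<noteq> \<zero>\<^bsub>k\<^esub>" using l J(3) by (auto simp: F_def)
    ultimately show False using lead[OF lJ(2)] wJ(2)[OF lJ(1)] k.integral by blast
  qed
  then have "c l \<odot>\<^bsub>A\<^esub> w l = \<zero>\<^bsub>A\<^esub>" if "l \<in> J" for l
    using that wJ by (auto simp: F_def)
  then show ?thesis unfolding J(4) by (intro A.M.add.finprod_one_eqI) 
qed

section \<open>The algebras representing \<open>\<A>\<close>, \<open>\<B>\<close> and \<open>\<C>\<close>\<close>

context cring
begin

lemma coord_algebra:
  "algebra R (coord_A R n)" "algebra R (coord_B R n)" "algebra R (coord_C R n)"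
  unfolding coord_A_def ideal_A_def coord_B_def ideal_B_def coord_C_def ideal_C_def Let_def
  by (intro pres_algebra rels_closed)+

lemma univ_A_eq: "univ_A R n = tuple_A n (\<lambda>v. ideal_A R n +>\<^bsub>mpoly R (vars_A n)\<^esub> indexed_var v)"
  by (simp add: univ_A_def gen_A_eq map_tuple_A)

lemma univ_B_eq: "univ_B R r = tuple_BC r (\<lambda>v. ideal_B R r +>\<^bsub>mpoly R (vars_BC r)\<^esub> indexed_var v)"
  by (simp add: univ_B_def gen_BC_eq map_tuple_BC)

lemma univ_C_eq:
  "univ_C R r = tuple_BC (r + 1) (\<lambda>v. ideal_C R r +>\<^bsub>mpoly R (vars_BC (r + 1))\<^esub> indexed_var v)"
  unfolding univ_C_def gen_BC_eq map_tuple_BC ..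

lemma proj_rels_zero:
  assumes "rels \<subseteq> carrier (mpoly R I)"
  shows "(\<lambda>x\<in>carrier (mpoly R I). Idl\<^bsub>mpoly R I\<^esub> rels +>\<^bsub>mpoly R I\<^esub> x) ` rels
    \<subseteq> {\<zero>\<^bsub>quot_alg (mpoly R I) (Idl\<^bsub>mpoly R I\<^esub> rels)\<^esub>}"
  using assms pres_rels_zero[OF assms] by auto

lemma univ_A_in_functor: "univ_A R n \<in> functor_A n (coord_A R n)"
proof -
  let ?P = "mpoly R (vars_A n)"
  let ?p = "\<lambda>x\<in>carrier ?P. ideal_A R n +>\<^bsub>?P\<^esub> x"
  have p: "ring_hom_cring ?P (coord_A R n) ?p"
    unfolding coord_A_def ideal_A_def Let_def
    by (intro alg_hom_ring_hom_cring[OF mpoly_algebra pres_algebra pres_proj] rels_closed)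
  have "univ_A R n = map_A ?p (tuple_A n indexed_var)"
    unfolding univ_A_eq map_tuple_A by (rule tuple_A_cong) (simp add: mpoly_var_closed)
  moreover have "?p ` rels_A ?P (tuple_A n indexed_var) \<subseteq> {\<zero>\<^bsub>coord_A R n\<^esub>}"
    using proj_rels_zero[OF rels_closed(1)[of n]]
    unfolding gen_A_eq coord_A_def ideal_A_def Let_def .
  then have "map_A ?p (tuple_A n indexed_var) \<in> functor_A n (coord_A R n)"
    by (rule iffD2[OF functor_A_map_iff[OF p gen_A_carrier length_tuple_A]])
  ultimately show ?thesis by simp
qed

lemma univ_B_in_functor: "univ_B R r \<in> functor_B r (coord_B R r)"
proof -
  let ?P = "mpoly R (vars_BC r)"
  let ?p = "\<lambda>x\<in>carrier ?P. ideal_B R r +>\<^bsub>?P\<^esub> x"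
  have p: "ring_hom_cring ?P (coord_B R r) ?p"
    unfolding coord_B_def ideal_B_def Let_def
    by (intro alg_hom_ring_hom_cring[OF mpoly_algebra pres_algebra pres_proj] rels_closed)
  have "univ_B R r = map_BC ?p (tuple_BC r indexed_var)"
    unfolding univ_B_eq map_tuple_BC by (rule tuple_BC_cong) (simp add: mpoly_var_closed)
  moreover have "?p ` rels_B ?P (tuple_BC r indexed_var) \<subseteq> {\<zero>\<^bsub>coord_B R r\<^esub>}"
    using proj_rels_zero[OF rels_closed(2)[of r]]
    unfolding gen_BC_eq coord_B_def ideal_B_def Let_def .
  then have "map_BC ?p (tuple_BC r indexed_var) \<in> functor_B r (coord_B R r)"
    unfolding tuple_BC_def
    by (rule iffD2[OF functor_B_map_iff[OF p gen_BC_carrier length_tuple_A]])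
  ultimately show ?thesis by simp
qed

lemma univ_C_in_functor: "univ_C R r \<in> functor_C r (coord_C R r)"
proof -
  let ?P = "mpoly R (vars_BC (r + 1))"
  let ?p = "\<lambda>x\<in>carrier ?P. ideal_C R r +>\<^bsub>?P\<^esub> x"
  have p: "ring_hom_cring ?P (coord_C R r) ?p"
    unfolding coord_C_def ideal_C_def Let_def
    by (intro alg_hom_ring_hom_cring[OF mpoly_algebra pres_algebra pres_proj] rels_closed)
  have "univ_C R r = map_BC ?p (tuple_BC (r + 1) indexed_var)"
    unfolding univ_C_eq map_tuple_BC by (rule tuple_BC_cong) (simp add: mpoly_var_closed)
  moreover have "?p ` rels_C r ?P (tuple_BC (r + 1) indexed_var) \<subseteq> {\<zero>\<^bsub>coord_C R r\<^esub>}"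
    using proj_rels_zero[OF rels_closed(3)[of r]]
    unfolding gen_BC_eq coord_C_def ideal_C_def Let_def .
  then have "map_BC ?p (tuple_BC (r + 1) indexed_var) \<in> functor_C r (coord_C R r)"
    unfolding tuple_BC_def
    by (rule iffD2[OF functor_C_map_iff[OF p gen_BC_carrier length_tuple_A]])
  ultimately show ?thesis by simp
qed

text \<open>The Yoneda bijection is used in two halves: existence of a classifying homomorphism
  here, uniqueness in \<open>represents_hom_eq\<close>.\<close>

lemma represents_hom_ex:
  assumes "represents R A u F Fmap" "algebra R T" "y \<in> F T"
  obtains f where "f \<in> alg_hom R A T" "Fmap f u = y"
proof -
  have "bij_betw (\<lambda>f. Fmap f u) (alg_hom R A T) (F T)"
    using assms(1,2) by (simp add: represents_def)
  then have "y \<in> (\<lambda>f. Fmap f u) ` alg_hom R A T"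
    using assms(3) by (simp add: bij_betw_imp_surj_on)
  then show thesis using that by blast
qed

lemma represents_hom_eq:
  assumes "represents R A u F Fmap" "algebra R T" "f \<in> alg_hom R A T" "g \<in> alg_hom R A T"
    "Fmap f u = Fmap g u"
  shows "f = g"
proof -
  have "bij_betw (\<lambda>f. Fmap f u) (alg_hom R A T) (F T)"
    using assms(1,2) by (simp add: represents_def)
  then show ?thesis
    using inj_onD[OF bij_betw_imp_inj_on assms(5,3,4)] by simp
qed

text \<open>The entries of the universal tuple generate the algebra, so a subspace that contains 1
  and is stable under multiplication by them is everything.\<close>

lemma coord_A_lspan:
  assumes S: "S \<subseteq> carrier (coord_A R n)" and one: "\<one>\<^bsub>coord_A R n\<^esub> \<in> lspan R (coord_A R n) S"
    and m: "\<And>m a s. m \<in> set (univ_A R n) \<Longrightarrow> a \<in> set_mat2 m \<Longrightarrow> s \<in> S \<Longrightarrow>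
      a \<otimes>\<^bsub>coord_A R n\<^esub> s \<in> lspan R (coord_A R n) S"
  shows "carrier (coord_A R n) \<subseteq> lspan R (coord_A R n) S"
proof
  interpret Q: algebra R "coord_A R n" by (rule coord_algebra)
  let ?J = "Idl\<^bsub>mpoly R (vars_A n)\<^esub> (rels_A (mpoly R (vars_A n)) (gen_A R n))"
  have Q: "coord_A R n = quot_alg (mpoly R (vars_A n)) ?J" "ideal_A R n = ?J"
    by (simp_all add: coord_A_def ideal_A_def Let_def)
  fix x assume "x \<in> carrier (coord_A R n)"
  then have "x \<in> carrier (quot_alg (mpoly R (vars_A n)) ?J)" unfolding Q(1) .
  then show "x \<in> lspan R (coord_A R n) S"
  proof (induction rule: pres_induct[OF rels_closed(1), consumes 1, case_names one smult add var])
    case (var y v)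
    let ?v = "ideal_A R n +>\<^bsub>mpoly R (vars_A n)\<^esub> indexed_var v"
    obtain i e where v: "v = MV i e" "i < n" using var.hyps by (auto simp: vars_A_def)
    have mem: "?v \<in> set_mat2 (univ_A R n ! i)" "univ_A R n ! i \<in> set (univ_A R n)"
      using v by (auto simp: univ_A_eq tuple_A_def mat2_of_def intro: entry.exhaust[of e])
    have "?v \<in> carrier (coord_A R n)"
      unfolding Q using var.hyps by (intro pres_var_closed rels_closed)
    then have "?v \<otimes>\<^bsub>coord_A R n\<^esub> y \<in> lspan R (coord_A R n) S"
      using m[OF mem(2,1)] var.IH by (rule Q.lspan_mult[OF S])
    then show ?case by (simp only: Q)
  qed (fold Q(1), (use one Q.lspan_add[OF S] Q.lspan_smult[OF S] in blast)+)
qed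

lemma coord_B_lspan:
  assumes S: "S \<subseteq> carrier (coord_B R r)" and one: "\<one>\<^bsub>coord_B R r\<^esub> \<in> lspan R (coord_B R r) S"
    and u: "univ_B R r = (\<phi>, \<alpha>, ms)"
    and m: "\<And>m a s. m \<in> insert \<phi> (set ms) \<Longrightarrow> a \<in> set_mat2 m \<Longrightarrow> s \<in> S \<Longrightarrow>
      a \<otimes>\<^bsub>coord_B R r\<^esub> s \<in> lspan R (coord_B R r) S"
    and \<alpha>: "\<And>s. s \<in> S \<Longrightarrow> \<alpha> \<otimes>\<^bsub>coord_B R r\<^esub> s \<in> lspan R (coord_B R r) S"
  shows "carrier (coord_B R r) \<subseteq> lspan R (coord_B R r) S"
proof
  interpret Q: algebra R "coord_B R r" by (rule coord_algebra)
  let ?J = "Idl\<^bsub>mpoly R (vars_BC r)\<^esub> (rels_B (mpoly R (vars_BC r)) (gen_BC R r))"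
  have Q: "coord_B R r = quot_alg (mpoly R (vars_BC r)) ?J" "ideal_B R r = ?J"
    by (simp_all add: coord_B_def ideal_B_def Let_def)
  fix x assume "x \<in> carrier (coord_B R r)"
  then have "x \<in> carrier (quot_alg (mpoly R (vars_BC r)) ?J)" unfolding Q(1) .
  then show "x \<in> lspan R (coord_B R r) S"
  proof (induction rule: pres_induct[OF rels_closed(2), consumes 1, case_names one smult add var])
    case (var y v)
    let ?v = "ideal_B R r +>\<^bsub>mpoly R (vars_BC r)\<^esub> indexed_var v"
    have "?v = \<alpha> \<or> (\<exists>m\<in>insert \<phi> (set ms). ?v \<in> set_mat2 m)"
    proof (cases v)
      case (PhiV e)
      then have "?v \<in> set_mat2 \<phi>"
        using u by (auto simp: univ_B_eq tuple_BC_def mat2_of_def intro: entry.exhaust[of e])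
      then show ?thesis by blast
    next
      case AlphaV
      then show ?thesis using u by (auto simp: univ_B_eq tuple_BC_def)
    next
      case (MV i e)
      then have i: "i < r" using var.hyps by (auto simp: vars_BC_def vars_A_def)
      have "?v \<in> set_mat2 (ms ! i)" "ms ! i \<in> set ms"
        using u i MV by (auto simp: univ_B_eq tuple_BC_def tuple_A_def mat2_of_def intro: entry.exhaust[of e])
      then show ?thesis by blast
    qed
    then have "?v \<otimes>\<^bsub>coord_B R r\<^esub> s \<in> lspan R (coord_B R r) S" if "s \<in> S" for s
      using m \<alpha> that by blast
    moreover have "?v \<in> carrier (coord_B R r)"
      unfolding Q using var.hyps by (intro pres_var_closed rels_closed)
    ultimately have "?v \<otimes>\<^bsub>coord_B R r\<^esub> y \<in> lspan R (coord_B R r) S"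
      using Q.lspan_mult[OF S _ _ var.IH] by blast
    then show ?case by (simp only: Q)
  qed (fold Q(1), (use one Q.lspan_add[OF S] Q.lspan_smult[OF S] in blast)+)
qed

end

section \<open>Scroll coordinates of strongly nilpotent matrices\<close>

definition scroll_gen :: "('a, 'c) ring_scheme \<Rightarrow> 'a mat2 \<Rightarrow> nat \<Rightarrow> 'a"
  where "scroll_gen T m e =
    (if e = 0 then m12 m else if e = 1 then m11 m else \<ominus>\<^bsub>T\<^esub> m21 m)"

context cring
begin

lemma add_minus_eq_zero: "x \<in> carrier R \<Longrightarrow> y \<in> carrier R \<Longrightarrow> x \<oplus> \<ominus> y = \<zero> \<Longrightarrow> x = y"
  using r_right_minus_eq by (simp add: a_minus_def)

lemma strongly_nilpotent_m22:
  assumes "strongly_nilpotent R m"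
  shows "m22 m = \<ominus> m11 m"
  using assms by (auto simp: strongly_nilpotent_def mat2_trace_def mat2_carrier_iff
      intro!: minus_equality[symmetric] simp: a_comm)

text \<open>For t (x, -y)^T (y, x) the entries m12, m11, -m21 are t x^2, t x y, t y^2. The four
  entries of the equation m n = 0 are exactly the relations that move one factor y from one such
  triple to the other.\<close>

lemma nilpotent_mult_zeroD:
  assumes m: "strongly_nilpotent R m" and n: "strongly_nilpotent R n"
    and mn: "mat2_mult R m n = mat2_zero R"
  shows "m12 m \<otimes> m11 n = m11 m \<otimes> m12 n" "m12 m \<otimes> (\<ominus> m21 n) = m11 m \<otimes> m11 n"
    "m11 m \<otimes> m11 n = (\<ominus> m21 m) \<otimes> m12 n" "m11 m \<otimes> (\<ominus> m21 n) = (\<ominus> m21 m) \<otimes> m11 n"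
proof -
  have c: "m11 m \<in> carrier R" "m12 m \<in> carrier R" "m21 m \<in> carrier R"
    "m11 n \<in> carrier R" "m12 n \<in> carrier R" "m21 n \<in> carrier R"
    using m n by (auto simp: strongly_nilpotent_def mat2_carrier_iff)
  have e: "m11 m \<otimes> m11 n \<oplus> m12 m \<otimes> m21 n = \<zero>" "m11 m \<otimes> m12 n \<oplus> m12 m \<otimes> (\<ominus> m11 n) = \<zero>"
    "m21 m \<otimes> m11 n \<oplus> (\<ominus> m11 m) \<otimes> m21 n = \<zero>" "m21 m \<otimes> m12 n \<oplus> (\<ominus> m11 m) \<otimes> (\<ominus> m11 n) = \<zero>"
    using mn by (simp_all add: mat2_mult_def mat2_zero_def strongly_nilpotent_m22[OF m]
        strongly_nilpotent_m22[OF n])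
  show "m12 m \<otimes> m11 n = m11 m \<otimes> m12 n"
    using add_minus_eq_zero[of "m11 m \<otimes> m12 n" "m12 m \<otimes> m11 n"] e(2) c by (simp add: r_minus)
  show "m12 m \<otimes> (\<ominus> m21 n) = m11 m \<otimes> m11 n"
    using add_minus_eq_zero[of "m11 m \<otimes> m11 n" "m12 m \<otimes> (\<ominus> m21 n)"] e(1) c by (simp add: r_minus)
  show "m11 m \<otimes> m11 n = (\<ominus> m21 m) \<otimes> m12 n"
    using add_minus_eq_zero[of "m11 m \<otimes> m11 n" "(\<ominus> m21 m) \<otimes> m12 n"] e(4) c
    by (simp add: r_minus l_minus a_comm)
  show "m11 m \<otimes> (\<ominus> m21 n) = (\<ominus> m21 m) \<otimes> m11 n"
    using add_minus_eq_zero[of "m21 m \<otimes> m11 n" "m11 m \<otimes> m21 n"] e(3) c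
    by (simp add: r_minus l_minus)
qed

lemma scroll_gen_closed: "m \<in> mat2_carrier R \<Longrightarrow> scroll_gen R m e \<in> carrier R"
  by (simp add: scroll_gen_def mat2_carrier_iff)

lemma scroll_gen_move:
  assumes "strongly_nilpotent R m" "strongly_nilpotent R n" "mat2_mult R m n = mat2_zero R"
    "e < 2" "f < 2"
  shows "scroll_gen R m e \<otimes> scroll_gen R n (Suc f) = scroll_gen R m (Suc e) \<otimes> scroll_gen R n f"
proof -
  have "e = 0 \<or> e = 1" "f = 0 \<or> f = 1" using assms(4,5) by auto
  then show ?thesis
    using nilpotent_mult_zeroD[OF assms(1-3)] by (auto simp: scroll_gen_def)
qed

text \<open>Since m22 = -m11, the three scroll generators account for all four entries up to
  sign.\<close>

lemma nilpotent_entry: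
  assumes "strongly_nilpotent R m" "a \<in> set_mat2 m"
  shows "\<exists>e\<le>2. a = scroll_gen R m e \<or> a = \<ominus> scroll_gen R m e"
proof -
  have c: "m21 m \<in> carrier R" using assms(1) by (simp add: strongly_nilpotent_def mat2_carrier_iff)
  consider "a = m11 m" | "a = m12 m" | "a = m21 m" | "a = m22 m"
    using assms(2) by (auto simp: set_mat2_eq)
  then show ?thesis
  proof cases
    case 1
    then show ?thesis by (intro exI[of _ 1]) (simp add: scroll_gen_def)
  next
    case 2
    then show ?thesis by (intro exI[of _ 0]) (simp add: scroll_gen_def)
  next
    case 3
    then show ?thesis using c by (intro exI[of _ 2]) (simp add: scroll_gen_def)
  next
    case 4
    then show ?thesis
      using strongly_nilpotent_m22[OF assms(1)] by (intro exI[of _ 1]) (simp add: scroll_gen_def)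
  qed
qed

end

text \<open>The point \<open>t (x, -y)\<^sup>T (y, x)\<close> of the scroll, in the chart \<open>x = 1\<close>.\<close>

definition chart :: "('a, 'c) ring_scheme \<Rightarrow> 'a \<Rightarrow> 'a \<Rightarrow> 'a mat2"
  where "chart T y t =
    Mat2 (y \<otimes>\<^bsub>T\<^esub> t) t (\<ominus>\<^bsub>T\<^esub> (y \<otimes>\<^bsub>T\<^esub> (y \<otimes>\<^bsub>T\<^esub> t))) (\<ominus>\<^bsub>T\<^esub> (y \<otimes>\<^bsub>T\<^esub> t))"

context cring
begin

lemma chart_nilpotent:
  assumes "y \<in> carrier R" "t \<in> carrier R"
  shows "strongly_nilpotent R (chart R y t)"
  using assms
  by (auto simp: strongly_nilpotent_def chart_def mat2_carrier_iff mat2_trace_def mat2_det_def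
      r_neg r_minus l_minus m_ac a_minus_def l_neg)

lemma chart_mult:
  assumes "y \<in> carrier R" "t \<in> carrier R" "s \<in> carrier R"
  shows "mat2_mult R (chart R y t) (chart R y s) = mat2_zero R"
  using assms
  by (auto simp: chart_def mat2_mult_def mat2_zero_def r_neg r_minus l_minus m_ac l_neg)

lemma charts_in_functor_A:
  assumes "y \<in> carrier T" "\<And>i. i < n \<Longrightarrow> t i \<in> carrier T" "algebra R T"
  shows "map (\<lambda>i. chart T y (t i)) [0..<n] \<in> functor_A n T"
proof -
  interpret T: algebra R T by fact
  show ?thesis using assms by (auto simp: functor_A_def T.chart_nilpotent T.chart_mult)
qed

lemma scroll_gen_chart:
  assumes "y \<in> carrier R" "t \<in> carrier R" "e \<le> 2"
  shows "scroll_gen R (chart R y t) e = y [^] e \<otimes> t"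
proof -
  have "e = 0 \<or> e = 1 \<or> e = 2" using assms(3) by auto
  then show ?thesis using assms by (auto simp: scroll_gen_def chart_def numeral_2_eq_2 m_assoc)
qed

lemma mpoly_var_pow:
  assumes "v \<in> I"
  shows "indexed_var v [^]\<^bsub>mpoly R I\<^esub> (e::nat) = mterm R (replicate_mset e v) \<one>"
proof -
  interpret P: algebra R "mpoly R I" by (rule mpoly_algebra)
  show ?thesis
  proof (induction e)
    case 0
    then show ?case by (simp add: mpoly_sel)
  next
    case (Suc e)
    have c: "mterm R (replicate_mset e v) \<one> \<in> carrier (mpoly R I)"
      using assms by (simp add: mpoly_carrier mterm_closed)
    have "indexed_var v [^]\<^bsub>mpoly R I\<^esub> Suc e = mconv R (mterm R (replicate_mset e v) \<one>) (indexed_var v)"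
      using Suc c assms by (simp add: mpoly_mult mpoly_var_closed)
    then show ?case by (simp add: indexed_var_mterm mconv_mterm_mterm)
  qed
qed

end

section \<open>Injectivity of the chart of A_n\<close>

context field
begin

definition chart_A :: "nat \<Rightarrow> (nat multiset \<Rightarrow> 'a) mat2 list"
  where "chart_A n = map (\<lambda>i. chart (mpoly R {..n}) (indexed_var 0) (indexed_var (Suc i))) [0..<n]"

lemma chart_A_in_functor: "chart_A n \<in> functor_A n (mpoly R {..n})"
  unfolding chart_A_def by (rule charts_in_functor_A) (auto simp: mpoly_var_closed mpoly_algebra)

lemma coord_A_chart_injective:
  assumes h: "h \<in> alg_hom R (coord_A R n) (mpoly R {..n})" "map_A h (univ_A R n) = chart_A n"
    and x: "x \<in> carrier (coord_A R n)" "h x = \<zero>\<^bsub>mpoly R {..n}\<^esub>"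
  shows "x = \<zero>\<^bsub>coord_A R n\<^esub>"
proof -
  let ?P = "mpoly R {..n}" and ?N = "{M. set_mset M \<subseteq> {..n}}"
  interpret Q: algebra R "coord_A R n" by (rule coord_algebra)
  interpret P: algebra R ?P by (rule mpoly_algebra)
  interpret h: ring_hom_cring "coord_A R n" ?P h
    by (rule alg_hom_ring_hom_cring[OF coord_algebra(1) mpoly_algebra h(1)])
  define ms where "ms = univ_A R n"
  have len: "length ms = n" by (simp add: ms_def univ_A_eq)
  have ms: "ms \<in> functor_A n (coord_A R n)" unfolding ms_def by (rule univ_A_in_functor)
  have nil: "strongly_nilpotent (coord_A R n) (ms ! i)" if "i < n" for i
    using ms that len by (auto simp: functor_A_def)
  have zero: "mat2_mult (coord_A R n) (ms ! i) (ms ! j) = mat2_zero (coord_A R n)"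
    if "i < n" "j < n" for i j
    using ms that len by (auto simp: functor_A_def)
  have mc: "ms ! i \<in> mat2_carrier (coord_A R n)" if "i < n" for i
    using nil[OF that] by (simp add: strongly_nilpotent_def)
  define g where "g i = scroll_gen (coord_A R n) (ms ! i)" for i
  \<comment> \<open>The cap is 2 because a matrix contributes the generators t, y t and y^2
    t.\<close>
  define \<W> where "\<W> = words {..<n} (\<lambda>_. 2)"
  have gc: "g i e \<in> carrier (coord_A R n)" if "i \<in> {..<n}" "e \<le> 2" for i e
    using that mc by (simp add: g_def Q.scroll_gen_closed)
  have gm: "g i e \<otimes>\<^bsub>coord_A R n\<^esub> g j (Suc f) = g i (Suc e) \<otimes>\<^bsub>coord_A R n\<^esub> g j f"
    if "i \<in> {..<n}" "j \<in> {..<n}" "e < 2" "f < 2" for i j e f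
    unfolding g_def using that nil zero by (intro Q.scroll_gen_move) auto
  let ?w = "mprod (coord_A R n) (case_prod g)"
  have wc: "?w W \<in> carrier (coord_A R n)" if "W \<in> \<W>" for W
    using gc gm that unfolding \<W>_def
    by (rule Q.word_closed[where I = "{..<n}" and cap = "\<lambda>_. 2" and x = g])
  have wa: "?w (add_mset (i, e) W) = g i e \<otimes>\<^bsub>coord_A R n\<^esub> ?w W"
    if "add_mset (i, e) W \<in> \<W>" for i e W
    using gc gm that unfolding \<W>_def
    by (rule Q.word_add[where I = "{..<n}" and cap = "\<lambda>_. 2" and x = g])
  have we: "?w W = ?w W'"
    if "W \<in> \<W>" "W' \<in> \<W>" "image_mset fst W = image_mset fst W'" "word_degree W = word_degree W'"
    for W W'
    using gc gm that unfolding \<W>_def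
    by (rule Q.word_eq[where I = "{..<n}" and cap = "\<lambda>_. 2" and x = g])
  \<comment> \<open>By \<open>word_eq\<close> the value of a word depends only on this label, so one
    word per label spans. Indexing by labels rather than words makes the leading monomials
    distinct.\<close>
  define lab where "lab W = (image_mset fst W, word_degree W)" for W :: "(nat \<times> nat) multiset"
  define rep where "rep l = (SOME W. W \<in> \<W> \<and> lab W = l)" for l
  have rep: "rep (lab W) \<in> \<W>" "lab (rep (lab W)) = lab W" if "W \<in> \<W>" for W
    using someI[of "\<lambda>W'. W' \<in> \<W> \<and> lab W' = lab W" W] that by (auto simp: rep_def)
  have wrep: "?w (rep (lab W)) = ?w W" if "W \<in> \<W>" for W
    using rep[OF that] that by (intro we) (auto simp: lab_def)
  have wL: "(\<lambda>l. ?w (rep l)) ` (lab ` \<W>) = ?w ` \<W>"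
    using wrep by (auto simp: image_iff)
  have hg: "h (g i e) = mterm R (add_mset (Suc i) (replicate_mset e 0)) \<one>" if "i < n" "e \<le> 2" for i e
  proof -
    have "map_mat2 h (ms ! i) = chart ?P (indexed_var 0) (indexed_var (Suc i))"
      using arg_cong[OF h(2), of "\<lambda>l. l ! i"] that len by (simp add: map_A_def chart_A_def ms_def)
    moreover have "h (g i e) = scroll_gen ?P (map_mat2 h (ms ! i)) e"
      using mc[OF that(1)] by (simp add: g_def scroll_gen_def mat2_carrier_iff)
    ultimately have "h (g i e) = indexed_var 0 [^]\<^bsub>?P\<^esub> e \<otimes>\<^bsub>?P\<^esub> indexed_var (Suc i)"
      using that by (simp add: P.scroll_gen_chart mpoly_var_closed)
    also have "\<dots> = mterm R (replicate_mset e 0) \<one> \<otimes>\<^bsub>?P\<^esub> mterm R {#Suc i#} \<one>"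
      using mpoly_var_pow[of 0 "{..n}" e] by (simp add: indexed_var_mterm[of "Suc i"])
    also have "\<dots> = mconv R (mterm R (replicate_mset e 0) \<one>) (mterm R {#Suc i#} \<one>)"
      using that by (intro mpoly_mult) (auto simp: mpoly_carrier intro!: mterm_closed split: if_splits)
    finally show ?thesis by (simp add: mconv_mterm_mterm)
  qed
  \<comment> \<open>Variable 0 is y and variable i + 1 is the scale t of matrix i, so the label can
    be recovered from the monomial.\<close>
  define mon where "mon l = image_mset Suc (fst l) + replicate_mset (snd l) 0" for l :: "nat multiset \<times> nat"
  have hw: "h (?w W) = mterm R (mon (lab W)) \<one>" if "W \<in> \<W>" for W
    using that
  proof (induction W)
    case empty
    then show ?case by (simp add: mon_def lab_def mpoly_sel)
  next
    case (add p W)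
    obtain i e where p: "p = (i, e)" by (cases p)
    have w: "i < n" "e \<le> 2" "W \<in> \<W>" using add.prems by (auto simp: \<W>_def p)
    have N: "mon (lab W) \<in> ?N"
      using w(3) by (auto simp: mon_def lab_def \<W>_def words_def set_mset_replicate_mset_subset split: if_splits)
    have "h (?w (add_mset p W)) = h (g i e) \<otimes>\<^bsub>?P\<^esub> h (?w W)"
      using w wa[of i e W] wc[OF w(3)] gc[of i e] add.prems p by simp
    also have "\<dots> = mconv R (mterm R (add_mset (Suc i) (replicate_mset e 0)) \<one>) (mterm R (mon (lab W)) \<one>)"
      using w N by (subst mpoly_mult)
        (auto simp: hg add.IH mpoly_carrier set_mset_replicate_mset_subset intro!: mterm_closed
          split: if_splits)
    finally have "h (?w (add_mset p W)) =
        mterm R (add_mset (Suc i) (replicate_mset e 0) + mon (lab W)) (\<one> \<otimes> \<one>)"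
      by (simp only: mconv_mterm_mterm[OF one_closed one_closed])
    moreover have "add_mset (Suc i) (replicate_mset e 0) + mon (lab W) = mon (lab (add_mset p W))"
      by (rule multiset_eqI) (simp add: mon_def lab_def p)
    ultimately show ?case by simp
  qed
  have mon_inj: "l = l'" if "mon l = mon l'" for l l'
  proof -
    have cS: "count (image_mset Suc M) (Suc i) = count M i" for M i
      by (induction M) auto
    have c0: "count (image_mset Suc M) 0 = 0" for M by (induction M) auto
    have "snd l = snd l'" using arg_cong[OF that, of "\<lambda>M. count M 0"] by (simp add: mon_def c0)
    moreover have "fst l = fst l'"
    proof (rule multiset_eqI)
      show "count (fst l) i = count (fst l') i" for i
        using arg_cong[OF that, of "\<lambda>M. count M (Suc i)"] by (simp add: mon_def cS)
    qed
    ultimately show ?thesis by (rule prod_eqI[rotated])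
  qed
  have h': "h \<in> alg_hom R (coord_A R n) (monoid_alg R ?N)"
    using h(1) unfolding alg_hom_def ring_hom_def
    by (auto simp: mpoly_carrier mpoly_sel mpoly_mult Pi_def)
  have span: "carrier (coord_A R n) \<subseteq> lspan R (coord_A R n) (?w ` \<W>)"
  proof (rule coord_A_lspan)
    show wS: "?w ` \<W> \<subseteq> carrier (coord_A R n)" using wc by auto
    have "?w {#} \<in> lspan R (coord_A R n) (?w ` \<W>)"
      by (rule Q.lspan_base[OF wS imageI]) (simp add: \<W>_def)
    then show "\<one>\<^bsub>coord_A R n\<^esub> \<in> lspan R (coord_A R n) (?w ` \<W>)" by simp
    fix m a s assume m: "m \<in> set (univ_A R n)" "a \<in> set_mat2 m" "s \<in> ?w ` \<W>"
    then obtain i where i: "i < n" "m = ms ! i" using len by (auto simp: ms_def in_set_conv_nth)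
    obtain W where W: "W \<in> \<W>" "s = ?w W" using m by blast
    obtain e where e: "e \<le> 2" "a = g i e \<or> a = \<ominus>\<^bsub>coord_A R n\<^esub> g i e"
      using Q.nilpotent_entry[OF nil[OF i(1)]] m(2) i by (auto simp: g_def)
    have "add_mset (i, e) W \<in> \<W>" using W i e by (simp add: \<W>_def)
    moreover from this have "g i e \<otimes>\<^bsub>coord_A R n\<^esub> s = ?w (add_mset (i, e) W)"
      using wa[of i e W] W by simp
    ultimately have "g i e \<otimes>\<^bsub>coord_A R n\<^esub> s \<in> lspan R (coord_A R n) (?w ` \<W>)"
      using Q.lspan_base[OF wS imageI] by simp
    then show "a \<otimes>\<^bsub>coord_A R n\<^esub> s \<in> lspan R (coord_A R n) (?w ` \<W>)"
      using e gc[of i e] i W wc Q.lspan_minus[OF wS] by (auto simp: Q.l_minus)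
  qed
  show ?thesis
  \<comment> \<open>Each image is a single monomial and different labels have different monomials,
    so a constant rank suffices.\<close>
  proof (rule triangular_injective[OF field_axioms coord_algebra(1) _ _ h', where L = "lab ` \<W>"
        and w = "\<lambda>l. ?w (rep l)" and lead = mon and rank = "\<lambda>_. 0"])
    show "?w (rep l) \<in> carrier (coord_A R n)" if "l \<in> lab ` \<W>" for l
      using that rep wc by auto
    show "carrier (coord_A R n) \<subseteq> lspan R (coord_A R n) ((\<lambda>l. ?w (rep l)) ` lab ` \<W>)"
      using span unfolding wL .
    show "h (?w (rep l)) (mon l) \<noteq> \<zero>" if "l \<in> lab ` \<W>" for l
      using that rep hw by (auto simp: mterm_def)
    show "i = l" if "i \<in> lab ` \<W>" "l \<in> lab ` \<W>" "h (?w (rep i)) (mon l) \<noteq> \<zero>" for i l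
    proof -
      have "h (?w (rep i)) = mterm R (mon i) \<one>" using that(1) rep hw by auto
      then show ?thesis using that(3) mon_inj by (auto simp: mterm_def split: if_splits)
    qed
    show "h x = \<zero>\<^bsub>monoid_alg R ?N\<^esub>" using x(2) by (simp add: mpoly_sel)
  qed (use x(1) in auto)
qed

end

section \<open>The scroll relations of B_r\<close>

context cring
begin

lemma diff_zero_imp_eq:
  "x \<in> carrier R \<Longrightarrow> y \<in> carrier R \<Longrightarrow> x \<ominus> y = \<zero> \<Longrightarrow> x = y"
  by (simp add: minus_eq_zero_iff)

text \<open>They concern \<phi> = a + (1, -y)^T (p, v). The first computes its determinant as a (p +
  a - y v), so determinant 1 determines p from y, v and a. The second says that a is a root of the
  characteristic polynomial, the others that m \<phi> = a m for a chart matrix m.\<close>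

lemma chart_phi_identities:
  assumes "p \<in> carrier R" "y \<in> carrier R" "v \<in> carrier R" "a \<in> carrier R" "t \<in> carrier R"
  shows "(p \<oplus> a) \<otimes> (\<ominus> (y \<otimes> v) \<oplus> a) \<ominus> v \<otimes> (\<ominus> (y \<otimes> p)) = a \<otimes> ((p \<oplus> a) \<ominus> y \<otimes> v)"
    "(a \<otimes> \<one> \<ominus> (p \<oplus> a)) \<otimes> (a \<otimes> \<one> \<ominus> (\<ominus> (y \<otimes> v) \<oplus> a)) \<ominus>
       (a \<otimes> \<zero> \<ominus> v) \<otimes> (a \<otimes> \<zero> \<ominus> \<ominus> (y \<otimes> p)) = \<zero>"
    "(y \<otimes> t) \<otimes> (p \<oplus> a) \<oplus> t \<otimes> (\<ominus> (y \<otimes> p)) = a \<otimes> (y \<otimes> t)"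
    "(y \<otimes> t) \<otimes> v \<oplus> t \<otimes> (\<ominus> (y \<otimes> v) \<oplus> a) = a \<otimes> t"
    "(\<ominus> (y \<otimes> (y \<otimes> t))) \<otimes> (p \<oplus> a) \<oplus> (\<ominus> (y \<otimes> t)) \<otimes> (\<ominus> (y \<otimes> p)) = a \<otimes> (\<ominus> (y \<otimes> (y \<otimes> t)))"
    "(\<ominus> (y \<otimes> (y \<otimes> t))) \<otimes> v \<oplus> (\<ominus> (y \<otimes> t)) \<otimes> (\<ominus> (y \<otimes> v) \<oplus> a) = a \<otimes> (\<ominus> (y \<otimes> t))"
  by (insert assms, algebra, algebra, algebra, algebra, algebra, algebra)

lemma chart_p_identity:
  assumes "y \<in> carrier R" "v \<in> carrier R" "a \<in> carrier R" "b \<in> carrier R"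
  shows "(((y \<otimes> v \<oplus> b) \<ominus> a) \<oplus> a) \<ominus> y \<otimes> v = b \<oplus> \<zero>"
  using assms by algebra

text \<open>On the left are the relations wanted for \<psi> = \<phi> - a; on the right are
  combinations of the defining equations: the characteristic polynomial at a, 1 - det \<phi>, and
  the entries of m \<phi> - a m.\<close>

lemma psi_identities:
  assumes "p \<in> carrier R" "q \<in> carrier R" "s \<in> carrier R" "u \<in> carrier R" "a \<in> carrier R"
    "x \<in> carrier R" "y \<in> carrier R" "z \<in> carrier R"
  shows "((\<ominus> s) \<otimes> q) \<ominus> ((p \<ominus> a) \<otimes> (a \<ominus> u)) =
      (a \<otimes> \<one> \<ominus> p) \<otimes> (a \<otimes> \<one> \<ominus> u) \<ominus> (a \<otimes> \<zero> \<ominus> q) \<otimes> (a \<otimes> \<zero> \<ominus> s)"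
    "((\<one> \<ominus> a \<otimes> (p \<ominus> a)) \<oplus> a \<otimes> (a \<ominus> u)) \<ominus> a \<otimes> a =
      ((a \<otimes> \<one> \<ominus> p) \<otimes> (a \<otimes> \<one> \<ominus> u) \<ominus> (a \<otimes> \<zero> \<ominus> q) \<otimes> (a \<otimes> \<zero> \<ominus> s)) \<oplus> (\<one> \<ominus> (p \<otimes> u \<ominus> q \<otimes> s))"
    "x \<otimes> (p \<ominus> a) \<ominus> y \<otimes> (\<ominus> s) = (x \<otimes> p \<oplus> y \<otimes> s) \<ominus> a \<otimes> x"
    "x \<otimes> q \<ominus> y \<otimes> (a \<ominus> u) = (x \<otimes> q \<oplus> y \<otimes> u) \<ominus> a \<otimes> y"
    "x \<otimes> (\<ominus> s) \<ominus> (\<ominus> z) \<otimes> (p \<ominus> a) = (z \<otimes> p \<oplus> (\<ominus> x) \<otimes> s) \<ominus> a \<otimes> z"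
    "x \<otimes> (a \<ominus> u) \<ominus> (\<ominus> z) \<otimes> q = (z \<otimes> q \<oplus> (\<ominus> x) \<otimes> u) \<ominus> a \<otimes> (\<ominus> x)"
  by (insert assms, algebra, algebra, algebra, algebra, algebra, algebra)

text \<open>The entries of \<open>\<psi> = \<phi> - \<alpha>\<close>, arranged as the two columns \<open>(\<psi>\<^sub>1\<^sub>1, -\<psi>\<^sub>2\<^sub>1)\<close> and
  \<open>(\<psi>\<^sub>1\<^sub>2, -\<psi>\<^sub>2\<^sub>2)\<close> of the scroll.\<close>

definition psi_gen :: "'a mat2 \<Rightarrow> 'a \<Rightarrow> nat \<Rightarrow> nat \<Rightarrow> 'a"
  where "psi_gen \<phi> a j e =
    (if j = 0 then (if e = 0 then m11 \<phi> \<ominus> a else \<ominus> m21 \<phi>) else (if e = 0 then m12 \<phi> else a \<ominus> m22 \<phi>))"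

text \<open>The one case beyond commutativity is det \<psi> = 0, which is the characteristic
  equation.\<close>

lemma psi_gen_move:
  assumes \<phi>: "\<phi> \<in> mat2_carrier R" and a: "a \<in> carrier R" and char: "mat2_charpoly_at R \<phi> a = \<zero>"
    and "i \<le> 1" "j \<le> 1"
  shows "psi_gen \<phi> a i 0 \<otimes> psi_gen \<phi> a j 1 = psi_gen \<phi> a i 1 \<otimes> psi_gen \<phi> a j 0"
proof -
  have c: "m11 \<phi> \<in> carrier R" "m12 \<phi> \<in> carrier R" "m21 \<phi> \<in> carrier R" "m22 \<phi> \<in> carrier R"
    using \<phi> by (auto simp: mat2_carrier_iff)
  have "((\<ominus> m21 \<phi>) \<otimes> m12 \<phi>) \<ominus> ((m11 \<phi> \<ominus> a) \<otimes> (a \<ominus> m22 \<phi>)) = \<zero>"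
    using psi_identities(1)[OF c(1,2,3,4) a a a a] char by (simp add: mat2_defs)
  then have "(\<ominus> m21 \<phi>) \<otimes> m12 \<phi> = (m11 \<phi> \<ominus> a) \<otimes> (a \<ominus> m22 \<phi>)"
    using c a by (subst (asm) minus_eq_zero_iff) auto
  moreover have "i = 0 \<or> i = 1" "j = 0 \<or> j = 1" using assms(4,5) by auto
  ultimately show ?thesis using c a by (auto simp: psi_gen_def m_comm)
qed

text \<open>This is the characteristic equation a^2 = a tr \<phi> - 1 written in the entries of
  \<psi>. It allows normal forms in which \<alpha> has degree at most one besides the letters of
  \<psi>.\<close>

lemma alpha_square:
  assumes \<phi>: "\<phi> \<in> mat2_carrier R" and a: "a \<in> carrier R" and char: "mat2_charpoly_at R \<phi> a = \<zero>"
    and det: "mat2_det R \<phi> = \<one>"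
  shows "a \<otimes> a = (\<one> \<ominus> a \<otimes> psi_gen \<phi> a 0 0) \<oplus> a \<otimes> psi_gen \<phi> a 1 1"
proof -
  have c: "m11 \<phi> \<in> carrier R" "m12 \<phi> \<in> carrier R" "m21 \<phi> \<in> carrier R" "m22 \<phi> \<in> carrier R"
    using \<phi> by (auto simp: mat2_carrier_iff)
  have "((\<one> \<ominus> a \<otimes> (m11 \<phi> \<ominus> a)) \<oplus> a \<otimes> (a \<ominus> m22 \<phi>)) \<ominus> a \<otimes> a = \<zero>"
    using psi_identities(2)[OF c(1,2,3,4) a a a a] char det
    by (simp add: mat2_defs a_minus_def r_neg)
  then show ?thesis
    using c a by (subst (asm) minus_eq_zero_iff) (auto simp: psi_gen_def)
qed

text \<open>The equation m \<phi> = a m means m \<psi> = 0, the same incidence as m n = 0; hence the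
  columns of \<psi> share the direction of m.\<close>

lemma scroll_psi_move:
  assumes \<phi>: "\<phi> \<in> mat2_carrier R" and a: "a \<in> carrier R" and m: "strongly_nilpotent R m"
    and m\<phi>: "mat2_mult R m \<phi> = mat2_smult R a m" and "e < 2" "j \<le> 1"
  shows "scroll_gen R m e \<otimes> psi_gen \<phi> a j 1 = scroll_gen R m (Suc e) \<otimes> psi_gen \<phi> a j 0"
proof -
  have c: "m11 \<phi> \<in> carrier R" "m12 \<phi> \<in> carrier R" "m21 \<phi> \<in> carrier R" "m22 \<phi> \<in> carrier R"
    using \<phi> by (auto simp: mat2_carrier_iff)
  have mc: "m11 m \<in> carrier R" "m12 m \<in> carrier R" "m21 m \<in> carrier R"
    using m by (auto simp: strongly_nilpotent_def mat2_carrier_iff)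
  have e: "m11 m \<otimes> m11 \<phi> \<oplus> m12 m \<otimes> m21 \<phi> = a \<otimes> m11 m"
    "m11 m \<otimes> m12 \<phi> \<oplus> m12 m \<otimes> m22 \<phi> = a \<otimes> m12 m"
    "m21 m \<otimes> m11 \<phi> \<oplus> (\<ominus> m11 m) \<otimes> m21 \<phi> = a \<otimes> m21 m"
    "m21 m \<otimes> m12 \<phi> \<oplus> (\<ominus> m11 m) \<otimes> m22 \<phi> = a \<otimes> (\<ominus> m11 m)"
    using m\<phi> by (simp_all add: mat2_mult_def mat2_smult_def mat2_eq_iff strongly_nilpotent_m22[OF m])
  note I = psi_identities(3-6)[OF c a mc]
  have z: "x \<ominus> x = \<zero>" if "x \<in> carrier R" for x using that by (simp add: a_minus_def r_neg)
  have "m11 m \<otimes> (m11 \<phi> \<ominus> a) = m12 m \<otimes> (\<ominus> m21 \<phi>)"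
    using I(1)[unfolded e] c a mc z by (subst (asm) z) (simp_all add: minus_eq_zero_iff)
  moreover have "m11 m \<otimes> m12 \<phi> = m12 m \<otimes> (a \<ominus> m22 \<phi>)"
    using I(2)[unfolded e] c a mc z by (subst (asm) z) (simp_all add: minus_eq_zero_iff)
  moreover have "m11 m \<otimes> (\<ominus> m21 \<phi>) = (\<ominus> m21 m) \<otimes> (m11 \<phi> \<ominus> a)"
    using I(3)[unfolded e] c a mc z by (subst (asm) z) (simp_all add: minus_eq_zero_iff)
  moreover have "m11 m \<otimes> (a \<ominus> m22 \<phi>) = (\<ominus> m21 m) \<otimes> m12 \<phi>"
    using I(4)[unfolded e] c a mc z by (subst (asm) z) (simp_all add: minus_eq_zero_iff)
  moreover have "e = 0 \<or> e = 1" "j = 0 \<or> j = 1" using assms(5,6) by auto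
  ultimately show ?thesis by (auto simp: psi_gen_def scroll_gen_def)
qed

lemma psi_gen_closed: "\<phi> \<in> mat2_carrier R \<Longrightarrow> a \<in> carrier R \<Longrightarrow> psi_gen \<phi> a j e \<in> carrier R"
  by (simp add: psi_gen_def mat2_carrier_iff)

text \<open>Serves to read off single coefficients, first of the powers of p and then of the images
  of the normal forms.\<close>

lemma mconv_mterm_shift:
  fixes N :: "'m::ab_group_add set"
  assumes f: "f \<in> carrier (monoid_alg R N)" and a: "a \<in> N" and c: "c \<in> carrier R"
  shows "mconv R f (mterm R a c) m = f (m - a) \<otimes> c"
  using f
proof (induction rule: monoid_alg_induct)
  case zero
  then show ?case using c by simp
next
  case (add_term f b d)
  have "mconv R (mterm R b d) (mterm R a c) m = mterm R b d (m - a) \<otimes> c"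
    using add_term c by (simp add: mconv_mterm_mterm) (auto simp: mterm_def)
  moreover have "mterm R b d (m - a) \<in> carrier R" using add_term by (simp add: mterm_def)
  ultimately show ?case
    using add_term a c monoid_algD(1)[OF add_term.hyps(1)]
    by (simp add: mconv_add_left[of _ N _ _ N] mterm_closed l_distr)
qed

end

definition chart_phi :: "('a, 'c) ring_scheme \<Rightarrow> 'a \<Rightarrow> 'a \<Rightarrow> 'a \<Rightarrow> 'a \<Rightarrow> 'a mat2"
  where "chart_phi T y v p a = Mat2 (p \<oplus>\<^bsub>T\<^esub> a) v (\<ominus>\<^bsub>T\<^esub> (y \<otimes>\<^bsub>T\<^esub> p)) (\<ominus>\<^bsub>T\<^esub> (y \<otimes>\<^bsub>T\<^esub> v) \<oplus>\<^bsub>T\<^esub> a)"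

text \<open>The entry p = y v + b - a solves a (p + a - y v) = 1 when b is the inverse of a; this is
  the determinant condition.\<close>

lemma (in cring) charts_in_functor_B:
  assumes T: "algebra R T" and y: "y \<in> carrier T" and v: "v \<in> carrier T" and a: "a \<in> carrier T"
    and b: "b \<in> carrier T" and ab: "a \<otimes>\<^bsub>T\<^esub> b = \<one>\<^bsub>T\<^esub>" and t: "\<And>i. i < r \<Longrightarrow> t i \<in> carrier T"
  shows "(chart_phi T y v ((y \<otimes>\<^bsub>T\<^esub> v \<oplus>\<^bsub>T\<^esub> b) \<ominus>\<^bsub>T\<^esub> a) a, a, map (\<lambda>i. chart T y (t i)) [0..<r]) \<in> functor_B r T"
proof -
  interpret T: algebra R T by fact
  define p where "p = (y \<otimes>\<^bsub>T\<^esub> v \<oplus>\<^bsub>T\<^esub> b) \<ominus>\<^bsub>T\<^esub> a"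
  have p: "p \<in> carrier T" using y v b a by (simp add: p_def)
  have pb: "(p \<oplus>\<^bsub>T\<^esub> a) \<ominus>\<^bsub>T\<^esub> y \<otimes>\<^bsub>T\<^esub> v = b"
    using T.chart_p_identity[OF y v a b] b by (simp add: p_def)
  have "map (\<lambda>i. chart T y (t i)) [0..<r] \<in> functor_A r T" by (rule charts_in_functor_A[OF y t T])
  moreover have "mat2_mult T (chart T y s) (chart_phi T y v p a) = mat2_smult T a (chart T y s)"
    if "s \<in> carrier T" for s
    using T.chart_phi_identities(3-6)[OF p y v a that]
    by (simp add: mat2_mult_def mat2_smult_def chart_def chart_phi_def)
  moreover have "chart_phi T y v p a \<in> mat2_carrier T"
    using p y v a by (simp add: chart_phi_def mat2_carrier_iff)
  moreover have "mat2_det T (chart_phi T y v p a) = \<one>\<^bsub>T\<^esub>"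
    using T.chart_phi_identities(1)[OF p y v a y] by (simp add: mat2_det_def chart_phi_def pb ab)
  moreover have "mat2_charpoly_at T (chart_phi T y v p a) a = \<zero>\<^bsub>T\<^esub>"
    using T.chart_phi_identities(2)[OF p y v a y] by (simp add: mat2_defs chart_phi_def)
  ultimately show ?thesis
    using t a unfolding p_def[symmetric] functor_B_def functor_A_def by auto
qed

section \<open>Laurent polynomials and the powers of p\<close>

declare Poly_Mapping.single_one [simp del] Poly_Mapping.single_of_nat [simp del]
  Poly_Mapping.single_of_int [simp del] Poly_Mapping.single_numeral [simp del]

text \<open>Index 0 is an ordinary variable here, so the simplification rules that read
  \<open>single\<close> at index 0 as a ring constant have been switched off.\<close>

abbreviation lexp :: "nat \<Rightarrow> int \<Rightarrow> (nat \<Rightarrow>\<^sub>0 int)"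
  where "lexp \<equiv> Poly_Mapping.single"

definition lexps :: "nat \<Rightarrow> (nat \<Rightarrow>\<^sub>0 int) set"
  where "lexps r = {p. \<forall>i\<ge>r + 3. Poly_Mapping.lookup p i = 0}"

lemma lexps_simps [simp]:
  "0 \<in> lexps r" "a \<in> lexps r \<Longrightarrow> b \<in> lexps r \<Longrightarrow> a + b \<in> lexps r" "i < r + 3 \<Longrightarrow> lexp i c \<in> lexps r"
  by (auto simp: lexps_def lookup_add lookup_single when_def)

text \<open>In the Laurent ring the variables \<open>0\<close>, \<open>1\<close>, \<open>2\<close>, \<open>i + 3\<close> are \<open>y\<close>, \<open>v\<close>, \<open>\<alpha>\<close>, \<open>t\<^sub>i\<close>.\<close>

context field
begin

abbreviation laurent :: "nat \<Rightarrow> ('a, (nat \<Rightarrow>\<^sub>0 int) \<Rightarrow> 'a) module"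
  where "laurent r \<equiv> monoid_alg R (lexps r)"

definition lvar :: "nat \<Rightarrow> (nat \<Rightarrow>\<^sub>0 int) \<Rightarrow> 'a"
  where "lvar i = mterm R (lexp i 1) \<one>"

definition lp :: "nat \<Rightarrow> (nat \<Rightarrow>\<^sub>0 int) \<Rightarrow> 'a"
  where "lp r = (lvar 0 \<otimes>\<^bsub>laurent r\<^esub> lvar 1 \<oplus>\<^bsub>laurent r\<^esub> mterm R (lexp 2 (-1)) \<one>) \<ominus>\<^bsub>laurent r\<^esub> lvar 2"

definition chart_B ::
    "nat \<Rightarrow> ((nat \<Rightarrow>\<^sub>0 int) \<Rightarrow> 'a) mat2 \<times> ((nat \<Rightarrow>\<^sub>0 int) \<Rightarrow> 'a) \<times> ((nat \<Rightarrow>\<^sub>0 int) \<Rightarrow> 'a) mat2 list"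
  where "chart_B r = (chart_phi (laurent r) (lvar 0) (lvar 1) (lp r) (lvar 2), lvar 2,
     map (\<lambda>i. chart (laurent r) (lvar 0) (lvar (i + 3))) [0..<r])"

lemma laurent_algebra: "algebra R (laurent r)"
  by (rule monoid_alg_algebra) simp_all

lemma laurent_domain: "domain (laurent r)"
  by (rule monoid_alg_domain) simp_all

lemma lvar_closed: "i < r + 3 \<Longrightarrow> lvar i \<in> carrier (laurent r)"
  by (simp add: lvar_def mterm_closed)

lemma chart_B_in_functor: "chart_B r \<in> functor_B r (laurent r)"
  unfolding chart_B_def lp_def
  by (rule charts_in_functor_B[OF laurent_algebra])
    (auto simp: lvar_closed mterm_closed, simp add: lvar_def mconv_mterm_mterm flip: single_add)

lemma lp_closed: "lp r \<in> carrier (laurent r)"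
proof -
  interpret L: algebra R "laurent r" by (rule laurent_algebra)
  show ?thesis unfolding lp_def by (intro L.M.minus_closed L.M.add.m_closed L.m_closed lvar_closed mterm_closed) auto
qed

text \<open>Multiplication by p = y v + 1/\<alpha> - \<alpha>, seen on coefficients. The recursion
  yields both the support and the extreme coefficients of p^n.\<close>

lemma lp_pow_Suc:
  "(lp r [^]\<^bsub>laurent r\<^esub> Suc n) m =
    ((lp r [^]\<^bsub>laurent r\<^esub> n) (m - (lexp 0 1 + lexp 1 1)) \<oplus> (lp r [^]\<^bsub>laurent r\<^esub> n) (m - lexp 2 (-1)))
      \<ominus> (lp r [^]\<^bsub>laurent r\<^esub> n) (m - lexp 2 1)"
proof -
  interpret L: algebra R "laurent r" by (rule laurent_algebra)
  let ?f = "lp r [^]\<^bsub>laurent r\<^esub> n"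
  let ?a = "mterm R (lexp 0 1 + lexp 1 1 :: nat \<Rightarrow>\<^sub>0 int) \<one>" and ?b = "mterm R (lexp 2 (-1)) \<one>"
    and ?c = "mterm R (lexp 2 1 :: nat \<Rightarrow>\<^sub>0 int) (\<ominus> \<one>)"
  have f: "?f \<in> carrier (laurent r)" by (intro L.nat_pow_closed lp_closed)
  have c: "?a \<in> carrier (laurent r)" "?b \<in> carrier (laurent r)" "?c \<in> carrier (laurent r)"
    by (auto intro!: mterm_closed)
  have "lvar 2 \<oplus>\<^bsub>laurent r\<^esub> ?c = \<zero>\<^bsub>laurent r\<^esub>"
    by (simp add: lvar_def mterm_def fun_eq_iff r_neg)
  then have "\<ominus>\<^bsub>laurent r\<^esub> lvar 2 = ?c"
    using c(3) lvar_closed[of 2 r] by (intro L.M.minus_equality) (auto simp: L.M.a_comm simp del: monoid_alg_sel)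
  then have lp: "lp r = (?a \<oplus>\<^bsub>laurent r\<^esub> ?b) \<oplus>\<^bsub>laurent r\<^esub> ?c"
    unfolding lp_def a_minus_def by (simp add: lvar_def mconv_mterm_mterm)
  have "?f \<otimes>\<^bsub>laurent r\<^esub> lp r =
     (?f \<otimes>\<^bsub>laurent r\<^esub> ?a \<oplus>\<^bsub>laurent r\<^esub> ?f \<otimes>\<^bsub>laurent r\<^esub> ?b) \<oplus>\<^bsub>laurent r\<^esub> ?f \<otimes>\<^bsub>laurent r\<^esub> ?c"
    unfolding lp using f c by (simp add: L.r_distr del: monoid_alg_sel)
  then have "(?f \<otimes>\<^bsub>laurent r\<^esub> lp r) m =
     (?f (m - (lexp 0 1 + lexp 1 1)) \<otimes> \<one> \<oplus> ?f (m - lexp 2 (-1)) \<otimes> \<one>) \<oplus> ?f (m - lexp 2 1) \<otimes> (\<ominus> \<one>)"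
    using f by (simp add: mconv_mterm_shift[OF f])
  then show ?thesis
    using monoid_algD(1)[OF f] by (simp add: a_minus_def r_minus)
qed

text \<open>Each factor p changes the exponent of \<alpha> by at most one, and the summand y v does
  not change it; so an extreme exponent is reached only by choosing 1/\<alpha> every time or
  \<alpha> every time.\<close>

lemma lp_pow_support:
  assumes "(lp r [^]\<^bsub>laurent r\<^esub> n) m \<noteq> \<zero>"
  shows "\<bar>Poly_Mapping.lookup m 2\<bar> \<le> int n" "\<bar>Poly_Mapping.lookup m 2\<bar> = int n \<Longrightarrow> m = lexp 2 (Poly_Mapping.lookup m 2)"
proof -
  interpret L: algebra R "laurent r" by (rule laurent_algebra)
  have "\<bar>Poly_Mapping.lookup m 2\<bar> \<le> int n \<and> (\<bar>Poly_Mapping.lookup m 2\<bar> = int n \<longrightarrow> m = lexp 2 (Poly_Mapping.lookup m 2))"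
    using assms
  proof (induction n arbitrary: m)
    case 0
    then show ?case by (auto simp: mterm_def split: if_splits)
  next
    case (Suc n)
    let ?f = "lp r [^]\<^bsub>laurent r\<^esub> n"
    consider (a) "?f (m - (lexp 0 1 + lexp 1 1)) \<noteq> \<zero>" | (b) "?f (m - lexp 2 (-1)) \<noteq> \<zero>"
      | (c) "?f (m - lexp 2 1) \<noteq> \<zero>"
    proof -
      have "?f (m - (lexp 0 1 + lexp 1 1)) \<noteq> \<zero> \<or> ?f (m - lexp 2 (-1)) \<noteq> \<zero> \<or> ?f (m - lexp 2 1) \<noteq> \<zero>"
        using Suc.prems unfolding lp_pow_Suc by (rule contrapos_np) (simp add: a_minus_def)
      then show thesis using that by blast
    qed
    then show ?case
    proof cases
      case a
      then show ?thesis using Suc.IH[OF a] by (auto simp: lookup_minus lookup_add lookup_single)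
    next
      case b
      have l: "Poly_Mapping.lookup (m - lexp 2 (-1)) 2 = Poly_Mapping.lookup m 2 + 1" by (simp add: lookup_minus lookup_single)
      have "m = lexp 2 (Poly_Mapping.lookup m 2)" if "\<bar>Poly_Mapping.lookup m 2\<bar> = int (Suc n)"
      proof -
        have "\<bar>Poly_Mapping.lookup m 2 + 1\<bar> = int n" using that Suc.IH[OF b] l by auto
        then have "m - lexp 2 (-1) = lexp 2 (Poly_Mapping.lookup m 2 + 1)" using Suc.IH[OF b] l by simp
        then have "m = lexp 2 (Poly_Mapping.lookup m 2 + 1) + lexp 2 (-1)" by (metis diff_add_cancel)
        then show ?thesis by (simp flip: single_add)
      qed
      then show ?thesis using Suc.IH[OF b] l by auto
    next
      case c
      have l: "Poly_Mapping.lookup (m - lexp 2 1) 2 = Poly_Mapping.lookup m 2 - 1" by (simp add: lookup_minus lookup_single)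
      have "m = lexp 2 (Poly_Mapping.lookup m 2)" if "\<bar>Poly_Mapping.lookup m 2\<bar> = int (Suc n)"
      proof -
        have "\<bar>Poly_Mapping.lookup m 2 - 1\<bar> = int n" using that Suc.IH[OF c] l by auto
        then have "m - lexp 2 1 = lexp 2 (Poly_Mapping.lookup m 2 - 1)" using Suc.IH[OF c] l by simp
        then have "m = lexp 2 (Poly_Mapping.lookup m 2 - 1) + lexp 2 1" by (metis diff_add_cancel)
        then show ?thesis by (simp flip: single_add)
      qed
      then show ?thesis using Suc.IH[OF c] l by auto
    qed
  qed
  then show "\<bar>Poly_Mapping.lookup m 2\<bar> \<le> int n" "\<bar>Poly_Mapping.lookup m 2\<bar> = int n \<Longrightarrow> m = lexp 2 (Poly_Mapping.lookup m 2)" by auto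
qed

text \<open>At an extreme exponent of \<alpha> two of the three terms of the recursion vanish by the
  support bound, so the coefficient stays a unit: 1 at the lowest exponent, (-1)^n at the
  highest.\<close>

lemma lp_pow_lead:
  "(lp r [^]\<^bsub>laurent r\<^esub> n) (lexp 2 (- int n)) \<noteq> \<zero>" "(lp r [^]\<^bsub>laurent r\<^esub> n) (lexp 2 (int n)) \<noteq> \<zero>"
proof -
  interpret L: algebra R "laurent r" by (rule laurent_algebra)
  let ?f = "\<lambda>n. lp r [^]\<^bsub>laurent r\<^esub> (n::nat)"
  have c: "?f n m \<in> carrier R" for n m
    by (rule monoid_algD(1)[where N = "lexps r"]) (intro L.nat_pow_closed lp_closed)
  have z: "?f n m = \<zero>" if "\<bar>Poly_Mapping.lookup m 2\<bar> > int n" for n m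
    using lp_pow_support(1)[of r n m] that by fastforce
  show "?f n (lexp 2 (- int n)) \<noteq> \<zero>"
  proof (induction n)
    case (Suc n)
    have "?f (Suc n) (lexp 2 (- int (Suc n))) = ?f n (lexp 2 (- int (Suc n)) - lexp 2 (-1))"
      unfolding lp_pow_Suc using c
      by (simp add: z lookup_minus lookup_add lookup_single a_minus_def)
    also have "lexp 2 (- int (Suc n)) - lexp 2 (-1) = lexp 2 (- int n)"
      by (simp flip: single_diff)
    finally show ?case using Suc by simp
  qed (simp add: mterm_def)
  show "?f n (lexp 2 (int n)) \<noteq> \<zero>"
  proof (induction n)
    case (Suc n)
    have "?f (Suc n) (lexp 2 (int (Suc n))) = \<ominus> ?f n (lexp 2 (int (Suc n)) - lexp 2 1)"
      unfolding lp_pow_Suc using c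
      by (simp add: z lookup_minus lookup_add lookup_single a_minus_def)
    also have "lexp 2 (int (Suc n)) - lexp 2 1 = lexp 2 (int n)"
      by (simp flip: single_diff)
    finally show ?case using Suc c by (metis minus_minus minus_zero)
  qed (simp add: mterm_def)
qed

end

lemma (in cring) add_diff_cancels:
  assumes "a \<in> carrier R" "x \<in> carrier R"
  shows "\<ominus> (a \<ominus> x) \<oplus> a = x" "a \<ominus> (\<ominus> x \<oplus> a) = x"
proof -
  have "a \<oplus> (x \<oplus> \<ominus> a) = x"
    using assms a_lcomm[of a x "\<ominus> a"] by (simp add: r_neg)
  then show "\<ominus> (a \<ominus> x) \<oplus> a = x" "a \<ominus> (\<ominus> x \<oplus> a) = x"
    using assms by (simp_all add: a_minus_def minus_add a_ac)
qed

section \<open>Injectivity of the chart of B_r\<close>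

context field
begin

text \<open>The monomial of a label apart from its power of p. Index 0 is the column of \<phi> -
  \<alpha> that maps to multiples of p and is left out; index 1 gives v; an index i >= 2 gives the
  scale of matrix i - 2, which is variable i + 1.\<close>

definition lbase :: "nat multiset \<times> nat \<Rightarrow> (nat \<Rightarrow>\<^sub>0 int)"
  where "lbase l = lexp 0 (int (snd l)) +
    sum_mset (image_mset (\<lambda>i. if i = 0 then 0 else lexp (if i = 1 then 1 else i + 1) 1) (fst l))"

lemma lbase_add:
  "lbase (add_mset i D, e + d) = lexp 0 (int e) + (if i = 0 then 0 else lexp (if i = 1 then 1 else i + 1) 1) + lbase (D, d)"
  by (simp add: lbase_def single_add ac_simps)

lemma lookup_lbase:
  "Poly_Mapping.lookup (lbase (D, e)) 0 = int e" "Poly_Mapping.lookup (lbase (D, e)) 2 = 0"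
  "Poly_Mapping.lookup (lbase (D, e)) 1 = int (count D 1)"
  "Poly_Mapping.lookup (lbase (D, e)) (i + 3) = int (count D (i + 2))"
proof -
  let ?b = "\<lambda>i. if i = 0 then 0 else lexp (if i = 1 then 1 else i + 1) 1"
  have *: "Poly_Mapping.lookup (sum_mset (image_mset ?b D)) 0 = 0"
    "Poly_Mapping.lookup (sum_mset (image_mset ?b D)) 2 = 0"
    "Poly_Mapping.lookup (sum_mset (image_mset ?b D)) 1 = int (count D 1)"
    "Poly_Mapping.lookup (sum_mset (image_mset ?b D)) (i + 3) = int (count D (i + 2))"
    by (induction D) (auto simp: lookup_add lookup_single when_def)
  then show "Poly_Mapping.lookup (lbase (D, e)) 0 = int e" "Poly_Mapping.lookup (lbase (D, e)) 2 = 0"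
    "Poly_Mapping.lookup (lbase (D, e)) 1 = int (count D 1)"
    "Poly_Mapping.lookup (lbase (D, e)) (i + 3) = int (count D (i + 2))"
    by (simp_all add: lbase_def lookup_add lookup_single)
qed

text \<open>The multiplicity of index 0 leaves no trace in \<open>lbase\<close>; it will be known
  from the power of p.\<close>

lemma lbase_inj:
  assumes "lbase l = lbase l'" "count (fst l) 0 = count (fst l') 0"
  shows "l = l'"
proof -
  obtain D e D' e' where l: "l = (D, e)" "l' = (D', e')" by (metis surj_pair)
  have "e = e'" using lookup_lbase(1)[of D e] lookup_lbase(1)[of D' e'] assms(1) l by simp
  moreover have "count D i = count D' i" for i
  proof -
    consider "i = 0" | "i = 1" | j where "i = j + 2" by (metis One_nat_def Suc_1 add_2_eq_Suc' not0_implies_Suc)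
    then show ?thesis
    proof cases
      case 2
      then show ?thesis using lookup_lbase(3)[of D e] lookup_lbase(3)[of D' e'] assms(1) l by simp
    next
      case 3
      then show ?thesis using lookup_lbase(4)[of D e j] lookup_lbase(4)[of D' e' j] assms(1) l by simp
    qed (use assms(2) l in simp)
  qed
  ultimately show ?thesis using l by (simp add: multiset_eq_iff)
qed

lemma lvar_pow: "lvar i [^]\<^bsub>laurent r\<^esub> (e::nat) = mterm R (lexp i (int e)) \<one>"
proof (induction e)
  case (Suc e)
  then have "lvar i [^]\<^bsub>laurent r\<^esub> Suc e = mconv R (mterm R (lexp i (int e)) \<one>) (lvar i)" by simp
  then show ?case by (simp add: lvar_def mconv_mterm_mterm add.commute flip: single_add)
qed simp

lemma coord_B_chart_injective:
  assumes h: "h \<in> alg_hom R (coord_B R r) (laurent r)" "map_BC h (univ_B R r) = chart_B r"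
    and x: "x \<in> carrier (coord_B R r)" "h x = \<zero>\<^bsub>laurent r\<^esub>"
  shows "x = \<zero>\<^bsub>coord_B R r\<^esub>"
proof -
  let ?B = "coord_B R r" and ?L = "laurent r"
  interpret Q: algebra R ?B by (rule coord_algebra)
  interpret L: algebra R ?L by (rule laurent_algebra)
  interpret h: ring_hom_cring ?B ?L h
    by (rule alg_hom_ring_hom_cring[OF coord_algebra(2) laurent_algebra h(1)])
  obtain \<phi> \<alpha> ms where u: "univ_B R r = (\<phi>, \<alpha>, ms)" by (metis prod_cases3)
  have B: "(\<phi>, \<alpha>, ms) \<in> functor_B r ?B" using univ_B_in_functor[of r] u by simp
  have len: "length ms = r" and \<phi>: "\<phi> \<in> mat2_carrier ?B" and \<alpha>: "\<alpha> \<in> carrier ?B"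
    and det: "mat2_det ?B \<phi> = \<one>\<^bsub>?B\<^esub>" and char: "mat2_charpoly_at ?B \<phi> \<alpha> = \<zero>\<^bsub>?B\<^esub>"
    using B by (auto simp: functor_B_def)
  have nil: "strongly_nilpotent ?B (ms ! i)" and m\<phi>: "mat2_mult ?B (ms ! i) \<phi> = mat2_smult ?B \<alpha> (ms ! i)"
    if "i < r" for i
    using B that by (auto simp: functor_B_def)
  have zero: "mat2_mult ?B (ms ! i) (ms ! j) = mat2_zero ?B" if "i < r" "j < r" for i j
    using B that by (auto simp: functor_B_def)
  have mc: "ms ! i \<in> mat2_carrier ?B" if "i < r" for i
    using nil[OF that] by (simp add: strongly_nilpotent_def)
  \<comment> \<open>Indices 0 and 1 are the two columns of \<phi> - \<alpha>, index i + 2 is the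
    matrix \<open>ms ! i\<close>. A column has degree at most 1 in y and a matrix degree at most 2,
    whence \<open>cap\<close>.\<close>
  define g where "g i = (if i \<le> 1 then Q.psi_gen \<phi> \<alpha> i else scroll_gen ?B (ms ! (i - 2)))" for i
  define cap where "cap i = (if i \<le> 1 then 1 else 2 :: nat)" for i :: nat
  let ?I = "{..<r + 2}"
  define \<W> where "\<W> = words ?I cap"
  have gc: "g i e \<in> carrier ?B" if "i \<in> ?I" "e \<le> cap i" for i e
    using that mc \<phi> \<alpha> by (auto simp: g_def cap_def Q.scroll_gen_closed Q.psi_gen_closed)
  have gc0: "g 0 e \<in> carrier ?B" "g 1 e \<in> carrier ?B" for e
    using \<phi> \<alpha> by (simp_all add: g_def Q.psi_gen_closed)
  have gm: "g i e \<otimes>\<^bsub>?B\<^esub> g j (Suc f) = g i (Suc e) \<otimes>\<^bsub>?B\<^esub> g j f"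
    if "i \<in> ?I" "j \<in> ?I" "e < cap i" "f < cap j" for i j e f
  proof -
    have *: "g i e \<otimes>\<^bsub>?B\<^esub> g j 1 = g i (Suc e) \<otimes>\<^bsub>?B\<^esub> g j 0"
      if "\<not> i \<le> 1" "j \<le> 1" "i < r + 2" "e < 2" for i j e
      using Q.scroll_psi_move[OF \<phi> \<alpha> nil m\<phi>, of "i - 2" e j] that by (simp add: g_def)
    have c: "g j f \<in> carrier ?B" "g j (Suc f) \<in> carrier ?B" "g i e \<in> carrier ?B" "g i (Suc e) \<in> carrier ?B"
      using gc that by auto
    show ?thesis
    proof (cases "i \<le> 1"; cases "j \<le> 1")
      assume ij: "i \<le> 1" "j \<le> 1"
      then have "e = 0" "f = 0" using that by (auto simp: cap_def)
      then show ?thesis using Q.psi_gen_move[OF \<phi> \<alpha> char ij] ij by (simp add: g_def)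
    next
      assume ij: "i \<le> 1" "\<not> j \<le> 1"
      then have "e = 0" "f < 2" using that by (auto simp: cap_def)
      then show ?thesis using *[OF ij(2,1), of f] that c by (simp add: Q.m_comm)
    next
      assume ij: "\<not> i \<le> 1" "j \<le> 1"
      then have "f = 0" "e < 2" using that by (auto simp: cap_def)
      then show ?thesis using *[OF ij, of e] that by simp
    next
      assume ij: "\<not> i \<le> 1" "\<not> j \<le> 1"
      then show ?thesis
        using Q.scroll_gen_move[OF nil nil zero, of "i - 2" "j - 2" e f] that
        by (simp add: g_def cap_def)
    qed
  qed
  let ?w = "mprod ?B (case_prod g)"
  have wc: "?w W \<in> carrier ?B" if "W \<in> \<W>" for W
    using gc gm that unfolding \<W>_def
    by (rule Q.word_closed[where I = ?I and cap = cap and x = g])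
  have wa: "?w (add_mset (i, e) W) = g i e \<otimes>\<^bsub>?B\<^esub> ?w W" if "add_mset (i, e) W \<in> \<W>" for i e W
    using gc gm that unfolding \<W>_def
    by (rule Q.word_add[where I = ?I and cap = cap and x = g])
  have we: "?w W = ?w W'"
    if "W \<in> \<W>" "W' \<in> \<W>" "image_mset fst W = image_mset fst W'" "word_degree W = word_degree W'"
    for W W'
    using gc gm that unfolding \<W>_def
    by (rule Q.word_eq[where I = ?I and cap = cap and x = g])
  define lab where "lab W = (image_mset fst W, word_degree W)" for W :: "(nat \<times> nat) multiset"
  define rep where "rep l = (SOME W. W \<in> \<W> \<and> lab W = l)" for l
  have rep: "rep (lab W) \<in> \<W>" "lab (rep (lab W)) = lab W" if "W \<in> \<W>" for W
    using someI[of "\<lambda>W'. W' \<in> \<W> \<and> lab W' = lab W" W] that by (auto simp: rep_def)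
  have wrep: "?w (rep (lab W)) = ?w W" if "W \<in> \<W>" for W
    using rep[OF that] that by (intro we) (auto simp: lab_def)
  \<comment> \<open>Normal forms are words times 1 or \<alpha>; the boolean tells which.\<close>
  define pa where "pa \<epsilon> = (if \<epsilon> then \<alpha> else \<one>\<^bsub>?B\<^esub>)" for \<epsilon>
  have pac: "pa \<epsilon> \<in> carrier ?B" for \<epsilon> using \<alpha> by (simp add: pa_def)
  define w where "w l = pa (snd l) \<otimes>\<^bsub>?B\<^esub> ?w (rep (fst l))" for l
  define S where "S = {pa \<epsilon> \<otimes>\<^bsub>?B\<^esub> ?w W | \<epsilon> W. W \<in> \<W>}"
  have wS: "w ` (lab ` \<W> \<times> UNIV) = S"
  proof
    show "w ` (lab ` \<W> \<times> UNIV) \<subseteq> S"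
    proof
      fix s assume "s \<in> w ` (lab ` \<W> \<times> UNIV)"
      then obtain W \<epsilon> where "W \<in> \<W>" "s = w (lab W, \<epsilon>)" by blast
      then have "s = pa \<epsilon> \<otimes>\<^bsub>?B\<^esub> ?w (rep (lab W))" "rep (lab W) \<in> \<W>"
        using rep(1) by (simp_all add: w_def)
      then show "s \<in> S" unfolding S_def by blast
    qed
    show "S \<subseteq> w ` (lab ` \<W> \<times> UNIV)"
    proof
      fix s assume "s \<in> S"
      then obtain \<epsilon> W where s: "s = pa \<epsilon> \<otimes>\<^bsub>?B\<^esub> ?w W" "W \<in> \<W>" by (auto simp: S_def)
      then have "s = w (lab W, \<epsilon>)" using wrep by (simp add: w_def)
      then show "s \<in> w ` (lab ` \<W> \<times> UNIV)" using s(2) by blast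
    qed
  qed
  have Sc: "S \<subseteq> carrier ?B" using wc pac by (auto simp: S_def)
  note base = Q.lspan_base[OF Sc] and ladd = Q.lspan_add[OF Sc] and lmin = Q.lspan_minus[OF Sc]
  have gS: "g i e \<otimes>\<^bsub>?B\<^esub> s \<in> S" if s: "s \<in> S" and i: "i \<in> ?I" "e \<le> cap i" for i e s
  proof -
    obtain \<epsilon> W where W: "s = pa \<epsilon> \<otimes>\<^bsub>?B\<^esub> ?w W" "W \<in> \<W>" using s by (auto simp: S_def)
    have "add_mset (i, e) W \<in> \<W>" using W(2) i by (simp add: \<W>_def)
    moreover have "g i e \<otimes>\<^bsub>?B\<^esub> s = pa \<epsilon> \<otimes>\<^bsub>?B\<^esub> ?w (add_mset (i, e) W)"
      using wa[OF calculation] W wc[OF W(2)] gc[OF i] pac[of \<epsilon>] by (simp add: Q.m_lcomm)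
    ultimately show ?thesis by (auto simp: S_def)
  qed
  have \<alpha>S: "\<alpha> \<otimes>\<^bsub>?B\<^esub> s \<in> lspan R ?B S" if s: "s \<in> S" for s
  proof -
    obtain \<epsilon> W where W: "s = pa \<epsilon> \<otimes>\<^bsub>?B\<^esub> ?w W" "W \<in> \<W>" using s by (auto simp: S_def)
    note c = wc[OF W(2)] \<alpha> gc0
    have pS: "pa \<delta> \<otimes>\<^bsub>?B\<^esub> ?w W' \<in> S" if "W' \<in> \<W>" for \<delta> W' using that by (auto simp: S_def)
    show ?thesis
    proof (cases \<epsilon>)
      case False
      then have "\<alpha> \<otimes>\<^bsub>?B\<^esub> s = pa True \<otimes>\<^bsub>?B\<^esub> ?w W" using W c by (simp add: pa_def)
      then show ?thesis using pS[OF W(2)] base by simp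
    next
      case True
      have "\<alpha> \<otimes>\<^bsub>?B\<^esub> s = (\<alpha> \<otimes>\<^bsub>?B\<^esub> \<alpha>) \<otimes>\<^bsub>?B\<^esub> ?w W" using W c True by (simp add: pa_def Q.m_assoc)
      \<comment> \<open>\<open>alpha_square\<close> replaces a second \<alpha> by terms with
        \<alpha> at most once; the new letters \<open>g 0 0\<close> and \<open>g 1 1\<close> are
        absorbed into the word.\<close>
      also have "\<alpha> \<otimes>\<^bsub>?B\<^esub> \<alpha> = (\<one>\<^bsub>?B\<^esub> \<oplus>\<^bsub>?B\<^esub> \<ominus>\<^bsub>?B\<^esub> (\<alpha> \<otimes>\<^bsub>?B\<^esub> g 0 0)) \<oplus>\<^bsub>?B\<^esub> \<alpha> \<otimes>\<^bsub>?B\<^esub> g 1 1"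
        using Q.alpha_square[OF \<phi> \<alpha> char det] by (simp add: g_def a_minus_def)
      also have "\<dots> \<otimes>\<^bsub>?B\<^esub> ?w W = (pa False \<otimes>\<^bsub>?B\<^esub> ?w W \<oplus>\<^bsub>?B\<^esub> \<ominus>\<^bsub>?B\<^esub> (g 0 0 \<otimes>\<^bsub>?B\<^esub> (pa True \<otimes>\<^bsub>?B\<^esub> ?w W)))
          \<oplus>\<^bsub>?B\<^esub> g 1 1 \<otimes>\<^bsub>?B\<^esub> (pa True \<otimes>\<^bsub>?B\<^esub> ?w W)"
        using c by (simp add: pa_def Q.l_distr Q.l_minus Q.m_assoc Q.m_lcomm)
      also have "\<dots> \<in> lspan R ?B S"
        by (intro ladd lmin base gS pS W(2)) (auto simp: cap_def)
      finally show ?thesis .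
    qed
  qed
  have entries: "a \<otimes>\<^bsub>?B\<^esub> s \<in> lspan R ?B S"
    if m: "m \<in> insert \<phi> (set ms)" and a: "a \<in> set_mat2 m" and s: "s \<in> S" for m a s
  proof (cases "m \<in> set ms")
    case True
    then obtain i where i: "i < r" "m = ms ! i" using len by (auto simp: in_set_conv_nth)
    obtain e where e: "e \<le> 2" "a = g (i + 2) e \<or> a = \<ominus>\<^bsub>?B\<^esub> g (i + 2) e"
      using Q.nilpotent_entry[OF nil[OF i(1)]] a i by (auto simp: g_def)
    have "g (i + 2) e \<otimes>\<^bsub>?B\<^esub> s \<in> lspan R ?B S"
      using gS[OF s, of "i + 2" e] i e base by (simp add: cap_def)
    then show ?thesis
      using e gc[of "i + 2" e] i s Sc lmin by (auto simp: Q.l_minus cap_def subset_iff)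
  next
    case False
    have s': "s \<in> carrier ?B" using s Sc by auto
    have f: "m11 \<phi> \<in> carrier ?B" "m12 \<phi> \<in> carrier ?B" "m21 \<phi> \<in> carrier ?B" "m22 \<phi> \<in> carrier ?B"
      using \<phi> by (auto simp: mat2_carrier_iff)
    have g: "g j e \<otimes>\<^bsub>?B\<^esub> s \<in> lspan R ?B S" if "j \<le> 1" "e \<le> 1" for j e
      using gS[OF s, of j e] that base by (simp add: cap_def)
    have "m = \<phi>" using m False by simp
    then consider "a = m11 \<phi>" | "a = m12 \<phi>" | "a = m21 \<phi>" | "a = m22 \<phi>"
      using a by (auto simp: set_mat2_eq)
    then show ?thesis
    proof cases
      case 1
      \<comment> \<open>The diagonal entries of \<phi> differ from scroll generators by \<alpha>, so
        here multiplication by \<alpha> is needed as well.\<close>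
      have "m11 \<phi> = g 0 0 \<oplus>\<^bsub>?B\<^esub> \<alpha>"
        using f \<alpha> by (simp add: g_def Q.psi_gen_def a_minus_def Q.M.a_assoc Q.M.l_neg)
      then have "a \<otimes>\<^bsub>?B\<^esub> s = g 0 0 \<otimes>\<^bsub>?B\<^esub> s \<oplus>\<^bsub>?B\<^esub> \<alpha> \<otimes>\<^bsub>?B\<^esub> s"
        using 1 s' gc0 \<alpha> by (simp add: Q.l_distr)
      then show ?thesis using ladd[OF g[of 0 0] \<alpha>S[OF s]] by simp
    next
      case 2
      then show ?thesis using g[of 1 0] by (simp add: g_def Q.psi_gen_def)
    next
      case 3
      then have "a \<otimes>\<^bsub>?B\<^esub> s = \<ominus>\<^bsub>?B\<^esub> (g 0 1 \<otimes>\<^bsub>?B\<^esub> s)"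
        using f s' by (simp add: g_def Q.psi_gen_def Q.l_minus)
      then show ?thesis using lmin[OF g[of 0 1]] by simp
    next
      case 4
      have "m22 \<phi> = \<ominus>\<^bsub>?B\<^esub> g 1 1 \<oplus>\<^bsub>?B\<^esub> \<alpha>"
        using f \<alpha> by (simp add: g_def Q.psi_gen_def Q.add_diff_cancels)
      then have "a \<otimes>\<^bsub>?B\<^esub> s = \<ominus>\<^bsub>?B\<^esub> (g 1 1 \<otimes>\<^bsub>?B\<^esub> s) \<oplus>\<^bsub>?B\<^esub> \<alpha> \<otimes>\<^bsub>?B\<^esub> s"
        using 4 s' gc0 \<alpha> by (simp add: Q.l_distr Q.l_minus)
      then show ?thesis using ladd[OF lmin[OF g[of 1 1]] \<alpha>S[OF s]] by simp
    qed
  qed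
  have "{#} \<in> \<W>" by (simp add: \<W>_def)
  then have "pa False \<otimes>\<^bsub>?B\<^esub> ?w {#} \<in> S" unfolding S_def by blast
  then have "\<one>\<^bsub>?B\<^esub> \<in> S" by (simp add: pa_def)
  then have "\<one>\<^bsub>?B\<^esub> \<in> lspan R ?B S" by (rule base)
  then have span: "carrier ?B \<subseteq> lspan R ?B S"
    using u entries \<alpha>S by (rule coord_B_lspan[OF Sc])
  have hu: "map_mat2 h \<phi> = chart_phi ?L (lvar 0) (lvar 1) (lp r) (lvar 2)" "h \<alpha> = lvar 2"
    "map (map_mat2 h) ms = map (\<lambda>i. chart ?L (lvar 0) (lvar (i + 3))) [0..<r]"
    using h(2) by (simp_all add: u map_BC_def chart_B_def)
  have lc: "lvar 0 \<in> carrier ?L" "lvar 1 \<in> carrier ?L" "lvar 2 \<in> carrier ?L" "lp r \<in> carrier ?L"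
    by (auto intro!: lvar_closed lp_closed)
  \<comment> \<open>The number of letters with index 0, which is the power of p in the image of the
    word.\<close>
  define n0 where "n0 l = count (fst l) 0" for l :: "nat multiset \<times> nat"
  have hg: "h (g i e) = mterm R (lexp 0 (int e) + (if i = 0 then 0 else lexp (if i = 1 then 1 else i + 1) 1)) \<one>
      \<otimes>\<^bsub>?L\<^esub> lp r [^]\<^bsub>?L\<^esub> (if i = 0 then 1 else 0 :: nat)" if i: "i \<in> ?I" "e \<le> cap i" for i e
  proof -
    have f: "m11 \<phi> \<in> carrier ?B" "m12 \<phi> \<in> carrier ?B" "m21 \<phi> \<in> carrier ?B" "m22 \<phi> \<in> carrier ?B"
      using \<phi> by (auto simp: mat2_carrier_iff)
    have hm: "h (m11 \<phi>) = lp r \<oplus>\<^bsub>?L\<^esub> lvar 2" "h (m12 \<phi>) = lvar 1" "h (m21 \<phi>) = \<ominus>\<^bsub>?L\<^esub> (lvar 0 \<otimes>\<^bsub>?L\<^esub> lp r)"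
      "h (m22 \<phi>) = \<ominus>\<^bsub>?L\<^esub> (lvar 0 \<otimes>\<^bsub>?L\<^esub> lvar 1) \<oplus>\<^bsub>?L\<^esub> lvar 2"
      using hu(1) by (simp_all add: mat2_eq_iff chart_phi_def del: monoid_alg_sel)
    consider "i = 0" "e = 0 \<or> e = 1" | "i = 1" "e = 0 \<or> e = 1" | j where "i = j + 2" "j < r" "e \<le> 2"
    proof -
      have "i = 0 \<or> i = 1 \<or> (\<exists>j. i = j + 2)" by presburger
      then show thesis using i that by (fastforce simp: cap_def)
    qed
    then show ?thesis
    proof cases
      case 1
      have "h (g 0 0) = lp r"
        using f \<alpha> lc hu(2) hm by (simp add: g_def Q.psi_gen_def h.hom_minus a_minus_def L.M.a_assoc L.M.r_neg del: monoid_alg_sel)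
      moreover have "h (g 0 1) = lvar 0 \<otimes>\<^bsub>?L\<^esub> lp r"
        using f lc hm by (simp add: g_def Q.psi_gen_def del: monoid_alg_sel)
      moreover have "\<one>\<^bsub>?L\<^esub> = mterm R (lexp 0 (int 0)) \<one>" "lvar 0 = mterm R (lexp 0 (int 1)) \<one>"
        by (simp_all add: lvar_def)
      ultimately show ?thesis
        using 1 lc L.l_one[OF lc(4)] by (auto simp del: monoid_alg_sel single_zero of_nat_0 of_nat_1)
    next
      case 2
      have "h (g 1 0) = lvar 1" using hm by (simp add: g_def Q.psi_gen_def)
      moreover have "h (g 1 1) = lvar 0 \<otimes>\<^bsub>?L\<^esub> lvar 1"
        using f \<alpha> lc hu(2) hm
        by (simp add: g_def Q.psi_gen_def h.hom_minus L.add_diff_cancels del: monoid_alg_sel)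
      ultimately show ?thesis
        using 2 by (auto simp: lvar_def mconv_mterm_mterm)
    next
      case 3
      have "map_mat2 h (ms ! j) = chart ?L (lvar 0) (lvar (j + 3))"
        using arg_cong[OF hu(3), of "\<lambda>l. l ! j"] 3 len by simp
      moreover have "h (scroll_gen ?B (ms ! j) e) = scroll_gen ?L (map_mat2 h (ms ! j)) e"
        using mc[OF 3(2)] by (simp add: scroll_gen_def mat2_carrier_iff)
      ultimately have "h (g i e) = lvar 0 [^]\<^bsub>?L\<^esub> e \<otimes>\<^bsub>?L\<^esub> lvar (j + 3)"
        using 3 lc lvar_closed[of "j + 3" r] by (simp add: g_def L.scroll_gen_chart del: monoid_alg_sel)
      then show ?thesis
        using 3 unfolding lvar_pow by (simp add: lvar_def mconv_mterm_mterm numeral_3_eq_3)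
    qed
  qed
  have lbN: "lbase (lab W) \<in> lexps r" if "W \<in> \<W>" for W
    using that
  proof (induction W)
    case empty
    then show ?case by (simp add: lab_def lbase_def)
  next
    case (add p W)
    obtain i e where p: "p = (i, e)" by (cases p)
    have w: "i < r + 2" "W \<in> \<W>" using add.prems by (auto simp: \<W>_def p)
    show ?case using add.IH[OF w(2)] w(1) by (simp add: lab_def p lbase_add)
  qed
  have hw: "h (?w W) = mterm R (lbase (lab W)) \<one> \<otimes>\<^bsub>?L\<^esub> lp r [^]\<^bsub>?L\<^esub> n0 (lab W)" if "W \<in> \<W>" for W
    using that
  proof (induction W)
    case empty
    then show ?case using mconv_one[of "mterm R 0 \<one>" "lexps r"] mterm_closed[of 0 "lexps r" \<one>]
      by (simp add: lab_def lbase_def n0_def)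
  next
    case (add p W)
    obtain i e where p: "p = (i, e)" by (cases p)
    have w: "i \<in> ?I" "e \<le> cap i" "W \<in> \<W>" using add.prems by (auto simp: \<W>_def p)
    let ?b = "lexp 0 (int e) + (if i = 0 then 0 else lexp (if i = 1 then 1 else i + 1) 1)"
      and ?d = "if i = 0 then 1 else 0 :: nat"
    have b: "mterm R ?b \<one> \<in> carrier ?L" "mterm R (lbase (lab W)) \<one> \<in> carrier ?L"
      using w lbN by (auto intro!: mterm_closed)
    have "h (?w (add_mset p W)) = h (g i e) \<otimes>\<^bsub>?L\<^esub> h (?w W)"
      using w wa[of i e W] wc[OF w(3)] gc[OF w(1,2)] add.prems p by (simp del: monoid_alg_sel)
    also have "\<dots> = (mterm R ?b \<one> \<otimes>\<^bsub>?L\<^esub> lp r [^]\<^bsub>?L\<^esub> ?d) \<otimes>\<^bsub>?L\<^esub>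
       (mterm R (lbase (lab W)) \<one> \<otimes>\<^bsub>?L\<^esub> lp r [^]\<^bsub>?L\<^esub> n0 (lab W))"
      unfolding hg[OF w(1,2)] add.IH[OF w(3)] ..
    also have "\<dots> = (mterm R ?b \<one> \<otimes>\<^bsub>?L\<^esub> mterm R (lbase (lab W)) \<one>) \<otimes>\<^bsub>?L\<^esub>
       (lp r [^]\<^bsub>?L\<^esub> ?d \<otimes>\<^bsub>?L\<^esub> lp r [^]\<^bsub>?L\<^esub> n0 (lab W))"
      using b lc(4) by (simp only: L.m_ac L.m_closed L.nat_pow_closed)
    also have "lp r [^]\<^bsub>?L\<^esub> ?d \<otimes>\<^bsub>?L\<^esub> lp r [^]\<^bsub>?L\<^esub> n0 (lab W) = lp r [^]\<^bsub>?L\<^esub> n0 (lab (add_mset p W))"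
      using lc(4) by (simp only: L.nat_pow_mult) (simp add: n0_def lab_def p)
    also have "mterm R ?b \<one> \<otimes>\<^bsub>?L\<^esub> mterm R (lbase (lab W)) \<one> = mterm R (lbase (lab (add_mset p W))) \<one>"
      by (simp add: mconv_mterm_mterm lab_def p lbase_add)
    finally show ?case .
  qed
  let ?a = "\<lambda>\<epsilon>. if \<epsilon> then lexp 2 1 else 0 :: nat \<Rightarrow>\<^sub>0 int"
  \<comment> \<open>The image of a normal form is a monomial times p^n, so its coefficients are
    those of p^n translated.\<close>
  have hwl: "h (w l) m = (lp r [^]\<^bsub>?L\<^esub> n0 (fst l)) (m - (lbase (fst l) + ?a (snd l)))"
    if l: "l \<in> lab ` \<W> \<times> UNIV" for l m
  proof -
    obtain W \<epsilon> where W: "l = (lab W, \<epsilon>)" "W \<in> \<W>" using l by auto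
    have pc: "lp r [^]\<^bsub>?L\<^esub> n0 (lab W) \<in> carrier ?L" using lc(4) by (rule L.nat_pow_closed)
    have aN: "lbase (lab W) + ?a \<epsilon> \<in> lexps r" using lbN[OF W(2)] by auto
    have c: "mterm R (?a \<epsilon>) \<one> \<in> carrier ?L" "mterm R (lbase (lab W)) \<one> \<in> carrier ?L"
      using lbN[OF W(2)] by (auto intro!: mterm_closed)
    have "h (pa \<epsilon>) = mterm R (?a \<epsilon>) \<one>" using hu(2) by (simp add: pa_def lvar_def)
    then have "h (w l) = mterm R (?a \<epsilon>) \<one> \<otimes>\<^bsub>?L\<^esub> (mterm R (lbase (lab W)) \<one> \<otimes>\<^bsub>?L\<^esub> lp r [^]\<^bsub>?L\<^esub> n0 (lab W))"
      using W pac wc[OF W(2)] hw[OF W(2)] wrep[OF W(2)] by (simp add: w_def del: monoid_alg_sel)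
    also have "\<dots> = lp r [^]\<^bsub>?L\<^esub> n0 (lab W) \<otimes>\<^bsub>?L\<^esub> (mterm R (lbase (lab W)) \<one> \<otimes>\<^bsub>?L\<^esub> mterm R (?a \<epsilon>) \<one>)"
      using c pc by (simp only: L.m_ac L.m_closed)
    also have "\<dots> = mconv R (lp r [^]\<^bsub>?L\<^esub> n0 (lab W)) (mterm R (lbase (lab W) + ?a \<epsilon>) \<one>)"
      by (simp add: mconv_mterm_mterm)
    finally show ?thesis
      using monoid_algD(1)[OF pc] W by (simp add: mconv_mterm_shift[OF pc aN])
  qed
  \<comment> \<open>Without \<alpha> the lead uses the lowest term of p^n in \<alpha>, at exponent
    -n; with \<alpha> it uses the highest, at exponent n + 1 in total. Taking the same end for both
    would produce equal leads for neighbouring powers of p.\<close>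
  define lead where "lead l = lbase (fst l) + ?a (snd l) +
     lexp 2 (if snd l then int (n0 (fst l)) else - int (n0 (fst l)))" for l
  show ?thesis
  proof (rule triangular_injective[OF field_axioms coord_algebra(2) _ _ h(1),
        where L = "lab ` \<W> \<times> UNIV" and w = w and lead = lead and rank = "\<lambda>l. n0 (fst l)"])
    show "w l \<in> carrier ?B" if "l \<in> lab ` \<W> \<times> UNIV" for l
      using that wS Sc by blast
    show "carrier ?B \<subseteq> lspan R ?B (w ` (lab ` \<W> \<times> UNIV))" unfolding wS by (rule span)
    show "h (w l) (lead l) \<noteq> \<zero>" if "l \<in> lab ` \<W> \<times> UNIV" for l
      unfolding hwl[OF that] using lp_pow_lead[of r "n0 (fst l)"] by (simp add: lead_def)
    show "i = l" if i: "i \<in> lab ` \<W> \<times> UNIV" and l: "l \<in> lab ` \<W> \<times> UNIV"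
      and le: "n0 (fst i) \<le> n0 (fst l)" and nz: "h (w i) (lead l) \<noteq> \<zero>" for i l
    proof -
      let ?m = "lead l - (lbase (fst i) + ?a (snd i))"
      note sup = lp_pow_support[OF nz[unfolded hwl[OF i]]]
      have b2: "Poly_Mapping.lookup (lbase j) 2 = 0" for j using lookup_lbase(2) by (metis surj_pair)
      have lk: "Poly_Mapping.lookup ?m 2 = (if snd l then int (n0 (fst l)) + 1 else - int (n0 (fst l)))
          - (if snd i then 1 else 0)"
        by (simp add: lead_def lookup_minus lookup_add b2 lookup_single)
      \<comment> \<open>The exponents of \<alpha> in the image of \<open>i\<close> are bounded by
        its rank, which is at most that of \<open>l\<close>. The lead of \<open>l\<close> lies at
        the edge of this range only if the booleans and the powers of p agree, and at the edge p^n
        has only pure powers of \<alpha>.\<close>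
      have eq: "snd i = snd l" "n0 (fst i) = n0 (fst l)" "\<bar>Poly_Mapping.lookup ?m 2\<bar> = int (n0 (fst i))"
        using sup(1) le unfolding lk by (auto split: if_splits)
      have "?m = lexp 2 (if snd l then int (n0 (fst l)) else - int (n0 (fst l)))"
        using sup(2)[OF eq(3)] eq(1) unfolding lk by (simp split: if_splits)
      then have "lbase (fst l) = lbase (fst i)" using eq(1) by (auto simp: lead_def algebra_simps)
      then have "fst l = fst i" using eq(2) by (intro lbase_inj) (simp_all add: n0_def)
      then show ?thesis using eq(1) by (simp add: prod_eq_iff)
    qed
  qed (use x in auto)
qed

end

section \<open>Decomposing \<open>\<C>\<close>\<close>

definition shift_mat :: "('a, 'c) ring_scheme \<Rightarrow> 'a \<Rightarrow> 'a mat2 \<Rightarrow> 'a mat2"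
  where "shift_mat T e m = Mat2 (m11 m \<oplus>\<^bsub>T\<^esub> e) (m12 m) (m21 m) (m22 m \<oplus>\<^bsub>T\<^esub> e)"

context cring
begin

text \<open>For trace zero the adjugate of m is -m, so n m = adj n adj m = adj (m n).\<close>

lemma nilpotent_mult_sym:
  assumes m: "strongly_nilpotent R m" and n: "strongly_nilpotent R n"
    and mn: "mat2_mult R m n = mat2_zero R"
  shows "mat2_mult R n m = mat2_zero R"
proof -
  have c: "m11 m \<in> carrier R" "m12 m \<in> carrier R" "m21 m \<in> carrier R"
    "m11 n \<in> carrier R" "m12 n \<in> carrier R" "m21 n \<in> carrier R"
    using m n by (auto simp: strongly_nilpotent_def mat2_carrier_iff)
  note e = nilpotent_mult_zeroD[OF m n mn]
  have e': "m12 n \<otimes> m21 m = \<ominus> (m11 n \<otimes> m11 m)" "m21 n \<otimes> m12 m = \<ominus> (m11 n \<otimes> m11 m)"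
    "m12 n \<otimes> m11 m = m11 n \<otimes> m12 m" "m21 n \<otimes> m11 m = m11 n \<otimes> m21 m"
    using e c by (auto simp: l_minus r_minus m_comm a_inv_inj minus_equality dest: arg_cong[of _ _ "a_inv R"])
  show ?thesis
    unfolding mat2_mult_def mat2_zero_def strongly_nilpotent_m22[OF m] strongly_nilpotent_m22[OF n]
    using c by (simp add: e' l_minus r_minus r_neg l_neg)
qed

text \<open>Cayley-Hamilton with trace and determinant zero.\<close>

lemma nilpotent_square:
  assumes m: "strongly_nilpotent R m"
  shows "mat2_mult R m m = mat2_zero R"
proof -
  have c: "m11 m \<in> carrier R" "m12 m \<in> carrier R" "m21 m \<in> carrier R"
    using m by (auto simp: strongly_nilpotent_def mat2_carrier_iff)
  have "\<ominus> (m11 m \<otimes> m11 m) \<ominus> m12 m \<otimes> m21 m = \<zero>"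
    using m c by (simp add: strongly_nilpotent_def mat2_det_def strongly_nilpotent_m22[OF m] r_minus)
  then have "m12 m \<otimes> m21 m = \<ominus> (m11 m \<otimes> m11 m)"
    using c diff_zero_imp_eq[of "\<ominus> (m11 m \<otimes> m11 m)" "m12 m \<otimes> m21 m"] by simp
  then show ?thesis
    unfolding mat2_mult_def mat2_zero_def strongly_nilpotent_m22[OF m]
    using c by (simp add: l_minus r_minus r_neg l_neg m_comm)
qed

lemma shift_identities:
  assumes "p \<in> carrier R" "q \<in> carrier R" "s \<in> carrier R" "u \<in> carrier R" "e \<in> carrier R"
    "x \<in> carrier R" "y \<in> carrier R"
  shows "(p \<oplus> \<ominus> e) \<otimes> (u \<oplus> \<ominus> e) \<ominus> q \<otimes> s =
      (e \<otimes> \<one> \<ominus> p) \<otimes> (e \<otimes> \<one> \<ominus> u) \<ominus> (e \<otimes> \<zero> \<ominus> q) \<otimes> (e \<otimes> \<zero> \<ominus> s)"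
    "e \<otimes> ((p \<oplus> \<ominus> e) \<oplus> (u \<oplus> \<ominus> e)) = ((p \<otimes> u \<ominus> q \<otimes> s) \<ominus> e \<otimes> e) \<ominus>
       ((e \<otimes> \<one> \<ominus> p) \<otimes> (e \<otimes> \<one> \<ominus> u) \<ominus> (e \<otimes> \<zero> \<ominus> q) \<otimes> (e \<otimes> \<zero> \<ominus> s))"
    "x \<otimes> (p \<oplus> e) \<oplus> y \<otimes> s = (x \<otimes> p \<oplus> y \<otimes> s) \<oplus> e \<otimes> x"
    "x \<otimes> q \<oplus> y \<otimes> (u \<oplus> e) = (x \<otimes> q \<oplus> y \<otimes> u) \<oplus> e \<otimes> y"
    "(p \<oplus> e) \<otimes> x \<oplus> q \<otimes> y = (p \<otimes> x \<oplus> q \<otimes> y) \<oplus> e \<otimes> x"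
    "s \<otimes> x \<oplus> (u \<oplus> e) \<otimes> y = (s \<otimes> x \<oplus> u \<otimes> y) \<oplus> e \<otimes> y"
    "(p \<oplus> e) \<otimes> (u \<oplus> e) \<ominus> q \<otimes> s = ((p \<otimes> u \<ominus> q \<otimes> s) \<oplus> e \<otimes> (p \<oplus> u)) \<oplus> e \<otimes> e"
    "(e \<otimes> \<one> \<ominus> (p \<oplus> e)) \<otimes> (e \<otimes> \<one> \<ominus> (u \<oplus> e)) \<ominus> (e \<otimes> \<zero> \<ominus> q) \<otimes> (e \<otimes> \<zero> \<ominus> s) = p \<otimes> u \<ominus> q \<otimes> s"
  by (insert assms, algebra, algebra, algebra, algebra, algebra, algebra, algebra, algebra)

lemma mult_shift:
  assumes "m \<in> mat2_carrier R" "n \<in> mat2_carrier R" "e \<in> carrier R"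
  shows "mat2_mult R m n = mat2_zero R \<Longrightarrow> mat2_mult R m (shift_mat R e n) = mat2_smult R e m"
    "mat2_mult R n m = mat2_zero R \<Longrightarrow> mat2_mult R (shift_mat R e n) m = mat2_smult R e m"
    "mat2_mult R m n = mat2_smult R e m \<Longrightarrow> mat2_mult R m (shift_mat R (\<ominus> e) n) = mat2_zero R"
proof -
  have c: "m11 m \<in> carrier R" "m12 m \<in> carrier R" "m21 m \<in> carrier R" "m22 m \<in> carrier R"
    "m11 n \<in> carrier R" "m12 n \<in> carrier R" "m21 n \<in> carrier R" "m22 n \<in> carrier R" "\<ominus> e \<in> carrier R"
    using assms by (auto simp: mat2_carrier_iff)
  note I = shift_identities(3-6)[OF c(5-8) assms(3)] and I' = shift_identities(3-6)[OF c(5-9)]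
  show "mat2_mult R m n = mat2_zero R \<Longrightarrow> mat2_mult R m (shift_mat R e n) = mat2_smult R e m"
    using c assms(3) by (simp add: mat2_mult_def mat2_zero_def shift_mat_def mat2_smult_def mat2_eq_iff I)
  show "mat2_mult R n m = mat2_zero R \<Longrightarrow> mat2_mult R (shift_mat R e n) m = mat2_smult R e m"
    using c assms(3) by (simp add: mat2_mult_def mat2_zero_def shift_mat_def mat2_smult_def mat2_eq_iff I)
  show "mat2_mult R m n = mat2_smult R e m \<Longrightarrow> mat2_mult R m (shift_mat R (\<ominus> e) n) = mat2_zero R"
    using c assms(3)
    by (simp add: mat2_mult_def mat2_zero_def shift_mat_def mat2_smult_def mat2_eq_iff I' l_minus r_neg)
qed

text \<open>The determinant of \<phi> - e is the characteristic polynomial at e, and e tr (\<phi> -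
  e) is det \<phi> - e^2 minus that value. Both vanish, and e is a unit because e^2 = 1.\<close>

lemma shift_nilpotent:
  assumes \<phi>: "\<phi> \<in> mat2_carrier R" and e: "e \<in> carrier R" "e \<otimes> e = \<one>"
    and det: "mat2_det R \<phi> = \<one>" and char: "mat2_charpoly_at R \<phi> e = \<zero>"
  shows "strongly_nilpotent R (shift_mat R (\<ominus> e) \<phi>)"
proof -
  have c: "m11 \<phi> \<in> carrier R" "m12 \<phi> \<in> carrier R" "m21 \<phi> \<in> carrier R" "m22 \<phi> \<in> carrier R"
    using \<phi> by (auto simp: mat2_carrier_iff)
  let ?t = "(m11 \<phi> \<oplus> \<ominus> e) \<oplus> (m22 \<phi> \<oplus> \<ominus> e)"
  have t: "?t \<in> carrier R" using c e by simp
  have "e \<otimes> ?t = (\<one> \<ominus> \<one>) \<ominus> \<zero>"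
    using shift_identities(2)[OF c e(1) c(1,1)] det char e by (simp add: mat2_defs)
  then have "e \<otimes> ?t = \<zero>" by (simp add: a_minus_def r_neg)
  then have "e \<otimes> (e \<otimes> ?t) = \<zero>" using e by simp
  then have "?t = \<zero>" using t e by (simp flip: m_assoc)
  moreover have "(m11 \<phi> \<oplus> \<ominus> e) \<otimes> (m22 \<phi> \<oplus> \<ominus> e) \<ominus> m12 \<phi> \<otimes> m21 \<phi> = \<zero>"
    using shift_identities(1)[OF c e(1) c(1,1)] char by (simp add: mat2_defs)
  ultimately show ?thesis
    using c e by (simp add: strongly_nilpotent_def shift_mat_def mat2_carrier_iff mat2_trace_def mat2_det_def)
qed

lemma shift_det_char:
  assumes m: "strongly_nilpotent R m" and e: "e \<in> carrier R" "e \<otimes> e = \<one>"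
  shows "mat2_det R (shift_mat R e m) = \<one>" "mat2_charpoly_at R (shift_mat R e m) e = \<zero>"
proof -
  have c: "m11 m \<in> carrier R" "m12 m \<in> carrier R" "m21 m \<in> carrier R" "m22 m \<in> carrier R"
    and n: "m11 m \<oplus> m22 m = \<zero>" "m11 m \<otimes> m22 m \<ominus> m12 m \<otimes> m21 m = \<zero>"
    using m by (auto simp: strongly_nilpotent_def mat2_carrier_iff mat2_trace_def mat2_det_def)
  show "mat2_det R (shift_mat R e m) = \<one>"
    using shift_identities(7)[OF c e(1) c(1,1)] e by (simp add: mat2_det_def shift_mat_def n)
  show "mat2_charpoly_at R (shift_mat R e m) e = \<zero>"
    using shift_identities(8)[OF c e(1) c(1,1)] by (simp add: mat2_defs shift_mat_def n)
qed

lemma shift_shift: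
  assumes "m \<in> mat2_carrier R" "e \<in> carrier R"
  shows "shift_mat R e (shift_mat R (\<ominus> e) m) = m"
  using assms by (simp add: shift_mat_def mat2_carrier_iff mat2_eq_iff a_assoc l_neg)

text \<open>The entries of adj \<phi> (\<phi> m) = det \<phi> m, each followed by the matching entry
  of adj \<phi> (e m), which up to sign is e times an entry of m \<phi>.\<close>

lemma annihilator_identities:
  assumes "p \<in> carrier R" "q \<in> carrier R" "s \<in> carrier R" "u \<in> carrier R" "e \<in> carrier R"
    "a \<in> carrier R" "b \<in> carrier R" "c \<in> carrier R"
  shows "(p \<otimes> u \<ominus> q \<otimes> s) \<otimes> a = u \<otimes> (p \<otimes> a \<oplus> q \<otimes> c) \<ominus> q \<otimes> (s \<otimes> a \<oplus> u \<otimes> c)"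
    "u \<otimes> (e \<otimes> a) \<ominus> q \<otimes> (e \<otimes> c) = \<ominus> (e \<otimes> (c \<otimes> q \<oplus> (\<ominus> a) \<otimes> u))"
    "(p \<otimes> u \<ominus> q \<otimes> s) \<otimes> b = u \<otimes> (p \<otimes> b \<oplus> q \<otimes> (\<ominus> a)) \<ominus> q \<otimes> (s \<otimes> b \<oplus> u \<otimes> (\<ominus> a))"
    "u \<otimes> (e \<otimes> b) \<ominus> q \<otimes> (e \<otimes> (\<ominus> a)) = e \<otimes> (a \<otimes> q \<oplus> b \<otimes> u)"
    "(p \<otimes> u \<ominus> q \<otimes> s) \<otimes> c = p \<otimes> (s \<otimes> a \<oplus> u \<otimes> c) \<ominus> s \<otimes> (p \<otimes> a \<oplus> q \<otimes> c)"
    "p \<otimes> (e \<otimes> c) \<ominus> s \<otimes> (e \<otimes> a) = e \<otimes> (c \<otimes> p \<oplus> (\<ominus> a) \<otimes> s)"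
  by (insert assms, algebra, algebra, algebra, algebra, algebra, algebra)

text \<open>With \<open>adj m = -m\<close>, taking adjugates in \<open>m \<phi> = \<alpha> m\<close> gives \<open>\<phi>\<^sup>-\<^sup>1 m = \<alpha> m\<close>, while
  \<open>\<phi> m = m \<phi> = \<alpha> m\<close>; hence \<open>m = \<alpha>\<^sup>2 m\<close>.\<close>

lemma alpha_square_annihilates:
  assumes \<phi>: "\<phi> \<in> mat2_carrier R" and e: "e \<in> carrier R" and m: "strongly_nilpotent R m"
    and det: "mat2_det R \<phi> = \<one>" and m\<phi>: "mat2_mult R m \<phi> = mat2_smult R e m"
    and comm: "mat2_mult R m \<phi> = mat2_mult R \<phi> m" and x: "x \<in> set_mat2 m"
  shows "(e \<otimes> e \<ominus> \<one>) \<otimes> x = \<zero>"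
proof -
  have f: "m11 \<phi> \<in> carrier R" "m12 \<phi> \<in> carrier R" "m21 \<phi> \<in> carrier R" "m22 \<phi> \<in> carrier R"
    using \<phi> by (auto simp: mat2_carrier_iff)
  have c: "m11 m \<in> carrier R" "m12 m \<in> carrier R" "m21 m \<in> carrier R"
    using m by (auto simp: strongly_nilpotent_def mat2_carrier_iff)
  note m22 = strongly_nilpotent_m22[OF m]
  have r: "m11 m \<otimes> m12 \<phi> \<oplus> m12 m \<otimes> m22 \<phi> = e \<otimes> m12 m"
    "m21 m \<otimes> m11 \<phi> \<oplus> (\<ominus> m11 m) \<otimes> m21 \<phi> = e \<otimes> m21 m"
    "m21 m \<otimes> m12 \<phi> \<oplus> (\<ominus> m11 m) \<otimes> m22 \<phi> = e \<otimes> (\<ominus> m11 m)"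
    using m\<phi> by (simp_all add: mat2_mult_def mat2_smult_def mat2_eq_iff m22)
  have l: "m11 \<phi> \<otimes> m11 m \<oplus> m12 \<phi> \<otimes> m21 m = e \<otimes> m11 m"
    "m11 \<phi> \<otimes> m12 m \<oplus> m12 \<phi> \<otimes> (\<ominus> m11 m) = e \<otimes> m12 m"
    "m21 \<phi> \<otimes> m11 m \<oplus> m22 \<phi> \<otimes> m21 m = e \<otimes> m21 m"
    "m21 \<phi> \<otimes> m12 m \<oplus> m22 \<phi> \<otimes> (\<ominus> m11 m) = e \<otimes> (\<ominus> m11 m)"
    using m\<phi>[unfolded comm] by (simp_all add: mat2_mult_def mat2_smult_def mat2_eq_iff m22)
  have d: "m11 \<phi> \<otimes> m22 \<phi> \<ominus> m12 \<phi> \<otimes> m21 \<phi> = \<one>" using det by (simp add: mat2_det_def)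
  note I = annihilator_identities[OF f e c]
  have self: "m11 m = e \<otimes> (e \<otimes> m11 m)" "m12 m = e \<otimes> (e \<otimes> m12 m)" "m21 m = e \<otimes> (e \<otimes> m21 m)"
    using I(1)[unfolded l I(2) r d] I(3)[unfolded l I(4) r d] I(5)[unfolded l I(6) r d] c e
    by (simp_all add: r_minus)
  have z: "(e \<otimes> e \<ominus> \<one>) \<otimes> y = \<zero>" if "y \<in> carrier R" "y = e \<otimes> (e \<otimes> y)" for y
  proof -
    have "(e \<otimes> e \<ominus> \<one>) \<otimes> y = e \<otimes> (e \<otimes> y) \<ominus> y"
      using that(1) e by (simp add: a_minus_def l_distr l_minus m_assoc)
    then show ?thesis using that(1) by (simp add: that(2)[symmetric] a_minus_def r_neg)
  qed
  have "(e \<otimes> e \<ominus> \<one>) \<otimes> (\<ominus> m11 m) = \<zero>"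
    using z[OF c(1) self(1)] c e by (simp add: r_minus)
  then show ?thesis using x z[OF c(1) self(1)] z[OF c(2) self(2)] z[OF c(3) self(3)]
    by (auto simp: set_mat2_eq m22)
qed

end

lemma (in ring_hom_cring) map_shift_mat:
  "m \<in> mat2_carrier R \<Longrightarrow> e \<in> carrier R \<Longrightarrow> map_mat2 h (shift_mat R e m) = shift_mat S (h e) (map_mat2 h m)"
  by (simp add: shift_mat_def mat2_carrier_iff)

lemma (in cring) shift_mat_closed:
  "m \<in> mat2_carrier R \<Longrightarrow> e \<in> carrier R \<Longrightarrow> shift_mat R e m \<in> mat2_carrier R"
  by (simp add: shift_mat_def mat2_carrier_iff)

text \<open>The last matrix n of the tuple becomes \<phi> = e + n; then m \<phi> = e m = \<phi> m
  because m n = n m = 0.\<close>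

lemma functor_A_to_C:
  fixes T :: "('k, 't) module"
  assumes T: "cring T" and e: "e \<in> carrier T" "e \<otimes>\<^bsub>T\<^esub> e = \<one>\<^bsub>T\<^esub>" and ms: "ms \<in> functor_A (r + 2) T"
  shows "(shift_mat T e (ms ! (r + 1)), e, take (r + 1) ms) \<in> functor_C r T"
proof -
  interpret T: cring T by (rule T)
  have len: "length ms = r + 2" and nil: "\<And>m. m \<in> set ms \<Longrightarrow> strongly_nilpotent T m"
    and z: "\<And>m m'. m \<in> set ms \<Longrightarrow> m' \<in> set ms \<Longrightarrow> mat2_mult T m m' = mat2_zero T"
    using ms by (auto simp: functor_A_def)
  let ?n = "ms ! (r + 1)"
  have n: "?n \<in> set ms" using len by simp
  have c: "m \<in> mat2_carrier T" if "m \<in> set ms" for m using nil[OF that] by (simp add: strongly_nilpotent_def)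
  have sub: "m \<in> set ms" if "m \<in> set (take (r + 1) ms)" for m using that by (rule in_set_takeD)
  have "take (r + 1) ms ! r \<in> set ms" using len by simp
  then have "mat2_mult T (take (r + 1) ms ! r) (shift_mat T e ?n) = mat2_mult T (shift_mat T e ?n) (take (r + 1) ms ! r)"
    using T.mult_shift(1,2)[OF c c[OF n] e(1)] z[OF _ n] z[OF n] by simp
  moreover have "\<forall>m\<in>set (take (r + 1) ms). mat2_mult T m (shift_mat T e ?n) = mat2_smult T e m"
    using T.mult_shift(1)[OF c c[OF n] e(1)] z[OF _ n] sub by blast
  ultimately show ?thesis
    unfolding functor_C_def
    using len sub nil z e T.shift_det_char[OF nil[OF n] e] T.shift_mat_closed[OF c[OF n] e(1)] by auto
qed

text \<open>The tuple is extended by \<phi> - e. That m (\<phi> - e) = 0 restates m \<phi> = e m,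
  and the product in the other order vanishes by \<open>nilpotent_mult_sym\<close>.\<close>

lemma functor_C_to_A:
  fixes T :: "('k, 't) module"
  assumes T: "cring T" and e: "e \<in> carrier T" "e \<otimes>\<^bsub>T\<^esub> e = \<one>\<^bsub>T\<^esub>" and C: "(\<phi>, e, ms) \<in> functor_C r T"
  shows "ms @ [shift_mat T (\<ominus>\<^bsub>T\<^esub> e) \<phi>] \<in> functor_A (r + 2) T"
proof -
  interpret T: cring T by (rule T)
  let ?n = "shift_mat T (\<ominus>\<^bsub>T\<^esub> e) \<phi>"
  have nil: "\<And>m. m \<in> set ms \<Longrightarrow> strongly_nilpotent T m" and len: "length ms = r + 1"
    and \<phi>: "\<phi> \<in> mat2_carrier T" "mat2_det T \<phi> = \<one>\<^bsub>T\<^esub>" "mat2_charpoly_at T \<phi> e = \<zero>\<^bsub>T\<^esub>"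
    and z: "\<And>m m'. m \<in> set ms \<Longrightarrow> m' \<in> set ms \<Longrightarrow> mat2_mult T m m' = mat2_zero T"
    and m\<phi>: "\<And>m. m \<in> set ms \<Longrightarrow> mat2_mult T m \<phi> = mat2_smult T e m"
    using C by (auto simp: functor_C_def)
  have n: "strongly_nilpotent T ?n" by (rule T.shift_nilpotent[OF \<phi>(1) e \<phi>(2,3)])
  have mn: "mat2_mult T m ?n = mat2_zero T" if "m \<in> set ms" for m
    using nil[OF that] m\<phi>[OF that] \<phi>(1) e(1)
    by (intro T.mult_shift(3)) (auto simp: strongly_nilpotent_def)
  show ?thesis
    unfolding functor_A_def
    using len nil n z mn T.nilpotent_mult_sym[OF nil n mn] T.nilpotent_square[OF n] by auto
qed

lemma functor_B_to_C:
  fixes T :: "('k, 't) module"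
  assumes T: "cring T" and B: "(\<phi>, \<alpha>, ms) \<in> functor_B r T"
  shows "(\<phi>, \<alpha>, ms @ [mat2_zero T]) \<in> functor_C r T"
proof -
  interpret T: cring T by (rule T)
  have z: "mat2_mult T m (mat2_zero T) = mat2_zero T" "mat2_mult T (mat2_zero T) m = mat2_zero T"
    if "m \<in> mat2_carrier T" for m
    using that by (simp_all add: mat2_mult_def mat2_zero_def mat2_carrier_iff)
  have "strongly_nilpotent T (mat2_zero T)" "mat2_zero T \<in> mat2_carrier T"
    by (simp_all add: strongly_nilpotent_def mat2_zero_def mat2_carrier_iff mat2_trace_def mat2_det_def T.r_right_minus_eq)
  moreover have "mat2_smult T \<alpha> (mat2_zero T) = mat2_zero T"
    using B by (simp add: mat2_smult_def mat2_zero_def functor_B_def)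
  moreover have "\<And>m. m \<in> set ms \<Longrightarrow> m \<in> mat2_carrier T"
    using B by (auto simp: functor_B_def strongly_nilpotent_def)
  moreover have "(ms @ [mat2_zero T]) ! r = mat2_zero T" using B by (auto simp: functor_B_def)
  ultimately show ?thesis
    using B z unfolding functor_B_def functor_C_def by auto
qed

lemma functor_C_to_B:
  fixes T :: "('k, 't) module"
  assumes "(\<phi>, \<alpha>, ms) \<in> functor_C r T"
  shows "(\<phi>, \<alpha>, take r ms) \<in> functor_B r T"
  using assms in_set_takeD[of _ r ms] unfolding functor_B_def functor_C_def by auto

section \<open>Kernels and quotients of algebra homomorphisms\<close>

lemma hom_image_lspan:
  assumes C: "algebra k C" and A: "algebra k A" and f: "f \<in> alg_hom k C A"
  shows "lspan k A (f ` carrier C) \<subseteq> f ` carrier C"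
proof
  interpret C: algebra k C by (rule C)
  interpret f: ring_hom_cring C A f by (rule alg_hom_ring_hom_cring[OF C A f])
  fix x assume "x \<in> lspan k A (f ` carrier C)"
  then show "x \<in> f ` carrier C"
  proof (induction rule: lspan.induct)
    case zero
    then show ?case using f.hom_zero C.M.zero_closed by (metis imageI)
  next
    case (add x c s)
    then obtain y z where yz: "y \<in> carrier C" "z \<in> carrier C" "x = f y" "s = f z" by blast
    then have "c \<odot>\<^bsub>A\<^esub> s \<oplus>\<^bsub>A\<^esub> x = f (c \<odot>\<^bsub>C\<^esub> z \<oplus>\<^bsub>C\<^esub> y)"
      using add.hyps alg_homD(3)[OF f] by simp
    then show ?case using yz add.hyps by (metis C.M.add.m_closed C.smult_closed imageI)
  qed
qed

text \<open>\<open>g\<close> is a left inverse of the map that \<open>f\<close> induces on the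
  quotient, so this map is injective and \<open>J\<close> is the whole kernel; surjectivity of
  \<open>f\<close> makes it an isomorphism. In the applications \<open>g\<close> comes from the
  representability of the functor of \<open>A\<close>.\<close>

lemma quot_iso:
  assumes C: "algebra k C" and J: "ideal J C" and A: "algebra k A"
    and f: "f \<in> alg_hom k C A" "\<And>x. x \<in> J \<Longrightarrow> f x = \<zero>\<^bsub>A\<^esub>"
    and g: "g \<in> alg_hom k A (quot_alg C J)" "\<And>x. x \<in> carrier C \<Longrightarrow> g (f x) = J +>\<^bsub>C\<^esub> x"
    and surj: "carrier A \<subseteq> f ` carrier C"
  shows "J = {x \<in> carrier C. f x = \<zero>\<^bsub>A\<^esub>}" "alg_isomorphic k (quot_alg C J) A"
proof -
  interpret C: algebra k C by (rule C)
  interpret f: ring_hom_cring C A f by (rule alg_hom_ring_hom_cring[OF C A f(1)])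
  interpret g: ring_hom_cring A "quot_alg C J" g
    by (rule alg_hom_ring_hom_cring[OF A quot_alg_algebra[OF C J] g(1)])
  have "x \<in> J" if "x \<in> carrier C" "f x = \<zero>\<^bsub>A\<^esub>" for x
    using g(2)[OF that(1)] that g.hom_zero quot_alg_zero_iff[OF C J that(1)] by simp
  then show "J = {x \<in> carrier C. f x = \<zero>\<^bsub>A\<^esub>}" using f(2) ideal.Icarr[OF J] by auto
  obtain F where F: "F \<in> alg_hom k (quot_alg C J) A" "\<And>x. x \<in> carrier C \<Longrightarrow> F (J +>\<^bsub>C\<^esub> x) = f x"
    using quot_alg_lift[OF C J A f(1)] f(2) by metis
  have "bij_betw F (carrier (quot_alg C J)) (carrier A)"
  proof (rule bij_betw_byWitness[where f' = g])
    show "\<forall>a\<in>carrier (quot_alg C J). g (F a) = a" using F(2) g(2) by (auto simp: carrier_quot_alg)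
    show "\<forall>b\<in>carrier A. F (g b) = b"
    proof
      fix b assume "b \<in> carrier A"
      then obtain x where "x \<in> carrier C" "b = f x" using surj by blast
      then show "F (g b) = b" using F(2) g(2) by simp
    qed
    show "F ` carrier (quot_alg C J) \<subseteq> carrier A" using alg_homD(2)[OF F(1)] by blast
    show "g ` carrier A \<subseteq> carrier (quot_alg C J)" using g.hom_closed by blast
  qed
  then show "alg_isomorphic k (quot_alg C J) A" using F(1) by (auto simp: alg_isomorphic_def)
qed

lemma kernel_prime:
  assumes "ring_hom_cring C D f" "domain D"
  shows "primeideal {x \<in> carrier C. f x = \<zero>\<^bsub>D\<^esub>} C"
proof -
  interpret f: ring_hom_cring C D f by fact
  interpret D: domain D by fact
  have "ideal (a_kernel C D f) C"
    by (rule ring_hom_ring.kernel_is_ideal[OF ring_hom_ringI2])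
      (auto intro: cring.axioms(1) f.R.is_cring f.S.is_cring)
  then show ?thesis
    unfolding a_kernel_def'
  proof (rule primeidealI[OF _ f.R.is_cring])
    have "f \<one>\<^bsub>C\<^esub> \<noteq> \<zero>\<^bsub>D\<^esub>" by simp
    then show "carrier C \<noteq> {x \<in> carrier C. f x = \<zero>\<^bsub>D\<^esub>}" using f.R.one_closed by blast
  qed (use D.integral in auto)
qed

lemma map_BC_compose:
  assumes "\<phi> \<in> mat2_carrier C" "\<alpha> \<in> carrier C" "set ms \<subseteq> mat2_carrier C"
  shows "map_BC (compose (carrier C) g f) (\<phi>, \<alpha>, ms) = map_BC g (map_BC f (\<phi>, \<alpha>, ms))"
proof -
  have "map_mat2 (compose (carrier C) g f) m = map_mat2 g (map_mat2 f m)" if "m \<in> mat2_carrier C" for m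
    using that by (simp add: mat2_eq_iff mat2_carrier_iff compose_def)
  then show ?thesis using assms by (auto simp: map_BC_def compose_def)
qed

text \<open>A boolean codes the sign, so that the components \<alpha> = 1 and \<alpha> = -1 are
  treated by one argument.\<close>

definition eps :: "('a, 'c) ring_scheme \<Rightarrow> bool \<Rightarrow> 'a"
  where "eps T b = (if b then \<one>\<^bsub>T\<^esub> else \<ominus>\<^bsub>T\<^esub> \<one>\<^bsub>T\<^esub>)"

lemma (in cring) eps_closed [simp]: "eps R b \<in> carrier R" and eps_square: "eps R b \<otimes> eps R b = \<one>"
  by (simp_all add: eps_def l_minus r_minus)

lemma (in ring_hom_cring) hom_eps: "h (eps R b) = eps S b"
  by (simp add: eps_def)

context cring
begin

text \<open>Together with \<open>double_identity\<close> this shows that x = y (a - 1) = z (a + 1)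
  implies 2 x = (y - z) (a^2 - 1).\<close>

lemma factor_identity:
  assumes "y \<in> carrier R" "a \<in> carrier R"
  shows "(y \<otimes> (a \<ominus> \<one>)) \<otimes> (a \<ominus> \<ominus> \<one>) = y \<otimes> (a \<otimes> a \<ominus> \<one>)"
    "(y \<otimes> (a \<ominus> \<ominus> \<one>)) \<otimes> (a \<ominus> \<one>) = y \<otimes> (a \<otimes> a \<ominus> \<one>)"
  by (insert assms, algebra, algebra)

lemma double_identity:
  assumes "x \<in> carrier R" "a \<in> carrier R"
  shows "x \<oplus> x = x \<otimes> (a \<ominus> \<ominus> \<one>) \<ominus> x \<otimes> (a \<ominus> \<one>)"
  using assms by algebra

end

lemma hom_genideal_zero:
  assumes "ring_hom_cring C D f" "E \<subseteq> carrier C" "\<And>x. x \<in> E \<Longrightarrow> f x = \<zero>\<^bsub>D\<^esub>" "x \<in> Idl\<^bsub>C\<^esub> E"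
  shows "f x = \<zero>\<^bsub>D\<^esub>"
proof -
  interpret f: ring_hom_cring C D f by fact
  have "ideal (a_kernel C D f) C"
    by (rule ring_hom_ring.kernel_is_ideal[OF ring_hom_ringI2])
      (auto intro: cring.axioms(1) f.R.is_cring f.S.is_cring)
  moreover have "E \<subseteq> a_kernel C D f" using assms(2,3) unfolding a_kernel_def' by blast
  ultimately have "Idl\<^bsub>C\<^esub> E \<subseteq> a_kernel C D f" by (rule f.R.genideal_minimal)
  then show ?thesis using assms(4) unfolding a_kernel_def' by blast
qed

text \<open>Source and target may be algebras over different rings, as base change requires.\<close>

lemma functor_C_hom:
  fixes C :: "('s, 'a) module" and D :: "('k, 'b) module"
  assumes h: "ring_hom_cring C D h" and u: "u \<in> functor_C r C"
  shows "map_BC h u \<in> functor_C r D"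
proof -
  interpret h: ring_hom_cring C D h by fact
  obtain \<phi> \<alpha> ms where uu: "u = (\<phi>, \<alpha>, ms)" by (metis prod_cases3)
  note D = u[unfolded uu functor_C_iff[OF h.R.is_cring]]
  have "h ` rels_C r C (\<phi>, \<alpha>, ms) \<subseteq> {\<zero>\<^bsub>D\<^esub>}" using D by auto
  then show ?thesis unfolding uu using D by (subst functor_C_map_iff[OF h]) auto
qed

section \<open>The three ideals of the components\<close>

context field
begin

definition phiC :: "nat \<Rightarrow> _" where "phiC r = fst (univ_C R r)"
definition alphaC :: "nat \<Rightarrow> _" where "alphaC r = fst (snd (univ_C R r))"
definition msC :: "nat \<Rightarrow> _" where "msC r = snd (snd (univ_C R r))"

lemma univ_C_split: "univ_C R r = (phiC r, alphaC r, msC r)"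
  by (simp add: phiC_def alphaC_def msC_def)

lemma univC: "(phiC r, alphaC r, msC r) \<in> functor_C r (coord_C R r)"
  using univ_C_in_functor[of r] by (simp add: univ_C_split)

lemma univC_closed:
  "phiC r \<in> mat2_carrier (coord_C R r)" "alphaC r \<in> carrier (coord_C R r)"
  "set (msC r) \<subseteq> mat2_carrier (coord_C R r)" "length (msC r) = r + 1"
  "i < r + 1 \<Longrightarrow> msC r ! i \<in> mat2_carrier (coord_C R r)"
  using univC[of r] by (auto simp: functor_C_def strongly_nilpotent_def)

definition J_eps :: "nat \<Rightarrow> bool \<Rightarrow> _"
  where "J_eps r b = Idl\<^bsub>coord_C R r\<^esub> {alphaC r \<ominus>\<^bsub>coord_C R r\<^esub> eps (coord_C R r) b}"

definition J_nil :: "nat \<Rightarrow> _"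
  where "J_nil r = Idl\<^bsub>coord_C R r\<^esub> (set_mat2 (msC r ! r))"

lemma J_gens_closed:
  "{alphaC r \<ominus>\<^bsub>coord_C R r\<^esub> eps (coord_C R r) b} \<subseteq> carrier (coord_C R r)"
  "set_mat2 (msC r ! r) \<subseteq> carrier (coord_C R r)"
proof -
  interpret C: algebra R "coord_C R r" by (rule coord_algebra)
  show "{alphaC r \<ominus>\<^bsub>coord_C R r\<^esub> eps (coord_C R r) b} \<subseteq> carrier (coord_C R r)"
    using univC_closed(2) by simp
  show "set_mat2 (msC r ! r) \<subseteq> carrier (coord_C R r)"
    using univC_closed(5)[of r r] by (simp add: mat2_carrier_def)
qed

lemma J_ideal: "ideal (J_eps r b) (coord_C R r)" "ideal (J_nil r) (coord_C R r)"
proof -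
  interpret C: algebra R "coord_C R r" by (rule coord_algebra)
  show "ideal (J_eps r b) (coord_C R r)" "ideal (J_nil r) (coord_C R r)"
    unfolding J_eps_def J_nil_def by (intro C.genideal_ideal J_gens_closed)+
qed

lemma J_gens_in:
  "alphaC r \<ominus>\<^bsub>coord_C R r\<^esub> eps (coord_C R r) b \<in> J_eps r b" "set_mat2 (msC r ! r) \<subseteq> J_nil r"
proof -
  interpret C: algebra R "coord_C R r" by (rule coord_algebra)
  show "alphaC r \<ominus>\<^bsub>coord_C R r\<^esub> eps (coord_C R r) b \<in> J_eps r b" "set_mat2 (msC r ! r) \<subseteq> J_nil r"
    using C.genideal_self[OF J_gens_closed(1)] C.genideal_self[OF J_gens_closed(2)]
    unfolding J_eps_def J_nil_def by blast+
qed

text \<open>\<open>f\<close> comes from \<open>functor_A_to_C\<close> applied to the universal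
  tuple, \<open>g\<close> from \<open>functor_C_to_A\<close> applied to the universal point modulo
  \<open>J_eps\<close>. Adding and subtracting the sign are inverse to each other, so g after f
  agrees with the projection on the universal point and hence everywhere. \<open>f\<close> is onto
  because the entries of the universal tuple generate.\<close>

lemma coord_C_mod_J_eps:
  obtains f where "f \<in> alg_hom R (coord_C R r) (coord_A R (r + 2))"
    "map_BC f (univ_C R r) = (shift_mat (coord_A R (r + 2)) (eps (coord_A R (r + 2)) b) (univ_A R (r + 2) ! (r + 1)),
        eps (coord_A R (r + 2)) b, take (r + 1) (univ_A R (r + 2)))"
    "J_eps r b = {x \<in> carrier (coord_C R r). f x = \<zero>\<^bsub>coord_A R (r + 2)\<^esub>}"
    "alg_isomorphic R (quot_alg (coord_C R r) (J_eps r b)) (coord_A R (r + 2))"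
proof -
  note [simp del] = add_2_eq_Suc'
  let ?C = "coord_C R r" and ?A = "coord_A R (r + 2)" and ?u = "univ_A R (r + 2)"
  let ?Q = "quot_alg ?C (J_eps r b)"
  interpret C: algebra R ?C by (rule coord_algebra)
  interpret A: algebra R ?A by (rule coord_algebra)
  interpret Q: algebra R ?Q by (rule quot_alg_algebra[OF coord_algebra(3) J_ideal(1)])
  have uA: "?u \<in> functor_A (r + 2) ?A" by (rule univ_A_in_functor)
  obtain f where f: "f \<in> alg_hom R ?C ?A"
    "map_BC f (univ_C R r) = (shift_mat ?A (eps ?A b) (?u ! (r + 1)), eps ?A b, take (r + 1) ?u)"
    using represents_hom_ex[OF represents_coord_C A.algebra_axioms
        functor_A_to_C[OF A.is_cring A.eps_closed A.eps_square uA]] by metis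
  interpret f: ring_hom_cring ?C ?A f by (rule alg_hom_ring_hom_cring[OF coord_algebra(3,1) f(1)])
  have fu: "map_mat2 f (phiC r) = shift_mat ?A (eps ?A b) (?u ! (r + 1))" "f (alphaC r) = eps ?A b"
    "map (map_mat2 f) (msC r) = take (r + 1) ?u"
    using f(2) by (simp_all add: univ_C_split map_BC_def)
  have fJ: "f x = \<zero>\<^bsub>?A\<^esub>" if "x \<in> J_eps r b" for x
    by (rule hom_genideal_zero[OF f.ring_hom_cring_axioms J_gens_closed(1) _ that[unfolded J_eps_def]])
      (simp add: f.hom_minus univC_closed fu f.hom_eps A.minus_eq_zero_iff)
  let ?p = "\<lambda>x\<in>carrier ?C. J_eps r b +>\<^bsub>?C\<^esub> x"
  have p: "?p \<in> alg_hom R ?C ?Q" by (rule quot_alg_proj[OF coord_algebra(3) J_ideal(1)])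
  interpret p: ring_hom_cring ?C ?Q ?p by (rule alg_hom_ring_hom_cring[OF C.algebra_axioms Q.algebra_axioms p])
  define \<phi> where "\<phi> = map_mat2 ?p (phiC r)"
  define ms where "ms = map (map_mat2 ?p) (msC r)"
  have "?p (alphaC r \<ominus>\<^bsub>?C\<^esub> eps ?C b) = \<zero>\<^bsub>?Q\<^esub>"
    using J_gens_in(1)[of r b] J_gens_closed(1)[of r b] quot_alg_zero_iff[OF coord_algebra(3) J_ideal(1)]
    by simp
  then have "?p (alphaC r) \<ominus>\<^bsub>?Q\<^esub> eps ?Q b = \<zero>\<^bsub>?Q\<^esub>"
    using p.hom_minus[OF univC_closed(2) C.eps_closed] p.hom_eps by simp
  then have p\<alpha>: "?p (alphaC r) = eps ?Q b"
    using Q.minus_eq_zero_iff p.hom_closed[OF univC_closed(2)] by simp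
  have pu: "map_BC ?p (univ_C R r) = (\<phi>, eps ?Q b, ms)"
    unfolding univ_C_split map_BC_def \<phi>_def ms_def prod.case p\<alpha> ..
  have QC: "(\<phi>, eps ?Q b, ms) \<in> functor_C r ?Q"
    using functor_C_hom[OF p.ring_hom_cring_axioms univ_C_in_functor] pu by simp
  have len: "length ms = r + 1" and \<phi>c: "\<phi> \<in> mat2_carrier ?Q" using QC by (auto simp: functor_C_def)
  obtain g where g: "g \<in> alg_hom R ?A ?Q" "map_A g ?u = ms @ [shift_mat ?Q (\<ominus>\<^bsub>?Q\<^esub> eps ?Q b) \<phi>]"
    using represents_hom_ex[OF represents_coord_A Q.algebra_axioms
        functor_C_to_A[OF Q.is_cring Q.eps_closed Q.eps_square QC]] by metis
  interpret g: ring_hom_cring ?A ?Q g by (rule alg_hom_ring_hom_cring[OF A.algebra_axioms Q.algebra_axioms g(1)])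
  have ulen: "length ?u = r + 2" using uA by (simp add: functor_A_def)
  have uc: "?u ! i \<in> mat2_carrier ?A" if "i < r + 2" for i
    using uA that ulen by (auto simp: functor_A_def strongly_nilpotent_def)
  have "map_BC (compose (carrier ?C) g f) (univ_C R r) = map_BC g (map_BC f (univ_C R r))"
    unfolding univ_C_split by (rule map_BC_compose[OF univC_closed(1-3)])
  also have "\<dots> = (shift_mat ?Q (eps ?Q b) (map_mat2 g (?u ! (r + 1))), eps ?Q b, take (r + 1) (map_A g ?u))"
    unfolding f(2) using uc[of "r + 1"]
    by (simp add: map_BC_def g.map_shift_mat g.hom_eps map_A_def take_map)
  also have "map_mat2 g (?u ! (r + 1)) = map_A g ?u ! (r + 1)" using ulen by (simp add: map_A_def)
  also have "map_A g ?u ! (r + 1) = shift_mat ?Q (\<ominus>\<^bsub>?Q\<^esub> eps ?Q b) \<phi>"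
    unfolding g(2) using len by (simp add: nth_append)
  also have "take (r + 1) (map_A g ?u) = ms" unfolding g(2) using len by simp
  also have "shift_mat ?Q (eps ?Q b) (shift_mat ?Q (\<ominus>\<^bsub>?Q\<^esub> eps ?Q b) \<phi>) = \<phi>"
    by (rule Q.shift_shift[OF \<phi>c Q.eps_closed])
  finally have "map_BC (compose (carrier ?C) g f) (univ_C R r) = map_BC ?p (univ_C R r)" unfolding pu .
  then have comp: "compose (carrier ?C) g f = ?p"
    by (rule represents_hom_eq[OF represents_coord_C Q.algebra_axioms
          alg_hom_compose[OF C.algebra_axioms f(1) g(1)] p])
  have gf: "g (f x) = J_eps r b +>\<^bsub>?C\<^esub> x" if "x \<in> carrier ?C" for x
    using fun_cong[OF comp, of x] that by (simp add: compose_def)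
  \<comment> \<open>The first r + 1 matrices are images of the m_i, and the last is the image of
    \<phi> minus the sign.\<close>
  have img: "\<exists>m0\<in>mat2_carrier ?C. m = map_mat2 f m0" if m: "m \<in> set ?u" for m
  proof -
    obtain i where i: "i < r + 2" "m = ?u ! i" using m ulen by (auto simp: in_set_conv_nth)
    show ?thesis
    proof (cases "i < r + 1")
      case True
      then have "m = map_mat2 f (msC r ! i)"
        using arg_cong[OF fu(3), of "\<lambda>l. l ! i"] i univC_closed(4)[of r] by simp
      then show ?thesis using univC_closed(5)[OF True] by blast
    next
      case False
      then have "i = r + 1" using i by simp
      have "map_mat2 f (shift_mat ?C (\<ominus>\<^bsub>?C\<^esub> eps ?C b) (phiC r)) =
          shift_mat ?A (\<ominus>\<^bsub>?A\<^esub> eps ?A b) (shift_mat ?A (eps ?A b) m)"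
        using fu(1) i \<open>i = r + 1\<close> by (simp add: f.map_shift_mat univC_closed f.hom_eps)
      also have "\<dots> = m"
        using uc[OF i(1)] i(2) by (simp add: shift_mat_def mat2_carrier_iff mat2_eq_iff A.M.a_assoc A.M.r_neg)
      finally have "m = map_mat2 f (shift_mat ?C (\<ominus>\<^bsub>?C\<^esub> eps ?C b) (phiC r))" ..
      moreover have "shift_mat ?C (\<ominus>\<^bsub>?C\<^esub> eps ?C b) (phiC r) \<in> mat2_carrier ?C"
        by (intro C.shift_mat_closed univC_closed C.a_inv_closed C.eps_closed)
      ultimately show ?thesis by (rule bexI)
    qed
  qed
  have fS: "f ` carrier ?C \<subseteq> carrier ?A" using f.hom_closed by blast
  have "carrier ?A \<subseteq> lspan R ?A (f ` carrier ?C)"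
  proof (rule coord_A_lspan[OF fS])
    have "f \<one>\<^bsub>?C\<^esub> \<in> lspan R ?A (f ` carrier ?C)" by (rule A.lspan_base[OF fS imageI]) simp
    then show "\<one>\<^bsub>?A\<^esub> \<in> lspan R ?A (f ` carrier ?C)" by simp
    fix m a s assume *: "m \<in> set ?u" "a \<in> set_mat2 m" "s \<in> f ` carrier ?C"
    obtain m0 where m0: "m0 \<in> mat2_carrier ?C" "m = map_mat2 f m0" using img[OF *(1)] by blast
    obtain a0 where a0: "a0 \<in> carrier ?C" "a = f a0"
      using *(2) m0 by (auto simp: mat2.set_map mat2_carrier_def)
    obtain s0 where s0: "s0 \<in> carrier ?C" "s = f s0" using *(3) by blast
    have "f (a0 \<otimes>\<^bsub>?C\<^esub> s0) \<in> lspan R ?A (f ` carrier ?C)"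
      by (rule A.lspan_base[OF fS imageI]) (simp add: a0 s0)
    then show "a \<otimes>\<^bsub>?A\<^esub> s \<in> lspan R ?A (f ` carrier ?C)" using a0 s0 by simp
  qed
  then have surj: "carrier ?A \<subseteq> f ` carrier ?C"
    using hom_image_lspan[OF C.algebra_axioms A.algebra_axioms f(1)] by blast
  show thesis
    using quot_iso[OF C.algebra_axioms J_ideal(1) A.algebra_axioms f(1) fJ g(1) gf surj]
    by (intro that[OF f]) blast+
qed

text \<open>The scheme is that of \<open>coord_C_mod_J_eps\<close>, with appending and dropping a
  zero matrix as the inverse constructions.\<close>

lemma coord_C_mod_J_nil:
  obtains f where "f \<in> alg_hom R (coord_C R r) (coord_B R r)"
    "map_BC f (univ_C R r) = (fst (univ_B R r), fst (snd (univ_B R r)), snd (snd (univ_B R r)) @ [mat2_zero (coord_B R r)])"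
    "J_nil r = {x \<in> carrier (coord_C R r). f x = \<zero>\<^bsub>coord_B R r\<^esub>}"
    "alg_isomorphic R (quot_alg (coord_C R r) (J_nil r)) (coord_B R r)"
proof -
  let ?C = "coord_C R r" and ?B = "coord_B R r"
  let ?Q = "quot_alg ?C (J_nil r)"
  interpret C: algebra R ?C by (rule coord_algebra)
  interpret B: algebra R ?B by (rule coord_algebra)
  interpret Q: algebra R ?Q by (rule quot_alg_algebra[OF coord_algebra(3) J_ideal(2)])
  obtain \<phi>b \<alpha>b mb where u: "univ_B R r = (\<phi>b, \<alpha>b, mb)" by (metis prod_cases3)
  have uB: "(\<phi>b, \<alpha>b, mb) \<in> functor_B r ?B" using univ_B_in_functor[of r] u by simp
  have lb: "length mb = r" and uc: "\<phi>b \<in> mat2_carrier ?B" "\<alpha>b \<in> carrier ?B" "set mb \<subseteq> mat2_carrier ?B"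
    using uB by (auto simp: functor_B_def strongly_nilpotent_def)
  obtain f where f: "f \<in> alg_hom R ?C ?B" "map_BC f (univ_C R r) = (\<phi>b, \<alpha>b, mb @ [mat2_zero ?B])"
    using represents_hom_ex[OF represents_coord_C B.algebra_axioms functor_B_to_C[OF B.is_cring uB]] by metis
  interpret f: ring_hom_cring ?C ?B f by (rule alg_hom_ring_hom_cring[OF coord_algebra(3,2) f(1)])
  have fu: "map_mat2 f (phiC r) = \<phi>b" "f (alphaC r) = \<alpha>b" "map (map_mat2 f) (msC r) = mb @ [mat2_zero ?B]"
    using f(2) by (simp_all add: univ_C_split map_BC_def)
  have fr: "map_mat2 f (msC r ! r) = mat2_zero ?B"
    using arg_cong[OF fu(3), of "\<lambda>l. l ! r"] lb univC_closed(4)[of r] by (simp add: nth_append)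
  have fJ: "f x = \<zero>\<^bsub>?B\<^esub>" if "x \<in> J_nil r" for x
    by (rule hom_genideal_zero[OF f.ring_hom_cring_axioms J_gens_closed(2) _ that[unfolded J_nil_def]])
      (use fr in \<open>auto simp: mat2_eq_iff set_mat2_eq mat2_zero_def\<close>)
  let ?p = "\<lambda>x\<in>carrier ?C. J_nil r +>\<^bsub>?C\<^esub> x"
  have p: "?p \<in> alg_hom R ?C ?Q" by (rule quot_alg_proj[OF coord_algebra(3) J_ideal(2)])
  interpret p: ring_hom_cring ?C ?Q ?p by (rule alg_hom_ring_hom_cring[OF C.algebra_axioms Q.algebra_axioms p])
  define \<phi> where "\<phi> = map_mat2 ?p (phiC r)"
  define \<alpha> where "\<alpha> = ?p (alphaC r)"
  define ms where "ms = map (map_mat2 ?p) (msC r)"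
  have pu: "map_BC ?p (univ_C R r) = (\<phi>, \<alpha>, ms)"
    unfolding univ_C_split map_BC_def \<phi>_def ms_def \<alpha>_def prod.case ..
  have QC: "(\<phi>, \<alpha>, ms) \<in> functor_C r ?Q"
    using functor_C_hom[OF p.ring_hom_cring_axioms univ_C_in_functor] pu by simp
  have len: "length ms = r + 1" using QC by (auto simp: functor_C_def)
  have pz: "?p x = \<zero>\<^bsub>?Q\<^esub>" if "x \<in> set_mat2 (msC r ! r)" for x
  proof -
    have "x \<in> J_nil r" "x \<in> carrier ?C" using J_gens_in(2)[of r] J_gens_closed(2)[of r] that by blast+
    then show ?thesis using quot_alg_zero_iff[OF coord_algebra(3) J_ideal(2)] by simp
  qed
  have "ms ! r = map_mat2 ?p (msC r ! r)" using univC_closed(4)[of r] by (simp add: ms_def)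
  also have "\<dots> = mat2_zero ?Q"
    unfolding mat2_eq_iff map_mat2_sel using pz by (simp add: set_mat2_eq mat2_zero_def del: restrict_apply)
  finally have ms: "ms = take r ms @ [mat2_zero ?Q]"
    using len by (metis Suc_eq_plus1 lessI order_refl take_Suc_conv_app_nth take_all)
  obtain g where g: "g \<in> alg_hom R ?B ?Q" "map_BC g (\<phi>b, \<alpha>b, mb) = (\<phi>, \<alpha>, take r ms)"
    using represents_hom_ex[OF represents_coord_B Q.algebra_axioms functor_C_to_B[OF QC]] u by metis
  interpret g: ring_hom_cring ?B ?Q g by (rule alg_hom_ring_hom_cring[OF B.algebra_axioms Q.algebra_axioms g(1)])
  have "map_BC (compose (carrier ?C) g f) (univ_C R r) = map_BC g (map_BC f (univ_C R r))"
    unfolding univ_C_split by (rule map_BC_compose[OF univC_closed(1-3)])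
  also have "\<dots> = (\<phi>, \<alpha>, take r ms @ [mat2_zero ?Q])"
    unfolding f(2) using g(2) by (simp add: map_BC_def mat2_zero_def)
  also have "\<dots> = (\<phi>, \<alpha>, ms)" using ms by simp
  finally have "map_BC (compose (carrier ?C) g f) (univ_C R r) = map_BC ?p (univ_C R r)" unfolding pu .
  then have comp: "compose (carrier ?C) g f = ?p"
    by (rule represents_hom_eq[OF represents_coord_C Q.algebra_axioms
          alg_hom_compose[OF C.algebra_axioms f(1) g(1)] p])
  have gf: "g (f x) = J_nil r +>\<^bsub>?C\<^esub> x" if "x \<in> carrier ?C" for x
    using fun_cong[OF comp, of x] that by (simp add: compose_def)
  have img: "\<exists>m0\<in>mat2_carrier ?C. m = map_mat2 f m0" if m: "m \<in> insert \<phi>b (set mb)" for m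
  proof (cases "m = \<phi>b")
    case True
    then show ?thesis using fu(1) univC_closed(1) by blast
  next
    case False
    then obtain i where i: "i < r" "m = mb ! i" using m lb by (auto simp: in_set_conv_nth)
    then have "m = map_mat2 f (msC r ! i)"
      using arg_cong[OF fu(3), of "\<lambda>l. l ! i"] lb univC_closed(4)[of r] by (simp add: nth_append)
    then show ?thesis using univC_closed(5)[of i r] i by auto
  qed
  have fS: "f ` carrier ?C \<subseteq> carrier ?B" using f.hom_closed by blast
  have mul: "f a0 \<otimes>\<^bsub>?B\<^esub> s \<in> lspan R ?B (f ` carrier ?C)" if a0: "a0 \<in> carrier ?C" and s: "s \<in> f ` carrier ?C" for a0 s
  proof -
    obtain s0 where s0: "s0 \<in> carrier ?C" "s = f s0" using s by blast
    have "f (a0 \<otimes>\<^bsub>?C\<^esub> s0) \<in> lspan R ?B (f ` carrier ?C)"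
      by (rule B.lspan_base[OF fS imageI]) (simp add: a0 s0)
    then show ?thesis using a0 s0 by simp
  qed
  have "carrier ?B \<subseteq> lspan R ?B (f ` carrier ?C)"
  proof (rule coord_B_lspan[OF fS _ u])
    have "f \<one>\<^bsub>?C\<^esub> \<in> lspan R ?B (f ` carrier ?C)" by (rule B.lspan_base[OF fS imageI]) simp
    then show "\<one>\<^bsub>?B\<^esub> \<in> lspan R ?B (f ` carrier ?C)" by simp
    show "\<alpha>b \<otimes>\<^bsub>?B\<^esub> s \<in> lspan R ?B (f ` carrier ?C)" if "s \<in> f ` carrier ?C" for s
      using mul[OF univC_closed(2) that] fu(2) by simp
    fix m a s assume *: "m \<in> insert \<phi>b (set mb)" "a \<in> set_mat2 m" "s \<in> f ` carrier ?C"
    obtain m0 where m0: "m0 \<in> mat2_carrier ?C" "m = map_mat2 f m0" using img[OF *(1)] by blast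
    obtain a0 where a0: "a0 \<in> carrier ?C" "a = f a0"
      using *(2) m0 by (auto simp: mat2.set_map mat2_carrier_def)
    then show "a \<otimes>\<^bsub>?B\<^esub> s \<in> lspan R ?B (f ` carrier ?C)" using mul *(3) by simp
  qed
  then have surj: "carrier ?B \<subseteq> f ` carrier ?C"
    using hom_image_lspan[OF C.algebra_axioms B.algebra_axioms f(1)] by blast
  show thesis
    using quot_iso[OF C.algebra_axioms J_ideal(2) B.algebra_axioms f(1) fJ g(1) gf surj] f u
    by (intro that[OF f(1)]) auto
qed

text \<open>The quotient map is composed with the injective chart of A_{r+2}. Variable 0 is y,
  variable i + 1 the scale of \<open>msC r ! i\<close>, and variable r + 2 the scale of \<phi> minus
  the sign. These values later separate the ideals and build chains of primes.\<close>

lemma J_eps_kernel: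
  obtains G where "G \<in> alg_hom R (coord_C R r) (mpoly R {..r + 2})"
    "J_eps r b = {x \<in> carrier (coord_C R r). G x = \<zero>\<^bsub>mpoly R {..r + 2}\<^esub>}"
    "G (alphaC r) = eps (mpoly R {..r + 2}) b"
    "G (m12 (phiC r)) = indexed_var (r + 2)"
    "\<And>i. i < r + 1 \<Longrightarrow> map_mat2 G (msC r ! i) = chart (mpoly R {..r + 2}) (indexed_var 0) (indexed_var (Suc i))"
proof -
  note [simp del] = add_2_eq_Suc'
  let ?C = "coord_C R r" and ?A = "coord_A R (r + 2)" and ?u = "univ_A R (r + 2)" and ?P = "mpoly R {..r + 2}"
  interpret C: algebra R ?C by (rule coord_algebra)
  interpret A: algebra R ?A by (rule coord_algebra)
  interpret P: algebra R ?P by (rule mpoly_algebra)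
  obtain f where f: "f \<in> alg_hom R ?C ?A"
    "map_BC f (univ_C R r) = (shift_mat ?A (eps ?A b) (?u ! (r + 1)), eps ?A b, take (r + 1) ?u)"
    "J_eps r b = {x \<in> carrier ?C. f x = \<zero>\<^bsub>?A\<^esub>}"
    by (rule coord_C_mod_J_eps)
  obtain h where h: "h \<in> alg_hom R ?A ?P" "map_A h ?u = chart_A (r + 2)"
    using represents_hom_ex[OF represents_coord_A mpoly_algebra chart_A_in_functor] by metis
  interpret f: ring_hom_cring ?C ?A f by (rule alg_hom_ring_hom_cring[OF coord_algebra(3,1) f(1)])
  interpret h: ring_hom_cring ?A ?P h by (rule alg_hom_ring_hom_cring[OF coord_algebra(1) mpoly_algebra h(1)])
  let ?G = "compose (carrier ?C) h f"
  have fu: "map_mat2 f (phiC r) = shift_mat ?A (eps ?A b) (?u ! (r + 1))" "f (alphaC r) = eps ?A b"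
    "map (map_mat2 f) (msC r) = take (r + 1) ?u"
    using f(2) by (simp_all add: univ_C_split map_BC_def)
  have ulen: "length ?u = r + 2" using univ_A_in_functor[of "r + 2"] by (simp add: functor_A_def)
  have hu: "map_mat2 h (?u ! i) = chart ?P (indexed_var 0) (indexed_var (Suc i))" if "i < r + 2" for i
    using arg_cong[OF h(2), of "\<lambda>l. l ! i"] that ulen by (simp add: map_A_def chart_A_def del: upt_Suc)
  show thesis
  proof (rule that[of ?G])
    show "?G \<in> alg_hom R ?C ?P" by (rule alg_hom_compose[OF C.algebra_axioms f(1) h(1)])
    show "J_eps r b = {x \<in> carrier ?C. ?G x = \<zero>\<^bsub>?P\<^esub>}"
    proof -
      have "f x = \<zero>\<^bsub>?A\<^esub> \<longleftrightarrow> ?G x = \<zero>\<^bsub>?P\<^esub>" if x: "x \<in> carrier ?C" for x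
        using coord_A_chart_injective[OF h f.hom_closed[OF x]] h.hom_zero x by (metis compose_eq)
      then show ?thesis unfolding f(3) by blast
    qed
    show "?G (alphaC r) = eps ?P b" using univC_closed(2) by (simp add: compose_def fu h.hom_eps)
    have "m12 (phiC r) \<in> carrier ?C" using univC_closed(1)[of r] by (simp add: mat2_carrier_iff)
    then have "?G (m12 (phiC r)) = m12 (map_mat2 h (map_mat2 f (phiC r)))" by (simp add: compose_def)
    also have "\<dots> = m12 (map_mat2 h (?u ! (r + 1)))" unfolding fu(1) by (simp add: shift_mat_def)
    also have "\<dots> = indexed_var (r + 2)" using hu[of "r + 1"] by (simp add: chart_def add_2_eq_Suc')
    finally show "?G (m12 (phiC r)) = indexed_var (r + 2)" .
    fix i assume i: "i < r + 1"
    have "map_mat2 ?G (msC r ! i) = map_mat2 h (map_mat2 f (msC r ! i))"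
      using univC_closed(5)[OF i] by (simp add: mat2_eq_iff mat2_carrier_iff compose_def)
    also have "map_mat2 f (msC r ! i) = ?u ! i"
      using arg_cong[OF fu(3), of "\<lambda>l. l ! i"] i univC_closed(4)[of r] by simp
    also have "map_mat2 h (?u ! i) = chart ?P (indexed_var 0) (indexed_var (Suc i))" using i by (intro hu) simp
    finally show "map_mat2 ?G (msC r ! i) = chart ?P (indexed_var 0) (indexed_var (Suc i))" .
  qed
qed

lemma J_nil_kernel:
  obtains G where "G \<in> alg_hom R (coord_C R r) (laurent r)"
    "J_nil r = {x \<in> carrier (coord_C R r). G x = \<zero>\<^bsub>laurent r\<^esub>}" "G (alphaC r) = lvar 2"
proof -
  let ?C = "coord_C R r" and ?B = "coord_B R r" and ?L = "laurent r"
  interpret C: algebra R ?C by (rule coord_algebra)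
  obtain f where f: "f \<in> alg_hom R ?C ?B"
    "map_BC f (univ_C R r) = (fst (univ_B R r), fst (snd (univ_B R r)), snd (snd (univ_B R r)) @ [mat2_zero ?B])"
    "J_nil r = {x \<in> carrier ?C. f x = \<zero>\<^bsub>?B\<^esub>}"
    by (rule coord_C_mod_J_nil)
  obtain h where h: "h \<in> alg_hom R ?B ?L" "map_BC h (univ_B R r) = chart_B r"
    using represents_hom_ex[OF represents_coord_B laurent_algebra chart_B_in_functor] by metis
  interpret f: ring_hom_cring ?C ?B f by (rule alg_hom_ring_hom_cring[OF coord_algebra(3,2) f(1)])
  interpret h: ring_hom_cring ?B ?L h by (rule alg_hom_ring_hom_cring[OF coord_algebra(2) laurent_algebra h(1)])
  let ?G = "compose (carrier ?C) h f"
  show thesis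
  proof (rule that[of ?G])
    show "?G \<in> alg_hom R ?C ?L" by (rule alg_hom_compose[OF C.algebra_axioms f(1) h(1)])
    show "J_nil r = {x \<in> carrier ?C. ?G x = \<zero>\<^bsub>?L\<^esub>}"
    proof -
      have "f x = \<zero>\<^bsub>?B\<^esub> \<longleftrightarrow> ?G x = \<zero>\<^bsub>?L\<^esub>" if x: "x \<in> carrier ?C" for x
        using coord_B_chart_injective[OF h f.hom_closed[OF x]] h.hom_zero x by (metis compose_eq)
      then show ?thesis unfolding f(3) by blast
    qed
    have "f (alphaC r) = fst (snd (univ_B R r))" using f(2) by (simp add: univ_C_split map_BC_def)
    moreover have "h (fst (snd (univ_B R r))) = lvar 2"
      using h(2) by (cases "univ_B R r") (simp add: map_BC_def chart_B_def)
    ultimately show "?G (alphaC r) = lvar 2" using univC_closed(2) by (simp add: compose_def)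
  qed
qed

lemma J_prime: "primeideal (J_eps r b) (coord_C R r)" "primeideal (J_nil r) (coord_C R r)"
proof -
  obtain G where G: "G \<in> alg_hom R (coord_C R r) (mpoly R {..r + 2})"
    "J_eps r b = {x \<in> carrier (coord_C R r). G x = \<zero>\<^bsub>mpoly R {..r + 2}\<^esub>}" by (rule J_eps_kernel)
  show "primeideal (J_eps r b) (coord_C R r)"
    unfolding G(2) by (rule kernel_prime[OF alg_hom_ring_hom_cring[OF coord_algebra(3) mpoly_algebra G(1)] mpoly_domain])
  obtain H where H: "H \<in> alg_hom R (coord_C R r) (laurent r)"
    "J_nil r = {x \<in> carrier (coord_C R r). H x = \<zero>\<^bsub>laurent r\<^esub>}" by (rule J_nil_kernel)
  show "primeideal (J_nil r) (coord_C R r)"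
    unfolding H(2) by (rule kernel_prime[OF alg_hom_ring_hom_cring[OF coord_algebra(3) laurent_algebra H(1)] laurent_domain])
qed

lemma lvar_square_ne_one: "lvar 2 \<otimes>\<^bsub>laurent r\<^esub> lvar 2 \<noteq> \<one>\<^bsub>laurent r\<^esub>"
proof
  assume "lvar 2 \<otimes>\<^bsub>laurent r\<^esub> lvar 2 = \<one>\<^bsub>laurent r\<^esub>"
  then have eq: "mterm R (lexp 2 2) \<one> = mterm R (0 :: nat \<Rightarrow>\<^sub>0 int) \<one>"
    by (simp add: lvar_def mconv_mterm_mterm flip: single_add)
  have "lexp 2 2 \<noteq> (0 :: nat \<Rightarrow>\<^sub>0 int)"
  proof
    assume "lexp 2 2 = (0 :: nat \<Rightarrow>\<^sub>0 int)"
    then have "Poly_Mapping.lookup (lexp 2 2) 2 = (0 :: int)" by simp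
    then show False by simp
  qed
  then show False using fun_cong[OF eq, of 0] by (simp add: mterm_def)
qed

text \<open>The separating functions: the two signs differ because 2 is not 0; \<alpha> is a free
  variable on the locus m_{r+1} = 0, so its square is not 1; and an entry of m_{r+1} is a free
  variable where \<alpha> is a sign.\<close>

lemma J_incomparable:
  assumes two: "\<one> \<oplus> \<one> \<noteq> \<zero>"
  shows "b \<noteq> b' \<Longrightarrow> \<not> J_eps r b \<subseteq> J_eps r b'" "\<not> J_eps r b \<subseteq> J_nil r" "\<not> J_nil r \<subseteq> J_eps r b"
proof -
  note [simp del] = add_2_eq_Suc'
  let ?C = "coord_C R r" and ?P = "mpoly R {..r + 2}"
  interpret C: algebra R ?C by (rule coord_algebra)
  interpret P: domain ?P by (rule mpoly_domain)
  interpret L: algebra R "laurent r" by (rule laurent_algebra)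
  show "\<not> J_eps r b \<subseteq> J_eps r b'" if "b \<noteq> b'"
  proof
    assume "J_eps r b \<subseteq> J_eps r b'"
    obtain G where G: "G \<in> alg_hom R ?C ?P" "J_eps r b' = {x \<in> carrier ?C. G x = \<zero>\<^bsub>?P\<^esub>}"
      "G (alphaC r) = eps ?P b'" by (rule J_eps_kernel)
    interpret G: ring_hom_cring ?C ?P G by (rule alg_hom_ring_hom_cring[OF coord_algebra(3) mpoly_algebra G(1)])
    have "G (alphaC r \<ominus>\<^bsub>?C\<^esub> eps ?C b) = \<zero>\<^bsub>?P\<^esub>" using \<open>J_eps r b \<subseteq> _\<close> J_gens_in(1)[of r b] G(2) by blast
    then have "eps ?P b' = eps ?P b"
      using G(3) univC_closed(2) by (simp add: G.hom_minus G.hom_eps P.minus_eq_zero_iff)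
    then have "\<one>\<^bsub>?P\<^esub> = \<ominus>\<^bsub>?P\<^esub> \<one>\<^bsub>?P\<^esub>" using that by (cases b; cases b') (simp_all add: eps_def)
    then have eq: "\<one>\<^bsub>?P\<^esub> \<oplus>\<^bsub>?P\<^esub> \<one>\<^bsub>?P\<^esub> = \<zero>\<^bsub>?P\<^esub>" by (metis P.one_closed P.r_neg)
    show False using two fun_cong[OF eq, of "{#}"] by (simp add: mpoly_sel mterm_def)
  qed
  show "\<not> J_eps r b \<subseteq> J_nil r"
  proof
    assume "J_eps r b \<subseteq> J_nil r"
    obtain G where G: "G \<in> alg_hom R ?C (laurent r)" "J_nil r = {x \<in> carrier ?C. G x = \<zero>\<^bsub>laurent r\<^esub>}"
      "G (alphaC r) = lvar 2" by (rule J_nil_kernel)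
    interpret G: ring_hom_cring ?C "laurent r" G by (rule alg_hom_ring_hom_cring[OF coord_algebra(3) laurent_algebra G(1)])
    have "G (alphaC r \<ominus>\<^bsub>?C\<^esub> eps ?C b) = \<zero>\<^bsub>laurent r\<^esub>" using \<open>J_eps r b \<subseteq> _\<close> J_gens_in(1)[of r b] G(2) by blast
    then have "lvar 2 = eps (laurent r) b"
      using G(3) univC_closed(2) lvar_closed[of 2 r]
      by (simp add: G.hom_minus G.hom_eps L.minus_eq_zero_iff del: monoid_alg_sel)
    then show False using lvar_square_ne_one[of r] L.eps_square[of b] by metis
  qed
  show "\<not> J_nil r \<subseteq> J_eps r b"
  proof
    assume "J_nil r \<subseteq> J_eps r b"
    obtain G where G: "J_eps r b = {x \<in> carrier ?C. G x = \<zero>\<^bsub>?P\<^esub>}"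
      "\<And>i. i < r + 1 \<Longrightarrow> map_mat2 G (msC r ! i) = chart ?P (indexed_var 0) (indexed_var (Suc i))"
      by (rule J_eps_kernel) blast
    have "m12 (msC r ! r) \<in> J_eps r b" using \<open>J_nil r \<subseteq> _\<close> J_gens_in(2)[of r] by (auto simp: set_mat2_eq)
    then have "G (m12 (msC r ! r)) = \<zero>\<^bsub>?P\<^esub>" using G(1) by blast
    moreover have "G (m12 (msC r ! r)) = indexed_var (Suc r)"
      using arg_cong[OF G(2)[of r], of m12] by (simp add: chart_def)
    ultimately have eq: "(indexed_var (Suc r) :: nat multiset \<Rightarrow> 'a) = (\<lambda>m. \<zero>)" by (simp add: mpoly_sel)
    show False using fun_cong[OF eq, of "{#Suc r#}"] by (simp add: indexed_var_mterm mterm_def)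
  qed
qed

lemma J_inter_zero:
  assumes two: "\<one> \<oplus> \<one> \<noteq> \<zero>"
    and x: "x \<in> J_eps r True" "x \<in> J_eps r False" "x \<in> J_nil r"
  shows "x = \<zero>\<^bsub>coord_C R r\<^esub>"
proof -
  let ?C = "coord_C R r"
  interpret C: algebra R ?C by (rule coord_algebra)
  let ?a = "alphaC r"
  have a: "?a \<in> carrier ?C" by (rule univC_closed)
  have princ: "\<exists>y\<in>carrier ?C. x = y \<otimes>\<^bsub>?C\<^esub> (?a \<ominus>\<^bsub>?C\<^esub> eps ?C b)" if "x \<in> J_eps r b" for b
    using that C.cgenideal_eq_genideal[of "?a \<ominus>\<^bsub>?C\<^esub> eps ?C b"] a by (auto simp: J_eps_def cgenideal_def)
  obtain y where y: "y \<in> carrier ?C" "x = y \<otimes>\<^bsub>?C\<^esub> (?a \<ominus>\<^bsub>?C\<^esub> \<one>\<^bsub>?C\<^esub>)" using princ[OF x(1)] by (auto simp: eps_def)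
  obtain z where z: "z \<in> carrier ?C" "x = z \<otimes>\<^bsub>?C\<^esub> (?a \<ominus>\<^bsub>?C\<^esub> \<ominus>\<^bsub>?C\<^esub> \<one>\<^bsub>?C\<^esub>)" using princ[OF x(2)] by (auto simp: eps_def)
  have xc: "x \<in> carrier ?C" using y a by simp
  let ?d = "?a \<otimes>\<^bsub>?C\<^esub> ?a \<ominus>\<^bsub>?C\<^esub> \<one>\<^bsub>?C\<^esub>"
  have dc: "?d \<in> carrier ?C" using a by simp
  have "x \<oplus>\<^bsub>?C\<^esub> x = x \<otimes>\<^bsub>?C\<^esub> (?a \<ominus>\<^bsub>?C\<^esub> \<ominus>\<^bsub>?C\<^esub> \<one>\<^bsub>?C\<^esub>) \<ominus>\<^bsub>?C\<^esub> x \<otimes>\<^bsub>?C\<^esub> (?a \<ominus>\<^bsub>?C\<^esub> \<one>\<^bsub>?C\<^esub>)"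
    by (rule C.double_identity[OF xc a])
  also have "x \<otimes>\<^bsub>?C\<^esub> (?a \<ominus>\<^bsub>?C\<^esub> \<ominus>\<^bsub>?C\<^esub> \<one>\<^bsub>?C\<^esub>) = y \<otimes>\<^bsub>?C\<^esub> ?d"
    unfolding y(2) by (rule C.factor_identity(1)[OF y(1) a])
  also have "x \<otimes>\<^bsub>?C\<^esub> (?a \<ominus>\<^bsub>?C\<^esub> \<one>\<^bsub>?C\<^esub>) = z \<otimes>\<^bsub>?C\<^esub> ?d"
    unfolding z(2) by (rule C.factor_identity(2)[OF z(1) a])
  also have "y \<otimes>\<^bsub>?C\<^esub> ?d \<ominus>\<^bsub>?C\<^esub> z \<otimes>\<^bsub>?C\<^esub> ?d = (y \<ominus>\<^bsub>?C\<^esub> z) \<otimes>\<^bsub>?C\<^esub> ?d"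
    using y z dc by (simp add: a_minus_def C.l_distr C.l_minus)
  finally have xx: "x \<oplus>\<^bsub>?C\<^esub> x = (y \<ominus>\<^bsub>?C\<^esub> z) \<otimes>\<^bsub>?C\<^esub> ?d" .
  define half where "half = inv (\<one> \<oplus> \<one>)"
  have h: "half \<in> carrier R" "half \<otimes> (\<one> \<oplus> \<one>) = \<one>"
    using two by (auto simp: half_def field_Units)
  define w where "w = half \<odot>\<^bsub>?C\<^esub> (y \<ominus>\<^bsub>?C\<^esub> z)"
  have w: "w \<in> carrier ?C" using h y z by (simp add: w_def)
  have "x = (half \<otimes> (\<one> \<oplus> \<one>)) \<odot>\<^bsub>?C\<^esub> x" using xc h by simp
  also have "\<dots> = half \<odot>\<^bsub>?C\<^esub> (x \<oplus>\<^bsub>?C\<^esub> x)" using xc h(1) by (simp only: C.smult_assoc1 one_closed a_closed C.smult_l_distr C.smult_one)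
  also have "\<dots> = w \<otimes>\<^bsub>?C\<^esub> ?d" unfolding xx w_def using h(1) y(1) z(1) dc by (simp add: C.smult_assoc2)
  finally have xw: "x = w \<otimes>\<^bsub>?C\<^esub> ?d" .
  obtain G where G: "G \<in> alg_hom R ?C (laurent r)" "J_nil r = {x \<in> carrier ?C. G x = \<zero>\<^bsub>laurent r\<^esub>}"
    "G ?a = lvar 2" by (rule J_nil_kernel)
  interpret L: domain "laurent r" by (rule laurent_domain)
  interpret G: ring_hom_cring ?C "laurent r" G by (rule alg_hom_ring_hom_cring[OF coord_algebra(3) laurent_algebra G(1)])
  have "G ?d \<noteq> \<zero>\<^bsub>laurent r\<^esub>"
    using lvar_square_ne_one[of r] a G(3) lvar_closed[of 2 r]
    by (simp add: G.hom_minus L.minus_eq_zero_iff del: monoid_alg_sel)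
  moreover have "G w \<otimes>\<^bsub>laurent r\<^esub> G ?d = \<zero>\<^bsub>laurent r\<^esub>"
    using x(3) G(2) arg_cong[OF xw, of G] G.hom_mult[OF w dc] by simp
  ultimately have "G w = \<zero>\<^bsub>laurent r\<^esub>" using L.integral G.hom_closed[OF w] G.hom_closed[OF dc] by blast
  then have wJ: "w \<in> J_nil r" using G(2) w by blast
  \<comment> \<open>The annihilator of \<alpha>^2 - 1. It contains the entries of m_{r+1} by
    \<open>alpha_square_annihilates\<close>, hence all of \<open>J_nil\<close>, and in particular
    \<open>w\<close>.\<close>
  let ?K = "{v \<in> carrier ?C. ?d \<otimes>\<^bsub>?C\<^esub> v = \<zero>\<^bsub>?C\<^esub>}"
  have "ideal ?K ?C"
  proof (rule idealI[OF C.ring_axioms])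
    show "subgroup ?K (add_monoid ?C)"
    proof (rule C.M.add.subgroupI)
      show "?K \<subseteq> carrier ?C" "?K \<noteq> {}" using dc C.M.zero_closed by auto
    qed (use dc in \<open>auto simp: C.r_minus C.r_distr\<close>)
  next
    fix v u assume vu: "v \<in> ?K" "u \<in> carrier ?C"
    then have v: "v \<in> carrier ?C" "?d \<otimes>\<^bsub>?C\<^esub> v = \<zero>\<^bsub>?C\<^esub>" by blast+
    show "u \<otimes>\<^bsub>?C\<^esub> v \<in> ?K" using v vu(2) C.m_lcomm[OF dc vu(2) v(1)] by simp
    then show "v \<otimes>\<^bsub>?C\<^esub> u \<in> ?K" using C.m_comm[OF v(1) vu(2)] by simp
  qed
  moreover have "set_mat2 (msC r ! r) \<subseteq> ?K"
  proof
    fix v assume v: "v \<in> set_mat2 (msC r ! r)"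
    have m: "msC r ! r \<in> set (msC r)" using univC_closed(4)[of r] by simp
    have "?d \<otimes>\<^bsub>?C\<^esub> v = \<zero>\<^bsub>?C\<^esub>"
      using univC[of r] m
      by (intro C.alpha_square_annihilates[OF univC_closed(1,2) _ _ _ _ v]) (auto simp: functor_C_def)
    then show "v \<in> ?K" using v J_gens_closed(2)[of r] by blast
  qed
  ultimately have "J_nil r \<subseteq> ?K" unfolding J_nil_def by (rule C.genideal_minimal)
  then show ?thesis using wJ xw w dc by (auto simp: C.m_comm)
qed

end

section \<open>Dimension of the components\<close>

context cring
begin

lemma kill_ex:
  "\<exists>s. s \<in> alg_hom R (mpoly R I) (mpoly R I) \<and>
    (\<forall>v\<in>I. s (indexed_var v) = (if v \<in> K then \<zero>\<^bsub>mpoly R I\<^esub> else indexed_var v))"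
proof -
  interpret P: algebra R "mpoly R I" by (rule mpoly_algebra)
  let ?a = "\<lambda>v. if v \<in> K then \<zero>\<^bsub>mpoly R I\<^esub> else indexed_var v"
  have a: "?a v \<in> carrier (mpoly R I)" if "v \<in> I" for v
    using mpoly_var_closed[OF that] P.M.zero_closed by (simp del: mpoly_sel)
  show ?thesis
  proof (rule mpoly_hom_ex[OF mpoly_algebra, where I = I and a = ?a])
    show "?a v \<in> carrier (mpoly R I)" if "v \<in> I" for v by (rule a[OF that])
    fix s assume "s \<in> alg_hom R (mpoly R I) (mpoly R I)" "\<And>v. v \<in> I \<Longrightarrow> s (indexed_var v) = ?a v"
    then show ?thesis by (intro exI[of _ s] conjI ballI)
  qed
qed

definition kill :: "'v set \<Rightarrow> 'v set \<Rightarrow> ('v multiset \<Rightarrow> 'a) \<Rightarrow> ('v multiset \<Rightarrow> 'a)"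
  where "kill I K = (SOME s. s \<in> alg_hom R (mpoly R I) (mpoly R I) \<and>
    (\<forall>v\<in>I. s (indexed_var v) = (if v \<in> K then \<zero>\<^bsub>mpoly R I\<^esub> else indexed_var v)))"

lemma kill_hom: "kill I K \<in> alg_hom R (mpoly R I) (mpoly R I)"
  and kill_var: "v \<in> I \<Longrightarrow> kill I K (indexed_var v) = (if v \<in> K then \<zero>\<^bsub>mpoly R I\<^esub> else indexed_var v)"
  using someI_ex[OF kill_ex[of I K]] unfolding kill_def by blast+

lemma kill_cring: "ring_hom_cring (mpoly R I) (mpoly R I) (kill I K)"
  by (rule alg_hom_ring_hom_cring[OF mpoly_algebra mpoly_algebra kill_hom])

text \<open>Setting more variables to zero afterwards absorbs setting fewer; this is why the kernels
  grow with \<open>K\<close>.\<close>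

lemma kill_kill:
  assumes "K \<subseteq> K'" "x \<in> carrier (mpoly R I)"
  shows "kill I K' (kill I K x) = kill I K' x"
proof -
  interpret k: ring_hom_cring "mpoly R I" "mpoly R I" "kill I K'" by (rule kill_cring)
  have eq: "compose (carrier (mpoly R I)) (kill I K') (kill I K) = kill I K'"
  proof (rule mpoly_hom_eqI[OF mpoly_algebra alg_hom_compose[OF mpoly_algebra kill_hom kill_hom] kill_hom])
    fix v assume v: "v \<in> I"
    show "compose (carrier (mpoly R I)) (kill I K') (kill I K) (indexed_var v) = kill I K' (indexed_var v)"
      using assms(1) v k.hom_zero
      by (auto simp: compose_eq mpoly_var_closed[OF v] kill_var[OF v] simp del: mpoly_sel)
  qed
  show ?thesis using fun_cong[OF eq, of x] assms(2) by (simp add: compose_eq)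
qed

lemma kill_empty:
  assumes "x \<in> carrier (mpoly R I)"
  shows "kill I {} x = x"
proof -
  have id: "(\<lambda>x\<in>carrier (mpoly R I). x) \<in> alg_hom R (mpoly R I) (mpoly R I)"
    by (rule alg_hom_restrict[OF mpoly_algebra]) (auto simp: ring_hom_def)
  have eq: "kill I {} = (\<lambda>x\<in>carrier (mpoly R I). x)"
    by (rule mpoly_hom_eqI[OF mpoly_algebra kill_hom id]) (simp add: kill_var mpoly_var_closed)
  show ?thesis using fun_cong[OF eq, of x] assms by simp
qed

end

section \<open>Irreducible components and chains of primes\<close>

context field
begin

lemma indexed_var_ne_zero: "indexed_var v \<noteq> \<zero>\<^bsub>mpoly R I\<^esub>"
proof
  assume eq: "indexed_var v = \<zero>\<^bsub>mpoly R I\<^esub>"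
  show False using fun_cong[OF eq, of "{#v#}"] by (simp add: indexed_var_mterm mterm_def mpoly_sel)
qed

text \<open>Otherwise each of the ideals has an element outside \<open>Q\<close>. The product of the
  three lies in all of them, so it is 0 and belongs to the prime \<open>Q\<close>.\<close>

lemma prime_contains_J:
  assumes two: "\<one> \<oplus> \<one> \<noteq> \<zero>" and Q: "primeideal Q (coord_C R r)"
  shows "J_eps r True \<subseteq> Q \<or> J_eps r False \<subseteq> Q \<or> J_nil r \<subseteq> Q"
proof (rule ccontr)
  let ?C = "coord_C R r"
  interpret C: algebra R ?C by (rule coord_algebra)
  interpret Q: primeideal Q ?C by (rule Q)
  interpret p: ideal "J_eps r True" ?C by (rule J_ideal)
  interpret m: ideal "J_eps r False" ?C by (rule J_ideal)
  interpret n: ideal "J_nil r" ?C by (rule J_ideal)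
  assume "\<not> ?thesis"
  then obtain x y z where xyz: "x \<in> J_eps r True" "x \<notin> Q" "y \<in> J_eps r False" "y \<notin> Q" "z \<in> J_nil r" "z \<notin> Q"
    by blast
  have c: "x \<in> carrier ?C" "y \<in> carrier ?C" "z \<in> carrier ?C"
    using xyz p.a_subset m.a_subset n.a_subset by blast+
  have "x \<otimes>\<^bsub>?C\<^esub> y \<otimes>\<^bsub>?C\<^esub> z = \<zero>\<^bsub>?C\<^esub>"
  proof (rule J_inter_zero[OF two])
    show "x \<otimes>\<^bsub>?C\<^esub> y \<otimes>\<^bsub>?C\<^esub> z \<in> J_eps r True" using xyz(1) c by (intro p.I_r_closed)
    show "x \<otimes>\<^bsub>?C\<^esub> y \<otimes>\<^bsub>?C\<^esub> z \<in> J_eps r False" using xyz(3) c by (intro m.I_r_closed m.I_l_closed)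
    show "x \<otimes>\<^bsub>?C\<^esub> y \<otimes>\<^bsub>?C\<^esub> z \<in> J_nil r" using xyz(5) c by (intro n.I_l_closed C.m_closed)
  qed
  then have "x \<otimes>\<^bsub>?C\<^esub> y \<otimes>\<^bsub>?C\<^esub> z \<in> Q" using Q.additive_subgroup_axioms additive_subgroup.zero_closed by metis
  then show False using xyz c C.prime_mult_iff[OF Q] by (metis C.m_closed)
qed

lemma coord_C_components:
  assumes two: "\<one> \<oplus> \<one> \<noteq> \<zero>"
  shows "irreducible_components (zariski (coord_C R r)) =
      zero_locus (coord_C R r) ` {J_eps r True, J_eps r False, J_nil r}"
    and "card (irreducible_components (zariski (coord_C R r))) = 3"
proof -
  let ?C = "coord_C R r" and ?Ps = "{J_eps r True, J_eps r False, J_nil r}"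
  interpret C: algebra R ?C by (rule coord_algebra)
  note inc = J_incomparable[OF two]
  have prime: "primeideal P ?C" if "P \<in> ?Ps" for P using that J_prime by blast
  show eq: "irreducible_components (zariski ?C) = zero_locus ?C ` ?Ps"
  proof (rule C.irreducible_components_zariski[OF prime])
    show "P = Q" if "P \<in> ?Ps" "Q \<in> ?Ps" "P \<subseteq> Q" for P Q
      using that inc(1)[of True False r] inc(1)[of False True r] inc(2,3)[of r] by auto
    show "\<exists>P\<in>?Ps. P \<subseteq> Q" if "primeideal Q ?C" for Q using prime_contains_J[OF two that] by blast
  qed
  have "inj_on (zero_locus ?C) ?Ps"
    using C.vanishing_ideal_zero_locus[OF prime] by (rule inj_on_inverseI)
  moreover have "J_eps r True \<noteq> J_eps r False" "J_eps r True \<noteq> J_nil r" "J_eps r False \<noteq> J_nil r"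
    using inc(1)[of True False r] inc(2)[of r True] inc(2)[of r False] by simp_all
  then have "card ?Ps = 3" by simp
  ultimately show "card (irreducible_components (zariski ?C)) = 3" unfolding eq by (simp only: card_image)
qed

text \<open>A nilpotent element lies in every prime, in particular in three primes with intersection
  0.\<close>

lemma coord_C_reduced:
  assumes two: "\<one> \<oplus> \<one> \<noteq> \<zero>"
  shows "reduced_ring (coord_C R r)"
  unfolding reduced_ring_def
proof (intro ballI impI)
  let ?C = "coord_C R r"
  interpret C: algebra R ?C by (rule coord_algebra)
  fix x assume x: "x \<in> carrier ?C" and "\<exists>n::nat. x [^]\<^bsub>?C\<^esub> n = \<zero>\<^bsub>?C\<^esub>"
  then obtain n :: nat where n: "x [^]\<^bsub>?C\<^esub> n = \<zero>\<^bsub>?C\<^esub>" by blast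
  have xp: "x \<in> p" if p: "primeideal p ?C" for p
  proof (rule ccontr)
    interpret p: primeideal p ?C by (rule p)
    assume "x \<notin> p"
    then have "\<zero>\<^bsub>?C\<^esub> \<notin> p" using C.prime_pow[OF p x, of n] unfolding n by blast
    then show False using additive_subgroup.zero_closed[OF p.additive_subgroup_axioms] by blast
  qed
  show "x = \<zero>\<^bsub>?C\<^esub>"
    by (rule J_inter_zero[OF two xp[OF J_prime(1)] xp[OF J_prime(1)] xp[OF J_prime(2)]])
qed

text \<open>The multiplicities of the r + 3 chart variables serve as coordinates for the counting
  bound.\<close>

lemma J_eps_chain_length:
  assumes "\<And>i. i \<le> n \<Longrightarrow> primeideal (Q i) (coord_C R r)" "\<And>i. i < n \<Longrightarrow> Q i \<subset> Q (Suc i)" "J_eps r b \<subseteq> Q 0"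
  shows "n \<le> r + 3"
proof -
  let ?C = "coord_C R r" and ?P = "mpoly R {..r + 2}" and ?N = "{M. set_mset M \<subseteq> {..r + 2}}"
  obtain G where G: "G \<in> alg_hom R ?C ?P" "J_eps r b = {x \<in> carrier ?C. G x = \<zero>\<^bsub>?P\<^esub>}"
    by (rule J_eps_kernel)
  have G': "G \<in> alg_hom R ?C (monoid_alg R ?N)"
    using G(1) unfolding alg_hom_def ring_hom_def by (auto simp: mpoly_carrier mpoly_sel mpoly_mult Pi_def)
  show ?thesis
  proof (rule prime_chain_length_le[OF field_axioms coord_algebra(3), where \<kappa> = "\<lambda>M i. int (count M i)"
        and N = ?N and D = "{..r + 2}" and h = G and Q = Q])
    show "inj_on (\<lambda>M i. int (count M i)) ?N"
      by (rule inj_onI) (simp add: fun_eq_iff multiset_eq_iff)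
    show "int (count a i) = 0" if "a \<in> ?N" "i \<notin> {..r + 2}" for a i
      using that by (auto simp: count_eq_zero_iff)
    show "a \<in> Q 0" if "a \<in> carrier ?C" "G a = \<zero>\<^bsub>monoid_alg R ?N\<^esub>" for a
      using that assms(3) by (auto simp: G(2) mpoly_sel)
  qed (use G' assms in auto)
qed

text \<open>The exponents of y, v, \<alpha> and of the r scales make r + 3 coordinates.\<close>

lemma J_nil_chain_length:
  assumes "\<And>i. i \<le> n \<Longrightarrow> primeideal (Q i) (coord_C R r)" "\<And>i. i < n \<Longrightarrow> Q i \<subset> Q (Suc i)" "J_nil r \<subseteq> Q 0"
  shows "n \<le> r + 3"
proof -
  let ?C = "coord_C R r"
  obtain G where G: "G \<in> alg_hom R ?C (laurent r)" "J_nil r = {x \<in> carrier ?C. G x = \<zero>\<^bsub>laurent r\<^esub>}"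
    by (rule J_nil_kernel)
  show ?thesis
  proof (rule prime_chain_length_le[OF field_axioms coord_algebra(3), where \<kappa> = Poly_Mapping.lookup
        and N = "lexps r" and D = "{..<r + 3}" and h = G and Q = Q])
    show "inj_on Poly_Mapping.lookup (lexps r)" by (rule inj_onI) (simp add: poly_mapping_eqI)
    show "Poly_Mapping.lookup a i = 0" if "a \<in> lexps r" "i \<notin> {..<r + 3}" for a i
      using that by (simp add: lexps_def)
    show "a \<in> Q 0" if "a \<in> carrier ?C" "G a = \<zero>\<^bsub>monoid_alg R (lexps r)\<^esub>" for a
      using that assms(3) unfolding G(2) by blast
  qed (use G(1) assms in \<open>auto simp: lookup_add\<close>)
qed

text \<open>Setting the coordinates in \<open>K\<close> of the chart \<open>(y, t\<^sub>1, \<dots>, t\<^sub>r\<^sub>+\<^sub>2)\<close> of a component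
  \<open>\<alpha> = \<plusminus>1\<close> to zero gives a prime ideal, which grows strictly with \<open>K\<close> unless every \<open>t\<^sub>i\<close>
  that could detect \<open>y\<close> is already gone.\<close>

lemma J_eps_flag:
  obtains Q where "\<And>K. primeideal (Q K) (coord_C R r)" "Q {} = J_eps r b"
    "\<And>K v. v \<le> r + 2 \<Longrightarrow> v \<notin> K \<Longrightarrow> (v = 0 \<Longrightarrow> 1 \<notin> K) \<Longrightarrow> Q K \<subset> Q (insert v K)"
    "\<And>K. J_eps r b \<subseteq> Q K" "\<And>K. r + 1 \<in> K \<Longrightarrow> J_nil r \<subseteq> Q K"
proof -
  let ?C = "coord_C R r" and ?I = "{..r + 2}"
  let ?P = "mpoly R ?I"
  note [simp del] = add_2_eq_Suc' mpoly_sel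
  interpret C: algebra R ?C by (rule coord_algebra)
  interpret P: domain ?P by (rule mpoly_domain)
  obtain G where G: "G \<in> alg_hom R ?C ?P" "J_eps r b = {x \<in> carrier ?C. G x = \<zero>\<^bsub>?P\<^esub>}"
    "G (m12 (phiC r)) = indexed_var (r + 2)"
    "\<And>i. i < r + 1 \<Longrightarrow> map_mat2 G (msC r ! i) = chart ?P (indexed_var 0) (indexed_var (Suc i))"
    by (rule J_eps_kernel) blast
  interpret G: ring_hom_cring ?C ?P G by (rule alg_hom_ring_hom_cring[OF coord_algebra(3) mpoly_algebra G(1)])
  define Q where "Q K = {x \<in> carrier ?C. kill ?I K (G x) = \<zero>\<^bsub>?P\<^esub>}" for K
  have mono: "Q K \<subseteq> Q K'" if "K \<subseteq> K'" for K K'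
  proof
    interpret k: ring_hom_cring ?P ?P "kill ?I K'" by (rule kill_cring)
    fix x assume "x \<in> Q K"
    then show "x \<in> Q K'" using kill_kill[OF that G.hom_closed, of x] k.hom_zero by (simp add: Q_def)
  qed
  have var: "(indexed_var v :: nat multiset \<Rightarrow> 'a) \<in> carrier ?P" if "v \<le> r + 2" for v
    using that by (simp add: mpoly_var_closed)
  have kv: "kill ?I K (indexed_var v) = (if v \<in> K then \<zero>\<^bsub>?P\<^esub> else indexed_var v)" if "v \<le> r + 2" for v K
    using that by (simp add: kill_var)
  have prime: "primeideal (Q K) ?C" for K
  proof -
    let ?h = "compose (carrier ?C) (kill ?I K) G"
    have "?h \<in> alg_hom R ?C ?P" by (rule alg_hom_compose[OF C.algebra_axioms G(1) kill_hom])
    then have "primeideal {x \<in> carrier ?C. ?h x = \<zero>\<^bsub>?P\<^esub>} ?C"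
      by (intro kernel_prime alg_hom_ring_hom_cring[OF coord_algebra(3) mpoly_algebra] mpoly_domain)
    also have "{x \<in> carrier ?C. ?h x = \<zero>\<^bsub>?P\<^esub>} = Q K" by (auto simp: Q_def compose_eq)
    finally show ?thesis .
  qed
  have Q0: "Q {} = J_eps r b"
    unfolding Q_def G(2) by (intro Collect_cong conj_cong refl) (simp add: kill_empty)
  have mc: "m11 (msC r ! i) \<in> carrier ?C" "m12 (msC r ! i) \<in> carrier ?C" if "i < r + 1" for i
    using univC_closed(5)[OF that] by (simp_all add: mat2_carrier_iff)
  have strict: "Q K \<subset> Q (insert v K)" if v: "v \<le> r + 2" "v \<notin> K" "v = 0 \<Longrightarrow> 1 \<notin> K" for K v
  proof -
    interpret k: ring_hom_cring ?P ?P "kill ?I K" by (rule kill_cring)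
    interpret k': ring_hom_cring ?P ?P "kill ?I (insert v K)" by (rule kill_cring)
    have "\<exists>x. x \<in> carrier ?C \<and> kill ?I K (G x) \<noteq> \<zero>\<^bsub>?P\<^esub> \<and> kill ?I (insert v K) (G x) = \<zero>\<^bsub>?P\<^esub>"
    proof (cases "v = 0")
      case True
      \<comment> \<open>y is detected through y t_1, an entry of m_1; therefore t_1 must not have
        been killed before y.\<close>
      have "G (m11 (msC r ! 0)) = indexed_var 0 \<otimes>\<^bsub>?P\<^esub> indexed_var 1"
        using arg_cong[OF G(4)[of 0], of m11] by (simp add: chart_def)
      then have "kill ?I K (G (m11 (msC r ! 0))) = indexed_var 0 \<otimes>\<^bsub>?P\<^esub> indexed_var 1"
        "kill ?I (insert v K) (G (m11 (msC r ! 0))) = \<zero>\<^bsub>?P\<^esub>"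
        using v True var kv k'.hom_mult[OF var[of 0] var[of 1]] by simp_all
      moreover have "indexed_var 0 \<otimes>\<^bsub>?P\<^esub> indexed_var 1 \<noteq> \<zero>\<^bsub>?P\<^esub>"
        using P.integral[of "indexed_var 0" "indexed_var 1"] var[of 0] var[of 1] indexed_var_ne_zero by fastforce
      ultimately show ?thesis using mc(1)[of 0] by auto
    next
      case False
      \<comment> \<open>Every scale is an upper right entry: of \<phi> for the last variable, of m_v
        for the variables v before it.\<close>
      obtain x where x: "x \<in> carrier ?C" "G x = indexed_var v"
      proof (cases "v = r + 2")
        case True
        then show thesis using that[of "m12 (phiC r)"] G(3) univC_closed(1)[of r] by (simp add: mat2_carrier_iff)
      next
        case neq: False
        have "G (m12 (msC r ! (v - 1))) = indexed_var (Suc (v - 1))"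
          using arg_cong[OF G(4)[of "v - 1"], of m12] neq v(1) False by (simp add: chart_def)
        then show thesis using mc(2)[of "v - 1"] that[of "m12 (msC r ! (v - 1))"] neq v(1) False by simp
      qed
      have "kill ?I K (G x) = indexed_var v" "kill ?I (insert v K) (G x) = \<zero>\<^bsub>?P\<^esub>"
        using v kv x by simp_all
      then show ?thesis using x(1) indexed_var_ne_zero by metis
    qed
    then obtain x where "x \<in> Q (insert v K)" "x \<notin> Q K" unfolding Q_def by blast
    then show ?thesis using mono[of K "insert v K"] by blast
  qed
  have nil: "J_nil r \<subseteq> Q K" if "r + 1 \<in> K" for K
    unfolding J_nil_def
  proof (rule C.genideal_minimal)
    interpret k: ring_hom_cring ?P ?P "kill ?I K" by (rule kill_cring)
    show "ideal (Q K) ?C" using prime by (rule primeideal.axioms)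
    \<comment> \<open>Every entry of the chart matrix of m_{r+1} is a multiple of its scale t_{r+1},
      which is set to zero.\<close>
    have "map_mat2 (kill ?I K) (map_mat2 G (msC r ! r)) = mat2_zero ?P"
      using that G(4)[of r] kv[of "Suc r" K] var[of 0] var[of "Suc r"] k.hom_closed[OF var[of 0]]
      by (simp add: chart_def mat2_zero_def)
    then have "kill ?I K (G x) = \<zero>\<^bsub>?P\<^esub>" if "x \<in> set_mat2 (msC r ! r)" for x
      using that by (auto simp: mat2_eq_iff set_mat2_eq mat2_zero_def)
    then show "set_mat2 (msC r ! r) \<subseteq> Q K" using J_gens_closed(2)[of r] unfolding Q_def by blast
  qed
  show thesis
    by (rule that[of Q]) (use prime Q0 strict nil mono[of "{}"] in auto)
qed

text \<open>The variables are killed in the order y, t_1, ..., t_{r+2}, with y first because t_1 is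
  needed to detect it.\<close>

lemma krull_dim_J_eps: "krull_dim (subtopology (zariski (coord_C R r)) (zero_locus (coord_C R r) (J_eps r b))) = enat (r + 3)"
proof -
  interpret C: algebra R "coord_C R r" by (rule coord_algebra)
  obtain Q where Q: "\<And>K. primeideal (Q K) (coord_C R r)" "Q {} = J_eps r b"
    "\<And>K v. v \<le> r + 2 \<Longrightarrow> v \<notin> K \<Longrightarrow> (v = 0 \<Longrightarrow> 1 \<notin> K) \<Longrightarrow> Q K \<subset> Q (insert v K)"
    by (rule J_eps_flag[of r b]) blast
  show ?thesis
  proof (rule C.krull_dim_zero_locus[OF J_prime(1) J_eps_chain_length, where C = "\<lambda>j. Q {..<j}"])
    show "Q {..<i} \<subset> Q {..<Suc i}" if "i < r + 3" for i
      using Q(3)[of i "{..<i}"] that by (simp add: lessThan_Suc)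
  qed (use Q in auto)
qed

text \<open>The chain starts at \<open>J_nil\<close>, jumps to the locus t_{r+1} = 0 in the
  component \<alpha> = 1, and kills the other variables of that chart. The jump is proper because
  \<alpha> - 1 lies outside \<open>J_nil\<close>. The condition r >= 1 keeps t_1 different from
  t_{r+1}, so that t_1 still detects y.\<close>

lemma krull_dim_J_nil:
  assumes two: "\<one> \<oplus> \<one> \<noteq> \<zero>" and r: "r \<ge> 1"
  shows "krull_dim (subtopology (zariski (coord_C R r)) (zero_locus (coord_C R r) (J_nil r))) = enat (r + 3)"
proof -
  interpret C: algebra R "coord_C R r" by (rule coord_algebra)
  obtain Q where Q: "\<And>K. primeideal (Q K) (coord_C R r)"
    "\<And>K v. v \<le> r + 2 \<Longrightarrow> v \<notin> K \<Longrightarrow> (v = 0 \<Longrightarrow> 1 \<notin> K) \<Longrightarrow> Q K \<subset> Q (insert v K)"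
    "\<And>K. J_eps r True \<subseteq> Q K" "\<And>K. r + 1 \<in> K \<Longrightarrow> J_nil r \<subseteq> Q K"
    by (rule J_eps_flag[of r True]) blast
  \<comment> \<open>Enumerates 0, ..., r, r + 2, skipping r + 1, which is killed from the
    start.\<close>
  define f where "f j = (if j = r + 1 then r + 2 else j)" for j
  define C where "C j = (case j of 0 \<Rightarrow> J_nil r | Suc i \<Rightarrow> Q (insert (r + 1) (f ` {..<i})))" for j
  show ?thesis
  proof (rule C.krull_dim_zero_locus[OF J_prime(2), where C = C])
    show "n \<le> r + 3" if "\<And>i. i \<le> n \<Longrightarrow> primeideal (Q i) (coord_C R r)" "\<And>i. i < n \<Longrightarrow> Q i \<subset> Q (Suc i)"
      "J_nil r \<subseteq> Q 0" for n Q using that by (rule J_nil_chain_length)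
    show "primeideal (C i) (coord_C R r)" for i
      using J_prime(2) Q(1) by (simp add: C_def split: nat.split)
    show "C i \<subset> C (Suc i)" if i: "i < r + 3" for i
    proof (cases i)
      case 0
      have "\<not> Q {r + 1} \<subseteq> J_nil r" using Q(3)[of "{r + 1}"] J_incomparable(2)[OF two, of r True] by blast
      then show ?thesis using Q(4)[of "{r + 1}"] 0 by (auto simp: C_def)
    next
      case (Suc j)
      then have "Q (insert (r + 1) (f ` {..<j})) \<subset> Q (insert (f j) (insert (r + 1) (f ` {..<j})))"
        using i r by (intro Q(2)) (auto simp: f_def split: if_splits)
      then show ?thesis using Suc by (simp add: C_def lessThan_Suc insert_commute)
    qed
    show "J_nil r \<subseteq> C 0" by (simp add: C_def)
  qed
qed

lemma coord_C_equidimensional: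
  assumes "\<one> \<oplus> \<one> \<noteq> \<zero>" "r \<ge> 1"
  shows "equidimensional (zariski (coord_C R r)) (r + 3)"
  unfolding equidimensional_def coord_C_components(1)[OF assms(1)]
  using krull_dim_J_eps krull_dim_J_nil[OF assms] by blast

end

section \<open>Base change\<close>

text \<open>The same ring as an algebra over another base, through a ring homomorphism. This covers
  restriction of scalars from an extension field to k as well as the structure of a tensor product
  as an algebra over its first factor.\<close>

definition alg_along :: "('b \<Rightarrow> 'a) \<Rightarrow> ('c, 'a) module \<Rightarrow> ('b, 'a) module"
  where "alg_along \<phi> A = \<lparr>carrier = carrier A, monoid.mult = monoid.mult A, one = one A, zero = zero A,
    ring.add = ring.add A, smult = (\<lambda>c x. \<phi> c \<otimes>\<^bsub>A\<^esub> x)\<rparr>"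

lemma alg_along_sel [simp]:
  "carrier (alg_along \<phi> A) = carrier A" "monoid.mult (alg_along \<phi> A) = monoid.mult A"
  "one (alg_along \<phi> A) = one A" "zero (alg_along \<phi> A) = zero A" "ring.add (alg_along \<phi> A) = ring.add A"
  "c \<odot>\<^bsub>alg_along \<phi> A\<^esub> x = \<phi> c \<otimes>\<^bsub>A\<^esub> x"
  by (simp_all add: alg_along_def)

lemma ring_hom_alg_along: "ring_hom B (alg_along \<phi> A) = ring_hom B A" "ring_hom (alg_along \<phi> A) B = ring_hom A B"
  by (simp_all add: ring_hom_def)

lemma alg_along_algebra:
  assumes "cring K" "cring A" "\<phi> \<in> ring_hom K A"
  shows "algebra K (alg_along \<phi> A)"
proof -
  interpret \<phi>: ring_hom_cring K A \<phi>
    using assms by (auto simp: ring_hom_cring_def ring_hom_cring_axioms_def)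
  have "cring (alg_along \<phi> A)" using assms(2) by (rule cring_cong) simp_all
  then show ?thesis
    by (intro algebraI \<phi>.R.is_cring)
      (simp_all add: \<phi>.S.l_distr \<phi>.S.r_distr \<phi>.S.m_assoc)
qed

lemma alg_along_id_hom: "cring A \<Longrightarrow> ring_hom_cring A (alg_along \<phi> A) (\<lambda>x. x)"
  using cring_cong[of A "alg_along \<phi> A"]
  by (auto simp: ring_hom_cring_def ring_hom_cring_axioms_def ring_hom_def)

lemma map_BC_ident: "map_BC (\<lambda>x. x) u = u"
  by (cases u) (simp add: map_BC_def mat2.map_ident map_idI)

lemma functor_C_alg_along:
  assumes "cring A" "u \<in> functor_C r A"
  shows "u \<in> functor_C r (alg_along \<phi> A)"
  using functor_C_hom[OF alg_along_id_hom[OF assms(1)] assms(2), of \<phi>] by (simp add: map_BC_ident)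

lemma algebra_unit_hom:
  assumes "algebra K A"
  shows "(\<lambda>c. c \<odot>\<^bsub>A\<^esub> \<one>\<^bsub>A\<^esub>) \<in> ring_hom K A"
proof -
  interpret A: algebra K A by fact
  show ?thesis
    by (rule ring_hom_memI)
      (simp_all add: A.smult_l_distr A.smult_assoc1 A.smult_assoc2)
qed

lemma algebra_smult_unit:
  assumes "algebra K A" "c \<in> carrier K" "x \<in> carrier A"
  shows "(c \<odot>\<^bsub>A\<^esub> \<one>\<^bsub>A\<^esub>) \<otimes>\<^bsub>A\<^esub> x = c \<odot>\<^bsub>A\<^esub> x"
proof -
  interpret A: algebra K A by fact
  show ?thesis using assms(2,3) by (simp add: A.smult_assoc2)
qed

context cring
begin

context
  fixes A :: "('a, 'm) module" and B :: "('a, 'n) module"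
  assumes A: "algebra R A" and B: "algebra R B"
begin

interpretation A: algebra R A by (rule A)
interpretation B: algebra R B by (rule B)
interpretation P: algebra R "mpoly R (carrier A \<times> carrier B)" by (rule mpoly_algebra)

abbreviation (input) "tvar x a \<equiv> indexed_var (x, a)"

lemma tvar_closed: "x \<in> carrier A \<Longrightarrow> a \<in> carrier B \<Longrightarrow> tvar x a \<in> carrier (mpoly R (carrier A \<times> carrier B))"
  by (simp add: mpoly_var_closed)

lemma tensor_rels_closed: "tensor_rels R A B \<subseteq> carrier (mpoly R (carrier A \<times> carrier B))"
  unfolding tensor_rels_def Let_def Un_subset_iff
  by (intro conjI; clarify; intro P.minus_closed P.M.add.m_closed P.m_closed P.smult_closed tvar_closed
      P.one_closed A.M.add.m_closed B.M.add.m_closed A.m_closed B.m_closed A.smult_closed B.smult_closed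
      A.one_closed B.one_closed; assumption)

definition ptensor :: "'m \<Rightarrow> 'n \<Rightarrow> (('m \<times> 'n) multiset \<Rightarrow> 'a) set"
  where "ptensor x a = Idl\<^bsub>mpoly R (carrier A \<times> carrier B)\<^esub> (tensor_rels R A B)
    +>\<^bsub>mpoly R (carrier A \<times> carrier B)\<^esub> tvar x a"

lemma tensor_algebra: "algebra R (tensor R A B)"
  unfolding tensor_def Let_def by (rule pres_algebra[OF tensor_rels_closed])

lemma ptensor_closed: "x \<in> carrier A \<Longrightarrow> a \<in> carrier B \<Longrightarrow> ptensor x a \<in> carrier (tensor R A B)"
  unfolding tensor_def Let_def ptensor_def by (rule pres_var_closed[OF tensor_rels_closed]) simp

lemma tensor_proj:
  obtains p where "p \<in> alg_hom R (mpoly R (carrier A \<times> carrier B)) (tensor R A B)"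
    "\<And>x a. x \<in> carrier A \<Longrightarrow> a \<in> carrier B \<Longrightarrow> p (tvar x a) = ptensor x a"
    "\<And>z. z \<in> tensor_rels R A B \<Longrightarrow> p z = \<zero>\<^bsub>tensor R A B\<^esub>"
proof (rule that)
  let ?P = "mpoly R (carrier A \<times> carrier B)"
  let ?p = "\<lambda>x\<in>carrier ?P. Idl\<^bsub>?P\<^esub> (tensor_rels R A B) +>\<^bsub>?P\<^esub> x"
  show "?p \<in> alg_hom R ?P (tensor R A B)"
    unfolding tensor_def Let_def by (rule pres_proj[OF tensor_rels_closed])
  show "?p (tvar x a) = ptensor x a" if "x \<in> carrier A" "a \<in> carrier B" for x a
    using tvar_closed[OF that] by (simp add: ptensor_def)
  show "?p z = \<zero>\<^bsub>tensor R A B\<^esub>" if "z \<in> tensor_rels R A B" for z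
    using that tensor_rels_closed pres_rels_zero[OF tensor_rels_closed that]
    unfolding tensor_def Let_def by auto
qed

lemma ptensor_simps:
  assumes x: "x \<in> carrier A" and y: "y \<in> carrier A" and a: "a \<in> carrier B" and b: "b \<in> carrier B"
    and c: "c \<in> carrier R"
  shows "ptensor (x \<oplus>\<^bsub>A\<^esub> y) a = ptensor x a \<oplus>\<^bsub>tensor R A B\<^esub> ptensor y a"
    "ptensor x (a \<oplus>\<^bsub>B\<^esub> b) = ptensor x a \<oplus>\<^bsub>tensor R A B\<^esub> ptensor x b"
    "ptensor (c \<odot>\<^bsub>A\<^esub> x) a = c \<odot>\<^bsub>tensor R A B\<^esub> ptensor x a"
    "ptensor x (c \<odot>\<^bsub>B\<^esub> a) = c \<odot>\<^bsub>tensor R A B\<^esub> ptensor x a"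
    "ptensor (x \<otimes>\<^bsub>A\<^esub> y) (a \<otimes>\<^bsub>B\<^esub> b) = ptensor x a \<otimes>\<^bsub>tensor R A B\<^esub> ptensor y b"
    "ptensor \<one>\<^bsub>A\<^esub> \<one>\<^bsub>B\<^esub> = \<one>\<^bsub>tensor R A B\<^esub>"
proof -
  let ?P = "mpoly R (carrier A \<times> carrier B)" and ?T = "tensor R A B"
  obtain p where p: "p \<in> alg_hom R ?P ?T"
    "\<And>x a. x \<in> carrier A \<Longrightarrow> a \<in> carrier B \<Longrightarrow> p (tvar x a) = ptensor x a"
    "\<And>z. z \<in> tensor_rels R A B \<Longrightarrow> p z = \<zero>\<^bsub>?T\<^esub>"
    by (rule tensor_proj) blast
  interpret T: algebra R ?T by (rule tensor_algebra)
  interpret p: ring_hom_cring ?P ?T p by (rule alg_hom_ring_hom_cring[OF mpoly_algebra tensor_algebra p(1)])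
  have rel: "p u = p v" if "u \<ominus>\<^bsub>?P\<^esub> v \<in> tensor_rels R A B" "u \<in> carrier ?P" "v \<in> carrier ?P" for u v
    using p(3)[OF that(1)] p.hom_minus[OF that(2,3)] T.minus_eq_zero_iff that(2,3) by simp
  note mem = tensor_rels_def Let_def Un_iff mem_Collect_eq
  note tc = tvar_closed
  have "p (tvar (x \<oplus>\<^bsub>A\<^esub> y) a) = p (tvar x a \<oplus>\<^bsub>?P\<^esub> tvar y a)"
  proof (rule rel)
    show "tvar (x \<oplus>\<^bsub>A\<^esub> y) a \<ominus>\<^bsub>?P\<^esub> (tvar x a \<oplus>\<^bsub>?P\<^esub> tvar y a) \<in> tensor_rels R A B"
      unfolding mem using x y a by blast
  qed (use x y a tc in auto)
  then show "ptensor (x \<oplus>\<^bsub>A\<^esub> y) a = ptensor x a \<oplus>\<^bsub>?T\<^esub> ptensor y a"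
    using p.hom_add[OF tc[OF x a] tc[OF y a]] p(2) x y a by simp
  have "p (tvar x (a \<oplus>\<^bsub>B\<^esub> b)) = p (tvar x a \<oplus>\<^bsub>?P\<^esub> tvar x b)"
  proof (rule rel)
    show "tvar x (a \<oplus>\<^bsub>B\<^esub> b) \<ominus>\<^bsub>?P\<^esub> (tvar x a \<oplus>\<^bsub>?P\<^esub> tvar x b) \<in> tensor_rels R A B"
      unfolding mem using x a b by blast
  qed (use x a b tc in auto)
  then show "ptensor x (a \<oplus>\<^bsub>B\<^esub> b) = ptensor x a \<oplus>\<^bsub>?T\<^esub> ptensor x b"
    using p.hom_add[OF tc[OF x a] tc[OF x b]] p(2) x a b by simp
  have "p (tvar (c \<odot>\<^bsub>A\<^esub> x) a) = p (c \<odot>\<^bsub>?P\<^esub> tvar x a)"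
  proof (rule rel)
    show "tvar (c \<odot>\<^bsub>A\<^esub> x) a \<ominus>\<^bsub>?P\<^esub> c \<odot>\<^bsub>?P\<^esub> tvar x a \<in> tensor_rels R A B"
      unfolding mem using x a c by blast
  qed (use x a c tc P.smult_closed in auto)
  then show "ptensor (c \<odot>\<^bsub>A\<^esub> x) a = c \<odot>\<^bsub>?T\<^esub> ptensor x a"
    using alg_homD(3)[OF p(1) c tc[OF x a]] p(2) x a c by simp
  have "p (tvar x (c \<odot>\<^bsub>B\<^esub> a)) = p (c \<odot>\<^bsub>?P\<^esub> tvar x a)"
  proof (rule rel)
    show "tvar x (c \<odot>\<^bsub>B\<^esub> a) \<ominus>\<^bsub>?P\<^esub> c \<odot>\<^bsub>?P\<^esub> tvar x a \<in> tensor_rels R A B"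
      unfolding mem using x a c by blast
  qed (use x a c tc P.smult_closed in auto)
  then show "ptensor x (c \<odot>\<^bsub>B\<^esub> a) = c \<odot>\<^bsub>?T\<^esub> ptensor x a"
    using alg_homD(3)[OF p(1) c tc[OF x a]] p(2) x a c by simp
  have "p (tvar (x \<otimes>\<^bsub>A\<^esub> y) (a \<otimes>\<^bsub>B\<^esub> b)) = p (tvar x a \<otimes>\<^bsub>?P\<^esub> tvar y b)"
  proof (rule rel)
    show "tvar (x \<otimes>\<^bsub>A\<^esub> y) (a \<otimes>\<^bsub>B\<^esub> b) \<ominus>\<^bsub>?P\<^esub> (tvar x a \<otimes>\<^bsub>?P\<^esub> tvar y b) \<in> tensor_rels R A B"
      unfolding mem using x y a b by blast
  qed (use x y a b tc in auto)
  then show "ptensor (x \<otimes>\<^bsub>A\<^esub> y) (a \<otimes>\<^bsub>B\<^esub> b) = ptensor x a \<otimes>\<^bsub>?T\<^esub> ptensor y b"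
    using p.hom_mult[OF tc[OF x a] tc[OF y b]] p(2) x y a b by simp
  have "p (tvar \<one>\<^bsub>A\<^esub> \<one>\<^bsub>B\<^esub>) = p \<one>\<^bsub>?P\<^esub>"
  proof (rule rel)
    show "tvar \<one>\<^bsub>A\<^esub> \<one>\<^bsub>B\<^esub> \<ominus>\<^bsub>?P\<^esub> \<one>\<^bsub>?P\<^esub> \<in> tensor_rels R A B"
      unfolding mem by blast
  qed (use tc P.one_closed in auto)
  then show "ptensor \<one>\<^bsub>A\<^esub> \<one>\<^bsub>B\<^esub> = \<one>\<^bsub>?T\<^esub>" using p(2) p.hom_one by simp
qed

lemma tensor_hom_eqI:
  assumes S: "algebra R S" and f: "f \<in> alg_hom R (tensor R A B) S" and g: "g \<in> alg_hom R (tensor R A B) S"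
    and eq: "\<And>x a. x \<in> carrier A \<Longrightarrow> a \<in> carrier B \<Longrightarrow> f (ptensor x a) = g (ptensor x a)"
  shows "f = g"
  using eq by (intro pres_hom_eqI[OF tensor_rels_closed S f[unfolded tensor_def Let_def]
        g[unfolded tensor_def Let_def]]) (auto simp: ptensor_def)

text \<open>The products of values of f and g respect the tensor relations because the target is
  commutative and both maps are linear over \<open>R\<close>.\<close>

lemma tensor_hom_ex:
  assumes S: "algebra R S" and f: "f \<in> alg_hom R A S" and g: "g \<in> alg_hom R B S"
  obtains h where "h \<in> alg_hom R (tensor R A B) S"
    "\<And>x a. x \<in> carrier A \<Longrightarrow> a \<in> carrier B \<Longrightarrow> h (ptensor x a) = f x \<otimes>\<^bsub>S\<^esub> g a"
proof -
  let ?I = "carrier A \<times> carrier B"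
  let ?P = "mpoly R ?I"
  interpret S: algebra R S by (rule S)
  interpret f: ring_hom_cring A S f by (rule alg_hom_ring_hom_cring[OF A S f])
  interpret g: ring_hom_cring B S g by (rule alg_hom_ring_hom_cring[OF B S g])
  have "(\<lambda>(x, a). f x \<otimes>\<^bsub>S\<^esub> g a) v \<in> carrier S" if "v \<in> ?I" for v using that by auto
  then obtain h where h: "h \<in> alg_hom R ?P S" "\<And>v. v \<in> ?I \<Longrightarrow> h (indexed_var v) = (\<lambda>(x, a). f x \<otimes>\<^bsub>S\<^esub> g a) v"
    using mpoly_hom_ex[OF S, of ?I "\<lambda>(x, a). f x \<otimes>\<^bsub>S\<^esub> g a"] by blast
  have hv: "h (tvar x a) = f x \<otimes>\<^bsub>S\<^esub> g a" if "x \<in> carrier A" "a \<in> carrier B" for x a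
    using h(2)[of "(x, a)"] that by simp
  interpret h: ring_hom_cring ?P S h by (rule alg_hom_ring_hom_cring[OF mpoly_algebra S h(1)])
  have eq: "h (u \<ominus>\<^bsub>?P\<^esub> v) = \<zero>\<^bsub>S\<^esub>" if "u \<in> carrier ?P" "v \<in> carrier ?P" "h u = h v" for u v
    using that by (simp add: h.hom_minus S.minus_eq_zero_iff)
  have sr: "s \<otimes>\<^bsub>S\<^esub> (c \<odot>\<^bsub>S\<^esub> t) = c \<odot>\<^bsub>S\<^esub> (s \<otimes>\<^bsub>S\<^esub> t)" if "s \<in> carrier S" "t \<in> carrier S" "c \<in> carrier R" for s t c
    using that S.smult_assoc2[of c t s] S.m_comm[of s t] S.m_comm[of s "c \<odot>\<^bsub>S\<^esub> t"] S.smult_closed by simp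
  have z: "h ` tensor_rels R A B \<subseteq> {\<zero>\<^bsub>S\<^esub>}"
    unfolding tensor_rels_def Let_def image_Un Un_subset_iff
    by (intro conjI; clarify; intro singleton_iff[THEN iffD2] eq)
      (simp_all add: tvar_closed hv S.l_distr S.r_distr alg_homD(3)[OF f] alg_homD(3)[OF g]
        alg_homD(3)[OF h(1)] S.smult_assoc2 sr S.m_ac)
  obtain q where q: "q \<in> alg_hom R (tensor R A B) S"
    "\<And>x. x \<in> carrier ?P \<Longrightarrow> q (Idl\<^bsub>?P\<^esub> (tensor_rels R A B) +>\<^bsub>?P\<^esub> x) = h x"
    using pres_hom_ex[OF tensor_rels_closed S h(1) z] unfolding tensor_def Let_def by blast
  show thesis by (rule that[OF q(1)]) (simp add: ptensor_def q(2) tvar_closed hv)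
qed

end

end

text \<open>The universal properties give \<open>f\<close> from the tensor product to the coordinate
  ring over K and \<open>g\<close> back, with g after f the identity. So \<open>f\<close> is
  injective, and it sends nilpotent elements into a reduced ring.\<close>

lemma (in field) coord_C_geometrically_reduced:
  assumes two: "\<one> \<oplus> \<one> \<noteq> \<zero>"
  shows "geometrically_reduced TYPE('l) R (coord_C R r)"
  unfolding geometrically_reduced_def
proof (intro allI impI)
  fix K :: "('a, 'l) module"
  assume K: "algebra R K \<and> field K"
  let ?C = "coord_C R r" and ?D = "coord_C K r"
  let ?T = "tensor R K ?C"
  interpret K: field K using K by blast
  interpret A: algebra R K using K by blast
  interpret C: algebra R ?C by (rule coord_algebra)
  interpret D: algebra K ?D by (rule K.coord_algebra)
  interpret T: algebra R ?T by (rule tensor_algebra[OF A.algebra_axioms C.algebra_axioms])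
  have unitK: "c \<odot>\<^bsub>K\<^esub> \<one>\<^bsub>K\<^esub> \<in> carrier K" if "c \<in> carrier R" for c using that by simp
  \<comment> \<open>2 is a unit of the base field, so it stays nonzero in K.\<close>
  have two': "\<one>\<^bsub>K\<^esub> \<oplus>\<^bsub>K\<^esub> \<one>\<^bsub>K\<^esub> \<noteq> \<zero>\<^bsub>K\<^esub>"
  proof
    assume "\<one>\<^bsub>K\<^esub> \<oplus>\<^bsub>K\<^esub> \<one>\<^bsub>K\<^esub> = \<zero>\<^bsub>K\<^esub>"
    then have z: "(\<one> \<oplus> \<one>) \<odot>\<^bsub>K\<^esub> \<one>\<^bsub>K\<^esub> = \<zero>\<^bsub>K\<^esub>" by (simp add: A.smult_l_distr)
    have h: "inv (\<one> \<oplus> \<one>) \<in> carrier R" "inv (\<one> \<oplus> \<one>) \<otimes> (\<one> \<oplus> \<one>) = \<one>"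
      using two by (auto simp: field_Units)
    have "\<one>\<^bsub>K\<^esub> = (inv (\<one> \<oplus> \<one>) \<otimes> (\<one> \<oplus> \<one>)) \<odot>\<^bsub>K\<^esub> \<one>\<^bsub>K\<^esub>" using h by simp
    also have "\<dots> = inv (\<one> \<oplus> \<one>) \<odot>\<^bsub>K\<^esub> ((\<one> \<oplus> \<one>) \<odot>\<^bsub>K\<^esub> \<one>\<^bsub>K\<^esub>)"
      by (rule A.smult_assoc1) (simp_all add: h)
    also have "\<dots> = \<zero>\<^bsub>K\<^esub>" unfolding z using h by simp
    finally show False by simp
  qed
  define \<phi> where "\<phi> = (\<lambda>x. x \<odot>\<^bsub>?D\<^esub> \<one>\<^bsub>?D\<^esub>)"
  \<comment> \<open>The structure map from the base field through K; it makes the coordinate ring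
    over K an algebra over the base field.\<close>
  define \<psi> where "\<psi> c = \<phi> (c \<odot>\<^bsub>K\<^esub> \<one>\<^bsub>K\<^esub>)" for c
  let ?D' = "alg_along \<psi> ?D"
  have \<phi>: "\<phi> \<in> ring_hom K ?D" unfolding \<phi>_def by (rule algebra_unit_hom[OF D.algebra_axioms])
  have \<psi>: "\<psi> \<in> ring_hom R ?D"
    using ring_hom_trans[OF algebra_unit_hom[OF A.algebra_axioms] \<phi>] by (simp add: \<psi>_def[abs_def] o_def)
  interpret D': algebra R ?D' by (rule alg_along_algebra[OF is_cring D.is_cring \<psi>])
  have \<phi>': "restrict \<phi> (carrier K) \<in> alg_hom R K ?D'"
  proof (rule alg_hom_restrict[OF A.algebra_axioms])
    show "\<phi> \<in> ring_hom K ?D'" using \<phi> by (simp add: ring_hom_alg_along)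
    show "\<phi> (c \<odot>\<^bsub>K\<^esub> x) = c \<odot>\<^bsub>?D'\<^esub> \<phi> x" if "c \<in> carrier R" "x \<in> carrier K" for c x
      using ring_hom_mult[OF \<phi> unitK[OF that(1)] that(2)] algebra_smult_unit[OF A.algebra_axioms that]
      by (simp add: \<psi>_def)
  qed
  \<comment> \<open>The universal point over K, viewed over the base field, is classified by
    \<open>j\<close>.\<close>
  obtain j where j: "j \<in> alg_hom R ?C ?D'" "map_BC j (univ_C R r) = univ_C K r"
    by (rule represents_hom_ex[OF represents_coord_C D'.algebra_axioms
          functor_C_alg_along[OF D.is_cring K.univ_C_in_functor]])
  obtain f where f: "f \<in> alg_hom R ?T ?D'"
    "\<And>x a. x \<in> carrier K \<Longrightarrow> a \<in> carrier ?C \<Longrightarrow>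
      f (ptensor K ?C x a) = restrict \<phi> (carrier K) x \<otimes>\<^bsub>?D'\<^esub> j a"
    using tensor_hom_ex[OF A.algebra_axioms C.algebra_axioms D'.algebra_axioms \<phi>' j(1)] by metis
  note ps = ptensor_simps[OF A.algebra_axioms C.algebra_axioms]
  note pc = ptensor_closed[OF A.algebra_axioms C.algebra_axioms]
  define i1 where "i1 x = ptensor K ?C x \<one>\<^bsub>?C\<^esub>" for x
  define i2 where "i2 = (\<lambda>a\<in>carrier ?C. ptensor K ?C \<one>\<^bsub>K\<^esub> a)"
  have i1: "i1 \<in> ring_hom K ?T"
  proof (rule ring_hom_memI)
    show "i1 (x \<otimes>\<^bsub>K\<^esub> y) = i1 x \<otimes>\<^bsub>?T\<^esub> i1 y" if "x \<in> carrier K" "y \<in> carrier K" for x y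
      using ps(5)[OF that C.one_closed C.one_closed zero_closed] by (simp add: i1_def)
    show "i1 (x \<oplus>\<^bsub>K\<^esub> y) = i1 x \<oplus>\<^bsub>?T\<^esub> i1 y" if "x \<in> carrier K" "y \<in> carrier K" for x y
      using ps(1)[OF that C.one_closed C.one_closed zero_closed] by (simp add: i1_def)
    show "i1 \<one>\<^bsub>K\<^esub> = \<one>\<^bsub>?T\<^esub>"
      using ps(6)[OF K.one_closed K.one_closed C.one_closed C.one_closed zero_closed] by (simp add: i1_def)
  qed (simp add: i1_def pc)
  have i2: "i2 \<in> alg_hom R ?C ?T"
    unfolding i2_def
  proof (rule alg_hom_restrict[OF C.algebra_axioms ring_hom_memI])
    show "ptensor K ?C \<one>\<^bsub>K\<^esub> (x \<otimes>\<^bsub>?C\<^esub> y) = ptensor K ?C \<one>\<^bsub>K\<^esub> x \<otimes>\<^bsub>?T\<^esub> ptensor K ?C \<one>\<^bsub>K\<^esub> y"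
      if "x \<in> carrier ?C" "y \<in> carrier ?C" for x y
      using ps(5)[OF K.one_closed K.one_closed that zero_closed] by simp
    show "ptensor K ?C \<one>\<^bsub>K\<^esub> (x \<oplus>\<^bsub>?C\<^esub> y) = ptensor K ?C \<one>\<^bsub>K\<^esub> x \<oplus>\<^bsub>?T\<^esub> ptensor K ?C \<one>\<^bsub>K\<^esub> y"
      if "x \<in> carrier ?C" "y \<in> carrier ?C" for x y
      using ps(2)[OF K.one_closed K.one_closed that zero_closed] by simp
    show "ptensor K ?C \<one>\<^bsub>K\<^esub> \<one>\<^bsub>?C\<^esub> = \<one>\<^bsub>?T\<^esub>"
      using ps(6)[OF K.one_closed K.one_closed C.one_closed C.one_closed zero_closed] .
    show "ptensor K ?C \<one>\<^bsub>K\<^esub> (c \<odot>\<^bsub>?C\<^esub> x) = c \<odot>\<^bsub>?T\<^esub> ptensor K ?C \<one>\<^bsub>K\<^esub> x"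
      if "c \<in> carrier R" "x \<in> carrier ?C" for c x
      using ps(4)[OF K.one_closed K.one_closed that(2) that(2) that(1)] .
  qed (simp add: pc)
  let ?T' = "alg_along i1 ?T"
  interpret T': algebra K ?T' by (rule alg_along_algebra[OF K.is_cring T.is_cring i1])
  have "map_BC i2 (univ_C R r) \<in> functor_C r ?T"
    by (rule functor_C_hom[OF alg_hom_ring_hom_cring[OF C.algebra_axioms T.algebra_axioms i2] univ_C_in_functor])
  then obtain g where g: "g \<in> alg_hom K ?D ?T'" "map_BC g (univ_C K r) = map_BC i2 (univ_C R r)"
    using K.represents_hom_ex[OF K.represents_coord_C T'.algebra_axioms functor_C_alg_along[OF T.is_cring]]
    by metis
  have gh: "g \<in> ring_hom ?D ?T" using alg_homD(1)[OF g(1)] by (simp add: ring_hom_alg_along)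
  have g\<phi>: "g (\<phi> x) = i1 x" if x: "x \<in> carrier K" for x
    using alg_homD(3)[OF g(1) x D.one_closed] ring_hom_one[OF gh] ring_hom_closed[OF i1 x]
    by (simp add: \<phi>_def)
  have gs: "g (\<psi> c \<otimes>\<^bsub>?D\<^esub> x) = c \<odot>\<^bsub>?T\<^esub> g x" if c: "c \<in> carrier R" and x: "x \<in> carrier ?D" for c x
  proof -
    have gx: "g x \<in> carrier ?T" by (rule ring_hom_closed[OF gh x])
    have "g (\<psi> c \<otimes>\<^bsub>?D\<^esub> x) = i1 (c \<odot>\<^bsub>K\<^esub> \<one>\<^bsub>K\<^esub>) \<otimes>\<^bsub>?T\<^esub> g x"
      using ring_hom_mult[OF gh ring_hom_closed[OF \<psi> c] x] g\<phi>[OF unitK[OF c]] by (simp add: \<psi>_def)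
    also have "i1 (c \<odot>\<^bsub>K\<^esub> \<one>\<^bsub>K\<^esub>) = c \<odot>\<^bsub>?T\<^esub> \<one>\<^bsub>?T\<^esub>"
      using ps(3)[OF K.one_closed K.one_closed C.one_closed C.one_closed c] ring_hom_one[OF i1] by (simp add: i1_def)
    also have "(c \<odot>\<^bsub>?T\<^esub> \<one>\<^bsub>?T\<^esub>) \<otimes>\<^bsub>?T\<^esub> g x = c \<odot>\<^bsub>?T\<^esub> g x"
      by (rule algebra_smult_unit[OF T.algebra_axioms c gx])
    finally show ?thesis .
  qed
  have g': "g \<in> alg_hom R ?D' ?T"
    using gh gs alg_homD(4)[OF g(1)] by (simp add: alg_hom_def ring_hom_alg_along)
  have "map_BC (compose (carrier ?C) g j) (univ_C R r) = map_BC g (map_BC j (univ_C R r))"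
    unfolding univ_C_split by (rule map_BC_compose[OF univC_closed(1-3)])
  then have gj: "compose (carrier ?C) g j = i2"
    by (intro represents_hom_eq[OF represents_coord_C T.algebra_axioms
          alg_hom_compose[OF C.algebra_axioms j(1) g'] i2]) (simp only: j(2) g(2))
  have id: "(\<lambda>x\<in>carrier ?T. x) \<in> alg_hom R ?T ?T"
    by (rule alg_hom_restrict[OF T.algebra_axioms]) (auto simp: ring_hom_def)
  \<comment> \<open>Two homomorphisms out of the tensor product are compared on pure tensors, where
    \<open>g\<phi>\<close> and \<open>gj\<close> give the values on the two factors.\<close>
  have gf: "compose (carrier ?T) g f = (\<lambda>x\<in>carrier ?T. x)"
  proof (rule tensor_hom_eqI[OF A.algebra_axioms C.algebra_axioms T.algebra_axioms
        alg_hom_compose[OF T.algebra_axioms f(1) g'] id])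
    fix x a assume xa: "x \<in> carrier K" "a \<in> carrier ?C"
    have jc: "j a \<in> carrier ?D" using alg_homD(2)[OF j(1) xa(2)] by simp
    have "g (j a) = i2 a" using fun_cong[OF gj, of a] xa(2) by (simp add: compose_eq)
    then have "g (\<phi> x \<otimes>\<^bsub>?D\<^esub> j a) = i1 x \<otimes>\<^bsub>?T\<^esub> i2 a"
      using ring_hom_mult[OF gh ring_hom_closed[OF \<phi> xa(1)] jc] g\<phi>[OF xa(1)] by simp
    also have "\<dots> = ptensor K ?C x a"
      using ps(5)[OF xa(1) K.one_closed C.one_closed xa(2) zero_closed] xa by (simp add: i1_def i2_def)
    finally show "compose (carrier ?T) g f (ptensor K ?C x a) = (\<lambda>x\<in>carrier ?T. x) (ptensor K ?C x a)"
      using f(2)[OF xa] pc[OF xa] xa by (simp add: compose_eq)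
  qed
  interpret f: ring_hom_cring ?T ?D' f by (rule alg_hom_ring_hom_cring[OF T.algebra_axioms D'.algebra_axioms f(1)])
  interpret i: ring_hom_cring ?D ?D' "\<lambda>x. x" by (rule alg_along_id_hom[OF D.is_cring])
  show "reduced_ring ?T"
    unfolding reduced_ring_def
  proof (intro ballI impI)
    fix y assume y: "y \<in> carrier ?T" and "\<exists>n::nat. y [^]\<^bsub>?T\<^esub> n = \<zero>\<^bsub>?T\<^esub>"
    then obtain n :: nat where n: "y [^]\<^bsub>?T\<^esub> n = \<zero>\<^bsub>?T\<^esub>" by blast
    have fy: "f y \<in> carrier ?D" using f.hom_closed[OF y] by simp
    have "f y [^]\<^bsub>?D\<^esub> n = f (y [^]\<^bsub>?T\<^esub> n)"
      using ring_hom_ring.hom_nat_pow[OF ring_hom_ringI2[OF T.ring_axioms D'.ring_axioms f.homh] y, of n]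
        ring_hom_ring.hom_nat_pow[OF ring_hom_ringI2[OF D.ring_axioms D'.ring_axioms i.homh] fy, of n]
      by simp
    also have "\<dots> = \<zero>\<^bsub>?D\<^esub>" by (simp only: n f.hom_zero alg_along_sel)
    finally have "f y = \<zero>\<^bsub>?D\<^esub>" using K.coord_C_reduced[OF two', of r] fy unfolding reduced_ring_def by blast
    moreover have "g \<zero>\<^bsub>?D\<^esub> = \<zero>\<^bsub>?T\<^esub>"
      using ring_hom_cring.hom_zero[OF alg_hom_ring_hom_cring[OF D'.algebra_axioms T.algebra_axioms g']]
      by (simp only: alg_along_sel)
    moreover have "g (f y) = y" using fun_cong[OF gf, of y] y by (simp only: compose_eq restrict_apply if_True)
    ultimately show "y = \<zero>\<^bsub>?T\<^esub>" by (simp only:)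
  qed
qed

theorem theorem3p9:
  fixes k :: "'k ring" and r :: nat
  assumes "field k" and "\<one>\<^bsub>k\<^esub> \<oplus>\<^bsub>k\<^esub> \<one>\<^bsub>k\<^esub> \<noteq> \<zero>\<^bsub>k\<^esub>" and "r \<ge> 1"
  shows
    "represents k (coord_A k (r + 2)) (univ_A k (r + 2))
       (functor_A (r + 2) :: ('k, 't) module \<Rightarrow> _) map_A \<and>
     represents k (coord_B k r) (univ_B k r)
       (functor_B r :: ('k, 't) module \<Rightarrow> _) map_BC \<and>
     represents k (coord_C k r) (univ_C k r)
       (functor_C r :: ('k, 't) module \<Rightarrow> _) map_BC \<and>
     geometrically_reduced TYPE('l) k (coord_C k r) \<and>
     equidimensional (zariski (coord_C k r)) (r + 3) \<and>
     (let R = coord_C k r;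
          (\<phi>, \<alpha>, ms) = univ_C k r;
          Jpos = Idl\<^bsub>R\<^esub> {\<alpha> \<ominus>\<^bsub>R\<^esub> \<one>\<^bsub>R\<^esub>};
          Jneg = Idl\<^bsub>R\<^esub> {\<alpha> \<ominus>\<^bsub>R\<^esub> (\<ominus>\<^bsub>R\<^esub> \<one>\<^bsub>R\<^esub>)};
          Jnil = Idl\<^bsub>R\<^esub> (set_mat2 (ms ! r))
      in card (irreducible_components (zariski R)) = 3 \<and>
         irreducible_components (zariski R)
           = {zero_locus R Jpos, zero_locus R Jneg, zero_locus R Jnil} \<and>
         (\<forall>J\<in>{Jpos, Jneg, Jnil}. vanishing_ideal R (zero_locus R J) = J) \<and>
         alg_isomorphic k (quot_alg R Jpos) (coord_A k (r + 2)) \<and>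
         alg_isomorphic k (quot_alg R Jneg) (coord_A k (r + 2)) \<and>
         alg_isomorphic k (quot_alg R Jnil) (coord_B k r))"
proof -
  interpret field k by (rule assms(1))
  note two = assms(2)
  let ?C = "coord_C k r"
  interpret C: algebra k ?C by (rule coord_algebra)
  have vanish: "vanishing_ideal ?C (zero_locus ?C J) = J" if "J \<in> {J_eps r True, J_eps r False, J_nil r}" for J
    using that by (intro C.vanishing_ideal_zero_locus) (use J_prime in blast)
  have isoA: "alg_isomorphic k (quot_alg ?C (J_eps r b)) (coord_A k (r + 2))" for b
    by (rule coord_C_mod_J_eps)
  have isoB: "alg_isomorphic k (quot_alg ?C (J_nil r)) (coord_B k r)"
    by (rule coord_C_mod_J_nil)
  have J: "Idl\<^bsub>?C\<^esub> {alphaC r \<ominus>\<^bsub>?C\<^esub> \<one>\<^bsub>?C\<^esub>} = J_eps r True"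
    "Idl\<^bsub>?C\<^esub> {alphaC r \<ominus>\<^bsub>?C\<^esub> (\<ominus>\<^bsub>?C\<^esub> \<one>\<^bsub>?C\<^esub>)} = J_eps r False"
    "Idl\<^bsub>?C\<^esub> (set_mat2 (msC r ! r)) = J_nil r"
    by (simp_all only: J_eps_def J_nil_def eps_def if_True if_False)
  have comps: "irreducible_components (zariski ?C) =
      {zero_locus ?C (J_eps r True), zero_locus ?C (J_eps r False), zero_locus ?C (J_nil r)}"
    unfolding coord_C_components(1)[OF two] by (simp only: image_insert image_empty)
  show ?thesis
    unfolding Let_def univ_C_split prod.case J
    by (intro conjI represents_coord_A represents_coord_B represents_coord_C[unfolded univ_C_split]
        coord_C_geometrically_reduced[OF two] coord_C_equidimensional[OF two assms(3)]
        coord_C_components(2)[OF two] comps ballI vanish isoA isoB)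
qed

end
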